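(* Let $\Bbbk$ be a commutative ring of characteristic not equal to two and let $z\in\Bbbk$. For any objects $X,Y$ of the quantum isomeric supercategory $\mathcal{Q}(z)$, the $\Bbbk$-supermodule $\mathrm{Hom}_{\mathcal{Q}(z)}(X,Y)$ is free with basis $B_\bullet(X,Y)$.
   Context: Everything is $\Bbbk$-linear. A supercategory is a category enriched in vector superspaces ($\mathbb{Z}/2$-graded $\Bbbk$-modules) with parity-preserving maps; $\bar f$ is the parity of a homogeneous $f$. In a strict monoidal supercategory (unit $\mathbb{1}$, identities $1_X$) the super interchange law holds: $(f'\otimes g)\circ(f\otimes g')=(-1)^{\bar f\bar g}(f'\circ f)\otimes(g\circ g')$. **The supercategory $\mathcal{Q}(z)$.** It is the strict monoidal supercategory generated by objects $\uparrow,\downarrow$; even morphisms $u^+,u^-\colon\uparrow\otimes\uparrow\to\uparrow\otimes\uparrow$, $r^-\colon\uparrow\otimes\downarrow\to\downarrow\otimes\uparrow$, $\mathrm{cap}_L\colon\downarrow\otimes\uparrow\to\mathbb{1}$, $\mathrm{cup}_L\colon\mathbb{1}\to\uparrow\otimes\downarrow$; and an odd morphism $c\colon\uparrow\to\uparrow$ (the Clifford token); subject to: $u^-u^+=1=u^+u^-$; $l^+r^-=1_{\uparrow\otimes\downarrow}$; $r^-l^+=1_{\downarrow\otimes\uparrow}$; $(u^+\otimes1_\uparrow)(1_\uparrow\otimes u^+)(u^+\otimes1_\uparrow)=(1_\uparrow\otimes u^+)(u^+\otimes1_\uparrow)(1_\uparrow\otimes u^+)$; $u^+-u^-=z\,1_{\uparrow\otimes\uparrow}$;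 $c^2=-1_\uparrow$; $u^+(c\otimes1_\uparrow)=(1_\uparrow\otimes c)u^+$; $\mathrm{cap}_R(c\otimes1_\downarrow)\mathrm{cup}_L=0=\mathrm{cap}_R\,\mathrm{cup}_L$; $(1_\uparrow\otimes\mathrm{cap}_L)(\mathrm{cup}_L\otimes1_\uparrow)=1_\uparrow$; $(\mathrm{cap}_L\otimes1_\downarrow)(1_\downarrow\otimes\mathrm{cup}_L)=1_\downarrow$. Here and below (writing $\Phi(f)=(\mathrm{cap}_L\otimes1)(1_\downarrow\otimes f\otimes1_\downarrow)(1\otimes\mathrm{cup}_L)$): $l^+:=\Phi(u^+)$ and $l^-:=\Phi(u^-)$, both $\downarrow\otimes\uparrow\to\uparrow\otimes\downarrow$; $d^+:=\Phi(l^+)$ and $d^-:=\Phi(l^-)$, both $\downarrow\otimes\downarrow\to\downarrow\otimes\downarrow$; $\mathrm{cap}_R:=\mathrm{cap}_L\circ r^-\colon\uparrow\otimes\downarrow\to\mathbb{1}$; $\mathrm{cup}_R:=r^-\circ\mathrm{cup}_L\colon\mathbb{1}\to\downarrow\otimes\uparrow$; $r^+:=r^-+z\,\mathrm{cup}_R\circ\mathrm{cap}_R\colon\uparrow\otimes\downarrow\to\downarrow\otimes\uparrow$; $c^\downarrow:=\Phi(c)\colon\downarrow\to\downarrow$. The positive crossings are $u^+,r^+,d^+,l^+$. Morphisms are depicted by oriented string diagrams read from bottom to top ($f\circ g$: $f$ above $g$; $f\otimes g$: $f$ to the left of $g$): each $\uparrow$ (resp. $\downarrow$) is a strand oriented upward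 (resp. downward), $u^\pm,r^\pm,d^\pm,l^\pm$ are crossings of two strands, $\mathrm{cap}_L,\mathrm{cap}_R$ are caps, $\mathrm{cup}_L,\mathrm{cup}_R$ are cups, and $c$, $c^\downarrow$ are tokens on a strand. **The sets $B_\bullet(X,Y)$.** Let $X=X_1\otimes\dotsb\otimes X_r$ and $Y=Y_1\otimes\dotsb\otimes Y_s$ with $X_i,Y_j\in\{\uparrow,\downarrow\}$. An $(X,Y)$-matching is a bijection between $\{i:X_i=\uparrow\}\sqcup\{j:Y_j=\downarrow\}$ and $\{i:X_i=\downarrow\}\sqcup\{j:Y_j=\uparrow\}$. A positive reduced lift of an $(X,Y)$-matching is a string diagram representing a morphism $X\to Y$ such that: the endpoints of each string are points that correspond under the matching; there are no Clifford tokens and no closed strings (strings with no endpoints); no string intersects itself and no two strings cross more than once; all crossings are positive. (Any two positive reduced lifts of the same matching are equal as morphisms.) Fix a set $B(X,Y)$ consisting of a choice of one positive reduced lift for each $(X,Y)$-matching. The terminus of a string is the endpoint toward which it is oriented, i.e. a factor $Y_j=\uparrow$ at the top or a factor $X_i=\downarrow$ at the bottom. $B_\bullet(X,Y)$ is the set of all morphisms obtained from elements of $B(X,Y)$ by adding at most one (possibly zero) Clifford token near the terminus of each string, where all tokens at top termini are at the same height, and all tokens at bottom termini are at the same height, below those at top termini. That is, $B_\bullet(X,Y)$ consists of all morphisms $(a_1\otimes\dotsb\otimes a_s)\circ D\circ(b_1\otimes\dotsb\otimes b_r)$ with $D\in B(X,Y)$, $a_j\in\{1_\uparrow,c\}$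 if $Y_j=\uparrow$ and $a_j=1_\downarrow$ if $Y_j=\downarrow$, $b_i\in\{1_\downarrow,c^\downarrow\}$ if $X_i=\downarrow$ and $b_i=1_\uparrow$ if $X_i=\uparrow$. *)

theory Defs
  imports "HOL-Algebra.Module" "HOL-Algebra.Multiplicative_Group"
begin

section \<open>Free supermodules\<close>

text \<open>
  Parities are booleans: \<open>True\<close> is odd, \<open>False\<close> is even, and \<open>p \<noteq> q\<close> is the sum of \<open>p\<close> and \<open>q\<close>.
\<close>

type_synonym parity = bool

text \<open>The additive order of \<open>1\<close>, which \<^const>\<open>group.ord\<close> takes to be \<open>0\<close> if it is infinite.\<close>

definition characteristic :: "('k, 'm) ring_scheme \<Rightarrow> nat" where
  "characteristic k = group.ord (add_monoid k) \<one>\<^bsub>k\<^esub>"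

definition supermodule ::
    "('k, 'm) ring_scheme \<Rightarrow> ('k, 'v, 'n) module_scheme \<Rightarrow> (parity \<Rightarrow> 'v set) \<Rightarrow> bool" where
  "supermodule k M P \<longleftrightarrow>
     module k M \<and> (\<forall>p. submodule (P p) k M) \<and>
     (\<forall>x \<in> carrier M. \<exists>!y. y \<in> P False \<times> P True \<and> x = fst y \<oplus>\<^bsub>M\<^esub> snd y)"

text \<open>
  The family \<open>(v i)\<close>, \<open>i \<in> I\<close>, is a basis of homogeneous elements. As this is a condition on the
  family and not on the set \<open>v ` I\<close>, it entails that \<open>v\<close> is injective on \<open>I\<close> whenever \<open>1 \<noteq> 0\<close>.
\<close>

definition free_supermodule_with_basis ::
    "('k, 'm) ring_scheme \<Rightarrow> ('k, 'v, 'n) module_scheme \<Rightarrow> (parity \<Rightarrow> 'v set) \<Rightarrow>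
      'i set \<Rightarrow> ('i \<Rightarrow> 'v) \<Rightarrow> bool" where
  "free_supermodule_with_basis k M P I v \<longleftrightarrow>
     supermodule k M P \<and>
     (\<forall>i \<in> I. \<exists>p. v i \<in> P p) \<and>
     (\<forall>x \<in> carrier M. \<exists>!a.
        a \<in> I \<rightarrow>\<^sub>E carrier k \<and> finite {i \<in> I. a i \<noteq> \<zero>\<^bsub>k\<^esub>} \<and>
        x = (\<Oplus>\<^bsub>M\<^esub>i \<in> {i \<in> I. a i \<noteq> \<zero>\<^bsub>k\<^esub>}. a i \<odot>\<^bsub>M\<^esub> v i))"


section \<open>The quantum isomeric supercategory\<close>

text \<open>
  Objects are words in the two generating objects; the tensor product is concatenation and the unit
  object is the empty word.
\<close>

datatype orientation = Up (\<open>\<up>\<close>) | Down (\<open>\<down>\<close>)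

type_synonym obj = "orientation list"

datatype gen = UPos | UNeg | RNeg | CapL | CupL | Clif

fun gdom :: "gen \<Rightarrow> obj" where
  "gdom UPos = [\<up>, \<up>]"
| "gdom UNeg = [\<up>, \<up>]"
| "gdom RNeg = [\<up>, \<down>]"
| "gdom CapL = [\<down>, \<up>]"
| "gdom CupL = []"
| "gdom Clif = [\<up>]"

fun gcod :: "gen \<Rightarrow> obj" where
  "gcod UPos = [\<up>, \<up>]"
| "gcod UNeg = [\<up>, \<up>]"
| "gcod RNeg = [\<down>, \<up>]"
| "gcod CapL = []"
| "gcod CupL = [\<up>, \<down>]"
| "gcod Clif = [\<up>]"

definition gpar :: "gen \<Rightarrow> parity" where
  "gpar g \<longleftrightarrow> g = Clif"

text \<open>
  Formal expressions for morphisms. The supercategory is obtained by identifying well-typed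
  expressions along the congruence \<open>eqv\<close> below.
\<close>

datatype 'k mor =
    Ident obj
  | Gen gen
  | Comp "'k mor" "'k mor"  (infixr \<open>\<cdot>\<close> 70)
  | Tens "'k mor" "'k mor"  (infixr \<open>\<parallel>\<close> 75)
  | Zero obj obj
  | Add "'k mor" "'k mor"
  | Scale 'k "'k mor"

inductive arrow :: "('k, 'm) ring_scheme \<Rightarrow> obj \<Rightarrow> obj \<Rightarrow> 'k mor \<Rightarrow> bool"
  for k :: "('k, 'm) ring_scheme" where
  Ident: "arrow k X X (Ident X)"
| Gen: "arrow k (gdom g) (gcod g) (Gen g)"
| Comp: "arrow k Y Z f \<Longrightarrow> arrow k X Y g \<Longrightarrow> arrow k X Z (f \<cdot> g)"
| Tens: "arrow k X Y f \<Longrightarrow> arrow k X' Y' g \<Longrightarrow> arrow k (X @ X') (Y @ Y') (f \<parallel> g)"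
| Zero: "arrow k X Y (Zero X Y)"
| Add: "arrow k X Y f \<Longrightarrow> arrow k X Y g \<Longrightarrow> arrow k X Y (Add f g)"
| Scale: "a \<in> carrier k \<Longrightarrow> arrow k X Y f \<Longrightarrow> arrow k X Y (Scale a f)"

inductive homogeneous :: "parity \<Rightarrow> 'k mor \<Rightarrow> bool" where
  Ident: "homogeneous False (Ident X)"
| Gen: "homogeneous (gpar g) (Gen g)"
| Comp: "homogeneous p f \<Longrightarrow> homogeneous q g \<Longrightarrow> homogeneous (p \<noteq> q) (f \<cdot> g)"
| Tens: "homogeneous p f \<Longrightarrow> homogeneous q g \<Longrightarrow> homogeneous (p \<noteq> q) (f \<parallel> g)"
| Zero: "homogeneous p (Zero X Y)"
| Add: "homogeneous p f \<Longrightarrow> homogeneous p g \<Longrightarrow> homogeneous p (Add f g)"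
| Scale: "homogeneous p f \<Longrightarrow> homogeneous p (Scale a f)"

text \<open>
  For \<open>f : A \<otimes> \<up> \<rightarrow> \<up> \<otimes> B\<close>, the morphism \<open>Phi A B f : \<down> \<otimes> A \<rightarrow> B \<otimes> \<down>\<close> is
  \<open>(cap\<^sub>L \<otimes> 1) (1\<^sub>\<down> \<otimes> f \<otimes> 1\<^sub>\<down>) (1 \<otimes> cup\<^sub>L)\<close>.
\<close>

definition Phi :: "obj \<Rightarrow> obj \<Rightarrow> 'k mor \<Rightarrow> 'k mor" where
  "Phi A B f =
     (Gen CapL \<parallel> Ident (B @ [\<down>])) \<cdot> (Ident [\<down>] \<parallel> f \<parallel> Ident [\<down>]) \<cdot> (Ident (\<down> # A) \<parallel> Gen CupL)"

definition l_pos :: "'k mor" where "l_pos = Phi [\<up>] [\<up>] (Gen UPos)"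
definition l_neg :: "'k mor" where "l_neg = Phi [\<up>] [\<up>] (Gen UNeg)"
definition d_pos :: "'k mor" where "d_pos = Phi [\<down>] [\<down>] l_pos"
definition d_neg :: "'k mor" where "d_neg = Phi [\<down>] [\<down>] l_neg"
definition cap_R :: "'k mor" where "cap_R = Gen CapL \<cdot> Gen RNeg"
definition cup_R :: "'k mor" where "cup_R = Gen RNeg \<cdot> Gen CupL"
definition r_pos :: "'k \<Rightarrow> 'k mor" where "r_pos z = Add (Gen RNeg) (Scale z (cup_R \<cdot> cap_R))"
definition clif_down :: "'k mor" where "clif_down = Phi [] [] (Gen Clif)"

inductive relation ::
    "('k, 'm) ring_scheme \<Rightarrow> 'k \<Rightarrow> obj \<Rightarrow> obj \<Rightarrow> 'k mor \<Rightarrow> 'k mor \<Rightarrow> bool"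
  for k :: "('k, 'm) ring_scheme" and z :: 'k where
  u_inv: "relation k z [\<up>, \<up>] [\<up>, \<up>] (Gen UNeg \<cdot> Gen UPos) (Ident [\<up>, \<up>])"
| u_inv': "relation k z [\<up>, \<up>] [\<up>, \<up>] (Gen UPos \<cdot> Gen UNeg) (Ident [\<up>, \<up>])"
| lr_inv: "relation k z [\<up>, \<down>] [\<up>, \<down>] (l_pos \<cdot> Gen RNeg) (Ident [\<up>, \<down>])"
| rl_inv: "relation k z [\<down>, \<up>] [\<down>, \<up>] (Gen RNeg \<cdot> l_pos) (Ident [\<down>, \<up>])"
| braid: "relation k z [\<up>, \<up>, \<up>] [\<up>, \<up>, \<up>]
    ((Gen UPos \<parallel> Ident [\<up>]) \<cdot> (Ident [\<up>] \<parallel> Gen UPos) \<cdot> (Gen UPos \<parallel> Ident [\<up>]))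
    ((Ident [\<up>] \<parallel> Gen UPos) \<cdot> (Gen UPos \<parallel> Ident [\<up>]) \<cdot> (Ident [\<up>] \<parallel> Gen UPos))"
| skein: "relation k z [\<up>, \<up>] [\<up>, \<up>]
    (Add (Gen UPos) (Scale (\<ominus>\<^bsub>k\<^esub> \<one>\<^bsub>k\<^esub>) (Gen UNeg))) (Scale z (Ident [\<up>, \<up>]))"
| clif_sq: "relation k z [\<up>] [\<up>] (Gen Clif \<cdot> Gen Clif) (Scale (\<ominus>\<^bsub>k\<^esub> \<one>\<^bsub>k\<^esub>) (Ident [\<up>]))"
| clif_slide: "relation k z [\<up>, \<up>] [\<up>, \<up>]
    (Gen UPos \<cdot> (Gen Clif \<parallel> Ident [\<up>])) ((Ident [\<up>] \<parallel> Gen Clif) \<cdot> Gen UPos)"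
| clif_bubble: "relation k z [] [] (cap_R \<cdot> (Gen Clif \<parallel> Ident [\<down>]) \<cdot> Gen CupL) (Zero [] [])"
| bubble: "relation k z [] [] (cap_R \<cdot> Gen CupL) (Zero [] [])"
| zigzag_up: "relation k z [\<up>] [\<up>]
    ((Ident [\<up>] \<parallel> Gen CapL) \<cdot> (Gen CupL \<parallel> Ident [\<up>])) (Ident [\<up>])"
| zigzag_down: "relation k z [\<down>] [\<down>]
    ((Gen CapL \<parallel> Ident [\<down>]) \<cdot> (Ident [\<down>] \<parallel> Gen CupL)) (Ident [\<down>])"

text \<open>
  The smallest congruence on well-typed expressions that satisfies the axioms of a strict monoidal
  \<open>k\<close>-linear supercategory and the defining relations.
\<close>

inductive eqv ::
    "('k, 'm) ring_scheme \<Rightarrow> 'k \<Rightarrow> obj \<Rightarrow> obj \<Rightarrow> 'k mor \<Rightarrow> 'k mor \<Rightarrow> bool"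
  for k :: "('k, 'm) ring_scheme" and z :: 'k where
  rel: "relation k z X Y f g \<Longrightarrow> eqv k z X Y f g"
| refl: "arrow k X Y f \<Longrightarrow> eqv k z X Y f f"
| sym: "eqv k z X Y f g \<Longrightarrow> eqv k z X Y g f"
| trans: "eqv k z X Y f g \<Longrightarrow> eqv k z X Y g h \<Longrightarrow> eqv k z X Y f h"
| comp_cong: "eqv k z Y Z f f' \<Longrightarrow> eqv k z X Y g g' \<Longrightarrow> eqv k z X Z (f \<cdot> g) (f' \<cdot> g')"
| tens_cong: "eqv k z X Y f f' \<Longrightarrow> eqv k z X' Y' g g' \<Longrightarrow>
    eqv k z (X @ X') (Y @ Y') (f \<parallel> g) (f' \<parallel> g')"
| add_cong: "eqv k z X Y f f' \<Longrightarrow> eqv k z X Y g g' \<Longrightarrow> eqv k z X Y (Add f g) (Add f' g')"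
| scale_cong: "a \<in> carrier k \<Longrightarrow> eqv k z X Y f f' \<Longrightarrow> eqv k z X Y (Scale a f) (Scale a f')"
| add_assoc: "arrow k X Y f \<Longrightarrow> arrow k X Y g \<Longrightarrow> arrow k X Y h \<Longrightarrow>
    eqv k z X Y (Add (Add f g) h) (Add f (Add g h))"
| add_commute: "arrow k X Y f \<Longrightarrow> arrow k X Y g \<Longrightarrow> eqv k z X Y (Add f g) (Add g f)"
| add_zero: "arrow k X Y f \<Longrightarrow> eqv k z X Y (Add (Zero X Y) f) f"
| add_neg: "arrow k X Y f \<Longrightarrow> eqv k z X Y (Add (Scale (\<ominus>\<^bsub>k\<^esub> \<one>\<^bsub>k\<^esub>) f) f) (Zero X Y)"
| scale_add_right: "a \<in> carrier k \<Longrightarrow> arrow k X Y f \<Longrightarrow> arrow k X Y g \<Longrightarrow>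
    eqv k z X Y (Scale a (Add f g)) (Add (Scale a f) (Scale a g))"
| scale_add_left: "a \<in> carrier k \<Longrightarrow> b \<in> carrier k \<Longrightarrow> arrow k X Y f \<Longrightarrow>
    eqv k z X Y (Scale (a \<oplus>\<^bsub>k\<^esub> b) f) (Add (Scale a f) (Scale b f))"
| scale_mult: "a \<in> carrier k \<Longrightarrow> b \<in> carrier k \<Longrightarrow> arrow k X Y f \<Longrightarrow>
    eqv k z X Y (Scale (a \<otimes>\<^bsub>k\<^esub> b) f) (Scale a (Scale b f))"
| scale_one: "arrow k X Y f \<Longrightarrow> eqv k z X Y (Scale \<one>\<^bsub>k\<^esub> f) f"
| comp_assoc: "arrow k Z W f \<Longrightarrow> arrow k Y Z g \<Longrightarrow> arrow k X Y h \<Longrightarrow>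
    eqv k z X W ((f \<cdot> g) \<cdot> h) (f \<cdot> (g \<cdot> h))"
| comp_ident_left: "arrow k X Y f \<Longrightarrow> eqv k z X Y (Ident Y \<cdot> f) f"
| comp_ident_right: "arrow k X Y f \<Longrightarrow> eqv k z X Y (f \<cdot> Ident X) f"
| comp_add_left: "arrow k Y Z f \<Longrightarrow> arrow k Y Z g \<Longrightarrow> arrow k X Y h \<Longrightarrow>
    eqv k z X Z (Add f g \<cdot> h) (Add (f \<cdot> h) (g \<cdot> h))"
| comp_add_right: "arrow k Y Z f \<Longrightarrow> arrow k X Y g \<Longrightarrow> arrow k X Y h \<Longrightarrow>
    eqv k z X Z (f \<cdot> Add g h) (Add (f \<cdot> g) (f \<cdot> h))"
| comp_scale_left: "a \<in> carrier k \<Longrightarrow> arrow k Y Z f \<Longrightarrow> arrow k X Y g \<Longrightarrow>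
    eqv k z X Z (Scale a f \<cdot> g) (Scale a (f \<cdot> g))"
| comp_scale_right: "a \<in> carrier k \<Longrightarrow> arrow k Y Z f \<Longrightarrow> arrow k X Y g \<Longrightarrow>
    eqv k z X Z (f \<cdot> Scale a g) (Scale a (f \<cdot> g))"
| tens_assoc: "arrow k X Y f \<Longrightarrow> arrow k X' Y' g \<Longrightarrow> arrow k X'' Y'' h \<Longrightarrow>
    eqv k z (X @ X' @ X'') (Y @ Y' @ Y'') ((f \<parallel> g) \<parallel> h) (f \<parallel> (g \<parallel> h))"
| tens_unit_left: "arrow k X Y f \<Longrightarrow> eqv k z X Y (Ident [] \<parallel> f) f"
| tens_unit_right: "arrow k X Y f \<Longrightarrow> eqv k z X Y (f \<parallel> Ident []) f"
| tens_ident: "eqv k z (X @ Y) (X @ Y) (Ident X \<parallel> Ident Y) (Ident (X @ Y))"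
| tens_add_left: "arrow k X Y f \<Longrightarrow> arrow k X Y g \<Longrightarrow> arrow k X' Y' h \<Longrightarrow>
    eqv k z (X @ X') (Y @ Y') (Add f g \<parallel> h) (Add (f \<parallel> h) (g \<parallel> h))"
| tens_add_right: "arrow k X Y f \<Longrightarrow> arrow k X' Y' g \<Longrightarrow> arrow k X' Y' h \<Longrightarrow>
    eqv k z (X @ X') (Y @ Y') (f \<parallel> Add g h) (Add (f \<parallel> g) (f \<parallel> h))"
| tens_scale_left: "a \<in> carrier k \<Longrightarrow> arrow k X Y f \<Longrightarrow> arrow k X' Y' g \<Longrightarrow>
    eqv k z (X @ X') (Y @ Y') (Scale a f \<parallel> g) (Scale a (f \<parallel> g))"
| tens_scale_right: "a \<in> carrier k \<Longrightarrow> arrow k X Y f \<Longrightarrow> arrow k X' Y' g \<Longrightarrow>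
    eqv k z (X @ X') (Y @ Y') (f \<parallel> Scale a g) (Scale a (f \<parallel> g))"
| interchange: "homogeneous p f \<Longrightarrow> homogeneous q g \<Longrightarrow>
    arrow k X Y f \<Longrightarrow> arrow k Y Z f' \<Longrightarrow> arrow k X' Y' g' \<Longrightarrow> arrow k Y' Z' g \<Longrightarrow>
    eqv k z (X @ X') (Z @ Z') ((f' \<parallel> g) \<cdot> (f \<parallel> g'))
      (Scale (if p \<and> q then \<ominus>\<^bsub>k\<^esub> \<one>\<^bsub>k\<^esub> else \<one>\<^bsub>k\<^esub>) ((f' \<cdot> f) \<parallel> (g \<cdot> g')))"

definition mclass ::
    "('k, 'm) ring_scheme \<Rightarrow> 'k \<Rightarrow> obj \<Rightarrow> obj \<Rightarrow> 'k mor \<Rightarrow> 'k mor set" where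
  "mclass k z X Y f = {g. eqv k z X Y f g}"

text \<open>The fields \<open>mult\<close> and \<open>one\<close> of the record are not used by modules.\<close>

definition Hom ::
    "('k, 'm) ring_scheme \<Rightarrow> 'k \<Rightarrow> obj \<Rightarrow> obj \<Rightarrow> ('k, 'k mor set) module" where
  "Hom k z X Y =
     \<lparr>carrier = mclass k z X Y ` {f. arrow k X Y f},
      mult = undefined, one = undefined,
      zero = mclass k z X Y (Zero X Y),
      add = (\<lambda>F G. \<Union>f \<in> F. \<Union>g \<in> G. mclass k z X Y (Add f g)),
      smult = (\<lambda>a F. \<Union>f \<in> F. mclass k z X Y (Scale a f))\<rparr>"

definition Hom_part ::
    "('k, 'm) ring_scheme \<Rightarrow> 'k \<Rightarrow> obj \<Rightarrow> obj \<Rightarrow> parity \<Rightarrow> 'k mor set set" where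
  "Hom_part k z X Y p = mclass k z X Y ` {f. arrow k X Y f \<and> homogeneous p f}"


section \<open>String diagrams\<close>

text \<open>
  The crossings \<open>u\<^sup>\<plusminus>\<close>, \<open>r\<^sup>\<plusminus>\<close>, \<open>d\<^sup>\<plusminus>\<close>, \<open>l\<^sup>\<plusminus>\<close> (\<open>True\<close> is the positive one), and the caps, cups and tokens.
\<close>

datatype atom =
    XU bool | XR bool | XD bool | XL bool | ACapL | ACapR | ACupL | ACupR | TokUp | TokDown

fun adom :: "atom \<Rightarrow> obj" where
  "adom (XU _) = [\<up>, \<up>]"
| "adom (XR _) = [\<up>, \<down>]"
| "adom (XD _) = [\<down>, \<down>]"
| "adom (XL _) = [\<down>, \<up>]"
| "adom ACapL = [\<down>, \<up>]"
| "adom ACapR = [\<up>, \<down>]"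
| "adom ACupL = []"
| "adom ACupR = []"
| "adom TokUp = [\<up>]"
| "adom TokDown = [\<down>]"

fun acod :: "atom \<Rightarrow> obj" where
  "acod (XU _) = [\<up>, \<up>]"
| "acod (XR _) = [\<down>, \<up>]"
| "acod (XD _) = [\<down>, \<down>]"
| "acod (XL _) = [\<up>, \<down>]"
| "acod ACapL = []"
| "acod ACapR = []"
| "acod ACupL = [\<up>, \<down>]"
| "acod ACupR = [\<down>, \<up>]"
| "acod TokUp = [\<up>]"
| "acod TokDown = [\<down>]"

fun atom_mor :: "'k \<Rightarrow> atom \<Rightarrow> 'k mor" where
  "atom_mor z (XU s) = Gen (if s then UPos else UNeg)"
| "atom_mor z (XR s) = (if s then r_pos z else Gen RNeg)"
| "atom_mor z (XD s) = (if s then d_pos else d_neg)"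
| "atom_mor z (XL s) = (if s then l_pos else l_neg)"
| "atom_mor z ACapL = Gen CapL"
| "atom_mor z ACapR = cap_R"
| "atom_mor z ACupL = Gen CupL"
| "atom_mor z ACupR = cup_R"
| "atom_mor z TokUp = Gen Clif"
| "atom_mor z TokDown = clif_down"

definition is_crossing :: "atom \<Rightarrow> bool" where
  "is_crossing a \<longleftrightarrow> a \<in> range XU \<union> range XR \<union> range XD \<union> range XL"

definition positive_crossings :: "atom set" where
  "positive_crossings = {XU True, XR True, XD True, XL True}"

text \<open>
  A string diagram in general position is a list of layers, from bottom to top. The layer
  \<open>(l, a, r)\<close> is the atom \<open>a\<close> with vertical strands \<open>l\<close> to its left and \<open>r\<close> to its right.
\<close>

type_synonym layer = "obj \<times> atom \<times> obj"

fun layer_dom :: "layer \<Rightarrow> obj" where "layer_dom (l, a, r) = l @ adom a @ r"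
fun layer_cod :: "layer \<Rightarrow> obj" where "layer_cod (l, a, r) = l @ acod a @ r"

fun diagram :: "obj \<Rightarrow> obj \<Rightarrow> layer list \<Rightarrow> bool" where
  "diagram X Y [] \<longleftrightarrow> X = Y"
| "diagram X Y (L # D) \<longleftrightarrow> X = layer_dom L \<and> diagram (layer_cod L) Y D"

fun diagram_mor :: "'k \<Rightarrow> obj \<Rightarrow> layer list \<Rightarrow> 'k mor" where
  "diagram_mor z X [] = Ident X"
| "diagram_mor z X ((l, a, r) # D) =
     diagram_mor z (l @ acod a @ r) D \<cdot> (Ident l \<parallel> atom_mor z a \<parallel> Ident r)"

text \<open>
  The strands of the diagram meet the horizontal line below layer \<open>h\<close> (or, for \<open>h = length D\<close>, the
  top line) in the points \<open>(h, i)\<close>, where \<open>i\<close> ranges over the positions of the word \<open>level X D h\<close>.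
\<close>

type_synonym point = "nat \<times> nat"

definition level :: "obj \<Rightarrow> layer list \<Rightarrow> nat \<Rightarrow> obj" where
  "level X D h = (if h = 0 then X else layer_cod (D ! (h - 1)))"

definition points :: "obj \<Rightarrow> layer list \<Rightarrow> point set" where
  "points X D = {(h, i). h \<le> length D \<and> i < length (level X D h)}"

text \<open>The pieces of strands within layer \<open>h\<close>, each given by its two ends.\<close>

inductive arc :: "layer list \<Rightarrow> point \<Rightarrow> point \<Rightarrow> bool" for D :: "layer list" where
  left: "h < length D \<Longrightarrow> D ! h = (l, a, r) \<Longrightarrow> i < length l \<Longrightarrow> arc D (h, i) (Suc h, i)"
| right: "h < length D \<Longrightarrow> D ! h = (l, a, r) \<Longrightarrow> i < length r \<Longrightarrow>
    arc D (h, length l + length (adom a) + i) (Suc h, length l + length (acod a) + i)"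
| crossing_up: "h < length D \<Longrightarrow> D ! h = (l, a, r) \<Longrightarrow> is_crossing a \<Longrightarrow>
    arc D (h, length l) (Suc h, length l + 1)"
| crossing_down: "h < length D \<Longrightarrow> D ! h = (l, a, r) \<Longrightarrow> is_crossing a \<Longrightarrow>
    arc D (h, length l + 1) (Suc h, length l)"
| cap: "h < length D \<Longrightarrow> D ! h = (l, a, r) \<Longrightarrow> a \<in> {ACapL, ACapR} \<Longrightarrow>
    arc D (h, length l) (h, length l + 1)"
| cup: "h < length D \<Longrightarrow> D ! h = (l, a, r) \<Longrightarrow> a \<in> {ACupL, ACupR} \<Longrightarrow>
    arc D (Suc h, length l) (Suc h, length l + 1)"
| token: "h < length D \<Longrightarrow> D ! h = (l, a, r) \<Longrightarrow> a \<in> {TokUp, TokDown} \<Longrightarrow>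
    arc D (h, length l) (Suc h, length l)"

definition same_string :: "layer list \<Rightarrow> point \<Rightarrow> point \<Rightarrow> bool" where
  "same_string D = equivclp (arc D)"

text \<open>The pairs of points at which the two strands of a crossing enter it from below.\<close>

definition crossings :: "layer list \<Rightarrow> (point \<times> point) set" where
  "crossings D =
     {((h, length l), (h, length l + 1)) | h l a r.
        h < length D \<and> D ! h = (l, a, r) \<and> is_crossing a}"


section \<open>Matchings and their positive reduced lifts\<close>

text \<open>\<open>Bot i\<close> stands for the factor \<open>X ! i\<close> and \<open>Top j\<close> for the factor \<open>Y ! j\<close> (counted from \<open>0\<close>).\<close>

datatype endpoint = Bot nat | Top nat

definition origins :: "obj \<Rightarrow> obj \<Rightarrow> endpoint set" where
  "origins X Y =
     Bot ` {i. i < length X \<and> X ! i = \<up>} \<union> Top ` {j. j < length Y \<and> Y ! j = \<down>}"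

definition termini :: "obj \<Rightarrow> obj \<Rightarrow> endpoint set" where
  "termini X Y =
     Bot ` {i. i < length X \<and> X ! i = \<down>} \<union> Top ` {j. j < length Y \<and> Y ! j = \<up>}"

definition matching :: "obj \<Rightarrow> obj \<Rightarrow> (endpoint \<Rightarrow> endpoint) \<Rightarrow> bool" where
  "matching X Y m \<longleftrightarrow> bij_betw m (origins X Y) (termini X Y)"

fun endpoint_pos :: "layer list \<Rightarrow> endpoint \<Rightarrow> point" where
  "endpoint_pos D (Bot i) = (0, i)"
| "endpoint_pos D (Top j) = (length D, j)"

definition positive_reduced_lift ::
    "obj \<Rightarrow> obj \<Rightarrow> (endpoint \<Rightarrow> endpoint) \<Rightarrow> layer list \<Rightarrow> bool" where
  "positive_reduced_lift X Y m D \<longleftrightarrow>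
     diagram X Y D \<and>
     \<comment> \<open>the endpoints of each string correspond under the matching\<close>
     (\<forall>s \<in> origins X Y. \<forall>t \<in> termini X Y.
        same_string D (endpoint_pos D s) (endpoint_pos D t) \<longleftrightarrow> m s = t) \<and>
     \<comment> \<open>no tokens\<close>
     (\<forall>(l, a, r) \<in> set D. a \<notin> {TokUp, TokDown}) \<and>
     \<comment> \<open>no closed strings\<close>
     (\<forall>x \<in> points X D. \<exists>e \<in> origins X Y \<union> termini X Y. same_string D x (endpoint_pos D e)) \<and>
     \<comment> \<open>no string intersects itself\<close>
     (\<forall>(x, y) \<in> crossings D. \<not> same_string D x y) \<and>
     \<comment> \<open>no two strings cross more than once\<close>
     (\<forall>(x, y) \<in> crossings D. \<forall>(x', y') \<in> crossings D. (x, y) \<noteq> (x', y') \<longrightarrow>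
        \<not> (same_string D x x' \<and> same_string D y y') \<and>
        \<not> (same_string D x y' \<and> same_string D y x')) \<and>
     \<comment> \<open>all crossings are positive\<close>
     (\<forall>(l, a, r) \<in> set D. is_crossing a \<longrightarrow> a \<in> positive_crossings)"

definition lift_choice :: "obj \<Rightarrow> obj \<Rightarrow> layer list set \<Rightarrow> bool" where
  "lift_choice X Y B \<longleftrightarrow>
     (\<forall>D \<in> B. \<exists>m. matching X Y m \<and> positive_reduced_lift X Y m D) \<and>
     (\<forall>m. matching X Y m \<longrightarrow> (\<exists>!D. D \<in> B \<and> positive_reduced_lift X Y m D))"

text \<open>
  An element of \<open>B_bullet X Y B\<close> is a diagram in \<open>B\<close> together with the set of the termini that
  carry a token; \<open>bullet_mor\<close> is the morphism \<open>(a\<^sub>1 \<otimes> \<dots> \<otimes> a\<^sub>s) \<circ> D \<circ> (b\<^sub>1 \<otimes> \<dots> \<otimes> b\<^sub>r)\<close> it represents.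
\<close>

definition B_bullet :: "obj \<Rightarrow> obj \<Rightarrow> layer list set \<Rightarrow> (layer list \<times> endpoint set) set" where
  "B_bullet X Y B = B \<times> Pow (termini X Y)"

fun token :: "orientation \<Rightarrow> 'k mor" where
  "token \<up> = Gen Clif"
| "token \<down> = clif_down"

definition token_row :: "obj \<Rightarrow> nat set \<Rightarrow> 'k mor" where
  "token_row X S =
     foldr (\<parallel>) (map (\<lambda>i. if i \<in> S then token (X ! i) else Ident [X ! i]) [0..<length X]) (Ident [])"

definition bullet_mor ::
    "('k, 'm) ring_scheme \<Rightarrow> 'k \<Rightarrow> obj \<Rightarrow> obj \<Rightarrow> layer list \<times> endpoint set \<Rightarrow> 'k mor set" where
  "bullet_mor k z X Y = (\<lambda>(D, T). mclass k z X Y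
     (token_row Y {j. Top j \<in> T} \<cdot> diagram_mor z X D \<cdot> token_row X {i. Bot i \<in> T}))"

end

theory Submission
  imports Defs "HOL-Library.Poly_Mapping" "HOL-Library.Multiset" "HOL-Library.Product_Plus"
    "Jordan_Normal_Form.Determinant"
begin

text \<open>
  Linear independence: the supercategory acts by matrices on the tensor powers of a superspace with
  basis \<open>e\<^sub>x\<close>, \<open>-N \<le> x < N\<close>, over the extension \<open>k[q] / (q\<^sup>2 - z q - 1)\<close>, in which \<open>z = q - q\<^sup>-\<^sup>1\<close> and
  of which \<open>k\<close> is a direct summand. The token exchanges \<open>e\<^sub>x\<close> and \<open>e\<^bsub>-1-x\<^esub>\<close>, which have the same
  colour. A nonzero matrix entry of a diagram comes from a labelling of its strands along which colours
  change place only at crossings. Give the strings of a matching \<open>m\<close> distinct colours and read off the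
  labels at the endpoints: the entry of the lift of \<open>m\<close> is a unit, and the entry of the lift of another
  matching \<open>m'\<close> vanishes unless \<open>m'\<close> has more crossings. So the elements of \<open>B_bullet\<close> have a unitriangular
  system of functionals.

  Spanning: bending and the invertibility of mixed crossings reduce to morphisms out of the unit object.
  These are spanned by nested cups followed by crossings and tokens of upward strands and then by mixed
  crossings, because this set of words is stable under all generators. The only generator whose effect is
  not again such a word up to sign is the cap; its effect is a partial trace, which the coset
  decomposition of the Hecke-Clifford algebra reduces to bubbles and curls. The decomposition also bounds
  the number of generators by \<open>2\<^sup>a a!\<close>, the size of \<open>B_bullet\<close> for \<open>a\<close> strings, and over a commutative ring
  as many generators as there are elements dual to functionals force the latter to be a basis.
\<close>

hide_const (open) Multiset.mult

section \<open>A quadratic extension of the ground ring\<close>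

text \<open>Matrix computations call for the ring arithmetic of type classes, but \<open>k\<close>
  and \<open>K\<close> are rings on carrier sets. The computations take place in the monoid ring
  \<open>(int \<times> 'k multiset) \<Rightarrow>\<^sub>0 int\<close>, whose monomials are powers of
  \<open>q\<close> times formal products of scalars; \<open>ev\<close> evaluates it in
  \<open>K\<close>. An identity between elements of \<open>k\<close> then holds only modulo the
  kernel of \<open>ev\<close>, and for this reason soundness, supports and triangularity are all
  stated modulo an ideal \<open>J\<close>. Determinants over \<open>k\<close> are borrowed from the
  same ring.

  The labels \<open>-N, ..., N - 1\<close> are ordered so that parity alternates and
  \<open>bar\<close> reverses both order and parity. Alternation lets the correction sums of the
  inverse mixed crossing telescope, and it gives superdimension zero, as the bubble relation
  demands.

  That an even and an odd class meet only in zero is not read off from the relations. Each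
  functional is one matrix entry, which sees morphisms of one parity only, so a class in both parts
  is killed by all of them and has zero coefficients in the basis.\<close>

definition qext :: "('k, 'm) ring_scheme \<Rightarrow> 'k \<Rightarrow> ('k \<times> 'k) ring" where
  "qext k z =
     \<lparr>carrier = carrier k \<times> carrier k,
      mult = (\<lambda>(a, b) (c, d).
        (a \<otimes>\<^bsub>k\<^esub> c \<oplus>\<^bsub>k\<^esub> b \<otimes>\<^bsub>k\<^esub> d, a \<otimes>\<^bsub>k\<^esub> d \<oplus>\<^bsub>k\<^esub> b \<otimes>\<^bsub>k\<^esub> c \<oplus>\<^bsub>k\<^esub> z \<otimes>\<^bsub>k\<^esub> (b \<otimes>\<^bsub>k\<^esub> d))),
      one = (\<one>\<^bsub>k\<^esub>, \<zero>\<^bsub>k\<^esub>), zero = (\<zero>\<^bsub>k\<^esub>, \<zero>\<^bsub>k\<^esub>),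
      add = (\<lambda>(a, b) (c, d). (a \<oplus>\<^bsub>k\<^esub> c, b \<oplus>\<^bsub>k\<^esub> d))\<rparr>"

locale cring_param = cring k for k :: "('k, 'm) ring_scheme" (structure) +
  fixes z :: 'k
  assumes z_closed [simp, intro]: "z \<in> carrier k"
begin

lemmas ring_distrib = l_distr r_distr

abbreviation K :: "('k \<times> 'k) ring" where "K \<equiv> qext k z"

lemma K_simps:
  "carrier K = carrier k \<times> carrier k"
  "(a, b) \<otimes>\<^bsub>K\<^esub> (c, d) = (a \<otimes> c \<oplus> b \<otimes> d, a \<otimes> d \<oplus> b \<otimes> c \<oplus> z \<otimes> (b \<otimes> d))"
  "\<one>\<^bsub>K\<^esub> = (\<one>, \<zero>)" "\<zero>\<^bsub>K\<^esub> = (\<zero>, \<zero>)"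
  "(a, b) \<oplus>\<^bsub>K\<^esub> (c, d) = (a \<oplus> c, b \<oplus> d)"
  by (simp_all add: qext_def)

lemma cring_K: "cring K"
proof (rule cringI)
  show "abelian_group K"
  proof (rule abelian_groupI)
    fix x assume "x \<in> carrier K"
    then show "\<exists>y \<in> carrier K. y \<oplus>\<^bsub>K\<^esub> x = \<zero>\<^bsub>K\<^esub>"
      by (intro bexI[of _ "(\<ominus> fst x, \<ominus> snd x)"]) (auto simp: K_simps l_neg)
  qed (auto simp: K_simps a_ac)
  show "comm_monoid K"
  proof (rule comm_monoidI)
    fix x y w assume *: "x \<in> carrier K" "y \<in> carrier K" "w \<in> carrier K"
    obtain a b c d e f where "x = (a, b)" "y = (c, d)" "w = (e, f)"
      by (metis surj_pair)
    moreover have "{a, b, c, d, e, f} \<subseteq> carrier k"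
      using * calculation by (auto simp: K_simps)
    ultimately show "x \<otimes>\<^bsub>K\<^esub> y \<otimes>\<^bsub>K\<^esub> w = x \<otimes>\<^bsub>K\<^esub> (y \<otimes>\<^bsub>K\<^esub> w)"
      by (simp add: K_simps ring_distrib a_ac m_ac)
  qed (auto simp: K_simps a_comm m_comm)
  show "\<And>x y w. \<lbrakk>x \<in> carrier K; y \<in> carrier K; w \<in> carrier K\<rbrakk> \<Longrightarrow>
     (x \<oplus>\<^bsub>K\<^esub> y) \<otimes>\<^bsub>K\<^esub> w = x \<otimes>\<^bsub>K\<^esub> w \<oplus>\<^bsub>K\<^esub> y \<otimes>\<^bsub>K\<^esub> w"
    by (auto simp: K_simps ring_distrib a_ac)
qed

sublocale K: cring K by (rule cring_K)

definition qK :: "'k \<times> 'k" where "qK = (\<zero>, \<one>)"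

lemma qK_Units: "qK \<in> Units K"
proof -
  \<comment> \<open>By \<open>q\<^sup>2 = z q + 1\<close> the inverse of \<open>q\<close> is
    \<open>q - z\<close>.\<close>
  have "qK \<otimes>\<^bsub>K\<^esub> (\<ominus> z, \<one>) = \<one>\<^bsub>K\<^esub>"
    by (simp add: qK_def K_simps l_neg)
  then show ?thesis
    using K.m_comm unfolding Units_def by (auto simp: qK_def K_simps l_neg intro!: bexI[of _ "(\<ominus> z, \<one>)"])
qed

section \<open>Formal monomials and their evaluation\<close>

text \<open>Monomials are \<open>(n, M)\<close>, a power of \<open>q\<close> times a product of scalars.\<close>

definition scal :: "'k \<Rightarrow> 'k \<times> 'k" where
  "scal a = (if a \<in> carrier k then (a, \<zero>) else \<one>\<^bsub>K\<^esub>)"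

text \<open>Outside the carrier the operator is the identity: folding over a multiset asks for
  operators that commute on the whole type. The default \<open>1\<close> in \<open>scal\<close> has
  a similar purpose, so that every formal product has a value in \<open>K\<close>.\<close>

definition scal_mult :: "'k \<Rightarrow> 'k \<times> 'k \<Rightarrow> 'k \<times> 'k" where
  "scal_mult a x = (if x \<in> carrier K then scal a \<otimes>\<^bsub>K\<^esub> x else x)"

lemma scal_closed [simp, intro]: "scal a \<in> carrier K"
  by (auto simp: scal_def K_simps)

lemma comp_fun_commute_scal_mult: "comp_fun_commute scal_mult"
  by unfold_locales (auto simp: scal_mult_def K.m_lcomm)

interpretation scal: comp_fun_commute scal_mult by (rule comp_fun_commute_scal_mult)

definition scal_prod :: "'k multiset \<Rightarrow> 'k \<times> 'k" where
  "scal_prod M = fold_mset scal_mult \<one>\<^bsub>K\<^esub> M"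

lemma scal_prod_closed [simp, intro]: "scal_prod M \<in> carrier K"
  by (induction M) (simp_all add: scal_prod_def scal_mult_def)

lemma scal_prod_add: "scal_prod (M + M') = scal_prod M \<otimes>\<^bsub>K\<^esub> scal_prod M'"
proof (induction M)
  case empty
  then show ?case by (simp add: scal_prod_def) (fold scal_prod_def, simp)
next
  case (add a M)
  then show ?case
    using scal_prod_closed[of M] scal_prod_closed[of M'] scal_prod_closed[of "M + M'"]
    by (simp add: scal_prod_def) (fold scal_prod_def, simp add: scal_mult_def K.m_assoc)
qed

text \<open>The power is taken in the group of units of \<open>K\<close>, where negative exponents
  are defined and exponents add.\<close>

definition monom_val :: "int \<times> 'k multiset \<Rightarrow> 'k \<times> 'k" where
  "monom_val e = (qK [^]\<^bsub>units_of K\<^esub> fst e) \<otimes>\<^bsub>K\<^esub> scal_prod (snd e)"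

interpretation U: group "units_of K" by (rule K.units_group)

lemma qpow_closed [simp, intro]: "qK [^]\<^bsub>units_of K\<^esub> (n::int) \<in> carrier K"
  using U.int_pow_closed[of qK n] qK_Units K.Units_closed by (simp add: units_of_carrier)

lemma monom_val_closed [simp, intro]: "monom_val e \<in> carrier K"
  by (simp add: monom_val_def)

lemma monom_val_add: "monom_val (e + e') = monom_val e \<otimes>\<^bsub>K\<^esub> monom_val e'"
proof -
  have "qK [^]\<^bsub>units_of K\<^esub> (fst e + fst e') =
      (qK [^]\<^bsub>units_of K\<^esub> fst e) \<otimes>\<^bsub>K\<^esub> (qK [^]\<^bsub>units_of K\<^esub> fst e')"
    using U.int_pow_mult[of qK "fst e" "fst e'"] qK_Units by (simp add: units_of_carrier units_of_mult)
  then show ?thesis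
    by (simp add: monom_val_def scal_prod_add K.m_ac)
qed

lemma monom_val_zero: "monom_val 0 = \<one>\<^bsub>K\<^esub>"
  by (simp add: monom_val_def scal_prod_def units_of_one)

text \<open>The ring homomorphism induced by the monoid homomorphism \<open>monom_val\<close>.
  Integer coefficients act by repeated addition in \<open>K\<close>.\<close>

definition ev :: "((int \<times> 'k multiset) \<Rightarrow>\<^sub>0 int) \<Rightarrow> 'k \<times> 'k" where
  "ev r = (\<Oplus>\<^bsub>K\<^esub>e \<in> Poly_Mapping.keys r. [Poly_Mapping.lookup r e] \<cdot>\<^bsub>K\<^esub> monom_val e)"

lemma ev_superset:
  assumes "finite S" "Poly_Mapping.keys r \<subseteq> S"
  shows "ev r = (\<Oplus>\<^bsub>K\<^esub>e \<in> S. [Poly_Mapping.lookup r e] \<cdot>\<^bsub>K\<^esub> monom_val e)"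
proof -
  have "[(0::int)] \<cdot>\<^bsub>K\<^esub> x = \<zero>\<^bsub>K\<^esub>" for x
    by (simp add: add_pow_def)
  then show ?thesis
    unfolding ev_def using assms
    by (intro K.add.finprod_mono_neutral_cong_left) (auto simp: in_keys_iff)
qed

lemma ev_closed [simp, intro]: "ev r \<in> carrier K"
  unfolding ev_def by (intro K.finsum_closed) auto

lemma ev_add: "ev (r + s) = ev r \<oplus>\<^bsub>K\<^esub> ev s"
proof -
  let ?S = "Poly_Mapping.keys r \<union> Poly_Mapping.keys s"
  have "ev (r + s) = (\<Oplus>\<^bsub>K\<^esub>e \<in> ?S. [(Poly_Mapping.lookup r e + Poly_Mapping.lookup s e)] \<cdot>\<^bsub>K\<^esub> monom_val e)"
    using Poly_Mapping.keys_add[of r s] by (subst ev_superset[of ?S]) (auto simp: lookup_add)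
  also have "\<dots> = (\<Oplus>\<^bsub>K\<^esub>e \<in> ?S. ([Poly_Mapping.lookup r e] \<cdot>\<^bsub>K\<^esub> monom_val e)
      \<oplus>\<^bsub>K\<^esub> ([Poly_Mapping.lookup s e] \<cdot>\<^bsub>K\<^esub> monom_val e))"
    by (intro K.finsum_cong') (auto simp: K.add.int_pow_mult)
  also have "\<dots> = ev r \<oplus>\<^bsub>K\<^esub> ev s"
    by (subst K.finsum_addf) (auto simp: ev_superset[of ?S r] ev_superset[of ?S s])
  finally show ?thesis .
qed

lemma ev_zero [simp]: "ev 0 = \<zero>\<^bsub>K\<^esub>"
  by (simp add: ev_def)

lemma ev_single: "ev (Poly_Mapping.single e n) = [n] \<cdot>\<^bsub>K\<^esub> monom_val e"
  by (subst ev_superset[of "{e}"]) (auto simp: in_keys_iff lookup_single when_def)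

lemma ev_uminus: "ev (- r) = \<ominus>\<^bsub>K\<^esub> ev r"
  using ev_add[of "- r" r] by (simp add: K.minus_equality)

text \<open>In contrast to \<open>update_induct\<close> the added monomial need not be new, so that
  both factors of a product can be taken apart by distributivity alone.\<close>

lemma poly_mapping_single_induct:
  fixes r :: "'c \<Rightarrow>\<^sub>0 'd::comm_monoid_add"
  assumes "P 0" and "\<And>e n r. P r \<Longrightarrow> P (Poly_Mapping.single e n + r)"
  shows "P r"
proof (induction r rule: update_induct)
  case const
  then show ?case using assms(1) .
next
  case (update r e n)
  have "Poly_Mapping.update e n r = Poly_Mapping.single e n + r"
    using update by (intro poly_mapping_eqI) (auto simp: lookup_add lookup_update lookup_single in_keys_iff when_def)
  then show ?case using assms(2)[OF update(3)] by simp
qed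

lemma ev_mult: "ev (r * s) = ev r \<otimes>\<^bsub>K\<^esub> ev s"
proof (induction r rule: poly_mapping_single_induct)
  case (2 e n r)
  have "ev (Poly_Mapping.single e n * s) = ev (Poly_Mapping.single e n) \<otimes>\<^bsub>K\<^esub> ev s"
  proof (induction s rule: poly_mapping_single_induct)
    case (2 e' n' s)
    have "ev (Poly_Mapping.single e n * Poly_Mapping.single e' n') =
        ev (Poly_Mapping.single e n) \<otimes>\<^bsub>K\<^esub> ev (Poly_Mapping.single e' n')"
      by (simp add: mult_single ev_single monom_val_add K.add_pow_ldistr_int K.add_pow_rdistr_int
          K.add.int_pow_pow K.m_comm mult.commute)
    then show ?case using 2 by (simp add: distrib_left ev_add K.r_distr)
  qed simp
  then show ?case using 2 by (simp add: distrib_right ev_add K.l_distr)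
qed simp

lemma ev_one [simp]: "ev 1 = \<one>\<^bsub>K\<^esub>"
proof -
  have "ev (Poly_Mapping.single 0 1) = \<one>\<^bsub>K\<^esub>"
    by (simp only: ev_single monom_val_zero K.add.int_pow_1 K.one_closed)
  then show ?thesis by simp
qed

text \<open>A scalar as a formal variable. This map is neither additive nor multiplicative; on the
  carrier of \<open>k\<close> it becomes a homomorphism after \<open>ev\<close>.\<close>

definition xscal :: "'k \<Rightarrow> (int \<times> 'k multiset) \<Rightarrow>\<^sub>0 int" where
  "xscal a = Poly_Mapping.single (0, {#a#}) 1"

lemma ev_xscal: "a \<in> carrier k \<Longrightarrow> ev (xscal a) = (a, \<zero>)"
  using scal_closed[of a]
  by (simp add: xscal_def ev_single monom_val_def scal_prod_def scal_mult_def units_of_one K.add.int_pow_1)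
    (simp add: scal_def)

end

definition qq :: "(int \<times> 'k multiset) \<Rightarrow>\<^sub>0 int" where "qq = Poly_Mapping.single (1, {#}) 1"
definition qi :: "(int \<times> 'k multiset) \<Rightarrow>\<^sub>0 int" where "qi = Poly_Mapping.single (- 1, {#}) 1"

lemma qq_qi: "qq * qi = 1"
  by (simp add: qq_def qi_def mult_single flip: zero_prod_def)

lemma (in cring_param) ev_qq_qi: "ev (qq - qi) = (z, \<zero>)"
proof -
  have q: "ev qq = qK"
    using qK_Units K.Units_closed[OF qK_Units]
    by (simp add: qq_def ev_single monom_val_def scal_prod_def K.add.int_pow_1 group.int_pow_1 K.units_group units_of_carrier)
  have qi: "ev qi = (\<ominus> z, \<one>)"
  proof -
    have "qK \<otimes>\<^bsub>K\<^esub> ev qi = \<one>\<^bsub>K\<^esub>" "qK \<otimes>\<^bsub>K\<^esub> (\<ominus> z, \<one>) = \<one>\<^bsub>K\<^esub>"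
      using ev_mult[of qq qi] by (simp_all add: q qq_qi qK_def K_simps l_neg)
    then show ?thesis
      by (metis K.Units_l_cancel K_simps(1) SigmaI a_inv_closed ev_closed one_closed qK_Units z_closed)
  qed
  have m: "\<ominus>\<^bsub>K\<^esub> (\<ominus> z, \<one>) = (z, \<ominus> \<one>)"
    by (rule K.minus_equality) (auto simp: K_simps l_neg r_neg)
  have "ev (qq + - qi) = (z, \<zero>)"
    by (simp only: ev_add ev_uminus q qi m) (simp add: qK_def K_simps r_neg)
  then show ?thesis by simp
qed

section \<open>One-sided inverses of square matrices\<close>

context cring_param
begin

lemma ev_sum_cong: "(\<And>i. i \<in> S \<Longrightarrow> ev (f i) = ev (g i)) \<Longrightarrow> ev (sum f S) = ev (sum g S)"
  by (induction S rule: infinite_finite_induct) (simp_all add: ev_add)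

lemma ev_prod_cong: "(\<And>i. i \<in> S \<Longrightarrow> ev (f i) = ev (g i)) \<Longrightarrow> ev (prod f S) = ev (prod g S)"
  by (induction S rule: infinite_finite_induct) (simp_all add: ev_mult)

lemma ev_mult_cong: "ev a = ev a' \<Longrightarrow> ev b = ev b' \<Longrightarrow> ev (a * b) = ev (a' * b')"
  by (simp add: ev_mult)

lemma fst_ev_xscal_sum:
  assumes "finite S" "\<And>i. i \<in> S \<Longrightarrow> f i \<in> carrier k" "\<And>i. i \<in> S \<Longrightarrow> g i \<in> carrier k"
  shows "ev (\<Sum>i \<in> S. xscal (f i) * xscal (g i)) = (\<Oplus>i \<in> S. f i \<otimes> g i, \<zero>)"
  using assms
  by (induction S rule: finite_induct) (simp_all add: ev_add ev_mult ev_xscal K_simps Pi_def)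

text \<open>Equality after evaluation. The entries themselves lie in a type class ring, where
  determinants and adjugates are available.\<close>

definition mat_eq :: "nat \<Rightarrow> ((int \<times> 'k multiset) \<Rightarrow>\<^sub>0 int) mat \<Rightarrow> ((int \<times> 'k multiset) \<Rightarrow>\<^sub>0 int) mat \<Rightarrow> bool" where
  "mat_eq n M N \<longleftrightarrow> M \<in> carrier_mat n n \<and> N \<in> carrier_mat n n \<and>
     (\<forall>i < n. \<forall>j < n. ev (M $$ (i, j)) = ev (N $$ (i, j)))"

lemma mat_eq_mult: "mat_eq n M M' \<Longrightarrow> mat_eq n N N' \<Longrightarrow> mat_eq n (M * N) (M' * N')"
  unfolding mat_eq_def by (auto simp: scalar_prod_def intro!: ev_sum_cong ev_mult_cong)

lemma mat_eq_det: "mat_eq n M N \<Longrightarrow> ev (det M) = ev (det N)"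
  unfolding mat_eq_def
  by (auto simp: det_def' permutes_in_image intro!: ev_sum_cong ev_mult_cong ev_prod_cong)

text \<open>From \<open>A B = 1\<close> follow \<open>det A * det B = 1\<close> and, multiplying by
  the adjugate on the left and by \<open>A\<close> on the right,
  \<open>det A * (B A) = det A * 1\<close>; the factor \<open>det A\<close> is then cancelled. The
  computation is made with formal scalars and every equation is read after
  \<open>ev\<close>.\<close>

lemma left_inverse_of_right_inverse:
  fixes A B :: "nat \<Rightarrow> nat \<Rightarrow> 'k"
  assumes closed: "\<And>i j. i < n \<Longrightarrow> j < n \<Longrightarrow> A i j \<in> carrier k" "\<And>i j. i < n \<Longrightarrow> j < n \<Longrightarrow> B i j \<in> carrier k"
    and AB: "\<And>i j. i < n \<Longrightarrow> j < n \<Longrightarrow> (\<Oplus>l \<in> {..<n}. A i l \<otimes> B l j) = (if i = j then \<one> else \<zero>)"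
    and ij: "i < n" "j < n"
  shows "(\<Oplus>l \<in> {..<n}. B i l \<otimes> A l j) = (if i = j then \<one> else \<zero>)"
proof -
  define MA where "MA = mat n n (\<lambda>(i, j). xscal (A i j))"
  define MB where "MB = mat n n (\<lambda>(i, j). xscal (B i j))"
  have cm [simp]: "MA \<in> carrier_mat n n" "MB \<in> carrier_mat n n" "adj_mat MA \<in> carrier_mat n n"
    by (auto simp: MA_def MB_def intro: adj_mat)
  have adj: "adj_mat MA * MA = det MA \<cdot>\<^sub>m 1\<^sub>m n"
    using adj_mat[of MA n] by simp
  have "ev ((MA * MB) $$ (i, j)) = (\<Oplus>l \<in> {..<n}. A i l \<otimes> B l j, \<zero>)" if "i < n" "j < n" for i j
    using that closed fst_ev_xscal_sum[of "{..<n}" "A i" "\<lambda>l. B l j"]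
    by (simp add: MA_def MB_def scalar_prod_def lessThan_atLeast0)
  then have eAB: "mat_eq n (MA * MB) (1\<^sub>m n)"
    using AB mult_carrier_mat[OF cm(1,2)] unfolding mat_eq_def by (auto simp: K_simps)
  have "ev (det MA * det MB) = \<one>\<^bsub>K\<^esub>"
    using mat_eq_det[OF eAB] by (simp add: det_mult[of _ n])
  moreover have "ev (det MA * (MB * MA) $$ (i, j)) = ev (det MA * 1\<^sub>m n $$ (i, j))"
  proof -
    have "mat_eq n (adj_mat MA * (MA * MB) * MA) (adj_mat MA * 1\<^sub>m n * MA)"
      by (intro mat_eq_mult eAB) (auto simp: mat_eq_def)
    also have "adj_mat MA * 1\<^sub>m n * MA = det MA \<cdot>\<^sub>m 1\<^sub>m n"
      using adj by (simp add: right_mult_one_mat[of _ n n])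
    also have "adj_mat MA * (MA * MB) * MA = (adj_mat MA * MA) * (MB * MA)"
      using assoc_mult_mat[OF cm(3) mult_carrier_mat[OF cm(1,2)] cm(1)]
        assoc_mult_mat[OF cm(1,2,1)] assoc_mult_mat[OF cm(3,1) mult_carrier_mat[OF cm(2,1)]]
      by simp
    also have "\<dots> = det MA \<cdot>\<^sub>m (MB * MA)"
      unfolding adj using mult_smult_assoc_mat[OF one_carrier_mat mult_carrier_mat[OF cm(2,1)]]
        left_mult_one_mat[OF mult_carrier_mat[OF cm(2,1)]] by simp
    finally show ?thesis
      using ij carrier_matD[OF cm(1)] carrier_matD[OF cm(2)] by (simp add: mat_eq_def)
  qed
  \<comment> \<open>Multiplying by \<open>det MB\<close> cancels \<open>det MA\<close>, as their
    product evaluates to one.\<close>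
  ultimately have "ev ((MB * MA) $$ (i, j)) = ev (1\<^sub>m n $$ (i, j))"
    by (simp only: ev_mult) (metis K.m_comm K.m_assoc K.l_one ev_closed)
  moreover have "ev ((MB * MA) $$ (i, j)) = (\<Oplus>l \<in> {..<n}. B i l \<otimes> A l j, \<zero>)"
    using ij closed fst_ev_xscal_sum[of "{..<n}" "B i" "\<lambda>l. A l j"]
    by (simp add: MA_def MB_def scalar_prod_def lessThan_atLeast0)
  ultimately show ?thesis
    using ij by (auto simp: K_simps split: if_splits)
qed

end

section \<open>A matrix functor\<close>

text \<open>An involution of \<open>{-N..<N}\<close> without fixed points that reverses the order
  and the parity. Its orbits are the colours. The basis vector with label \<open>x\<close> is odd
  exactly if \<open>x\<close> is odd, which makes the token an odd map.\<close>

definition bar :: "int \<Rightarrow> int" where "bar x = - 1 - x"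

lemma bar_bar [simp]: "bar (bar x) = x" by (simp add: bar_def)
lemma bar_eq_iff [simp]: "bar x = bar y \<longleftrightarrow> x = y" by (auto simp: bar_def)
lemma bar_neq [simp]: "bar x \<noteq> x" "x \<noteq> bar x" unfolding bar_def by presburger+
lemma odd_bar [simp]: "odd (bar x) \<longleftrightarrow> even x" by (simp add: bar_def)

definition par :: "int list \<Rightarrow> bool" where "par w \<longleftrightarrow> odd (sum_list w)"

lemma par_simps [simp]:
  "par [] \<longleftrightarrow> False" "par (x # w) \<longleftrightarrow> odd x \<noteq> par w" "par (w @ w') \<longleftrightarrow> par w \<noteq> par w'"
  by (auto simp: par_def)

definition sgn_if :: "bool \<Rightarrow> 'r::comm_ring_1" where "sgn_if b = (if b then - 1 else 1)"

lemma sgn_if_sq [simp]: "sgn_if b * sgn_if b = 1" "sgn_if b * (sgn_if b * x) = x"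
  by (simp_all add: sgn_if_def)
lemma sgn_if_simps [simp]: "sgn_if True = - 1" "sgn_if False = 1"
  by (simp_all add: sgn_if_def)

abbreviation sgm :: "int list \<Rightarrow> int list \<Rightarrow> 'r::comm_ring_1" where
  "sgm x y \<equiv> sgn_if (par x \<and> par y)"

text \<open>Expressions carry no types, so \<open>F\<close> recovers from the expression itself
  where a word has to be cut at a tensor product.\<close>

fun src :: "'k mor \<Rightarrow> nat" where
  "src (Ident X) = length X"
| "src (Gen g) = length (gdom g)"
| "src (f \<cdot> g) = src g"
| "src (f \<parallel> g) = src f + src g"
| "src (Zero X Y) = length X"
| "src (Add f g) = src f"
| "src (Scale a f) = src f"

lemma src_arrow: "arrow k X Y f \<Longrightarrow> src f = length X"
  by (induction rule: arrow.induct) auto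

locale rmat =
  fixes q qi :: "'r::comm_ring_1" and S :: "'k \<Rightarrow> 'r" and N :: int
  assumes q_qi: "q * qi = 1"
begin

definition zz :: 'r where "zz = q - qi"

text \<open>The coefficient of \<open>e\<^sub>y \<otimes> e\<^sub>x\<close> in the image of \<open>e\<^sub>x \<otimes> e\<^sub>y\<close> under the braiding.\<close>

definition thru :: "int \<Rightarrow> int \<Rightarrow> 'r" where
  "thru x y = sgn_if (odd x \<and> odd y) *
     (if x = y \<or> x = bar y then if odd y then qi else q else 1)"

text \<open>
  A matrix is represented by its action on row vectors: the value at \<open>w\<close> of the image of \<open>v\<close> is the
  sum of the \<open>v w'\<close> weighted with the entries in column \<open>w\<close> and row \<open>w'\<close>.
\<close>

fun Fgen :: "gen \<Rightarrow> (int list \<Rightarrow> 'r) \<Rightarrow> int list \<Rightarrow> 'r" where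
  "Fgen UPos v [x, y] = thru x y * v [y, x] + (if x < y then zz * v [x, y] else 0)
     + (if bar x < y then zz * (sgn_if (odd y) * v [bar x, bar y]) else 0)"
| "Fgen UNeg v [x, y] = thru x y * v [y, x] + (if x < y then zz * v [x, y] else 0)
     + (if bar x < y then zz * (sgn_if (odd y) * v [bar x, bar y]) else 0) - zz * v [x, y]"
| "Fgen RNeg v [y, x] = thru x y * v [x, y]
     - (if x = y then zz * (sgn_if (odd y) * (\<Sum>t\<in>{y..<N}. sgn_if (odd t) * v [t, t])) else 0)
     - (if x = bar y then zz * (\<Sum>t\<in>{x<..<N}. sgn_if (odd t) * v [t, bar t]) else 0)"
| "Fgen CapL v [x, y] = (if x = y then v [] else 0)"
| "Fgen CupL v [] = (\<Sum>t\<in>{-N..<N}. v [t, t])"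
| "Fgen Clif v [x] = sgn_if (odd x) * v [bar x]"
| "Fgen _ v _ = 0"

text \<open>Let \<open>a\<close> and \<open>b\<close> be the two halves of \<open>w\<close>. The
  signs in the tensor rule multiply to -1 to the power \<open>par a * (par b + par y')\<close>. For
  homogeneous \<open>g\<close> this is the Koszul sign for moving \<open>g\<close> past the basis
  vector of \<open>a\<close>, obtained here without referring to the parity of \<open>g\<close>, so
  that sums of expressions need no separate treatment.\<close>

fun F :: "'k mor \<Rightarrow> (int list \<Rightarrow> 'r) \<Rightarrow> int list \<Rightarrow> 'r" where
  "F (Ident X) v w = v w"
| "F (Gen g) v w = Fgen g v w"
| "F (f \<cdot> g) v w = F g (F f v) w"
| "F (f \<parallel> g) v w =
     F f (\<lambda>y. sgm (take (src f) w) (drop (src f) w) *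
       F g (\<lambda>y'. sgm (take (src f) w) y' * v (y @ y')) (drop (src f) w)) (take (src f) w)"
| "F (Zero X Y) v w = 0"
| "F (Add f g) v w = F f v w + F g v w"
| "F (Scale a f) v w = S a * F f v w"

lemma Fgen_add: "Fgen g (\<lambda>y. v y + v' y) w = Fgen g v w + Fgen g v' w"
  by (cases "(g, v, w)" rule: Fgen.cases) (simp_all add: algebra_simps sum.distrib)

lemma Fgen_mult: "Fgen g (\<lambda>y. a * v y) w = a * Fgen g v w"
  by (cases "(g, v, w)" rule: Fgen.cases) (simp_all add: algebra_simps sum_distrib_left)

lemma F_add: "F f (\<lambda>y. v y + v' y) w = F f v w + F f v' w"
proof (induction f arbitrary: v v' w)
  case (Comp f g)
  have "F f (\<lambda>y. v y + v' y) = (\<lambda>w. F f v w + F f v' w)" using Comp by blast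
  then show ?case using Comp by simp
qed (simp_all add: Fgen_add algebra_simps)

lemma F_mult: "F f (\<lambda>y. a * v y) w = a * F f v w"
proof (induction f arbitrary: v w a)
  case (Comp f g)
  have "F f (\<lambda>y. a * v y) = (\<lambda>w. a * F f v w)" using Comp by blast
  then show ?case using Comp by simp
next
  case (Tens f g)
  then show ?case by (simp add: mult.left_commute[of _ a])
qed (simp_all add: Fgen_mult algebra_simps)

definition lin :: "((int list \<Rightarrow> 'r) \<Rightarrow> 'r) \<Rightarrow> bool" where
  "lin L \<longleftrightarrow> (\<forall>u u'. L (\<lambda>y. u y + u' y) = L u + L u') \<and> (\<forall>a u. L (\<lambda>y. a * u y) = a * L u)"

lemma lin_F: "lin (\<lambda>u. F g u w)"
  by (simp add: lin_def F_add F_mult)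

lemma lin_simps:
  assumes "lin L"
  shows "L (\<lambda>y. u y + u' y) = L u + L u'" "L (\<lambda>y. a * u y) = a * L u"
    "L (\<lambda>y. u y - u' y) = L u - L u'" "L (\<lambda>y. if b then u y else u' y) = (if b then L u else L u')"
proof -
  have 1: "L (\<lambda>y. u y + u' y) = L u + L u'" for u u'
    by (rule lin_def[THEN iffD1, THEN conjunct1, rule_format, OF assms])
  show "L (\<lambda>y. u y + u' y) = L u + L u'" by (rule 1)
  show "L (\<lambda>y. a * u y) = a * L u"
    by (rule lin_def[THEN iffD1, THEN conjunct2, rule_format, OF assms])
  show "L (\<lambda>y. u y - u' y) = L u - L u'"
    using 1[of "\<lambda>y. u y - u' y" u'] by simp
  show "L (\<lambda>y. if b then u y else u' y) = (if b then L u else L u')"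
    by (cases b) simp_all
qed

lemma lin_zero: "lin L \<Longrightarrow> L (\<lambda>y. 0) = 0"
  using lin_simps(2)[of L 0 "\<lambda>y. 0"] by simp

lemma lin_sum:
  assumes "lin L" shows "L (\<lambda>y. \<Sum>i\<in>A. u i y) = (\<Sum>i\<in>A. L (u i))"
  by (induction A rule: infinite_finite_induct) (simp_all add: lin_zero[OF assms] lin_simps(1)[OF assms])

text \<open>\<open>F f\<close> consists of finite sums and scalar multiples, hence commutes with
  every linear functional applied in a second variable. This replaces an expansion in matrix
  entries; for the functional \<open>\<lambda>u. F g u w\<close> it is the exchange of summations in
  \<open>F_swap\<close>.\<close>

lemma F_lin:
  assumes "lin L" shows "F f (\<lambda>y. L (u y)) x = L (\<lambda>j. F f (\<lambda>y. u y j) x)"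
proof (induction f arbitrary: u x)
  case (Gen g)
  show ?case
    by (cases "(g, undefined :: int list \<Rightarrow> 'r, x)" rule: Fgen.cases)
      (simp_all add: lin_simps[OF assms] lin_sum[OF assms] lin_zero[OF assms] if_distrib)
next
  case (Comp f g)
  have "F f (\<lambda>y. L (u y)) = (\<lambda>x. L (\<lambda>j. F f (\<lambda>y. u y j) x))" using Comp by blast
  then show ?case using Comp by simp
next
  case (Tens f g)
  then show ?case by (simp flip: lin_simps[OF assms])
qed (simp_all add: lin_simps[OF assms] lin_zero[OF assms])

lemma F_swap: "F f (\<lambda>y. F g (u y) x') x = F g (\<lambda>y'. F f (\<lambda>y. u y y') x) x'"
  by (rule F_lin[OF lin_F])

definition W :: "obj \<Rightarrow> int list set" where
  "W X = {w. length w = length X \<and> set w \<subseteq> {-N..<N}}"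

definition ideal :: "('r \<Rightarrow> bool) \<Rightarrow> bool" where
  "ideal J \<longleftrightarrow> J 0 \<and> (\<forall>a b. J a \<longrightarrow> J b \<longrightarrow> J (a + b)) \<and> (\<forall>a b. J b \<longrightarrow> J (a * b))"

lemma ideal_simps:
  assumes "ideal J"
  shows "J 0" "J a \<Longrightarrow> J b \<Longrightarrow> J (a + b)" "J b \<Longrightarrow> J (a * b)" "J a \<Longrightarrow> J b \<Longrightarrow> J (a - b)"
proof -
  show "J a \<Longrightarrow> J b \<Longrightarrow> J (a - b)"
    using assms unfolding ideal_def by (metis add_uminus_conv_diff mult_minus1)
qed (use assms in \<open>auto simp: ideal_def\<close>)

lemma ideal_sum: "ideal J \<Longrightarrow> (\<And>i. i \<in> A \<Longrightarrow> J (u i)) \<Longrightarrow> J (\<Sum>i\<in>A. u i)"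
  by (induction A rule: infinite_finite_induct) (auto simp: ideal_def)

lemma W_bar [simp]: "x \<in> {-N..<N} \<Longrightarrow> bar x \<in> {-N..<N}"
  by (auto simp: bar_def)

lemma append_W: "w \<in> W X \<Longrightarrow> w' \<in> W X' \<Longrightarrow> w @ w' \<in> W (X @ X')"
  by (auto simp: W_def)

lemma W_append: "w \<in> W (X @ X') \<longleftrightarrow> take (length X) w \<in> W X \<and> drop (length X) w \<in> W X'"
proof
  show "w \<in> W (X @ X') \<Longrightarrow> take (length X) w \<in> W X \<and> drop (length X) w \<in> W X'"
    using set_take_subset[of "length X" w] set_drop_subset[of "length X" w]
    unfolding W_def by (intro conjI) (simp_all, (blast intro: subset_trans)+)
  show "take (length X) w \<in> W X \<and> drop (length X) w \<in> W X' \<Longrightarrow> w \<in> W (X @ X')"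
    using append_W[of "take (length X) w" X "drop (length X) w" X'] by simp
qed

lemma Fgen_ideal:
  assumes J: "ideal J" and w: "w \<in> W (gdom g)"
    and v: "\<And>y. y \<in> W (gcod g) \<Longrightarrow> par y = (par w \<noteq> gpar g) \<Longrightarrow> J (v y)"
  shows "J (Fgen g v w)"
proof (cases g)
  case UPos
  then obtain x y where [simp]: "w = [x, y]" and xy: "x \<in> {-N..<N}" "y \<in> {-N..<N}"
    using w by (auto simp: W_def length_Suc_conv numeral_2_eq_2)
  have "J (v [x, y])" "J (v [y, x])" "J (v [bar x, bar y])"
    using xy W_bar[OF xy(1)] W_bar[OF xy(2)] by (auto intro!: v simp: UPos W_def gpar_def)
  then show ?thesis using UPos by (auto intro!: ideal_simps[OF J])
next
  case UNeg
  then obtain x y where [simp]: "w = [x, y]" and xy: "x \<in> {-N..<N}" "y \<in> {-N..<N}"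
    using w by (auto simp: W_def length_Suc_conv numeral_2_eq_2)
  have "J (v [x, y])" "J (v [y, x])" "J (v [bar x, bar y])"
    using xy W_bar[OF xy(1)] W_bar[OF xy(2)] by (auto intro!: v simp: UNeg W_def gpar_def)
  then show ?thesis using UNeg by (auto intro!: ideal_simps[OF J])
next
  case RNeg
  then obtain x y where [simp]: "w = [y, x]" and xy: "x \<in> {-N..<N}" "y \<in> {-N..<N}"
    using w by (auto simp: W_def length_Suc_conv numeral_2_eq_2)
  have "J (v [x, y])" using xy by (auto intro!: v simp: RNeg W_def gpar_def)
  moreover have "J (v [t, t])" if "t \<in> {y..<N}" "x = y" for t
    using xy that by (auto intro!: v simp: RNeg W_def gpar_def)
  moreover have "J (v [t, bar t])" if "t \<in> {x<..<N}" "x = bar y" for t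
    using xy that by (auto intro!: v simp: RNeg W_def gpar_def bar_def)
  ultimately show ?thesis using RNeg by (auto intro!: ideal_simps[OF J] ideal_sum[OF J])
next
  case CapL
  then obtain x y where [simp]: "w = [x, y]"
    using w by (auto simp: W_def length_Suc_conv numeral_2_eq_2)
  have "J (v [])" if "x = y" using that by (auto intro!: v simp: CapL W_def gpar_def)
  then show ?thesis using CapL by (auto intro!: ideal_simps[OF J])
next
  case CupL
  then have [simp]: "w = []" using w by (auto simp: W_def)
  have "J (v [t, t])" if "t \<in> {-N..<N}" for t
    using that by (auto intro!: v simp: CupL W_def gpar_def)
  then show ?thesis using CupL by (auto intro!: ideal_sum[OF J])
next
  case Clif
  then obtain x where [simp]: "w = [x]" and x: "x \<in> {-N..<N}"
    using w by (auto simp: W_def length_Suc_conv)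
  have "J (v [bar x])" using W_bar[OF x] by (auto intro!: v simp: Clif W_def gpar_def)
  then show ?thesis using Clif by (auto intro!: ideal_simps[OF J])
qed

text \<open>With the zero ideal this gives extensionality on admissible words, with the kernel of
  \<open>ev\<close> compatibility with congruence.\<close>

lemma F_ideal:
  assumes "ideal J" "arrow k X Y f" "w \<in> W X" "\<And>y. y \<in> W Y \<Longrightarrow> J (v y)"
  shows "J (F f v w)"
  using assms(2-)
proof (induction arbitrary: v w rule: arrow.induct)
  case (Gen g)
  then show ?case using Fgen_ideal[OF assms(1)] by simp
next
  case (Tens X Y f X' Y' g)
  have "take (length X) w \<in> W X" "drop (length X) w \<in> W X'"
    using Tens.prems(1) by (auto simp: W_append)
  then show ?case
    using Tens.hyps by (auto simp: src_arrow intro!: Tens.IH ideal_simps[OF assms(1)] append_W Tens.prems(2))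
qed (auto intro: ideal_simps[OF assms(1)])

text \<open>A homogeneous expression relates only words with a fixed difference of parities. This
  determines the signs in whiskerings of even morphisms, and it lets matrix entries tell even
  morphisms from odd ones.\<close>

lemma F_ideal_par:
  assumes "ideal J" "homogeneous p f" "arrow k X Y f" "w \<in> W X"
    "\<And>y. y \<in> W Y \<Longrightarrow> par y = (par w \<noteq> p) \<Longrightarrow> J (v y)"
  shows "J (F f v w)"
  using assms(2-)
proof (induction arbitrary: X Y v w rule: homogeneous.induct)
  case (Ident X)
  then show ?case by (auto elim: arrow.cases)
next
  case (Gen g)
  then have "X = gdom g" "Y = gcod g" by (auto elim: arrow.cases)
  then show ?case using Fgen_ideal[OF assms(1), of w g v] Gen by simp
next
  case (Comp p f q g)
  from Comp.prems(1) obtain Y' where Y': "arrow k Y' Y f" "arrow k X Y' g"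
    by (cases rule: arrow.cases) auto
  show ?case
    unfolding F.simps
    by (rule Comp.IH(2)[OF Y'(2) Comp.prems(2)], rule Comp.IH(1)[OF Y'(1)])
      (auto intro: Comp.prems(3))
next
  case (Tens p f q g)
  from Tens.prems(1) obtain X1 X2 Y1 Y2
    where X: "X = X1 @ X2" "Y = Y1 @ Y2" and fg: "arrow k X1 Y1 f" "arrow k X2 Y2 g"
    by (cases rule: arrow.cases) auto
  define w1 w2 where "w1 = take (src f) w" and "w2 = drop (src f) w"
  have w: "w = w1 @ w2" "w1 \<in> W X1" "w2 \<in> W X2"
    using Tens.prems(2) by (auto simp: w1_def w2_def src_arrow[OF fg(1)] X W_append)
  have "J (F f (\<lambda>y. sgm w1 w2 * F g (\<lambda>y'. sgm w1 y' * v (y @ y')) w2) w1)"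
  proof (rule Tens.IH(1)[OF fg(1) w(2)])
    fix y assume y: "y \<in> W Y1" "par y = (par w1 \<noteq> p)"
    show "J (sgm w1 w2 * F g (\<lambda>y'. sgm w1 y' * v (y @ y')) w2)"
      by (intro ideal_simps[OF assms(1)] Tens.IH(2)[OF fg(2) w(3)] Tens.prems(3))
        (use y w X append_W in auto)
  qed
  then show ?case by (simp add: w1_def w2_def)
next
  case (Zero p X' Y')
  then show ?case by (simp add: ideal_simps[OF assms(1)])
next
  case (Add p f g)
  from Add.prems(1) have "arrow k X Y f" "arrow k X Y g" by (auto elim: arrow.cases)
  then show ?case using Add by (auto intro!: ideal_simps[OF assms(1)])
next
  case (Scale p f a)
  from Scale.prems(1) have "arrow k X Y f" by (auto elim: arrow.cases)
  then show ?case using Scale by (auto intro!: ideal_simps[OF assms(1)])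
qed

lemma ideal_zero: "ideal (\<lambda>a. a = 0)"
  by (simp add: ideal_def)

lemma F_diff: "F f v w - F f v' w = F f (\<lambda>y. v y - v' y) w"
  using lin_simps(3)[OF lin_F] by metis

lemma F_cong:
  assumes "arrow k X Y f" "w \<in> W X" "\<And>y. y \<in> W Y \<Longrightarrow> v y = v' y"
  shows "F f v w = F f v' w"
  using F_ideal[OF ideal_zero assms(1,2), of "\<lambda>y. v y - v' y"] assms(3)
  by (simp flip: F_diff)

lemma F_cong_par:
  assumes "homogeneous p f" "arrow k X Y f" "w \<in> W X"
    "\<And>y. y \<in> W Y \<Longrightarrow> par y = (par w \<noteq> p) \<Longrightarrow> v y = v' y"
  shows "F f v w = F f v' w"
  using F_ideal_par[OF ideal_zero assms(1-3), of "\<lambda>y. v y - v' y"] assms(4)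
  by (simp flip: F_diff)

end

section \<open>Whiskered generators and the inverse mixed crossings\<close>

context rmat
begin

lemma F_Tens_Ident [simp]:
  "F (f \<parallel> Ident X) v w = F f (\<lambda>y. v (y @ drop (src f) w)) (take (src f) w)"
  by simp

text \<open>An even \<open>g\<close> preserves parity, so both signs of the tensor rule are equal
  and cancel.\<close>

lemma F_Ident_Tens:
  assumes "homogeneous False g" "arrow k X Y g" "drop (length Z) w \<in> W X"
  shows "F (Ident Z \<parallel> g) v w = F g (\<lambda>y. v (take (length Z) w @ y)) (drop (length Z) w)"
proof -
  let ?a = "take (length Z) w" and ?b = "drop (length Z) w"
  have "F (Ident Z \<parallel> g) v w = sgm ?a ?b * F g (\<lambda>y. sgm ?a y * v (?a @ y)) ?b"
    by simp
  also have "F g (\<lambda>y. sgm ?a y * v (?a @ y)) ?b = F g (\<lambda>y. sgm ?a ?b * v (?a @ y)) ?b"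
    using assms by (intro F_cong_par[OF assms]) auto
  also have "sgm ?a ?b * \<dots> = F g (\<lambda>y. v (?a @ y)) ?b"
    by (simp only: F_mult sgn_if_sq)
  finally show ?thesis .
qed

lemma homogeneous_even_Gen: "g \<noteq> Clif \<Longrightarrow> homogeneous False (Gen g)"
  using homogeneous.Gen[of g] by (simp add: gpar_def)

lemma homogeneous_Tens_even: "homogeneous False f \<Longrightarrow> homogeneous False g \<Longrightarrow> homogeneous False (f \<parallel> g)"
  using homogeneous.Tens[of False f False g] by simp

lemma homogeneous_Comp_even: "homogeneous False f \<Longrightarrow> homogeneous False g \<Longrightarrow> homogeneous False (f \<cdot> g)"
  using homogeneous.Comp[of False f False g] by simp

lemmas homogeneous_even = homogeneous_even_Gen homogeneous_Tens_even homogeneous_Comp_even homogeneous.Ident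

lemma F_Ident_Gen:
  assumes "g \<noteq> Clif" "drop (length Z) w \<in> W (gdom g)"
  shows "F (Ident Z \<parallel> Gen g) v w = Fgen g (\<lambda>y. v (take (length Z) w @ y)) (drop (length Z) w)"
  using F_Ident_Tens[OF homogeneous_even_Gen[OF assms(1)] arrow.Gen assms(2)] by simp

lemma F_Ident_Gen_Ident:
  assumes "g \<noteq> Clif" "drop (length Z) w \<in> W (gdom g @ Z')"
  shows "F (Ident Z \<parallel> Gen g \<parallel> Ident Z') v w =
    Fgen g (\<lambda>y. v (take (length Z) w @ y @ drop (length (gdom g)) (drop (length Z) w)))
      (take (length (gdom g)) (drop (length Z) w))"
  using assms
  by (subst F_Ident_Tens[OF homogeneous_Tens_even[OF homogeneous_even_Gen homogeneous.Ident] arrow.Tens[OF arrow.Gen arrow.Ident]])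
    auto

text \<open>The sum runs over the label \<open>t\<close> of the cup. In the through term of
  \<open>UPos\<close> the cap forces \<open>t = x\<close>; in the two other terms it forces
  \<open>x = y\<close> or \<open>x = bar y\<close>, and the sum over \<open>t\<close>
  survives.\<close>

lemma F_l_pos:
  assumes "x \<in> {-N..<N}" "y \<in> {-N..<N}"
  shows "F l_pos v [x, y] = thru y x * v [y, x]
    + (if x = y then zz * (\<Sum>t\<in>{x<..<N}. v [t, t]) else 0)
    + (if x = bar y then zz * (\<Sum>t\<in>{x<..<N}. sgn_if (odd t) * v [bar t, t]) else 0)"
proof -
  have mid: "F (Ident [\<down>] \<parallel> Gen UPos \<parallel> Ident [\<down>]) (F (Gen CapL \<parallel> Ident [\<up>, \<down>]) v) [x, y, t, t] =
      thru y t * (if x = t then v [y, t] else 0)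
      + (if y < t then zz * (if x = y then v [t, t] else 0) else 0)
      + (if bar y < t then zz * (sgn_if (odd t) * (if x = bar y then v [bar t, t] else 0)) else 0)"
    if "t \<in> {-N..<N}" for t
    using assms that by (subst F_Ident_Gen_Ident) (auto simp: W_def)
  have "F l_pos v [x, y] = (\<Sum>t\<in>{-N..<N}.
      thru y t * (if x = t then v [y, t] else 0)
      + (if y < t then zz * (if x = y then v [t, t] else 0) else 0)
      + (if bar y < t then zz * (sgn_if (odd t) * (if x = bar y then v [bar t, t] else 0)) else 0))"
    unfolding l_pos_def Phi_def
    using mid by (subst F.simps(3), subst F.simps(3), subst F_Ident_Gen)
      (auto simp: W_def simp del: F.simps(4) F_Tens_Ident intro!: sum.cong)
  also have "\<dots> = (\<Sum>t\<in>{-N..<N}. if x = t then thru y t * v [y, t] else 0)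
      + (\<Sum>t\<in>{-N..<N}. if y < t then zz * (if x = y then v [t, t] else 0) else 0)
      + (\<Sum>t\<in>{-N..<N}. if bar y < t then zz * (sgn_if (odd t) * (if x = bar y then v [bar t, t] else 0)) else 0)"
    unfolding sum.distrib by (intro arg_cong2[where f = "(+)"] sum.cong refl) auto
  also have "(\<Sum>t\<in>{-N..<N}. if x = t then thru y t * v [y, t] else 0) = thru y x * v [y, x]"
    using assms by simp
  also have "(\<Sum>t\<in>{-N..<N}. if y < t then zz * (if x = y then v [t, t] else 0) else 0) =
      (if x = y then zz * (\<Sum>t\<in>{x<..<N}. v [t, t]) else 0)"
    using assms by (simp add: sum_distrib_left sum.If_cases) (intro impI sum.cong, auto)
  also have "(\<Sum>t\<in>{-N..<N}. if bar y < t then zz * (sgn_if (odd t) * (if x = bar y then v [bar t, t] else 0)) else 0) =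
      (if x = bar y then zz * (\<Sum>t\<in>{x<..<N}. sgn_if (odd t) * v [bar t, t]) else 0)"
    using assms by (simp add: sum_distrib_left sum.If_cases) (intro impI sum.cong, auto)
  finally show ?thesis .
qed

lemma F_Gen: "F (Gen g) v = Fgen g v"
  by (rule ext) simp

text \<open>\<open>q\<close> to the power \<open>(-1)^y\<close>; \<open>qe'\<close> is its inverse.
  A shift of \<open>y\<close> by one and \<open>bar\<close> both exchange the two.\<close>

definition qe :: "int \<Rightarrow> 'r" where "qe y = (if odd y then qi else q)"
definition qe' :: "int \<Rightarrow> 'r" where "qe' y = (if odd y then q else qi)"

lemma qe_simps:
  "qe y * qe' y = 1" "qe' y * qe y = 1" "qe (y + 1) = qe' y" "qe' (y + 1) = qe y" "qe (bar y) = qe' y"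
  "qe' (bar y) = qe y" "qe y * (qe' y * a) = a" "qe' y * (qe y * a) = a"
  "qe' y + zz * sgn_if (odd y) = qe y" "qe y - zz * sgn_if (odd y) = qe' y"
proof -
  have 1: "qi * q = 1" using q_qi by (simp add: mult.commute)
  have 2: "q * (qi * a) = a" "qi * (q * a) = a" for a
    using q_qi 1 by (simp_all flip: mult.assoc)
  show "qe y * qe' y = 1" "qe' y * qe y = 1" "qe (y + 1) = qe' y" "qe' (y + 1) = qe y" "qe (bar y) = qe' y"
    "qe' (bar y) = qe y" "qe y * (qe' y * a) = a" "qe' y * (qe y * a) = a"
    "qe' y + zz * sgn_if (odd y) = qe y" "qe y - zz * sgn_if (odd y) = qe' y"
    by (simp_all add: qe_def qe'_def zz_def q_qi 1 2)
qed

lemma thru_simps: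
  "thru x x = sgn_if (odd x) * qe x" "thru (bar y) y = qe y" "thru y (bar y) = qe' y"
  "x \<noteq> y \<Longrightarrow> x \<noteq> bar y \<Longrightarrow> thru x y = sgn_if (odd x \<and> odd y)"
  by (auto simp: thru_def qe_def qe'_def)

text \<open>Both telescoping identities reduce to \<open>q\<^sup>2 = z q + 1\<close> because parities alternate along \<open>{-N..<N}\<close>.\<close>

lemma telescope_lr:
  fixes u :: "int \<Rightarrow> 'r"
  assumes "y < N"
  shows "(\<Sum>t\<in>{y<..<N}. sgn_if (odd t) * (sgn_if (odd t) * qe t * u t + zz * (\<Sum>j\<in>{t<..<N}. u j)))
    = qe' y * (\<Sum>j\<in>{y<..<N}. u j)" (is "?L y = _")
proof -
  have "y \<le> N - 1" using assms by simp
  then show ?thesis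
proof (induction y rule: int_le_induct)
  case base
  have "{N - 1<..<N} = {}" by auto
  then show ?case by simp
next
  case (step y)
  have *: "{y - 1<..<N} = insert y {y<..<N}" using step(1) by auto
  have "?L (y - 1) = sgn_if (odd y) * (sgn_if (odd y) * qe y * u y + zz * (\<Sum>j\<in>{y<..<N}. u j))
      + qe' y * (\<Sum>j\<in>{y<..<N}. u j)"
    unfolding * using step by simp
  also have "\<dots> = qe y * u y + (qe' y + zz * sgn_if (odd y)) * (\<Sum>j\<in>{y<..<N}. u j)"
    by (simp add: algebra_simps)
  also have "\<dots> = qe' (y - 1) * (\<Sum>j\<in>{y - 1<..<N}. u j)"
    unfolding * qe_simps using qe_simps(3)[of "y - 1"] by (simp add: algebra_simps)
  finally show ?case .
qed
qed

lemma telescope_rl: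
  fixes u :: "int \<Rightarrow> 'r"
  assumes "y < N"
  shows "(\<Sum>j\<in>{y<..<N}. sgn_if (odd j) * qe' j * u j - zz * (sgn_if (odd j) * (\<Sum>t\<in>{j<..<N}. sgn_if (odd t) * u t)))
    = qe y * (\<Sum>t\<in>{y<..<N}. sgn_if (odd t) * u t)" (is "?L y = _")
proof -
  have "y \<le> N - 1" using assms by simp
  then show ?thesis
proof (induction y rule: int_le_induct)
  case base
  have "{N - 1<..<N} = {}" by auto
  then show ?case by simp
next
  case (step y)
  have *: "{y - 1<..<N} = insert y {y<..<N}" using step(1) by auto
  let ?s = "\<Sum>t\<in>{y<..<N}. sgn_if (odd t) * u t"
  have "?L (y - 1) = sgn_if (odd y) * qe' y * u y - zz * (sgn_if (odd y) * ?s) + qe y * ?s"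
    unfolding * using step by simp
  also have "\<dots> = qe' y * (sgn_if (odd y) * u y) + (qe y - zz * sgn_if (odd y)) * ?s"
    by (simp add: algebra_simps)
  also have "\<dots> = qe (y - 1) * (\<Sum>j\<in>{y - 1<..<N}. sgn_if (odd j) * u j)"
    unfolding * qe_simps using qe_simps(4)[of "y - 1"] by (simp add: algebra_simps)
  finally show ?case .
qed
qed

text \<open>Words \<open>[t, t]\<close>, words \<open>[t, bar t]\<close> and words of two colours
  are not mixed by \<open>l_pos\<close>. On the first two kinds it is triangular up to a flip, in
  the order of the labels, and the formula for \<open>RNeg\<close> is its inverse there: by
  \<open>telescope_lr\<close> the double sums reduce to single sums times a power of
  \<open>q\<close>. On the third kind both matrices are signed flips.\<close>

lemma rel_lr:
  assumes w: "w \<in> W [\<up>, \<down>]"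
  shows "F (l_pos \<cdot> Gen RNeg) v w = v w"
proof -
  obtain x y where [simp]: "w = [y, x]" and xy: "x \<in> {-N..<N}" "y \<in> {-N..<N}"
    using w by (auto simp: W_def length_Suc_conv numeral_2_eq_2)
  have l: "F l_pos v [t, t] = sgn_if (odd t) * qe t * v [t, t] + zz * (\<Sum>j\<in>{t<..<N}. v [j, j])"
    if "t \<in> {-N..<N}" for t
    using F_l_pos[OF that that] by (simp add: thru_simps)
  have lb: "F l_pos v [t, bar t] = qe t * v [bar t, t] + zz * (\<Sum>j\<in>{t<..<N}. sgn_if (odd j) * v [bar j, j])"
    if "t \<in> {-N..<N}" for t
    using F_l_pos[OF that W_bar[OF that]] by (simp add: thru_simps)
  consider "x = y" | "x = bar y" | "x \<noteq> y" "x \<noteq> bar y" by blast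
  then show ?thesis
  proof cases
    case 1
    have i: "{y..<N} = insert y {y<..<N}" using xy by auto
    let ?u = "\<Sum>j\<in>{y<..<N}. v [j, j]"
    have "(\<Sum>t\<in>{y<..<N}. sgn_if (odd t) * F l_pos v [t, t]) = qe' y * ?u"
      using xy by (subst telescope_lr[symmetric]) (auto intro!: sum.cong simp: l)
    then have "F (l_pos \<cdot> Gen RNeg) v w = sgn_if (odd y) * qe y * F l_pos v [y, y]
        - zz * (sgn_if (odd y) * (sgn_if (odd y) * F l_pos v [y, y] + qe' y * ?u))"
      using 1 by (simp add: thru_simps i)
    also have "\<dots> = sgn_if (odd y) * (qe y - zz * sgn_if (odd y)) * F l_pos v [y, y] - zz * sgn_if (odd y) * qe' y * ?u"
      by (simp add: algebra_simps)
    also have "\<dots> = (qe' y * qe y) * v [y, y]"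
      unfolding l[OF xy(2)] by (simp add: algebra_simps qe_simps)
    finally show ?thesis using 1 by (simp add: qe_simps)
  next
    case 2
    let ?u = "\<Sum>j\<in>{x<..<N}. sgn_if (odd j) * v [bar j, j]"
    have "(\<Sum>t\<in>{x<..<N}. sgn_if (odd t) * F l_pos v [t, bar t]) = qe' x * ?u"
      using xy by (subst telescope_lr[symmetric]) (auto intro!: sum.cong simp: lb algebra_simps)
    then have "F (l_pos \<cdot> Gen RNeg) v w = qe y * F l_pos v [x, bar x] - zz * (qe' x * ?u)"
      using 2 by (simp add: thru_simps)
    also have "\<dots> = v w"
      unfolding lb[OF xy(1)] using 2 qe_simps(5)[of x] qe_simps(2)[of x] qe_simps(1)[of x]
      by (simp add: algebra_simps) (simp flip: mult.assoc)
    finally show ?thesis .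
  next
    case 3
    then have "F (l_pos \<cdot> Gen RNeg) v w = thru x y * F l_pos v [x, y]"
      by (auto simp: bar_def)
    also have "\<dots> = v w"
      using 3 xy by (subst F_l_pos) (auto simp: thru_simps bar_def conj_commute)
    finally show ?thesis .
  qed
qed

text \<open>The blocks are those of \<open>rel_lr\<close>. In this order the inner sums carry the
  signs, which is the form of \<open>telescope_rl\<close>.\<close>

lemma rel_rl:
  assumes w: "w \<in> W [\<down>, \<up>]"
  shows "F (Gen RNeg \<cdot> l_pos) v w = v w"
proof -
  obtain x y where [simp]: "w = [x, y]" and xy: "x \<in> {-N..<N}" "y \<in> {-N..<N}"
    using w by (auto simp: W_def length_Suc_conv numeral_2_eq_2)
  let ?r = "Fgen RNeg v"
  have r: "?r [t, t] = sgn_if (odd t) * qe' t * v [t, t] - zz * (sgn_if (odd t) * (\<Sum>j\<in>{t<..<N}. sgn_if (odd j) * v [j, j]))"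
    if "t \<in> {-N..<N}" for t
  proof -
    have i: "{t..<N} = insert t {t<..<N}" using that by auto
    show ?thesis
      by (cases "odd t") (simp_all add: thru_simps i qe_def qe'_def zz_def algebra_simps)
  qed
  have rb: "sgn_if (odd t) * ?r [bar t, t] = sgn_if (odd t) * qe' t * v [t, bar t] - zz * (sgn_if (odd t) * (\<Sum>j\<in>{t<..<N}. sgn_if (odd j) * v [j, bar j]))"
    for t
    by (simp add: thru_simps algebra_simps)
  have "F (Gen RNeg \<cdot> l_pos) v w = F l_pos ?r [x, y]"
    by (simp add: F_Gen)
  also have "\<dots> = v w"
  proof -
    consider "x = y" | "x = bar y" | "x \<noteq> y" "x \<noteq> bar y" by blast
    then show ?thesis
    proof cases
      case 1
      let ?u = "\<Sum>t\<in>{x<..<N}. sgn_if (odd t) * v [t, t]"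
      have "(\<Sum>t\<in>{x<..<N}. ?r [t, t]) = qe x * ?u"
        using xy by (subst telescope_rl[symmetric]) (auto intro!: sum.cong simp: r simp del: Fgen.simps)
      then have "F l_pos ?r [x, y] = sgn_if (odd x) * qe x * ?r [x, x] + zz * (qe x * ?u)"
        using 1 xy by (subst F_l_pos) (auto simp: thru_simps simp del: Fgen.simps)
      also have "\<dots> = (qe x * qe' x) * v [x, x]"
        unfolding r[OF xy(1)] by (simp add: algebra_simps)
      finally show ?thesis using 1 by (simp add: qe_simps)
    next
      case 2
      let ?u = "\<Sum>t\<in>{x<..<N}. sgn_if (odd t) * v [t, bar t]"
      have "(\<Sum>t\<in>{x<..<N}. sgn_if (odd t) * ?r [bar t, t]) = qe x * ?u"
        using xy by (subst telescope_rl[symmetric]) (auto intro!: sum.cong simp: rb simp del: Fgen.simps)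
      then have "F l_pos ?r [x, y] = qe x * ?r [bar x, x] + zz * (qe x * ?u)"
        using 2 xy by (subst F_l_pos) (auto simp: thru_simps qe_simps simp del: Fgen.simps)
      also have "\<dots> = (qe x * qe' x) * v [x, bar x]"
        using 2 by (simp add: thru_simps qe_simps algebra_simps)
      finally show ?thesis using 2 by (simp add: qe_simps)
    next
      case 3
      then show ?thesis
        using xy by (subst F_l_pos) (auto simp: thru_simps bar_def conj_commute)
    qed
  qed
  finally show ?thesis .
qed

end

section \<open>The braid relation\<close>

context rmat
begin

text \<open>The action of \<open>UPos\<close> on three labels without lists and without the bound
  \<open>N\<close>, so that the braid relation becomes a finite case distinction.\<close>

definition T12 :: "(int \<Rightarrow> int \<Rightarrow> int \<Rightarrow> 'r) \<Rightarrow> int \<Rightarrow> int \<Rightarrow> int \<Rightarrow> 'r" where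
  "T12 v x y w = thru x y * v y x w + (if x < y then zz * v x y w else 0)
     + (if bar x < y then zz * (sgn_if (odd y) * v (bar x) (bar y) w) else 0)"

definition T23 :: "(int \<Rightarrow> int \<Rightarrow> int \<Rightarrow> 'r) \<Rightarrow> int \<Rightarrow> int \<Rightarrow> int \<Rightarrow> 'r" where
  "T23 v x y w = thru y w * v x w y + (if y < w then zz * v x y w else 0)
     + (if bar y < w then zz * (sgn_if (odd w) * v x (bar y) (bar w)) else 0)"

lemma q_cancel: "qi * q = 1" "q * (qi * a) = a" "qi * (q * a) = a"
proof -
  show 1: "qi * q = 1" using q_qi by (simp add: mult.commute)
  show "q * (qi * a) = a" "qi * (q * a) = a"
    using q_qi 1 by (simp_all flip: mult.assoc)
qed

text \<open>\<open>bar\<close> changes parity, so signs of complementary parities appear in the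
  cases of the braid relation. These equations reduce them to a few signs that ring normalisation
  can treat as atoms.\<close>

lemma sgn_if_bilinear:
  "sgn_if (odd x \<and> even y) = sgn_if (odd x) * (sgn_if (odd x \<and> odd y) :: 'r)"
  "sgn_if (even x \<and> odd y) = sgn_if (odd y) * (sgn_if (odd x \<and> odd y) :: 'r)"
  "sgn_if (even x \<and> even y) = - (sgn_if (odd x) * (sgn_if (odd y) * (sgn_if (odd x \<and> odd y) :: 'r)))"
  "sgn_if (even x) = - (sgn_if (odd x) :: 'r)"
  by (simp_all add: sgn_if_def)

text \<open>Which terms of \<open>UPos\<close> are present at \<open>x, y\<close> depends on how
  \<open>x\<close> compares with \<open>y\<close> and with \<open>bar y\<close>. Equality in both is
  impossible since \<open>bar y\<close> differs from \<open>y\<close>.\<close>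

lemma order_cases:
  fixes x y :: int
  obtains "x < y" "x < - 1 - y" | "x < y" "x = - 1 - y" | "x < y" "x > - 1 - y"
    | "x = y" "x < - 1 - y" | "x = y" "x > - 1 - y"
    | "x > y" "x < - 1 - y" | "x > y" "x = - 1 - y" | "x > y" "x > - 1 - y"
proof -
  have "\<not> (x = y \<and> x = - 1 - y)" by presburger
  then show thesis using that by linarith
qed

text \<open>The relative positions of the three pairs of labels determine all terms. Contradictory
  combinations are excluded by linear arithmetic, and the others are ring identities modulo
  \<open>q * qi = 1\<close>.\<close>

lemma braid_T: "T12 (T23 (T12 v)) x y w = T23 (T12 (T23 v)) x y w"
  by (cases rule: order_cases[of x y]; cases rule: order_cases[of x w]; cases rule: order_cases[of y w];
      (linarith | (simp add: T12_def T23_def thru_def bar_def,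
        (simp add: sgn_if_bilinear conj_ac algebra_simps zz_def q_qi q_cancel)?)))

end

section \<open>Typing of the derived morphisms\<close>

lemma arrow_Gen_simps:
  "arrow k [\<up>, \<up>] [\<up>, \<up>] (Gen UPos)" "arrow k [\<up>, \<up>] [\<up>, \<up>] (Gen UNeg)" "arrow k [\<up>, \<down>] [\<down>, \<up>] (Gen RNeg)"
  "arrow k [\<down>, \<up>] [] (Gen CapL)" "arrow k [] [\<up>, \<down>] (Gen CupL)" "arrow k [\<up>] [\<up>] (Gen Clif)"
  using arrow.Gen[of k UPos] arrow.Gen[of k UNeg] arrow.Gen[of k RNeg] arrow.Gen[of k CapL]
    arrow.Gen[of k CupL] arrow.Gen[of k Clif] by simp_all

lemma arrow_Tens_eq:
  "arrow k X Y f \<Longrightarrow> arrow k X' Y' g \<Longrightarrow> A = X @ X' \<Longrightarrow> B = Y @ Y' \<Longrightarrow> arrow k A B (f \<parallel> g)"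
  using arrow.Tens by simp

lemma arrow_Phi: "arrow k (A @ [\<up>]) (\<up> # B) f \<Longrightarrow> arrow k (\<down> # A) (B @ [\<down>]) (Phi A B f)"
  unfolding Phi_def
  apply (rule arrow.Comp[where Y = "\<down> # \<up> # B @ [\<down>]"])
   apply (rule arrow_Tens_eq[OF arrow_Gen_simps(4) arrow.Ident]; simp)
  apply (rule arrow.Comp[where Y = "\<down> # A @ \<up> # [\<down>]"])
   apply (rule arrow_Tens_eq[OF arrow.Ident arrow.Tens[OF _ arrow.Ident]]; simp)
  apply (rule arrow_Tens_eq[OF arrow.Ident arrow_Gen_simps(5)]; simp)
  done

lemma arrow_l_pos: "arrow k [\<down>, \<up>] [\<up>, \<down>] l_pos"
  unfolding l_pos_def by (rule arrow_Phi[of k "[\<up>]" "[\<up>]", simplified]) (rule arrow_Gen_simps)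
lemma arrow_l_neg: "arrow k [\<down>, \<up>] [\<up>, \<down>] l_neg"
  unfolding l_neg_def by (rule arrow_Phi[of k "[\<up>]" "[\<up>]", simplified]) (rule arrow_Gen_simps)
lemma arrow_d_pos: "arrow k [\<down>, \<down>] [\<down>, \<down>] d_pos"
  unfolding d_pos_def by (rule arrow_Phi[of k "[\<down>]" "[\<down>]", simplified]) (rule arrow_l_pos)
lemma arrow_d_neg: "arrow k [\<down>, \<down>] [\<down>, \<down>] d_neg"
  unfolding d_neg_def by (rule arrow_Phi[of k "[\<down>]" "[\<down>]", simplified]) (rule arrow_l_neg)
lemma arrow_clif_down: "arrow k [\<down>] [\<down>] clif_down"
  unfolding clif_down_def by (rule arrow_Phi[of k "[]" "[]", simplified]) (rule arrow_Gen_simps)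
lemma arrow_cap_R: "arrow k [\<up>, \<down>] [] cap_R"
  unfolding cap_R_def by (rule arrow.Comp[OF arrow_Gen_simps(4,3)])
lemma arrow_cup_R: "arrow k [] [\<down>, \<up>] cup_R"
  unfolding cup_R_def by (rule arrow.Comp[OF arrow_Gen_simps(3,5)])

lemmas arrow_basic = arrow_Gen_simps arrow_l_pos arrow_l_neg arrow_d_pos arrow_d_neg arrow_clif_down
  arrow_cap_R arrow_cup_R arrow.Ident

context cring_param
begin

lemma relation_arrow: "relation k z X Y f g \<Longrightarrow> arrow k X Y f \<and> arrow k X Y g"
proof (induction rule: relation.induct)
  case u_inv
  then show ?case by (intro conjI arrow.intros(3)[OF arrow_basic(2,1)] arrow.Ident)
next
  case u_inv'
  then show ?case by (intro conjI arrow.intros(3)[OF arrow_basic(1,2)] arrow.Ident)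
next
  case lr_inv
  then show ?case by (intro conjI arrow.Comp[OF arrow_l_pos arrow_basic(3)] arrow.Ident)
next
  case rl_inv
  then show ?case by (intro conjI arrow.Comp[OF arrow_basic(3) arrow_l_pos] arrow.Ident)
next
  case braid
  have "arrow k [\<up>, \<up>, \<up>] [\<up>, \<up>, \<up>] (Gen UPos \<parallel> Ident [\<up>])"
    "arrow k [\<up>, \<up>, \<up>] [\<up>, \<up>, \<up>] (Ident [\<up>] \<parallel> Gen UPos)"
    by (rule arrow_Tens_eq[OF arrow_Gen_simps(1) arrow.Ident]; simp)
      (rule arrow_Tens_eq[OF arrow.Ident arrow_Gen_simps(1)]; simp)
  then show ?case by (blast intro: arrow.Comp)
next
  case skein
  then show ?case by (auto intro!: arrow.Add arrow.Scale arrow_basic)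
next
  case clif_sq
  then show ?case by (auto intro!: arrow.Scale arrow_basic arrow.Comp)
next
  case clif_slide
  have "arrow k [\<up>, \<up>] [\<up>, \<up>] (Gen Clif \<parallel> Ident [\<up>])" "arrow k [\<up>, \<up>] [\<up>, \<up>] (Ident [\<up>] \<parallel> Gen Clif)"
    by (rule arrow_Tens_eq[OF arrow_Gen_simps(6) arrow.Ident]; simp)
      (rule arrow_Tens_eq[OF arrow.Ident arrow_Gen_simps(6)]; simp)
  then show ?case by (blast intro: arrow.Comp arrow_basic)
next
  case clif_bubble
  have "arrow k [\<up>, \<down>] [\<up>, \<down>] (Gen Clif \<parallel> Ident [\<down>])"
    by (rule arrow_Tens_eq[OF arrow_Gen_simps(6) arrow.Ident]; simp)
  then show ?case by (blast intro: arrow.Comp arrow_basic arrow.Zero)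
next
  case bubble
  then show ?case by (blast intro: arrow.Comp arrow_basic arrow.Zero)
next
  case zigzag_up
  have "arrow k [\<up>, \<down>, \<up>] [\<up>] (Ident [\<up>] \<parallel> Gen CapL)" "arrow k [\<up>] [\<up>, \<down>, \<up>] (Gen CupL \<parallel> Ident [\<up>])"
    by (rule arrow_Tens_eq[OF arrow.Ident arrow_Gen_simps(4)]; simp)
      (rule arrow_Tens_eq[OF arrow_Gen_simps(5) arrow.Ident]; simp)
  then show ?case by (blast intro: arrow.Comp arrow_basic)
next
  case zigzag_down
  have "arrow k [\<down>, \<up>, \<down>] [\<down>] (Gen CapL \<parallel> Ident [\<down>])" "arrow k [\<down>] [\<down>, \<up>, \<down>] (Ident [\<down>] \<parallel> Gen CupL)"
    by (rule arrow_Tens_eq[OF arrow_Gen_simps(4) arrow.Ident]; simp)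
      (rule arrow_Tens_eq[OF arrow.Ident arrow_Gen_simps(5)]; simp)
  then show ?case by (blast intro: arrow.Comp arrow_basic)
qed

lemma eqv_arrow: "eqv k z X Y f g \<Longrightarrow> arrow k X Y f \<and> arrow k X Y g"
proof (induction rule: eqv.induct)
  case (rel X Y f g)
  then show ?case by (rule relation_arrow)
next
  case (tens_assoc X Y f X' Y' g X'' Y'' h)
  then show ?case using arrow.Tens[OF arrow.Tens[of k X Y f X' Y' g]] by (auto intro: arrow.Tens)
next
  case (tens_unit_left X Y f)
  then show ?case using arrow.Tens[OF arrow.Ident tens_unit_left, of "[]"] by simp
next
  case (tens_unit_right X Y f)
  then show ?case using arrow.Tens[OF tens_unit_right arrow.Ident, of "[]"] by simp
qed (auto intro: arrow.intros)

end

section \<open>The remaining relations between matrices\<close>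

context rmat
begin

lemma rel_UU:
  "Fgen UPos (Fgen UNeg v) [x, y] = v [x, y]" "Fgen UNeg (Fgen UPos v) [x, y] = v [x, y]"
  by (cases rule: order_cases[of x y]; cases "odd x"; cases "odd y";
      simp add: thru_def bar_def algebra_simps zz_def q_qi q_cancel)+

lemma F_Ident_Clif:
  "F (Ident [c] \<parallel> Gen Clif) v [x, y] = sgn_if (odd x) * (sgn_if (odd y) * v [x, bar y])"
  by (cases "odd x"; cases "odd y"; simp)

lemma rel_slide:
  "F (Gen UPos \<cdot> (Gen Clif \<parallel> Ident [\<up>])) v [x, y] = F ((Ident [\<up>] \<parallel> Gen Clif) \<cdot> Gen UPos) v [x, y]"
  by (cases rule: order_cases[of x y]; cases "odd x"; cases "odd y";
      simp add: F_Ident_Clif thru_def bar_def algebra_simps zz_def q_qi q_cancel del: F.simps(4))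

lemma rel_clif_bubble: "F (cap_R \<cdot> (Gen Clif \<parallel> Ident [\<down>]) \<cdot> Gen CupL) v [] = 0"
  by (simp add: cap_R_def sum.neutral)

text \<open>Superdimension zero. Each induction step adds the labels \<open>n\<close> and
  \<open>-n - 1\<close>, one even and one odd.\<close>

lemma sum_sgn_if: "(\<Sum>t\<in>{-N..<N}. sgn_if (odd t) :: 'r) = 0"
proof (cases "N \<ge> 0")
  case True
  then obtain n where "N = int n" by (metis nonneg_int_cases)
  moreover have "(\<Sum>t\<in>{-int n..<int n}. sgn_if (odd t) :: 'r) = 0"
  proof (induction n)
    case (Suc n)
    have "{-int (Suc n)..<int (Suc n)} = insert (- int (Suc n)) (insert (int n) {-int n..<int n})" by auto
    then show ?case using Suc by (cases "even n") simp_all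
  qed simp
  ultimately show ?thesis by simp
qed simp

text \<open>The scalar \<open>qe t - zz * (\<Sum>j\<in>{t..<N}. sgn_if (odd j))\<close> does not
  depend on \<open>t\<close>: lowering \<open>t\<close> by one inverts the power of
  \<open>q\<close>, and the new summand undoes this. It is read off at \<open>t = N - 1\<close>. So
  the right cap is a supertrace up to a power of \<open>q\<close>.\<close>

lemma cap_R_eq:
  assumes "t \<in> {-N..<N}"
  shows "F cap_R v [t, t] = sgn_if (odd t) * (qe' (N - 1) * v [])"
proof -
  have "t \<le> N - 1" using assms by simp
  then have "qe t - zz * (\<Sum>j\<in>{t..<N}. sgn_if (odd j)) = qe' (N - 1)"
  proof (induction t rule: int_le_induct)
    case base
    have "{N - 1..<N} = {N - 1}" by auto
    then show ?case using qe_simps(10)[of "N - 1"] by simp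
  next
    case (step t)
    have "{t - 1..<N} = insert (t - 1) {t..<N}" using step(1) by auto
    then have "qe (t - 1) - zz * (\<Sum>j\<in>{t - 1..<N}. sgn_if (odd j))
        = (qe (t - 1) - zz * sgn_if (odd (t - 1))) - zz * (\<Sum>j\<in>{t..<N}. sgn_if (odd j))"
      by (simp add: algebra_simps)
    also have "\<dots> = qe t - zz * (\<Sum>j\<in>{t..<N}. sgn_if (odd j))"
      unfolding qe_simps using qe_simps(3)[of "t - 1"] by simp
    finally show ?case using step by simp
  qed
  moreover have "F cap_R v [t, t] = sgn_if (odd t) * ((qe t - zz * (\<Sum>j\<in>{t..<N}. sgn_if (odd j))) * v [])"
    by (simp add: cap_R_def thru_simps algebra_simps sum_distrib_left sum_distrib_right)
  ultimately show ?thesis by simp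
qed

lemma rel_bubble: "F (cap_R \<cdot> Gen CupL) v [] = 0"
  using sum_sgn_if by (simp add: cap_R_eq flip: sum_distrib_right)

lemma rel_clif_sq: "F (Gen Clif \<cdot> Gen Clif) v [x] = - v [x]"
  by (cases "odd x") simp_all

lemma rel_zigzag_up:
  assumes "x \<in> {-N..<N}"
  shows "F ((Ident [\<up>] \<parallel> Gen CapL) \<cdot> (Gen CupL \<parallel> Ident [\<up>])) v [x] = v [x]"
proof -
  have "F (Ident [\<up>] \<parallel> Gen CapL) v [t, t, x] = (if t = x then v [x] else 0)" if "t \<in> {-N..<N}" for t
    using that assms by (subst F_Ident_Gen) (auto simp: W_def)
  then show ?thesis using assms by (simp del: F.simps(4))
qed

lemma rel_zigzag_down:
  assumes "x \<in> {-N..<N}"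
  shows "F ((Gen CapL \<parallel> Ident [\<down>]) \<cdot> (Ident [\<down>] \<parallel> Gen CupL)) v [x] = v [x]"
proof -
  have "F ((Gen CapL \<parallel> Ident [\<down>]) \<cdot> (Ident [\<down>] \<parallel> Gen CupL)) v [x]
      = F (Ident [\<down>] \<parallel> Gen CupL) (F (Gen CapL \<parallel> Ident [\<down>]) v) [x]" by simp
  also have "\<dots> = v [x]"
    using assms by (subst F_Ident_Gen) (auto simp: W_def simp del: F.simps(4))
  finally show ?thesis .
qed

lemma F_UPos_Ident: "F (Gen UPos \<parallel> Ident [\<up>]) v [x, y, w] = T12 (\<lambda>x y w. v [x, y, w]) x y w"
  by (simp add: T12_def)

lemma F_Ident_UPos:
  "[x, y, w] \<in> W [\<up>, \<up>, \<up>] \<Longrightarrow> F (Ident [\<up>] \<parallel> Gen UPos) v [x, y, w] = T23 (\<lambda>x y w. v [x, y, w]) x y w"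
  by (subst F_Ident_Gen) (auto simp: T23_def W_def)

lemma T12_cong:
  assumes "[x, y, w] \<in> W [\<up>, \<up>, \<up>]" "\<And>x y w. [x, y, w] \<in> W [\<up>, \<up>, \<up>] \<Longrightarrow> v x y w = v' x y w"
  shows "T12 v x y w = T12 v' x y w" "T23 v x y w = T23 v' x y w"
  using assms W_bar[of x] W_bar[of y] W_bar[of w] by (auto simp: T12_def T23_def W_def)

lemma rel_braid:
  assumes "[x, y, w] \<in> W [\<up>, \<up>, \<up>]"
  shows "F ((Gen UPos \<parallel> Ident [\<up>]) \<cdot> (Ident [\<up>] \<parallel> Gen UPos) \<cdot> (Gen UPos \<parallel> Ident [\<up>])) v [x, y, w] =
    F ((Ident [\<up>] \<parallel> Gen UPos) \<cdot> (Gen UPos \<parallel> Ident [\<up>]) \<cdot> (Ident [\<up>] \<parallel> Gen UPos)) v [x, y, w]"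
  (is "?L = ?R")
proof -
  let ?v = "\<lambda>x y w. v [x, y, w]"
  have 1: "F (Ident [\<up>] \<parallel> Gen UPos) u [x, y, w] = T23 (\<lambda>x y w. u [x, y, w]) x y w"
    if "[x, y, w] \<in> W [\<up>, \<up>, \<up>]" for u x y w
    using F_Ident_UPos[OF that] .
  have "?L = T12 (T23 (T12 ?v)) x y w"
    unfolding F.simps(3) F_UPos_Ident
    by (intro T12_cong(1)[OF assms]) (simp only: 1 F_UPos_Ident)
  also have "\<dots> = T23 (T12 (T23 ?v)) x y w"
    by (rule braid_T)
  also have "\<dots> = ?R"
    unfolding F.simps(3) 1[OF assms] F_UPos_Ident
    by (intro T12_cong(2)[OF assms] T12_cong(1)) (simp_all only: 1)
  finally show ?thesis .
qed

end

section \<open>Soundness of the matrix functor\<close>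

locale rmat_sound = rmat q qi S N + cring_param k z
  for q qi :: "'r::comm_ring_1" and S :: "'k \<Rightarrow> 'r" and N :: int
    and k :: "('k, 'm) ring_scheme" (structure) and z :: 'k +
  fixes J :: "'r \<Rightarrow> bool"
  assumes J: "ideal J"
    and S_add: "a \<in> carrier k \<Longrightarrow> b \<in> carrier k \<Longrightarrow> J (S (a \<oplus> b) - (S a + S b))"
    and S_mult: "a \<in> carrier k \<Longrightarrow> b \<in> carrier k \<Longrightarrow> J (S (a \<otimes> b) - S a * S b)"
    and S_one: "J (S \<one> - 1)"
    and S_minus_one: "J (S (\<ominus> \<one>) + 1)"
    and S_z: "J (S z - (q - qi))"
begin

text \<open>\<open>S\<close> respects the operations of \<open>k\<close> only modulo
  \<open>J\<close>, so congruence and not equality is what \<open>F\<close> preserves.\<close>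

definition sim :: "'r \<Rightarrow> 'r \<Rightarrow> bool" (infix \<open>\<simeq>\<close> 50) where "a \<simeq> b \<longleftrightarrow> J (a - b)"

lemma sim_refl [simp, intro]: "a \<simeq> a"
  using ideal_simps(1)[OF J] by (simp add: sim_def)

lemma sim_sym: "a \<simeq> b \<Longrightarrow> b \<simeq> a"
  using ideal_simps(3)[OF J, of "a - b" "- 1"] by (simp add: sim_def)

lemma sim_trans [trans]: "a \<simeq> b \<Longrightarrow> b \<simeq> c \<Longrightarrow> a \<simeq> c"
  using ideal_simps(2)[OF J, of "a - b" "b - c"] by (simp add: sim_def)

lemma sim_add: "a \<simeq> a' \<Longrightarrow> b \<simeq> b' \<Longrightarrow> a + b \<simeq> a' + b'"
  using ideal_simps(2)[OF J, of "a - a'" "b - b'"] by (simp add: sim_def algebra_simps)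

lemma sim_mult: "a \<simeq> a' \<Longrightarrow> b \<simeq> b' \<Longrightarrow> a * b \<simeq> a' * b'"
  using ideal_simps(2)[OF J, of "b * (a - a')" "a' * (b - b')"] ideal_simps(3)[OF J, of "a - a'" b]
    ideal_simps(3)[OF J, of "b - b'" a']
  by (simp add: sim_def algebra_simps)

lemma F_sim_cong:
  assumes "arrow k X Y f" "w \<in> W X" "\<And>y. y \<in> W Y \<Longrightarrow> v y \<simeq> v' y"
  shows "F f v w \<simeq> F f v' w"
  using F_ideal[OF J assms(1,2), of "\<lambda>y. v y - v' y"] assms(3)
  by (simp add: sim_def flip: F_diff)

lemma S_minus_one': "S (\<ominus> \<one>) \<simeq> - 1"
  using S_minus_one by (simp add: sim_def)

lemma S_z': "S z \<simeq> zz"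
  using S_z by (simp add: sim_def zz_def)

lemma S_one': "S \<one> \<simeq> 1"
  using S_one by (simp add: sim_def)

lemma relation_sound:
  assumes "relation k z X Y f g" "w \<in> W X"
  shows "F f v w \<simeq> F g v w"
  using assms
proof (induction rule: relation.induct)
  case u_inv
  then show ?case using rel_UU by (auto simp: W_def length_Suc_conv numeral_2_eq_2 F_Gen)
next
  case u_inv'
  then show ?case using rel_UU by (auto simp: W_def length_Suc_conv numeral_2_eq_2 F_Gen)
next
  case lr_inv
  then show ?case using rel_lr[of w v] by simp
next
  case rl_inv
  then show ?case using rel_rl[of w v] by simp
next
  case braid
  then obtain x y t where w: "w = [x, y, t]" by (auto simp: W_def length_Suc_conv numeral_3_eq_3)
  show ?case using rel_braid[of x y t v] braid unfolding w by simp
next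
  case skein
  then obtain x y where w: "w = [x, y]" by (auto simp: W_def length_Suc_conv numeral_2_eq_2)
  have "F (Add (Gen UPos) (Scale (\<ominus> \<one>) (Gen UNeg))) v w = Fgen UPos v w + S (\<ominus> \<one>) * Fgen UNeg v w"
    by simp
  also have "\<dots> \<simeq> Fgen UPos v w + (- 1) * Fgen UNeg v w"
    by (intro sim_add sim_mult S_minus_one' sim_refl)
  also have "Fgen UPos v w + (- 1) * Fgen UNeg v w = zz * v w"
    by (simp add: w)
  also have "zz * v w \<simeq> F (Scale z (Ident [\<up>, \<up>])) v w"
    by (auto intro!: sim_mult sim_sym[OF S_z'])
  finally show ?case .
next
  case clif_sq
  then obtain x where w: "w = [x]" by (auto simp: W_def length_Suc_conv)
  have "F (Gen Clif \<cdot> Gen Clif) v w = (- 1) * v w" using rel_clif_sq[of v x] w by simp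
  also have "\<dots> \<simeq> F (Scale (\<ominus> \<one>) (Ident [\<up>])) v w"
    unfolding F.simps by (rule sim_mult[OF sim_sym[OF S_minus_one'] sim_refl])
  finally show ?case .
next
  case clif_slide
  then obtain x y where w: "w = [x, y]" by (auto simp: W_def length_Suc_conv numeral_2_eq_2)
  show ?case using rel_slide[of v x y] unfolding w by simp
next
  case clif_bubble
  then show ?case using rel_clif_bubble[of v] by (simp add: W_def)
next
  case bubble
  then show ?case using rel_bubble[of v] by (simp add: W_def)
next
  case zigzag_up
  then obtain x where w: "w = [x]" "x \<in> {-N..<N}" by (auto simp: W_def length_Suc_conv)
  show ?case using rel_zigzag_up[OF w(2), of v] unfolding w(1) by simp
next
  case zigzag_down
  then obtain x where w: "w = [x]" "x \<in> {-N..<N}" by (auto simp: W_def length_Suc_conv)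
  show ?case using rel_zigzag_down[OF w(2), of v] unfolding w(1) by simp
qed

lemma W_split:
  assumes "w \<in> W (X @ X')"
  obtains a b where "w = a @ b" "a \<in> W X" "b \<in> W X'" "length a = length X"
  using assms W_append[of w X X'] that[of "take (length X) w" "drop (length X) w"]
  by (auto simp: W_def)

lemma F_Tens_append:
  assumes "arrow k X Y f" "a \<in> W X"
  shows "F (f \<parallel> g) v (a @ b) = F f (\<lambda>y. sgm a b * F g (\<lambda>y'. sgm a y' * v (y @ y')) b) a"
  using assms src_arrow[OF assms(1)] by (simp add: W_def)

lemma sgn_if_mult: "sgn_if a * sgn_if b = (sgn_if (a \<noteq> b) :: 'r)"
  "sgn_if a * (sgn_if b * c) = sgn_if (a \<noteq> b) * (c :: 'r)"
  by (simp_all add: sgn_if_def)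

lemma F_ext:
  "F (f \<cdot> g) v = F g (F f v)" "F (Ident X) v = v" "F (Add f g) v = (\<lambda>w. F f v w + F g v w)"
  "F (Scale a f) v = (\<lambda>w. S a * F f v w)"
  by (simp_all add: fun_eq_iff)

lemma F_mult_fun: "F f (\<lambda>y. a * v y) = (\<lambda>w. a * F f v w)"
  by (simp add: fun_eq_iff F_mult)

text \<open>Once \<open>F_swap\<close> has exchanged the two inner operators, the sides differ by
  signs only. Homogeneity is required of \<open>f\<close> and \<open>g\<close>, the two morphisms
  that pass each other; it determines the parities of \<open>y\<close> and \<open>t'\<close>, and
  what remains of the signs is that of \<open>p \<and> p'\<close>.\<close>

lemma interchange_sound:
  assumes "homogeneous p f" "homogeneous p' g" "arrow k X Y f" "arrow k Y Z f'" "arrow k X' Y' g'"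
    "arrow k Y' Z' g" "w \<in> W (X @ X')"
  shows "F ((f' \<parallel> g) \<cdot> (f \<parallel> g')) v w = sgn_if (p \<and> p') * F ((f' \<cdot> f) \<parallel> (g \<cdot> g')) v w"
proof -
  obtain a b where w: "w = a @ b" "a \<in> W X" "b \<in> W X'"
    using W_split[OF assms(7)] by metis
  let ?h = "\<lambda>t y'. F g (\<lambda>t'. sgn_if (par a) * v (t @ t')) y'"
  have "F ((f' \<parallel> g) \<cdot> (f \<parallel> g')) v w =
      F f (\<lambda>y. sgm a b * F g' (\<lambda>y'. sgm a y' * F (f' \<parallel> g) v (y @ y')) b) a"
    unfolding F.simps(3) w(1) by (rule F_Tens_append[OF assms(3) w(2)])
  also have "\<dots> = F f (\<lambda>y. sgm a b * F g' (\<lambda>y'. F f' (\<lambda>t. F g (\<lambda>t'. sgn_if (p \<and> p') * (sgm a t' * v (t @ t'))) y') y) b) a"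
  proof (intro F_cong_par[OF assms(1,3) w(2)] arg_cong[where f = "(*) _"] F_cong[OF assms(5) w(3)])
    fix y y' assume y: "y \<in> W Y" "par y = (par a \<noteq> p)" and y': "y' \<in> W Y'"
    have "sgm a y' * F (f' \<parallel> g) v (y @ y') =
        F f' (\<lambda>t. F g (\<lambda>t'. sgm a y' * (sgm y y' * (sgm y t' * v (t @ t')))) y') y"
      by (simp only: F_Tens_append[OF assms(4) y(1)] F_mult)
    also have "\<dots> = F f' (\<lambda>t. F g (\<lambda>t'. sgn_if (p \<and> p') * (sgm a t' * v (t @ t'))) y') y"
    proof (intro F_cong[OF assms(4) y(1)] F_cong_par[OF assms(2,6) y'])
      fix t t' assume "par t' = (par y' \<noteq> p')"
      then show "sgm a y' * (sgm y y' * (sgm y t' * v (t @ t'))) = sgn_if (p \<and> p') * (sgm a t' * v (t @ t'))"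
        unfolding sgn_if_mult y(2) by (intro arg_cong2[where f = "(*)"] arg_cong[where f = sgn_if]) auto
    qed
    finally show "sgm a y' * F (f' \<parallel> g) v (y @ y') =
      F f' (\<lambda>t. F g (\<lambda>t'. sgn_if (p \<and> p') * (sgm a t' * v (t @ t'))) y') y" .
  qed
  also have "\<dots> = F f (\<lambda>y. sgm a b * F f' (\<lambda>t. F g' (\<lambda>y'. F g (\<lambda>t'. sgn_if (p \<and> p') * (sgm a t' * v (t @ t'))) y') b) y) a"
    by (subst F_swap) simp
  also have "\<dots> = sgn_if (p \<and> p') * F ((f' \<cdot> f) \<parallel> (g \<cdot> g')) v w"
    unfolding w(1) F_Tens_append[OF arrow.Comp[OF assms(4,3)] w(2)] F.simps(3)
    by (simp only: F_mult_fun mult.left_commute)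
  finally show ?thesis .
qed

lemma F_sound:
  assumes "eqv k z X Y f g" "w \<in> W X"
  shows "F f v w \<simeq> F g v w"
  using assms
proof (induction arbitrary: v w rule: eqv.induct)
  case (rel X Y f g)
  then show ?case by (rule relation_sound)
next
  case (sym X Y f g)
  then show ?case using sim_sym by blast
next
  case (trans X Y f g h)
  then show ?case using sim_trans by blast
next
  case (comp_cong Y Z f f' X g g')
  have "F g (F f v) w \<simeq> F g (F f' v) w"
    using comp_cong eqv_arrow by (intro F_sim_cong) auto
  then show ?case using comp_cong sim_trans by simp
next
  case (tens_cong X Y f f' X' Y' g g')
  obtain a b where w: "w = a @ b" "a \<in> W X" "b \<in> W X'"
    using W_split[OF tens_cong.prems] by metis
  have arr: "arrow k X Y f" "arrow k X Y f'" using eqv_arrow tens_cong by blast+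
  have "F (f \<parallel> g) v w \<simeq> F f' (\<lambda>y. sgm a b * F g (\<lambda>y'. sgm a y' * v (y @ y')) b) a"
    unfolding w(1) F_Tens_append[OF arr(1) w(2)] by (rule tens_cong.IH(1)[OF w(2)])
  also have "\<dots> \<simeq> F (f' \<parallel> g') v w"
    unfolding w(1) F_Tens_append[OF arr(2) w(2)]
    by (intro F_sim_cong[OF arr(2) w(2)] sim_mult sim_refl tens_cong.IH(2)[OF w(3)])
  finally show ?case .
next
  case (tens_assoc X Y f X' Y' g X'' Y'' h)
  then obtain a b c where w: "w = a @ b @ c" "a \<in> W X" "b \<in> W X'" "c \<in> W X''"
    using W_split by metis
  have "F ((f \<parallel> g) \<parallel> h) v w = F (f \<parallel> g) (\<lambda>y. sgm (a @ b) c * F h (\<lambda>y'. sgm (a @ b) y' * v (y @ y')) c) (a @ b)"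
    unfolding w(1) append.assoc[symmetric]
    by (rule F_Tens_append[OF arrow.Tens[OF tens_assoc(1,2)] append_W[OF w(2,3)]])
  also have "\<dots> = F f (\<lambda>y. F g (\<lambda>y'. F h (\<lambda>t. sgm a b * (sgm a y' * (sgm (a @ b) c * (sgm (a @ b) t * v (y @ y' @ t))))) c) b) a"
    unfolding F_Tens_append[OF tens_assoc(1) w(2)] by (simp only: F_mult append.assoc)
  \<comment> \<open>Both products of signs are bilinear in the parities of \<open>a\<close>,
    \<open>b\<close>, \<open>c\<close>, \<open>y'\<close> and \<open>t\<close>, and they agree once
    expanded.\<close>
  also have "\<dots> = F f (\<lambda>y. F g (\<lambda>y'. F h (\<lambda>t. sgm a (b @ c) * (sgm b c * (sgm b t * (sgm a (y' @ t) * v (y @ y' @ t))))) c) b) a"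
    unfolding sgn_if_mult
    by (intro arg_cong[where f = "\<lambda>u. F f u a"] arg_cong[where f = "\<lambda>u. F g u b"] arg_cong[where f = "\<lambda>u. F h u c"]
        ext arg_cong2[where f = "(*)"] arg_cong[where f = sgn_if]) auto
  also have "\<dots> = F f (\<lambda>y. sgm a (b @ c) * F (g \<parallel> h) (\<lambda>y'. sgm a y' * v (y @ y')) (b @ c)) a"
    unfolding F_Tens_append[OF tens_assoc(2) w(3)] by (simp only: F_mult)
  also have "\<dots> = F (f \<parallel> (g \<parallel> h)) v w"
    unfolding w(1) by (rule F_Tens_append[OF tens_assoc(1) w(2), symmetric])
  finally show ?case by simp
next
  case (interchange p f p' g X Y Z f' X' Y' g' Z')
  have "F ((f' \<parallel> g) \<cdot> (f \<parallel> g')) v w = sgn_if (p \<and> p') * F ((f' \<cdot> f) \<parallel> (g \<cdot> g')) v w"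
    using interchange by (rule interchange_sound)
  also have "\<dots> \<simeq> S (if p \<and> p' then \<ominus> \<one> else \<one>) * F ((f' \<cdot> f) \<parallel> (g \<cdot> g')) v w"
    using sim_sym[OF S_one'] sim_sym[OF S_minus_one'] by (intro sim_mult) auto
  finally show ?case by simp
next
  case (add_neg X Y f)
  have "F (Add (Scale (\<ominus> \<one>) f) f) v w \<simeq> (- 1) * F f v w + F f v w"
    unfolding F.simps by (intro sim_add sim_mult S_minus_one' sim_refl)
  then show ?case by simp
next
  case (scale_add_left a b X Y f)
  then have "F (Scale (a \<oplus> b) f) v w \<simeq> (S a + S b) * F f v w"
    using S_add by (auto intro!: sim_mult simp: sim_def[of _ "S a + S b"])
  then show ?case by (simp add: algebra_simps)
next
  case (scale_mult a b X Y f)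
  then have "F (Scale (a \<otimes> b) f) v w \<simeq> (S a * S b) * F f v w"
    using S_mult by (auto intro!: sim_mult simp: sim_def[of _ "S a * S b"])
  then show ?case by (simp add: algebra_simps)
next
  case (scale_one X Y f)
  have "S \<one> * F f v w \<simeq> 1 * F f v w" by (intro sim_mult S_one' sim_refl)
  then show ?case by simp
next
  case (tens_unit_left X Y f)
  then show ?case by simp
next
  case (tens_unit_right X Y f)
  then have "take (src f) w = w" "drop (src f) w = []"
    using src_arrow[of k X Y f] by (auto simp: W_def)
  then show ?case by simp
next
  case (tens_scale_left a X Y f X' Y' g)
  then show ?case by simp
next
  case (tens_scale_right a X Y f X' Y' g)
  then show ?case by (simp add: F_mult mult.left_commute[of _ "S a"])
next
  case (tens_add_left X Y f g X' Y' h)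
  then have "src f = src g" by (simp add: src_arrow)
  then show ?case by simp
qed (auto simp: F_ext F_add F_mult algebra_simps sim_add sim_mult)

end

section \<open>Matrix entries of reduced diagrams\<close>

definition col :: "int \<Rightarrow> int" where "col x = (if x < 0 then bar x else x)"

lemma col_bar [simp]: "col (bar x) = col x"
  by (auto simp: col_def bar_def)

lemma col_eq_iff: "col x = col y \<longleftrightarrow> x = y \<or> x = bar y"
  by (auto simp: col_def bar_def)

text \<open>The labels follow the strands through the layer. At a crossing the colours must differ;
  equal colours are left to \<open>nstep\<close>.\<close>

definition tstep :: "atom \<Rightarrow> int list \<Rightarrow> int list \<Rightarrow> bool" where
  "tstep a xa ya \<longleftrightarrow>
     is_crossing a \<and> (\<exists>x y. xa = [x, y] \<and> ya = [y, x] \<and> col x \<noteq> col y) \<or>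
     a \<in> {ACapL, ACapR} \<and> (\<exists>t. xa = [t, t] \<and> ya = []) \<or>
     a \<in> {ACupL, ACupR} \<and> (\<exists>t. xa = [] \<and> ya = [t, t])"

text \<open>The other entries that may be nonzero. Up to \<open>bar\<close> on the labels these are
  labellings of the oriented smoothing of the crossing, which is vertical for two parallel strands
  and a cap below a cup for a mixed crossing. For equal colours they include the exchange of the two
  labels.\<close>

definition nstep :: "atom \<Rightarrow> int list \<Rightarrow> int list \<Rightarrow> bool" where
  "nstep a xa ya \<longleftrightarrow> is_crossing a \<and> (\<exists>x y x' y'. xa = [x, y] \<and> ya = [x', y'] \<and>
     (a \<in> range XU \<union> range XD \<and> col x' = col x \<and> col y' = col y \<or>
      a \<in> range XR \<union> range XL \<and> col x = col y \<and> col x' = col y'))"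

definition good_atom :: "atom \<Rightarrow> bool" where
  "good_atom a \<longleftrightarrow> a \<in> positive_crossings \<union> {ACapL, ACapR, ACupL, ACupR}"

definition lstep :: "layer \<Rightarrow> int list \<Rightarrow> int list \<Rightarrow> bool" where
  "lstep L x y \<longleftrightarrow> (\<exists>l a r xl xa xr ya. L = (l, a, r) \<and> x = xl @ xa @ xr \<and> y = xl @ ya @ xr \<and>
     length xl = length l \<and> length xr = length r \<and> (tstep a xa ya \<or> nstep a xa ya))"

definition ltstep :: "layer \<Rightarrow> int list \<Rightarrow> int list \<Rightarrow> bool" where
  "ltstep L x y \<longleftrightarrow> (\<exists>l a r xl xa xr ya. L = (l, a, r) \<and> x = xl @ xa @ xr \<and> y = xl @ ya @ xr \<and>
     length xl = length l \<and> length xr = length r \<and> tstep a xa ya)"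

definition valid_path :: "layer list \<Rightarrow> (nat \<Rightarrow> int list) \<Rightarrow> bool" where
  "valid_path D p \<longleftrightarrow> (\<forall>h < length D. lstep (D ! h) (p h) (p (Suc h)))"

definition thru_path :: "layer list \<Rightarrow> (nat \<Rightarrow> int list) \<Rightarrow> bool" where
  "thru_path D p \<longleftrightarrow> (\<forall>h < length D. ltstep (D ! h) (p h) (p (Suc h)))"

lemma ltstep_imp_lstep: "ltstep L x y \<Longrightarrow> lstep L x y"
  unfolding lstep_def ltstep_def by blast

lemma level_Cons: "level X (L # D) (Suc h) = level (layer_cod L) D h"
  by (cases h) (simp_all add: level_def)

lemma level_0 [simp]: "level X D 0 = X"
  by (simp add: level_def)

lemma arrow_atom: "z \<in> carrier k \<Longrightarrow> arrow k (adom a) (acod a) (atom_mor z a)"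
  by (cases a) (auto simp: r_pos_def intro!: arrow_basic arrow.Add arrow.Scale arrow.Comp)

section \<open>Matrix entries of caps, cups and crossings\<close>

context rmat
begin

lemma F_cap_R:
  assumes "y \<in> {-N..<N}"
  shows "F cap_R v [y, x] = (if x = y then sgn_if (odd y) * (qe' (N - 1) * v []) else 0)"
proof (cases "x = y")
  case True
  then show ?thesis using cap_R_eq[OF assms, of v] by simp
next
  case False
  then show ?thesis by (simp add: cap_R_def sum.neutral)
qed

text \<open>Once the two sums are exchanged, the coefficient of \<open>v [j, j]\<close> is, up to a
  sign, \<open>qe j - zz * (\<Sum>t\<in>{-N..j}. sgn_if (odd t))\<close>, and this is the same for
  all \<open>j\<close> because parities alternate.\<close>

lemma F_cup_R: "F cup_R v [] = qe' (- N) * (\<Sum>j\<in>{-N..<N}. sgn_if (odd j) * v [j, j])"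
proof -
  have *: "qe j - zz * (\<Sum>t\<in>{-N..j}. sgn_if (odd t)) = qe' (- N)" if "- N \<le> j" for j
    using that
  proof (induction j rule: int_ge_induct)
    case base
    then show ?case using qe_simps(10)[of "- N"] by simp
  next
    case (step j)
    have "{-N..j + 1} = insert (j + 1) {-N..j}" using step(1) by auto
    then have "qe (j + 1) - zz * (\<Sum>t\<in>{-N..j + 1}. sgn_if (odd t)) =
        (qe (j + 1) - zz * sgn_if (odd (j + 1))) - zz * (\<Sum>t\<in>{-N..j}. sgn_if (odd t))"
      by (simp add: algebra_simps)
    also have "qe (j + 1) - zz * sgn_if (odd (j + 1)) = qe j"
      using qe_simps(10)[of "j + 1"] qe_simps(4)[of j] by simp
    finally show ?case using step by simp
  qed
  have "F cup_R v [] = (\<Sum>t\<in>{-N..<N}. sgn_if (odd t) * qe t * v [t, t]) -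
      zz * (\<Sum>t\<in>{-N..<N}. \<Sum>j\<in>{t..<N}. sgn_if (odd t) * (sgn_if (odd j) * v [j, j]))"
    by (simp add: cup_R_def thru_simps sum_subtractf sum_distrib_left)
  also have "(\<Sum>t\<in>{-N..<N}. \<Sum>j\<in>{t..<N}. sgn_if (odd t) * (sgn_if (odd j) * v [j, j])) =
      (\<Sum>t\<in>{-N..<N}. \<Sum>j\<in>{-N..<N}. if t \<le> j then sgn_if (odd t) * (sgn_if (odd j) * v [j, j]) else 0)"
    by (rule sum.cong[OF HOL.refl], rule sum.mono_neutral_cong_left) auto
  also have "\<dots> = (\<Sum>j\<in>{-N..<N}. \<Sum>t\<in>{-N..<N}. if t \<le> j then sgn_if (odd t) * (sgn_if (odd j) * v [j, j]) else 0)"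
    by (rule sum.swap)
  also have "\<dots> = (\<Sum>j\<in>{-N..<N}. \<Sum>t\<in>{-N..j}. sgn_if (odd t) * (sgn_if (odd j) * v [j, j]))"
    by (rule sum.cong[OF HOL.refl], rule sum.mono_neutral_cong_right) auto
  also have "(\<Sum>t\<in>{-N..<N}. sgn_if (odd t) * qe t * v [t, t]) - zz * \<dots> =
      (\<Sum>j\<in>{-N..<N}. (qe j - zz * (\<Sum>t\<in>{-N..j}. sgn_if (odd t))) * (sgn_if (odd j) * v [j, j]))"
    by (simp add: algebra_simps sum_subtractf sum_distrib_left sum_distrib_right)
  also have "\<dots> = (\<Sum>j\<in>{-N..<N}. qe' (- N) * (sgn_if (odd j) * v [j, j]))"
    by (rule sum.cong[OF HOL.refl]) (simp only: * atLeastLessThan_iff)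
  also have "\<dots> = qe' (- N) * (\<Sum>j\<in>{-N..<N}. sgn_if (odd j) * v [j, j])"
    by (simp add: sum_distrib_left)
  finally show ?thesis .
qed

lemma F_r_pos:
  assumes "y \<in> {-N..<N}"
  shows "F (r_pos z) v [y, x] = Fgen RNeg v [y, x]
    + (if x = y then S z * (sgn_if (odd y) * (qe' (N - 1) * F cup_R v [])) else 0)"
  unfolding r_pos_def F.simps F_cap_R[OF assms] by (simp add: F_Gen)

lemma F_d_pos:
  assumes "x \<in> {-N..<N}" "y \<in> {-N..<N}"
  shows "F d_pos v [x, y] = thru x y * v [y, x] + (if y < x then zz * v [x, y] else 0)
    + (if y < bar x then zz * (sgn_if (odd (bar x)) * v [bar x, bar y]) else 0)"
proof -
  have mid: "F (Ident [\<down>] \<parallel> l_pos \<parallel> Ident [\<down>]) (F (Gen CapL \<parallel> Ident [\<down>, \<down>]) v) [x, y, t, t] =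
      F l_pos (\<lambda>w. F (Gen CapL \<parallel> Ident [\<down>, \<down>]) v (x # w @ [t])) [y, t]"
    if "t \<in> {-N..<N}" for t
  proof -
    have h: "homogeneous False (l_pos \<parallel> Ident [\<down>])"
      unfolding l_pos_def Phi_def by (intro homogeneous_even) simp_all
    have a: "arrow undefined [\<down>, \<up>, \<down>] [\<up>, \<down>, \<down>] (l_pos \<parallel> Ident [\<down>])"
      by (rule arrow_Tens_eq[OF arrow_l_pos arrow.Ident]; simp)
    have "src (l_pos :: 'k mor) = Suc (Suc 0)" using src_arrow[OF arrow_l_pos] by simp
    then show ?thesis
      using assms that by (subst F_Ident_Tens[OF h a]) (simp_all add: W_def)
  qed
  have "F d_pos v [x, y] = (\<Sum>t\<in>{-N..<N}. F l_pos (\<lambda>w. F (Gen CapL \<parallel> Ident [\<down>, \<down>]) v (x # w @ [t])) [y, t])"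
    unfolding d_pos_def Phi_def
    using mid assms by (subst F.simps(3), subst F.simps(3), subst F_Ident_Gen)
      (auto simp: W_def simp del: F.simps(4) F_Tens_Ident intro!: sum.cong)
  also have "\<dots> = (\<Sum>t\<in>{-N..<N}. (if x = t then thru t y * v [y, t] else 0)
      + (if y = t then zz * (\<Sum>j\<in>{y<..<N}. if x = j then v [j, t] else 0) else 0)
      + (if y = bar t then zz * (\<Sum>j\<in>{y<..<N}. if x = bar j then sgn_if (odd j) * v [j, t] else 0) else 0))"
    by (rule sum.cong[OF HOL.refl], subst F_l_pos[OF assms(2)]) (auto intro!: arg_cong[where f = "(*) _"] sum.cong)
  also have "\<dots> = (\<Sum>t\<in>{-N..<N}. if x = t then thru t y * v [y, t] else 0)
      + (\<Sum>t\<in>{-N..<N}. if y = t then zz * (\<Sum>j\<in>{y<..<N}. if x = j then v [j, t] else 0) else 0)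
      + (\<Sum>t\<in>{-N..<N}. if bar y = t then zz * (\<Sum>j\<in>{y<..<N}. if bar x = j then sgn_if (odd j) * v [j, t] else 0) else 0)"
    unfolding sum.distrib by (intro arg_cong2[where f = "(+)"] sum.cong HOL.refl if_cong arg_cong[where f = "(*) _"]) auto
  also have "(\<Sum>t\<in>{-N..<N}. if x = t then thru t y * v [y, t] else 0) = thru x y * v [y, x]"
    using assms by simp
  also have "(\<Sum>t\<in>{-N..<N}. if y = t then zz * (\<Sum>j\<in>{y<..<N}. if x = j then v [j, t] else 0) else 0)
      = (if y < x then zz * v [x, y] else 0)"
    using assms by simp
  also have "(\<Sum>t\<in>{-N..<N}. if bar y = t then zz * (\<Sum>j\<in>{y<..<N}. if bar x = j then sgn_if (odd j) * v [j, t] else 0) else 0)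
      = (if y < bar x then zz * (sgn_if (odd (bar x)) * v [bar x, bar y]) else 0)"
    using assms W_bar[OF assms(1)] W_bar[OF assms(2)] by (simp del: W_bar)
  finally show ?thesis .
qed

lemma F_clif_down:
  assumes "x \<in> {-N..<N}"
  shows "F clif_down v [x] = (sgn_if (odd x) * sgn_if (odd (bar x))) * v [bar x]"
proof -
  have mid: "F (Ident [\<down>] \<parallel> Gen Clif \<parallel> Ident [\<down>]) w [x, t, t] =
      sgn_if (odd x) * (sgn_if (odd t) * w [x, bar t, t])" for t w
    by (cases "odd x"; cases "odd t"; simp)
  have "F clif_down v [x] = (\<Sum>t\<in>{-N..<N}. F (Ident [\<down>] \<parallel> Gen Clif \<parallel> Ident [\<down>]) (F (Gen CapL \<parallel> Ident [\<down>]) v) [x, t, t])"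
    unfolding clif_down_def Phi_def using assms
    by (subst F.simps(3), subst F.simps(3), subst F_Ident_Gen) (auto simp: W_def simp del: F.simps(4) F_Tens_Ident)
  also have "\<dots> = (\<Sum>t\<in>{-N..<N}. if bar x = t then sgn_if (odd x) * (sgn_if (odd t) * v [t]) else 0)"
    unfolding mid by (intro sum.cong HOL.refl) auto
  also have "\<dots> = (sgn_if (odd x) * sgn_if (odd (bar x))) * v [bar x]"
    using W_bar[OF assms] by simp
  finally show ?thesis .
qed

lemma even_atom: "good_atom a \<Longrightarrow> homogeneous False (atom_mor z a)"
  by (auto simp: good_atom_def positive_crossings_def r_pos_def d_pos_def l_pos_def cap_R_def cup_R_def Phi_def
      intro!: homogeneous_even homogeneous.Add homogeneous.Scale)

lemma W_pair:
  assumes "w \<in> W X" "X = [a, b]"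
  obtains x y where "w = [x, y]" "x \<in> {-N..<N}" "y \<in> {-N..<N}"
  using assms by (auto simp: W_def length_Suc_conv numeral_2_eq_2)

lemma W_pair_iff: "[x, y] \<in> W [a, b] \<longleftrightarrow> x \<in> {-N..<N} \<and> y \<in> {-N..<N}"
  by (auto simp: W_def)

text \<open>Membership in an ideal composes well, whereas single vanishing entries would require
  sums over intermediate words: to control the value at \<open>xa\<close> it suffices to look at the
  words that can be reached from \<open>xa\<close>.\<close>

lemma atom_support:
  assumes J: "ideal J" and "good_atom a" and xa: "xa \<in> W (adom a)"
    and v: "\<And>ya. ya \<in> W (acod a) \<Longrightarrow> tstep a xa ya \<or> nstep a xa ya \<Longrightarrow> J (v ya)"
  shows "J (F (atom_mor z a) v xa)"
proof -
  consider "a = XU True" | "a = XR True" | "a = XD True" | "a = XL True"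
    | "a = ACapL" | "a = ACapR" | "a = ACupL" | "a = ACupR"
    using assms(2) by (auto simp: good_atom_def positive_crossings_def)
  then show ?thesis
  proof cases
    case 1
    then have "\<exists>c d. adom a = [c, d]" by simp
    then obtain x y where w: "xa = [x, y]" "x \<in> {-N..<N}" "y \<in> {-N..<N}" by (metis W_pair[OF xa])
    have "J (v [y, x])" "J (v [x, y])" "J (v [bar x, bar y])"
      using w W_bar by (auto intro!: v simp: 1 W_pair_iff tstep_def nstep_def is_crossing_def simp del: atLeastLessThan_iff)
    then show ?thesis by (auto simp: 1 w intro!: ideal_simps[OF J])
  next
    case 2
    then have "\<exists>c d. adom a = [c, d]" by simp
    then obtain x y where w: "xa = [y, x]" "x \<in> {-N..<N}" "y \<in> {-N..<N}" by (metis W_pair[OF xa])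
    have t: "J (v [x, y])" if "col x \<noteq> col y"
      using w(2,3) that by (intro v) (simp_all add: 2 w W_pair_iff tstep_def is_crossing_def)
    have n: "J (v [t, t'])" if "t \<in> {-N..<N}" "t' \<in> {-N..<N}" "col t = col t'" "col x = col y" for t t'
      using that by (intro v disjI2) (simp_all add: 2 w W_pair_iff nstep_def is_crossing_def)
    have "J (v [x, y])" using t n[OF w(2,3)] by blast
    moreover have "J (v [t, t])" "J (v [t, bar t])" if "t \<in> {-N..<N}" "x = y \<or> x = bar y" for t
      using that W_bar[OF that(1)] by (auto intro!: n simp del: atLeastLessThan_iff)
    ultimately show ?thesis
      using w by (auto simp: 2 F_r_pos F_cup_R intro!: ideal_simps[OF J] ideal_sum[OF J])
  next
    case 3
    then have "\<exists>c d. adom a = [c, d]" by simp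
    then obtain x y where w: "xa = [x, y]" "x \<in> {-N..<N}" "y \<in> {-N..<N}" by (metis W_pair[OF xa])
    have "J (v [y, x])" "J (v [x, y])" "J (v [bar x, bar y])"
      using w W_bar by (auto intro!: v simp: 3 W_pair_iff tstep_def nstep_def is_crossing_def simp del: atLeastLessThan_iff)
    then show ?thesis using w by (auto simp: 3 F_d_pos simp del: atLeastLessThan_iff intro!: ideal_simps[OF J])
  next
    case 4
    then have "\<exists>c d. adom a = [c, d]" by simp
    then obtain x y where w: "xa = [x, y]" "x \<in> {-N..<N}" "y \<in> {-N..<N}" by (metis W_pair[OF xa])
    have t: "J (v [y, x])" if "col x \<noteq> col y"
      using w(2,3) that by (intro v disjI1) (simp_all add: 4 w W_pair_iff tstep_def is_crossing_def)
    have n: "J (v [t', t])" if "t \<in> {-N..<N}" "t' \<in> {-N..<N}" "col t' = col t" "col x = col y" for t t'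
      using that by (intro v disjI2) (simp_all add: 4 w W_pair_iff nstep_def is_crossing_def)
    have "J (v [y, x])" using t n[OF w(2,3)] by fastforce
    moreover have "J (v [t, t])" "J (v [bar t, t])" if "t \<in> {x<..<N}" "x = y \<or> x = bar y" for t
    proof -
      have t: "t \<in> {-N..<N}" using that w by auto
      show "J (v [t, t])" "J (v [bar t, t])"
        using that(2) W_bar[OF t] t by (auto intro!: n simp del: atLeastLessThan_iff)
    qed
    ultimately show ?thesis
      using w by (auto simp: 4 F_l_pos simp del: atLeastLessThan_iff intro!: ideal_simps[OF J] ideal_sum[OF J])
  next
    case 5
    then have "\<exists>c d. adom a = [c, d]" by simp
    then obtain x y where w: "xa = [x, y]" "x \<in> {-N..<N}" "y \<in> {-N..<N}" by (metis W_pair[OF xa])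
    have "J (v [])" if "x = y" using that by (auto intro!: v simp: 5 w W_def tstep_def)
    then show ?thesis by (auto simp: 5 w intro!: ideal_simps[OF J])
  next
    case 6
    then have "\<exists>c d. adom a = [c, d]" by simp
    then obtain x y where w: "xa = [x, y]" "x \<in> {-N..<N}" "y \<in> {-N..<N}" by (metis W_pair[OF xa])
    have "J (v [])" if "x = y" using that by (auto intro!: v simp: 6 w W_def tstep_def)
    then show ?thesis using w by (auto simp: 6 F_cap_R simp del: atLeastLessThan_iff intro!: ideal_simps[OF J])
  next
    case 7
    have "J (v [t, t])" if "t \<in> {-N..<N}" for t
      using that xa by (auto intro!: v simp: 7 W_def tstep_def)
    then show ?thesis using xa by (auto simp: 7 W_def intro!: ideal_sum[OF J])
  next
    case 8
    have "J (v [t, t])" if "t \<in> {-N..<N}" for t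
      using that xa by (auto intro!: v simp: 8 W_def tstep_def)
    then show ?thesis using xa by (auto simp: 8 W_def F_cup_R intro!: ideal_simps[OF J] ideal_sum[OF J])
  qed
qed

definition invertible_elt :: "'r \<Rightarrow> bool" where
  "invertible_elt u \<longleftrightarrow> (\<exists>u'. u * u' = 1)"

lemma invertible_elt_mult: "invertible_elt u \<Longrightarrow> invertible_elt v \<Longrightarrow> invertible_elt (u * v)"
  unfolding invertible_elt_def
  by (metis (no_types, opaque_lifting) mult.assoc mult.left_commute mult_1_right)

lemma invertible_elt_simps [simp]: "invertible_elt 1" "invertible_elt (sgn_if b)" "invertible_elt (qe t)" "invertible_elt (qe' t)"
  using qe_simps(1,2) sgn_if_sq(1) unfolding invertible_elt_def by (blast intro: mult_1_right)+

abbreviation delta :: "int list \<Rightarrow> int list \<Rightarrow> 'r" where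
  "delta y \<equiv> \<lambda>w. if w = y then 1 else 0"

text \<open>Different colours reduce \<open>thru\<close> to a sign and switch off the correction
  terms; caps and cups contribute signs and powers of \<open>q\<close>.\<close>

lemma atom_entry:
  assumes "good_atom a" "tstep a xa ya" "xa \<in> W (adom a)" "ya \<in> W (acod a)"
  shows "invertible_elt (F (atom_mor z a) (delta ya) xa)"
proof -
  have sum1: "(\<Sum>j\<in>{-N..<N}. if j = t then sgn_if (odd j) else 0) = (sgn_if (odd t) :: 'r)"
    "(\<Sum>j\<in>{-N..<N}. if j = t then 1 else 0) = (1 :: 'r)" if "t \<in> {-N..<N}" for t
    using that by simp_all
  from assms(2) consider
      x y where "is_crossing a" "xa = [x, y]" "ya = [y, x]" "col x \<noteq> col y"
    | t where "a \<in> {ACapL, ACapR}" "xa = [t, t]" "ya = []"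
    | t where "a \<in> {ACupL, ACupR}" "xa = []" "ya = [t, t]"
    unfolding tstep_def by blast
  then show ?thesis
  proof cases
    case 1
    have xy: "x \<in> {-N..<N}" "y \<in> {-N..<N}"
      using assms(3) 1 by (cases a; auto simp: W_def is_crossing_def)+
    have ne: "x \<noteq> y" "x \<noteq> bar y" "y \<noteq> bar x" "y \<noteq> x"
      using 1(4) by (auto simp: col_eq_iff)
    have "a \<in> {XU True, XR True, XD True, XL True}"
      using 1(1) assms(1) by (auto simp: good_atom_def positive_crossings_def is_crossing_def)
    then have "F (atom_mor z a) (delta ya) xa \<in> {thru x y, thru y x}"
      using 1(2,3) xy ne by (elim insertE) (auto simp: F_r_pos F_d_pos F_l_pos simp del: atLeastLessThan_iff)
    then show ?thesis using ne by (auto simp: thru_simps)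
  next
    case 2
    then have "t \<in> {-N..<N}" using assms(3) by (auto simp: W_def)
    then show ?thesis using 2
      by (auto simp: F_cap_R invertible_elt_mult simp del: atLeastLessThan_iff)
  next
    case 3
    then have "t \<in> {-N..<N}" using assms(4) by (auto simp: W_def)
    note sum1 = sum1[OF this]
    show ?thesis using 3(1)
    proof (elim insertE)
      assume "a = ACupL"
      then show ?thesis using sum1 3 by simp
    next
      assume "a = ACupR"
      moreover have "(\<Sum>j\<in>{-N..<N}. sgn_if (odd j) * delta ya [j, j]) = sgn_if (odd t)"
        using sum1(1) 3 by (simp add: if_distrib cong: if_cong)
      ultimately show ?thesis using 3 by (simp add: F_cup_R invertible_elt_mult)
    qed simp
  qed
qed

lemma F_layer:
  assumes "good_atom a" "x = xl @ xa @ xr" "xl \<in> W l" "xa \<in> W (adom a)" "xr \<in> W r"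
  shows "F (Ident l \<parallel> atom_mor z a \<parallel> Ident r) v x = F (atom_mor z a) (\<lambda>ya. v (xl @ ya @ xr)) xa"
proof -
  \<comment> \<open>A dummy structure in which every scalar is admissible. Typing serves only to
    know the lengths of words.\<close>
  let ?k = "\<lparr>carrier = UNIV, mult = undefined, one = undefined, zero = undefined, add = undefined\<rparr> :: 'k ring"
  have arr: "arrow ?k (adom a @ r) (acod a @ r) (atom_mor z a \<parallel> Ident r)"
    by (intro arrow.Tens arrow_atom arrow.Ident) simp
  have src: "src (atom_mor z a) = length (adom a)"
    by (rule src_arrow[of ?k]) (rule arrow_atom, simp)
  show ?thesis
    using assms append_W[OF assms(4,5)]
    by (subst F_Ident_Tens[OF homogeneous_Tens_even[OF even_atom[OF assms(1)] homogeneous.Ident] arr])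
      (auto simp: W_def src)
qed

lemma layer_support:
  assumes "ideal J" "good_atom a" "x \<in> W (l @ adom a @ r)"
    "\<And>y. y \<in> W (l @ acod a @ r) \<Longrightarrow> lstep (l, a, r) x y \<Longrightarrow> J (v y)"
  shows "J (F (Ident l \<parallel> atom_mor z a \<parallel> Ident r) v x)"
proof -
  define xl xa xr where "xl = take (length l) x" and "xa = take (length (adom a)) (drop (length l) x)"
    and "xr = drop (length (adom a)) (drop (length l) x)"
  have x: "x = xl @ xa @ xr" "xl \<in> W l" "xa \<in> W (adom a)" "xr \<in> W r"
    using assms(3) unfolding W_append xl_def xa_def xr_def by (metis append_take_drop_id, auto simp: W_append)
  show ?thesis
    unfolding F_layer[OF assms(2) x]
  proof (rule atom_support[OF assms(1,2) x(3)])
    fix ya assume "ya \<in> W (acod a)" "tstep a xa ya \<or> nstep a xa ya"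
    then show "J (v (xl @ ya @ xr))"
      using x by (intro assms(4) append_W) (auto simp: lstep_def W_def)
  qed
qed

lemma layer_unit:
  assumes "ideal J" "good_atom a" "x \<in> W (l @ adom a @ r)" "y \<in> W (l @ acod a @ r)" "ltstep (l, a, r) x y"
    "\<And>y'. y' \<in> W (l @ acod a @ r) \<Longrightarrow> lstep (l, a, r) x y' \<Longrightarrow> y' \<noteq> y \<Longrightarrow> J (v y')"
  shows "\<exists>u. invertible_elt u \<and> J (F (Ident l \<parallel> atom_mor z a \<parallel> Ident r) v x - u * v y)"
proof -
  let ?f = "Ident l \<parallel> atom_mor z a \<parallel> Ident r"
  obtain xl xa xr ya where x: "x = xl @ xa @ xr" "y = xl @ ya @ xr" "length xl = length l"
    "length xr = length r" "tstep a xa ya"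
    using assms(5) unfolding ltstep_def by auto
  have la: "length xa = length (adom a)" "length ya = length (acod a)"
    using assms(3,4) x by (auto simp: W_def)
  have W: "xl \<in> W l" "xa \<in> W (adom a)" "xr \<in> W r" "ya \<in> W (acod a)"
    using assms(3,4) x la by (auto simp: W_def)
  have "F ?f (delta y) x = F (atom_mor z a) (delta ya) xa"
    unfolding F_layer[OF assms(2) x(1) W(1-3)] by (rule arg_cong[where f = "\<lambda>u. F (atom_mor z a) u xa"]) (auto simp: x(2))
  then have "invertible_elt (F ?f (delta y) x)"
    using atom_entry[OF assms(2) x(5) W(2,4)] by simp
  moreover have "J (F ?f (\<lambda>w. if w = y then 0 else v w) x)"
    using assms(6) ideal_simps(1)[OF assms(1)] by (intro layer_support[OF assms(1-3)]) auto
  \<comment> \<open>\<open>v\<close> is split into its value at \<open>y\<close> and the rest, and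
    the rest contributes an element of \<open>J\<close>.\<close>
  moreover have "F ?f v x = F ?f (\<lambda>w. v y * delta y w + (if w = y then 0 else v w)) x"
    by (rule arg_cong[where f = "\<lambda>u. F ?f u x"]) auto
  then have "F ?f v x - F ?f (delta y) x * v y = F ?f (\<lambda>w. if w = y then 0 else v w) x"
    by (simp only: F_add F_mult) (simp add: mult.commute)
  ultimately show ?thesis by auto
qed

definition path_in :: "obj \<Rightarrow> layer list \<Rightarrow> (nat \<Rightarrow> int list) \<Rightarrow> bool" where
  "path_in X D p \<longleftrightarrow> (\<forall>h \<le> length D. p h \<in> W (level X D h))"

lemma path_Cons:
  "valid_path (L # D) p \<longleftrightarrow> lstep L (p 0) (p 1) \<and> valid_path D (\<lambda>h. p (Suc h))"
  "thru_path (L # D) p \<longleftrightarrow> ltstep L (p 0) (p 1) \<and> thru_path D (\<lambda>h. p (Suc h))"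
  "path_in X (L # D) p \<longleftrightarrow> p 0 \<in> W X \<and> path_in (layer_cod L) D (\<lambda>h. p (Suc h))"
proof -
  have *: "(\<forall>h \<le> Suc n. P h) \<longleftrightarrow> P 0 \<and> (\<forall>h \<le> n. P (Suc h))" for P n
    using All_less_Suc2[of "Suc n" P] by (simp add: less_Suc_eq_le)
  show "valid_path (L # D) p \<longleftrightarrow> lstep L (p 0) (p 1) \<and> valid_path D (\<lambda>h. p (Suc h))"
    "thru_path (L # D) p \<longleftrightarrow> ltstep L (p 0) (p 1) \<and> thru_path D (\<lambda>h. p (Suc h))"
    by (simp_all add: valid_path_def thru_path_def All_less_Suc2)
  show "path_in X (L # D) p \<longleftrightarrow> p 0 \<in> W X \<and> path_in (layer_cod L) D (\<lambda>h. p (Suc h))"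
    by (simp add: path_in_def * level_Cons)
qed

text \<open>An entry of a diagram is a sum over the labellings of its levels, so only the values of
  \<open>v\<close> at the upper ends of labellings that start in \<open>x\<close> matter.\<close>

lemma diagram_support:
  assumes "ideal J" "diagram X Y D" "\<forall>(l, a, r) \<in> set D. good_atom a" "x \<in> W X"
    "\<And>p. p 0 = x \<Longrightarrow> valid_path D p \<Longrightarrow> path_in X D p \<Longrightarrow> J (v (p (length D)))"
  shows "J (F (diagram_mor z X D) v x)"
  using assms(2-)
proof (induction D arbitrary: X x)
  case Nil
  then show ?case by (auto simp: valid_path_def path_in_def level_def dest: spec[of _ "\<lambda>_. x"])
next
  case (Cons L D)
  obtain l a r where L: "L = (l, a, r)" by (cases L)
  show ?case
    unfolding L diagram_mor.simps F.simps(3)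
  proof (rule layer_support[OF assms(1)])
    show "good_atom a" "x \<in> W (l @ adom a @ r)" using Cons.prems L by auto
    fix y assume y: "y \<in> W (l @ acod a @ r)" "lstep (l, a, r) x y"
    show "J (F (diagram_mor z (l @ acod a @ r) D) v y)"
    proof (rule Cons.IH)
      fix p assume p: "p 0 = y" "valid_path D p" "path_in (l @ acod a @ r) D p"
      show "J (v (p (length D)))"
        using Cons.prems(4)[of "\<lambda>h. case h of 0 \<Rightarrow> x | Suc h \<Rightarrow> p h"] p y Cons.prems(3)
        by (simp add: path_Cons L)
    qed (use Cons.prems y L in auto)
  qed
qed

text \<open>If a single labelling joins the two words, the sum over labellings has one essential
  term, a product of invertible entries of layers. The uniqueness assumption puts every other term
  into \<open>J\<close>.\<close>

lemma diagram_unit: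
  assumes "ideal J" "diagram X Y D" "\<forall>(l, a, r) \<in> set D. good_atom a" "p 0 \<in> W X"
    "thru_path D p" "path_in X D p"
    "\<And>p' h. p' 0 = p 0 \<Longrightarrow> valid_path D p' \<Longrightarrow> path_in X D p' \<Longrightarrow> p' (length D) = p (length D) \<Longrightarrow>
      h \<le> length D \<Longrightarrow> p' h = p h"
  shows "\<exists>u. invertible_elt u \<and> J (F (diagram_mor z X D) (delta (p (length D))) (p 0) - u)"
  using assms(2-)
proof (induction D arbitrary: X p)
  case Nil
  show ?case by (intro exI[of _ 1]) (simp add: ideal_simps(1)[OF assms(1)])
next
  case (Cons L D)
  obtain l a r where L: "L = (l, a, r)" by (cases L)
  define V where "V = F (diagram_mor z (l @ acod a @ r) D) (delta (p (length (L # D))))"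
  have X: "X = l @ adom a @ r" and ga: "good_atom a" using Cons.prems(1,2) L by auto
  have p45: "ltstep L (p 0) (p 1)" "thru_path D (\<lambda>h. p (Suc h))" "path_in (l @ acod a @ r) D (\<lambda>h. p (Suc h))"
    using Cons.prems(4,5) unfolding path_Cons by (simp_all add: L)
  have p: "p 0 \<in> W (l @ adom a @ r)" "p 1 \<in> W (l @ acod a @ r)" "ltstep (l, a, r) (p 0) (p 1)"
    using Cons.prems(3) p45(1) p45(3)[unfolded path_in_def, rule_format, of 0] by (simp_all add: X L)
  have uniq: "p' h = p (Suc h)"
    if "lstep L (p 0) (p' 0)" "valid_path D p'" "path_in (l @ acod a @ r) D p'" "p' (length D) = p (Suc (length D))"
      "h \<le> length D" for p' h
    using Cons.prems(6)[of "\<lambda>h. case h of 0 \<Rightarrow> p 0 | Suc h \<Rightarrow> p' h" "Suc h"] that Cons.prems(3)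
    by (simp add: path_Cons L)
  \<comment> \<open>A word other than \<open>p 1\<close> would begin a second labelling with the
    same ends.\<close>
  have "J (V y)" if "y \<in> W (l @ acod a @ r)" "lstep (l, a, r) (p 0) y" "y \<noteq> p 1" for y
    unfolding V_def
  proof (rule diagram_support[OF assms(1)])
    fix p' assume "p' 0 = y" "valid_path D p'" "path_in (l @ acod a @ r) D p'"
    then have "p' (length D) \<noteq> p (Suc (length D))"
      using uniq[of p' 0] that L by auto
    then show "J (delta (p (length (L # D))) (p' (length D)))"
      using ideal_simps(1)[OF assms(1)] by simp
  next
    show "diagram (l @ acod a @ r) Y D" "\<forall>(l, a, r) \<in> set D. good_atom a" using Cons.prems(1,2) L by auto
  qed (fact that(1))
  then obtain u where u: "invertible_elt u" "J (F (Ident l \<parallel> atom_mor z a \<parallel> Ident r) V (p 0) - u * V (p 1))"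
    using layer_unit[OF assms(1) ga p(1-3), of V z] by blast
  have "\<exists>u'. invertible_elt u' \<and>
      J (F (diagram_mor z (l @ acod a @ r) D) (delta ((\<lambda>h. p (Suc h)) (length D))) ((\<lambda>h. p (Suc h)) 0) - u')"
  proof (rule Cons.IH)
    show "diagram (l @ acod a @ r) Y D" "\<forall>(l, a, r) \<in> set D. good_atom a" using Cons.prems(1,2) L by auto
    show "p (Suc 0) \<in> W (l @ acod a @ r)" using p(2) by simp
    fix p' h assume p': "p' 0 = p (Suc 0)" "valid_path D p'" "path_in (l @ acod a @ r) D p'"
      "p' (length D) = p (Suc (length D))" "h \<le> length D"
    have "lstep L (p 0) (p' 0)" using ltstep_imp_lstep[OF p(3)] p'(1) L by simp
    then show "p' h = p (Suc h)" by (rule uniq[OF _ p'(2-5)])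
  qed (fact p45(2,3))+
  then have "\<exists>u'. invertible_elt u' \<and> J (V (p 1) - u')"
    by (simp add: V_def)
  then obtain u' where u': "invertible_elt u'" "J (V (p 1) - u')" by blast
  have "J ((F (Ident l \<parallel> atom_mor z a \<parallel> Ident r) V (p 0) - u * V (p 1)) + u * (V (p 1) - u'))"
    by (rule ideal_simps(2)[OF assms(1) u(2) ideal_simps(3)[OF assms(1) u'(2)]])
  then have "J (F (diagram_mor z X (L # D)) (delta (p (length (L # D)))) (p 0) - u * u')"
    by (simp add: L V_def algebra_simps)
  with invertible_elt_mult[OF u(1) u'(1)] show ?case by (intro exI[of _ "u * u'"] conjI)
qed

end

section \<open>Counting crossings through pairs of colours\<close>

definition cnt :: "int list \<Rightarrow> int \<Rightarrow> nat" where
  "cnt w b = length (filter (\<lambda>x. col x = b) w)"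

text \<open>The number of subwords of two letters with colours \<open>a\<close> and
  \<open>b\<close>, in this order.\<close>

fun icnt :: "int list \<Rightarrow> int \<Rightarrow> int \<Rightarrow> nat" where
  "icnt [] a b = 0"
| "icnt (x # w) a b = (if col x = a then cnt w b else 0) + icnt w a b"

lemma cnt_simps [simp]:
  "cnt [] b = 0" "cnt (x # w) b = (if col x = b then 1 else 0) + cnt w b" "cnt (u @ w) b = cnt u b + cnt w b"
  by (simp_all add: cnt_def)

lemma icnt_append [simp]: "icnt (u @ w) a b = icnt u a b + icnt w a b + cnt u a * cnt w b"
  by (induction u) (auto simp: algebra_simps)

lemma cnt_icnt_cong: "map col w = map col w' \<Longrightarrow> cnt w b = cnt w' b \<and> icnt w a b = icnt w' a b"
proof (induction w arbitrary: w')
  case (Cons x w)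
  then obtain y v where "w' = y # v" by (cases w') auto
  with Cons.prems Cons.IH[of v] show ?case by simp
qed simp

definition cross_thru :: "layer \<Rightarrow> int list \<Rightarrow> int list \<Rightarrow> int \<Rightarrow> int \<Rightarrow> bool" where
  "cross_thru L x y a b \<longleftrightarrow> (\<exists>l c r xl xr u v. L = (l, c, r) \<and> is_crossing c \<and> x = xl @ [u, v] @ xr \<and>
     y = xl @ [v, u] @ xr \<and> length xl = length l \<and> {col u, col v} = {a, b})"

lemma cross_thru_iff:
  assumes "length xl = length l"
  shows "cross_thru (l, c, r) (xl @ u # v # xr) (xl @ u' # v' # xr) a b \<longleftrightarrow>
    is_crossing c \<and> u' = v \<and> v' = u \<and> {col u, col v} = {a, b}"
proof
  assume "cross_thru (l, c, r) (xl @ u # v # xr) (xl @ u' # v' # xr) a b"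
  then obtain yl yr s t where *: "is_crossing c" "xl @ u # v # xr = yl @ s # t # yr"
    "xl @ u' # v' # xr = yl @ t # s # yr" "length yl = length l" "{col s, col t} = {a, b}"
    unfolding cross_thru_def by auto
  have "xl = yl" using *(2,4) assms by (simp add: append_eq_append_conv)
  then show "is_crossing c \<and> u' = v \<and> v' = u \<and> {col u, col v} = {a, b}" using * by simp
next
  assume "is_crossing c \<and> u' = v \<and> v' = u \<and> {col u, col v} = {a, b}"
  then show "cross_thru (l, c, r) (xl @ u # v # xr) (xl @ u' # v' # xr) a b"
    using assms unfolding cross_thru_def
    by (intro exI[of _ l] exI[of _ c] exI[of _ r] exI[of _ xl] exI[of _ xr] exI[of _ u] exI[of _ v]) simp
qed

text \<open>Each letter outside the pair \<open>t, t'\<close> forms a counted subword with both of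
  its members or with neither, and the pair itself forms none.\<close>

lemma icnt_double:
  assumes "col t = col t'" "a \<noteq> b"
  shows "even (icnt (xl @ t # t' # xr) a b) \<longleftrightarrow> even (icnt (xl @ xr) a b)"
proof -
  have "icnt (xl @ t # t' # xr) a b = icnt (xl @ xr) a b +
      2 * (if col t' = a then cnt xr b else if col t' = b then cnt xl a else 0)"
    using assms by (simp add: algebra_simps)
  then show ?thesis by (simp only: even_add dvd_triv_left simp_thms)
qed

lemma icnt_swap:
  assumes "col u \<noteq> col v" "a \<noteq> b"
  shows "even (icnt (xl @ u # v # xr) a b + icnt (xl @ v # u # xr) a b) \<longleftrightarrow> {col u, col v} \<noteq> {a, b}"
proof -
  have "icnt (xl @ u # v # xr) a b + (if col v = a \<and> col u = b then 1 else 0) =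
      icnt (xl @ v # u # xr) a b + (if col u = a \<and> col v = b then 1 else 0)"
    using assms by (simp add: algebra_simps)
  then consider "{col u, col v} \<noteq> {a, b}" "icnt (xl @ u # v # xr) a b = icnt (xl @ v # u # xr) a b"
    | "{col u, col v} = {a, b}" "icnt (xl @ u # v # xr) a b = Suc (icnt (xl @ v # u # xr) a b)"
    | "{col u, col v} = {a, b}" "icnt (xl @ v # u # xr) a b = Suc (icnt (xl @ u # v # xr) a b)"
    using assms by (simp only: doubleton_eq_iff split: if_splits) (simp_all del: icnt_append, blast+)
  then show ?thesis by cases (simp_all del: icnt_append)
qed

text \<open>Smoothings, caps and cups keep the sequence of colours except for neighbours of equal
  colour, which do not affect the parity. A through crossing exchanges two neighbours of different
  colours, and this matters only if the colours are \<open>a\<close> and \<open>b\<close>.\<close>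

lemma parity_step:
  assumes "lstep L x y" "a \<noteq> b"
  shows "even (icnt x a b + icnt y a b) \<longleftrightarrow> \<not> cross_thru L x y a b"
proof -
  obtain l c r xl xa xr ya where L: "L = (l, c, r)" "x = xl @ xa @ xr" "y = xl @ ya @ xr"
    "length xl = length l" "length xr = length r" and st: "tstep c xa ya \<or> nstep c xa ya"
    using assms(1) unfolding lstep_def by auto
  note ct = cross_thru_iff[OF L(4)]
  consider
      u v where "is_crossing c" "xa = [u, v]" "ya = [v, u]" "col u \<noteq> col v"
    | u v u' v' where "is_crossing c" "xa = [u, v]" "ya = [u', v']" "col u' = col u" "col v' = col v"
    | u v u' v' where "is_crossing c" "xa = [u, v]" "ya = [u', v']" "col u = col v" "col u' = col v'"
    | t where "\<not> is_crossing c" "xa = [t, t]" "ya = []"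
    | t where "\<not> is_crossing c" "xa = []" "ya = [t, t]"
    using st unfolding tstep_def nstep_def by (elim disjE exE conjE) (auto simp: is_crossing_def)
  then show ?thesis
  proof cases
    case 1
    then have "cross_thru L x y a b \<longleftrightarrow> {col u, col v} = {a, b}"
      by (simp add: L ct)
    moreover have "even (icnt x a b + icnt y a b) \<longleftrightarrow> {col u, col v} \<noteq> {a, b}"
      using 1 icnt_swap[of u v a b xl xr] assms(2) by (simp add: L del: icnt_append)
    ultimately show ?thesis by simp
  next
    case 2
    then have "\<not> cross_thru L x y a b" using assms(2) by (auto simp: L ct doubleton_eq_iff)
    moreover have "icnt x a b = icnt y a b" using 2 by (simp add: L)
    ultimately show ?thesis by simp
  next
    case 3
    then have "\<not> cross_thru L x y a b" using assms(2) by (auto simp: L ct doubleton_eq_iff)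
    moreover have "even (icnt x a b + icnt y a b)"
      using 3 icnt_double[OF _ assms(2)] by (simp add: L del: icnt_append)
    ultimately show ?thesis by simp
  next
    case 4
    then have "\<not> cross_thru L x y a b" by (auto simp: L cross_thru_def)
    moreover have "even (icnt x a b + icnt y a b)"
      using 4 icnt_double[of t t a b xl xr] assms(2) by (simp add: L del: icnt_append)
    ultimately show ?thesis by simp
  next
    case 5
    then have "\<not> cross_thru L x y a b" by (auto simp: L cross_thru_def)
    moreover have "even (icnt x a b + icnt y a b)"
      using 5 icnt_double[of t t a b xl xr] assms(2) by (simp add: L del: icnt_append)
    ultimately show ?thesis by simp
  qed
qed

definition nthru :: "layer list \<Rightarrow> (nat \<Rightarrow> int list) \<Rightarrow> int \<Rightarrow> int \<Rightarrow> nat set" where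
  "nthru D p a b = {h. h < length D \<and> cross_thru (D ! h) (p h) (p (Suc h)) a b}"

lemma step_length: "tstep a xa ya \<or> nstep a xa ya \<Longrightarrow> length xa = length (adom a) \<and> length ya = length (acod a)"
  by (auto simp: tstep_def nstep_def is_crossing_def)

lemma parity_path:
  assumes "valid_path D p" "a \<noteq> b"
  shows "even (icnt (p 0) a b + icnt (p (length D)) a b + card (nthru D p a b))"
proof -
  let ?S = "\<lambda>n. {h. h < n \<and> cross_thru (D ! h) (p h) (p (Suc h)) a b}"
  have "even (icnt (p 0) a b + icnt (p n) a b + card (?S n))" if "n \<le> length D" for n
    using that
  proof (induction n)
    case (Suc n)
    have ps: "even (icnt (p n) a b + icnt (p (Suc n)) a b) \<longleftrightarrow> \<not> cross_thru (D ! n) (p n) (p (Suc n)) a b"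
      using Suc.prems assms by (intro parity_step) (auto simp: valid_path_def)
    have "?S (Suc n) = (if cross_thru (D ! n) (p n) (p (Suc n)) a b then insert n (?S n) else ?S n)"
      by (auto simp: less_Suc_eq)
    then have "card (?S (Suc n)) = (if cross_thru (D ! n) (p n) (p (Suc n)) a b then 1 else 0) + card (?S n)"
      by simp
    with ps Suc show ?case by (auto split: if_splits)
  qed simp
  then show ?thesis by (simp add: nthru_def)
qed

definition color_pairs :: "int \<Rightarrow> (int \<times> int) set" where
  "color_pairs N = {(a, b). 0 \<le> a \<and> a < b \<and> b < N}"

lemma finite_color_pairs [simp]: "finite (color_pairs N)"
  by (rule finite_subset[of _ "{0..N} \<times> {0..N}"]) (auto simp: color_pairs_def)

definition crossing_layers :: "layer list \<Rightarrow> nat set" where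
  "crossing_layers D = {h. h < length D \<and> is_crossing (fst (snd (D ! h)))}"

text \<open>These are the pairs of colours that every labelling between the two words has to
  exchange an odd number of times. Only the words enter, not the diagram.\<close>

definition inversions :: "int \<Rightarrow> int list \<Rightarrow> int list \<Rightarrow> nat" where
  "inversions N x y = card {(a, b) \<in> color_pairs N. odd (icnt x a b + icnt y a b)}"

lemma inversions_alt:
  "inversions N x y = (\<Sum>(a, b)\<in>color_pairs N. if odd (icnt x a b + icnt y a b) then 1 else 0)"
proof -
  have "{(a, b) \<in> color_pairs N. odd (icnt x a b + icnt y a b)} =
      {p \<in> color_pairs N. case p of (a, b) \<Rightarrow> odd (icnt x a b + icnt y a b)}" by auto
  then show ?thesis
    by (simp add: inversions_def sum.If_cases Int_def case_prod_beta)
qed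

text \<open>A through crossing determines its pair of colours, so the sets for different pairs are
  disjoint.\<close>

lemma card_Union_nthru:
  "card (\<Union>(a, b)\<in>color_pairs N. nthru D p a b) = (\<Sum>(a, b)\<in>color_pairs N. card (nthru D p a b))"
proof -
  have "card (\<Union>c\<in>color_pairs N. case c of (a, b) \<Rightarrow> nthru D p a b) =
      (\<Sum>c\<in>color_pairs N. card (case c of (a, b) \<Rightarrow> nthru D p a b))"
  proof (rule card_UN_disjoint)
    show "\<forall>c\<in>color_pairs N. \<forall>c'\<in>color_pairs N. c \<noteq> c' \<longrightarrow>
        (case c of (a, b) \<Rightarrow> nthru D p a b) \<inter> (case c' of (a, b) \<Rightarrow> nthru D p a b) = {}"
    proof (intro ballI impI, rule ccontr)
      fix c c' assume c: "c \<in> color_pairs N" "c' \<in> color_pairs N" "c \<noteq> c'"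
        and ne: "(case c of (a, b) \<Rightarrow> nthru D p a b) \<inter> (case c' of (a, b) \<Rightarrow> nthru D p a b) \<noteq> {}"
      obtain a b a' b' where cc: "c = (a, b)" "c' = (a', b')" by fastforce
      from ne cc obtain h where h: "cross_thru (D ! h) (p h) (p (Suc h)) a b" "cross_thru (D ! h) (p h) (p (Suc h)) a' b'"
        by (auto simp: nthru_def)
      then have "{a, b} = {a', b'}" unfolding cross_thru_def by auto
      then show False using c cc by (auto simp: color_pairs_def doubleton_eq_iff)
    qed
  qed (auto simp: nthru_def)
  then show ?thesis by (simp add: case_prod_beta)
qed

lemma Union_nthru_subset: "(\<Union>(a, b)\<in>color_pairs N. nthru D p a b) \<subseteq> crossing_layers D"
  by (auto simp: nthru_def crossing_layers_def cross_thru_def)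

lemma inversions_le_sum:
  assumes "valid_path D p"
  shows "inversions N (p 0) (p (length D)) \<le> (\<Sum>(a, b)\<in>color_pairs N. card (nthru D p a b))"
  unfolding inversions_alt
proof (rule sum_mono)
  fix c assume "c \<in> color_pairs N"
  then obtain a b where c: "c = (a, b)" "a \<noteq> b" by (auto simp: color_pairs_def)
  have "card (nthru D p a b) \<noteq> 0" if "odd (icnt (p 0) a b + icnt (p (length D)) a b)"
    using parity_path[OF assms c(2)] that by (metis add.right_neutral)
  then show "(case c of (a, b) \<Rightarrow> if odd (icnt (p 0) a b + icnt (p (length D)) a b) then 1 else 0) \<le>
      (case c of (a, b) \<Rightarrow> card (nthru D p a b))"
    using c by auto
qed

text \<open>Each pair counted by \<open>inversions\<close> needs a crossing where it is exchanged,
  and a crossing exchanges only one pair. If the bound is attained, no crossing is left for a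
  smoothing.\<close>

lemma inversions_le_crossings:
  assumes "valid_path D p"
  shows "inversions N (p 0) (p (length D)) \<le> card (crossing_layers D)"
    and "inversions N (p 0) (p (length D)) = card (crossing_layers D) \<Longrightarrow> thru_path D p"
proof -
  have fin: "finite (crossing_layers D)" by (simp add: crossing_layers_def)
  show "inversions N (p 0) (p (length D)) \<le> card (crossing_layers D)"
    using inversions_le_sum[OF assms, of N] card_mono[OF fin Union_nthru_subset[of D p N]]
    by (simp add: card_Union_nthru)
  assume eq: "inversions N (p 0) (p (length D)) = card (crossing_layers D)"
  have "(\<Union>(a, b)\<in>color_pairs N. nthru D p a b) = crossing_layers D"
    using inversions_le_sum[OF assms, of N] card_mono[OF fin Union_nthru_subset[of D p N]]
    by (intro card_subset_eq[OF fin Union_nthru_subset]) (simp add: card_Union_nthru eq)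
  show "thru_path D p"
    unfolding thru_path_def
  proof (intro allI impI)
    fix h assume h: "h < length D"
    have ls: "lstep (D ! h) (p h) (p (Suc h))" using assms h by (simp add: valid_path_def)
    show "ltstep (D ! h) (p h) (p (Suc h))"
    proof (cases "is_crossing (fst (snd (D ! h)))")
      case True
      then have "h \<in> (\<Union>(a, b)\<in>color_pairs N. nthru D p a b)"
        using h \<open>_ = crossing_layers D\<close> by (simp add: crossing_layers_def)
      then obtain a b where ab: "a < b" "cross_thru (D ! h) (p h) (p (Suc h)) a b"
        by (auto simp: nthru_def color_pairs_def)
      then obtain l c r xl xr u v where L: "D ! h = (l, c, r)" "is_crossing c" "p h = xl @ [u, v] @ xr"
        "p (Suc h) = xl @ [v, u] @ xr" "length xl = length l" "{col u, col v} = {a, b}"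
        unfolding cross_thru_def by auto
      have "col u \<noteq> col v" using L(6) ab(1) by (auto simp: doubleton_eq_iff)
      then have "tstep c [u, v] [v, u]" using L(2) by (simp add: tstep_def)
      moreover have "length xr = length r"
      proof -
        have lc: "length (adom c) = 2" using L(2) by (auto simp: is_crossing_def)
        obtain l' c' r' xl' xa' xr' ya' where ph: "D ! h = (l', c', r')" "p h = xl' @ xa' @ xr'"
          "length xl' = length l'" "length xr' = length r'" "tstep c' xa' ya' \<or> nstep c' xa' ya'"
          using ls unfolding lstep_def by blast
        then have "length (p h) = length l + 2 + length r"
          using step_length[OF ph(5)] lc L(1) by simp
        then show ?thesis using L(3,5) by simp
      qed
      ultimately show ?thesis using L unfolding ltstep_def by blast
    next
      case False
      obtain l c r xl xa xr ya where L: "D ! h = (l, c, r)" "p h = xl @ xa @ xr" "p (Suc h) = xl @ ya @ xr"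
        "length xl = length l" "length xr = length r" "tstep c xa ya \<or> nstep c xa ya"
        using ls unfolding lstep_def by blast
      then have "tstep c xa ya" using False by (simp add: nstep_def)
      with L show ?thesis unfolding ltstep_def by blast
    qed
  qed
qed

text \<open>In a through labelling every crossing exchanges two colours, and by assumption never the
  same two again; so a pair is exchanged once if \<open>inversions\<close> counts it and not at all
  otherwise.\<close>

lemma crossings_eq_inversions:
  assumes "thru_path D p" "\<And>h. h \<le> length D \<Longrightarrow> set (p h) \<subseteq> {-N..<N}"
    and "\<And>a b h h'. h \<in> nthru D p a b \<Longrightarrow> h' \<in> nthru D p a b \<Longrightarrow> h = h'"
  shows "card (crossing_layers D) = inversions N (p 0) (p (length D))"
proof -
  have vp: "valid_path D p"
    using assms(1) unfolding thru_path_def valid_path_def ltstep_def lstep_def by blast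
  have "crossing_layers D \<subseteq> (\<Union>(a, b)\<in>color_pairs N. nthru D p a b)"
  proof
    fix h assume h: "h \<in> crossing_layers D"
    then obtain l c r xl xa xr ya where L: "D ! h = (l, c, r)" "is_crossing c" "p h = xl @ xa @ xr"
        "p (Suc h) = xl @ ya @ xr" "length xl = length l" "tstep c xa ya" "h < length D"
      using assms(1) unfolding thru_path_def ltstep_def crossing_layers_def by auto
    then obtain u v where uv: "xa = [u, v]" "ya = [v, u]" "col u \<noteq> col v"
      unfolding tstep_def is_crossing_def by auto
    have "u \<in> {-N..<N}" "v \<in> {-N..<N}" using assms(2)[of h] L uv by auto
    then have "(min (col u) (col v), max (col u) (col v)) \<in> color_pairs N"
      using uv(3) by (auto simp: color_pairs_def col_def bar_def min_def max_def)
    moreover have "cross_thru (D ! h) (p h) (p (Suc h)) (min (col u) (col v)) (max (col u) (col v))"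
      unfolding cross_thru_def
      by (rule exI[of _ l], rule exI[of _ c], rule exI[of _ r], rule exI[of _ xl], rule exI[of _ xr],
          rule exI[of _ u], rule exI[of _ v]) (use L uv in \<open>auto simp: min_def max_def\<close>)
    ultimately show "h \<in> (\<Union>(a, b)\<in>color_pairs N. nthru D p a b)"
      using L(7) by (auto simp: nthru_def)
  qed
  then have "card (crossing_layers D) = (\<Sum>(a, b)\<in>color_pairs N. card (nthru D p a b))"
    using Union_nthru_subset[of D p N] card_Union_nthru[of D p N] by (metis subset_antisym)
  also have "\<dots> = inversions N (p 0) (p (length D))"
    unfolding inversions_alt
  proof (rule sum.cong[OF HOL.refl])
    fix c assume "c \<in> color_pairs N"
    then obtain a b where c: "c = (a, b)" "a \<noteq> b" by (auto simp: color_pairs_def)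
    \<comment> \<open>A number that is at most one is determined by its parity, which
      \<open>parity_path\<close> provides.\<close>
    have "card (nthru D p a b) \<le> 1"
      using assms(3)[of _ a b] by (intro card_le_Suc0_iff_eq[THEN iffD2, folded One_nat_def]) (auto simp: nthru_def)
    then have "card (nthru D p a b) = (if odd (icnt (p 0) a b + icnt (p (length D)) a b) then 1 else 0)"
      using parity_path[OF vp c(2)] by (cases "card (nthru D p a b)") auto
    then show "(case c of (a, b) \<Rightarrow> card (nthru D p a b)) =
      (case c of (a, b) \<Rightarrow> if odd (icnt (p 0) a b + icnt (p (length D)) a b) then 1 else 0)"
      using c by simp
  qed
  finally show ?thesis .
qed

section \<open>Labellings that follow the strings\<close>

lemma thru_path_arc:
  assumes "thru_path D p" "arc D P Q"
  shows "p (fst P) ! snd P = p (fst Q) ! snd Q"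
proof -
  have step: "\<exists>xl xa xr ya. p h = xl @ xa @ xr \<and> p (Suc h) = xl @ ya @ xr \<and>
     length xl = length l \<and> length xr = length r \<and> tstep a xa ya"
    if "h < length D" "D ! h = (l, a, r)" for h l a r
    using assms(1) that unfolding thru_path_def ltstep_def by (metis prod.inject)
  show ?thesis
    using assms(2)
  proof (cases rule: arc.cases)
    case (left h l a r i)
    then show ?thesis using step[OF left(3,4)] by (auto simp: nth_append)
  next
    case (right h l a r i)
    then obtain xl xa xr ya where *: "p h = xl @ xa @ xr" "p (Suc h) = xl @ ya @ xr"
      "length xl = length l" "length xr = length r" "tstep a xa ya" using step[OF right(3,4)] by blast
    then show ?thesis using right step_length[OF disjI1[OF *(5)]] by (simp add: nth_append)
  next
    case (crossing_up h l a r)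
    then show ?thesis using step[OF crossing_up(3,4)] by (auto simp: nth_append tstep_def is_crossing_def)
  next
    case (crossing_down h l a r)
    then show ?thesis using step[OF crossing_down(3,4)] by (auto simp: nth_append tstep_def is_crossing_def)
  next
    case (cap h l a r)
    then show ?thesis using step[OF cap(3,4)] by (auto simp: nth_append tstep_def is_crossing_def)
  next
    case (cup h l a r)
    then show ?thesis using step[OF cup(3,4)] by (auto simp: nth_append tstep_def is_crossing_def)
  next
    case (token h l a r)
    then show ?thesis using step[OF token(3,4)] by (auto simp: nth_append tstep_def is_crossing_def)
  qed
qed

lemma thru_path_same_string:
  assumes "thru_path D p" "same_string D P Q"
  shows "p (fst P) ! snd P = p (fst Q) ! snd Q"
proof -
  have "(\<lambda>P Q. p (fst P) ! snd P = p (fst Q) ! snd Q) P Q"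
    using assms(2) unfolding same_string_def
    by (induction rule: equivclp_induct) (auto dest: thru_path_arc[OF assms(1)])
  then show ?thesis .
qed

text \<open>A token is recorded by \<open>bar\<close>, which does not change the colour. With
  \<open>e\<close> taking nonnegative values, the label of a terminus is negative exactly if the
  terminus carries a token.\<close>

definition idx :: "obj \<Rightarrow> obj \<Rightarrow> (endpoint \<Rightarrow> int) \<Rightarrow> (endpoint \<Rightarrow> endpoint) \<Rightarrow> endpoint set \<Rightarrow> endpoint \<Rightarrow> int" where
  "idx X Y e m T s =
     (if s \<in> origins X Y then e s
      else if s \<in> T then bar (e (inv_into (origins X Y) m s)) else e (inv_into (origins X Y) m s))"

definition bword :: "obj \<Rightarrow> obj \<Rightarrow> (endpoint \<Rightarrow> int) \<Rightarrow> (endpoint \<Rightarrow> endpoint) \<Rightarrow> endpoint set \<Rightarrow> int list" where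
  "bword X Y e m T = map (\<lambda>i. idx X Y e m T (Bot i)) [0..<length X]"

definition tword :: "obj \<Rightarrow> obj \<Rightarrow> (endpoint \<Rightarrow> int) \<Rightarrow> (endpoint \<Rightarrow> endpoint) \<Rightarrow> endpoint set \<Rightarrow> int list" where
  "tword X Y e m T = map (\<lambda>j. idx X Y e m T (Top j)) [0..<length Y]"

lemma origins_termini_disjoint: "origins X Y \<inter> termini X Y = {}"
  by (auto simp: origins_def termini_def)

lemma Bot_in: "i < length X \<Longrightarrow> Bot i \<in> origins X Y \<union> termini X Y"
  by (cases "X ! i") (auto simp: origins_def termini_def)

lemma Top_in: "j < length Y \<Longrightarrow> Top j \<in> origins X Y \<union> termini X Y"
  by (cases "Y ! j") (auto simp: origins_def termini_def)

lemma endpoint_cases: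
  assumes "s \<in> origins X Y \<union> termini X Y"
  obtains i where "s = Bot i" "i < length X" | j where "s = Top j" "j < length Y"
  using assms by (auto simp: origins_def termini_def)

lemma diagram_level_dom: "diagram X Y D \<Longrightarrow> h < length D \<Longrightarrow> level X D h = layer_dom (D ! h)"
proof (induction D arbitrary: X h)
  case (Cons L D)
  then show ?case
    by (cases h) (auto simp: level_Cons)
qed simp

lemma diagram_level_last: "diagram X Y D \<Longrightarrow> level X D (length D) = Y"
proof (induction D arbitrary: X)
  case (Cons L D)
  then show ?case by (auto simp: level_Cons)
qed (simp add: level_def)

lemma level_cod: "h < length D \<Longrightarrow> level X D (Suc h) = layer_cod (D ! h)"
  by (simp add: level_def)

lemma upt_map_split: "map f [0..<a + b + c] =
    map f [0..<a] @ map (\<lambda>i. f (a + i)) [0..<b] @ map (\<lambda>i. f (a + b + i)) [0..<c]"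
  by (rule nth_equalityI) (auto simp: nth_append)

text \<open>Each point gets the label of the origin of its string. Without closed strings this is
  defined everywhere; as no string intersects itself, the colours at a crossing differ; and as two
  strings cross at most once, so do two colours.\<close>

lemma reduced_lift_path:
  assumes m: "matching X Y m" and D: "positive_reduced_lift X Y m D"
    and e: "inj_on e (origins X Y)" "e ` origins X Y \<subseteq> {0..<N}"
  shows "\<exists>p. thru_path D p \<and> (\<forall>h \<le> length D. length (p h) = length (level X D h)) \<and>
    (\<forall>h \<le> length D. set (p h) \<subseteq> {-N..<N}) \<and>
    p 0 = bword X Y e m {} \<and> p (length D) = tword X Y e m {} \<and>
    (\<forall>a b h h'. h \<in> nthru D p a b \<longrightarrow> h' \<in> nthru D p a b \<longrightarrow> h = h')"
proof -
  let ?O = "origins X Y" and ?T = "termini X Y"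
  note D' = D[unfolded positive_reduced_lift_def]
  note D2 = D'[THEN conjunct2]
  note D3 = D2[THEN conjunct2]
  note D4 = D3[THEN conjunct2]
  note D5 = D4[THEN conjunct2]
  note D6 = D5[THEN conjunct2]
  have dia: "diagram X Y D" using D' by (rule conjunct1)
  have ends: "same_string D (endpoint_pos D s) (endpoint_pos D t) \<longleftrightarrow> m s = t" if "s \<in> ?O" "t \<in> ?T" for s t
    using bspec[OF bspec[OF D2[THEN conjunct1] that(1)] that(2)] .
  have tok: "a \<notin> {TokUp, TokDown}" if "(l, a, r) \<in> set D" for l a r
    using bspec[OF D3[THEN conjunct1] that] by simp
  have closed: "\<exists>s \<in> ?O \<union> ?T. same_string D x (endpoint_pos D s)" if "x \<in> points X D" for x
    using bspec[OF D4[THEN conjunct1] that] .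
  have self: "\<not> same_string D x y" if "(x, y) \<in> crossings D" for x y
    using bspec[OF D5[THEN conjunct1] that] by simp
  have once: "\<not> (same_string D x x' \<and> same_string D y y') \<and> \<not> (same_string D x y' \<and> same_string D y x')"
    if "(x, y) \<in> crossings D" "(x', y') \<in> crossings D" "(x, y) \<noteq> (x', y')" for x y x' y'
  proof -
    have "\<forall>(x', y') \<in> crossings D. (x, y) \<noteq> (x', y') \<longrightarrow>
        \<not> (same_string D x x' \<and> same_string D y y') \<and> \<not> (same_string D x y' \<and> same_string D y x')"
      using bspec[OF D6[THEN conjunct1] that(1)] unfolding prod.case .
    from bspec[OF this that(2)] that(3) show ?thesis unfolding prod.case by (rule mp)
  qed
  have bij: "bij_betw m ?O ?T" using m by (simp add: matching_def)
  have sym: "same_string D P Q \<Longrightarrow> same_string D Q P" for P Q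
    unfolding same_string_def by (rule equivclp_sym)
  have trans: "same_string D P Q \<Longrightarrow> same_string D Q R \<Longrightarrow> same_string D P R" for P Q R
    unfolding same_string_def by (rule equivclp_trans)
  have arc: "arc D P Q \<Longrightarrow> same_string D P Q" for P Q
    unfolding same_string_def by (rule r_into_equivclp)
  have term_orig: "same_string D (endpoint_pos D t) (endpoint_pos D (inv_into ?O m t))" "inv_into ?O m t \<in> ?O" if "t \<in> ?T" for t
  proof -
    show o: "inv_into ?O m t \<in> ?O"
      using inv_into_into[of t m ?O] bij that by (simp add: bij_betw_def)
    have "m (inv_into ?O m t) = t"
      by (rule bij_betw_inv_into_right[OF bij that])
    then show "same_string D (endpoint_pos D t) (endpoint_pos D (inv_into ?O m t))"
      using ends[OF o that] sym by blast
  qed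
  have ex: "\<exists>s \<in> ?O. same_string D P (endpoint_pos D s)" if "P \<in> points X D" for P
    using closed[OF that] term_orig trans by blast
  have uniq: "s = s'" if "s \<in> ?O" "s' \<in> ?O" "same_string D (endpoint_pos D s) (endpoint_pos D s')" for s s'
  proof -
    have "m s' \<in> ?T" using bij that(2) by (auto simp: bij_betw_def)
    moreover have "same_string D (endpoint_pos D s') (endpoint_pos D (m s'))"
      using ends[OF that(2) calculation] by simp
    ultimately have "m s = m s'" using ends[OF that(1)] trans that(3) by blast
    then show ?thesis using bij that by (auto simp: bij_betw_def inj_on_def)
  qed
  \<comment> \<open>The origin of the string through \<open>P\<close>. It is unique, since two
    origins on one string have the same partner under \<open>m\<close>.\<close>
  define st where "st P = (SOME s. s \<in> ?O \<and> same_string D P (endpoint_pos D s))" for P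
  have st: "st P \<in> ?O" "same_string D P (endpoint_pos D (st P))" if "P \<in> points X D" for P
    using someI_ex[of "\<lambda>s. s \<in> ?O \<and> same_string D P (endpoint_pos D s)"] ex[OF that] unfolding st_def by blast+
  have st_eq: "st P = s" if "s \<in> ?O" "same_string D P (endpoint_pos D s)" "P \<in> points X D" for P s
    using uniq[OF st(1)[OF that(3)] that(1)] st(2)[OF that(3)] that(2) sym trans by blast
  have st_same: "st P = st Q" if "same_string D P Q" "P \<in> points X D" "Q \<in> points X D" for P Q
    using st_eq[OF st(1)[OF that(3)] _ that(2)] st(2)[OF that(3)] trans[OF that(1)] by blast
  have same_st: "same_string D P Q" if "st P = st Q" "P \<in> points X D" "Q \<in> points X D" for P Q
    using trans[OF st(2)[OF that(2)] sym[OF st(2)[OF that(3), folded that(1)]]] .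
  define sc where "sc P = e (st P)" for P
  have sc_same: "sc P = sc Q \<longleftrightarrow> same_string D P Q" if "P \<in> points X D" "Q \<in> points X D" for P Q
    unfolding sc_def inj_on_eq_iff[OF e(1) st(1)[OF that(1)] st(1)[OF that(2)]]
    using st_same[OF _ that] same_st[OF _ that] by blast
  have sc_range: "0 \<le> sc P" "sc P < N" if "P \<in> points X D" for P
    using st(1)[OF that] e(2) by (auto simp: sc_def)
  have sc_col: "col (sc P) = sc P" if "P \<in> points X D" for P
    using sc_range[OF that] by (simp add: col_def)
  define p where "p h = map (\<lambda>i. sc (h, i)) [0..<length (level X D h)]" for h
  have pts: "(h, i) \<in> points X D" if "h \<le> length D" "i < length (level X D h)" for h i
    using that by (simp add: points_def)
  have layer: "\<exists>xl xr. p h = xl @ map (\<lambda>i. sc (h, length l + i)) [0..<length (adom a)] @ xr \<and>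
      p (Suc h) = xl @ map (\<lambda>i. sc (Suc h, length l + i)) [0..<length (acod a)] @ xr \<and>
      length xl = length l \<and> length xr = length r"
    if h: "h < length D" "D ! h = (l, a, r)" for h l a r
  proof (intro exI conjI)
    have lv: "level X D h = l @ adom a @ r" "level X D (Suc h) = l @ acod a @ r"
      using diagram_level_dom[OF dia h(1)] level_cod[OF h(1)] h(2) by simp_all
    show "p h = map (\<lambda>i. sc (h, i)) [0..<length l] @ map (\<lambda>i. sc (h, length l + i)) [0..<length (adom a)] @
        map (\<lambda>i. sc (h, length l + length (adom a) + i)) [0..<length r]"
      unfolding p_def lv using upt_map_split[of _ "length l" "length (adom a)" "length r"] by (simp add: add.assoc)
    have 1: "map (\<lambda>i. sc (Suc h, i)) [0..<length l] = map (\<lambda>i. sc (h, i)) [0..<length l]"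
    proof (rule map_cong[OF HOL.refl])
      fix i assume i: "i \<in> set [0..<length l]"
      then have "arc D (h, i) (Suc h, i)" by (intro arc.left[OF h]) simp
      then show "sc (Suc h, i) = sc (h, i)"
        using sc_same[of "(h, i)" "(Suc h, i)"] arc pts[of h i] pts[of "Suc h" i] h(1) i by (simp add: lv)
    qed
    have 2: "map (\<lambda>i. sc (Suc h, length l + length (acod a) + i)) [0..<length r] =
        map (\<lambda>i. sc (h, length l + length (adom a) + i)) [0..<length r]"
    proof (rule map_cong[OF HOL.refl])
      fix i assume i: "i \<in> set [0..<length r]"
      then have "arc D (h, length l + length (adom a) + i) (Suc h, length l + length (acod a) + i)"
        by (intro arc.right[OF h]) simp
      then show "sc (Suc h, length l + length (acod a) + i) = sc (h, length l + length (adom a) + i)"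
        using sc_same[of "(h, length l + length (adom a) + i)" "(Suc h, length l + length (acod a) + i)"] arc
          pts[of h "length l + length (adom a) + i"] pts[of "Suc h" "length l + length (acod a) + i"] h(1) i
        by (simp add: lv)
    qed
    show "p (Suc h) = map (\<lambda>i. sc (h, i)) [0..<length l] @ map (\<lambda>i. sc (Suc h, length l + i)) [0..<length (acod a)] @
        map (\<lambda>i. sc (h, length l + length (adom a) + i)) [0..<length r]"
      unfolding p_def lv using upt_map_split[of "\<lambda>i. sc (Suc h, i)" "length l" "length (acod a)" "length r"] 1 2
      by (simp add: add.assoc)
  qed simp_all
  have two: "map f [0..<Suc (Suc 0)] = [f 0, f 1]" for f :: "nat \<Rightarrow> int"
    by (simp add: upt_rec)
  have c1: "thru_path D p"
    unfolding thru_path_def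
  proof (intro allI impI)
    fix h assume h: "h < length D"
    obtain l a r where L: "D ! h = (l, a, r)" by (metis prod_cases3)
    have lv: "level X D h = l @ adom a @ r" "level X D (Suc h) = l @ acod a @ r"
      using diagram_level_dom[OF dia h] level_cod[OF h] L by simp_all
    have tk: "a \<notin> {TokUp, TokDown}" using tok[of l a r] h L nth_mem by metis
    have "tstep a (map (\<lambda>i. sc (h, length l + i)) [0..<length (adom a)]) (map (\<lambda>i. sc (Suc h, length l + i)) [0..<length (acod a)])"
    proof -
      consider "is_crossing a" | "a \<in> {ACapL, ACapR}" | "a \<in> {ACupL, ACupR}"
        using tk by (cases a) (auto simp: is_crossing_def)
      then show ?thesis
      proof cases
        case 1
        then have len: "length (adom a) = Suc (Suc 0)" "length (acod a) = Suc (Suc 0)" by (auto simp: is_crossing_def)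
        have P: "(h, length l) \<in> points X D" "(h, length l + 1) \<in> points X D"
          "(Suc h, length l) \<in> points X D" "(Suc h, length l + 1) \<in> points X D"
          using h by (auto intro!: pts simp: lv len)
        have "sc (h, length l) = sc (Suc h, length l + 1)" "sc (h, length l + 1) = sc (Suc h, length l)"
          using sc_same[OF P(1,4)] sc_same[OF P(2,3)] arc arc.crossing_up[OF h L 1] arc.crossing_down[OF h L 1] by blast+
        \<comment> \<open>Labels are values of \<open>e\<close>, hence nonnegative and equal to
          their own colours; the two strings differ because no string intersects itself.\<close>
        moreover have "col (sc (h, length l)) \<noteq> col (sc (h, length l + 1))"
          using self[of "(h, length l)" "(h, length l + 1)"] sc_same[OF P(1,2)] sc_col[OF P(1)] sc_col[OF P(2)] 1 L h
          by (auto simp: crossings_def)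
        ultimately show ?thesis using 1 unfolding tstep_def len two by auto
      next
        case 2
        then have len: "length (adom a) = Suc (Suc 0)" "length (acod a) = 0" by auto
        have P: "(h, length l) \<in> points X D" "(h, length l + 1) \<in> points X D"
          using h by (auto intro!: pts simp: lv len)
        have "sc (h, length l) = sc (h, length l + 1)"
          using sc_same[OF P] arc arc.cap[OF h L 2] by blast
        then show ?thesis using 2 unfolding tstep_def len two by auto
      next
        case 3
        then have len: "length (adom a) = 0" "length (acod a) = Suc (Suc 0)" by auto
        have P: "(Suc h, length l) \<in> points X D" "(Suc h, length l + 1) \<in> points X D"
          using h by (auto intro!: pts simp: lv len)
        have "sc (Suc h, length l) = sc (Suc h, length l + 1)"
          using sc_same[OF P] arc arc.cup[OF h L 3] by blast
        then show ?thesis using 3 unfolding tstep_def len two by auto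
      qed
    qed
    then show "ltstep (D ! h) (p h) (p (Suc h))"
      using layer[OF h L] L unfolding ltstep_def by blast
  qed
  have len: "length (p h) = length (level X D h)" for h
    by (simp add: p_def)
  have c3: "set (p h) \<subseteq> {-N..<N}" if "h \<le> length D" for h
    using sc_range[OF pts[OF that]] by (force simp: p_def)
  have sc_end: "sc (endpoint_pos D s) = idx X Y e m {} s" if "s \<in> ?O \<union> ?T" for s
  proof -
    have P: "endpoint_pos D s \<in> points X D"
      using that diagram_level_last[OF dia] by (elim endpoint_cases) (auto simp: points_def)
    show ?thesis
    proof (cases "s \<in> ?O")
      case True
      have "same_string D (endpoint_pos D s) (endpoint_pos D s)" by (simp add: same_string_def)
      then show ?thesis using st_eq[OF True _ P] True by (simp add: sc_def idx_def)
    next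
      case False
      then have "s \<in> ?T" using that by blast
      then show ?thesis using st_eq[OF term_orig(2) term_orig(1) P] False by (simp add: sc_def idx_def)
    qed
  qed
  have c4: "p 0 = bword X Y e m {}"
    unfolding p_def bword_def using sc_end[OF Bot_in] by (intro map_cong) auto
  have c5: "p (length D) = tword X Y e m {}"
    unfolding p_def tword_def diagram_level_last[OF dia] using sc_end[OF Top_in] by (intro map_cong) auto
  have c6: "h = h'" if hh: "h \<in> nthru D p a b" "h' \<in> nthru D p a b" for a b h h'
  proof (rule ccontr)
    assume ne: "h \<noteq> h'"
    have *: "\<exists>i. ((h, i), (h, i + 1)) \<in> crossings D \<and> (h, i) \<in> points X D \<and> (h, i + 1) \<in> points X D \<and>
        {sc (h, i), sc (h, i + 1)} = {a, b}" if h: "h \<in> nthru D p a b" for h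
    proof -
      from h obtain l c r xl xr u v where L: "D ! h = (l, c, r)" "is_crossing c" "p h = xl @ [u, v] @ xr"
        "length xl = length l" "{col u, col v} = {a, b}" "h < length D"
        unfolding nthru_def cross_thru_def by auto
      have "length (p h) = length l + 2 + length xr" using L(3,4) by simp
      then have P: "(h, length l) \<in> points X D" "(h, length l + 1) \<in> points X D"
        using L(6) by (auto intro!: pts simp: len)
      have "p h ! length l = u" "p h ! (length l + 1) = v" using L(3,4) by (auto simp: nth_append)
      then have "sc (h, length l) = u" "sc (h, length l + 1) = v"
        using P by (auto simp: p_def points_def)
      then have "{sc (h, length l), sc (h, length l + 1)} = {a, b}"
        using L(5) sc_col[OF P(1)] sc_col[OF P(2)] by simp
      moreover have "((h, length l), (h, length l + 1)) \<in> crossings D"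
        unfolding crossings_def using L by blast
      ultimately show ?thesis using P by blast
    qed
    obtain i where i: "((h, i), (h, i + 1)) \<in> crossings D" "(h, i) \<in> points X D" "(h, i + 1) \<in> points X D"
      "{sc (h, i), sc (h, i + 1)} = {a, b}" using *[OF hh(1)] by blast
    obtain i' where i': "((h', i'), (h', i' + 1)) \<in> crossings D" "(h', i') \<in> points X D" "(h', i' + 1) \<in> points X D"
      "{sc (h', i'), sc (h', i' + 1)} = {a, b}" using *[OF hh(2)] by blast
    have "sc (h, i) = sc (h', i') \<and> sc (h, i + 1) = sc (h', i' + 1) \<or>
        sc (h, i) = sc (h', i' + 1) \<and> sc (h, i + 1) = sc (h', i')"
      using i(4) i'(4) by (metis doubleton_eq_iff)
    then show False
      using once[OF i(1) i'(1)] ne sc_same[OF i(2) i'(2)] sc_same[OF i(3) i'(3)] sc_same[OF i(2) i'(3)] sc_same[OF i(3) i'(2)]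
      by blast
  qed
  have l': "\<forall>h \<le> length D. length (p h) = length (level X D h)"
    by (simp add: len)
  have s': "\<forall>h \<le> length D. set (p h) \<subseteq> {-N..<N}"
    by (intro allI impI) (rule c3)
  have u': "\<forall>a b h h'. h \<in> nthru D p a b \<longrightarrow> h' \<in> nthru D p a b \<longrightarrow> h = h'"
    by (intro allI impI) (rule c6)
  show ?thesis
    by (rule exI[of _ p], rule conjI[OF c1 conjI[OF l' conjI[OF s' conjI[OF c4 conjI[OF c5 u']]]]])
qed

definition bullet_expr :: "'k \<Rightarrow> obj \<Rightarrow> obj \<Rightarrow> layer list \<Rightarrow> endpoint set \<Rightarrow> 'k mor" where
  "bullet_expr z X Y D T =
     token_row Y {j. Top j \<in> T} \<cdot> diagram_mor z X D \<cdot> token_row X {i. Bot i \<in> T}"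

lemma arrow_diagram: "z \<in> carrier k \<Longrightarrow> diagram X Y D \<Longrightarrow> arrow k X Y (diagram_mor z X D)"
proof (induction D arbitrary: X)
  case (Cons L D)
  obtain l a r where L: "L = (l, a, r)" by (cases L)
  have "arrow k (l @ adom a @ r) (l @ acod a @ r) (Ident l \<parallel> atom_mor z a \<parallel> Ident r)"
    by (intro arrow.Tens arrow.Ident arrow_atom Cons.prems(1))
  then show ?case using Cons L by (auto intro: arrow.Comp)
qed (auto intro: arrow.Ident)

section \<open>Triangularity of the entries of lifts\<close>

context rmat
begin

lemma bword_nth: "i < length X \<Longrightarrow> bword X Y e m T ! i = idx X Y e m T (Bot i)"
  by (simp add: bword_def)

lemma tword_nth: "j < length Y \<Longrightarrow> tword X Y e m T ! j = idx X Y e m T (Top j)"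
  by (simp add: tword_def)

lemma idx_range:
  assumes m: "matching X Y m" and e: "e ` origins X Y \<subseteq> {0..<N}" and s: "s \<in> origins X Y \<union> termini X Y"
  shows "idx X Y e m T s \<in> {-N..<N}"
proof -
  have *: "0 \<le> e t \<and> e t < N" if "t \<in> origins X Y" for t
  proof -
    have "e t \<in> {0..<N}" using e that by blast
    then show ?thesis by simp
  qed
  have "s \<in> origins X Y \<or> inv_into (origins X Y) m s \<in> origins X Y"
  proof (rule disjCI)
    assume "inv_into (origins X Y) m s \<notin> origins X Y"
    moreover have "termini X Y = m ` origins X Y" using m by (simp add: matching_def bij_betw_def)
    ultimately show "s \<in> origins X Y" using s inv_into_into[of s m "origins X Y"] by blast
  qed
  then obtain t where t: "t \<in> origins X Y" "idx X Y e m T s = e t \<or> idx X Y e m T s = bar (e t)"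
    unfolding idx_def by metis
  show ?thesis using *[OF t(1)] t(2) by (elim disjE) (simp_all add: bar_def)
qed

lemma bword_W:
  assumes "matching X Y m" "e ` origins X Y \<subseteq> {0..<N}"
  shows "bword X Y e m T \<in> W X"
proof -
  have "idx X Y e m T (Bot i) \<in> {-N..<N}" if "i < length X" for i
    by (rule idx_range[OF assms Bot_in[OF that]])
  then show ?thesis unfolding W_def bword_def by auto
qed

lemma tword_W:
  assumes "matching X Y m" "e ` origins X Y \<subseteq> {0..<N}"
  shows "tword X Y e m T \<in> W Y"
proof -
  have "idx X Y e m T (Top i) \<in> {-N..<N}" if "i < length Y" for i
    by (rule idx_range[OF assms Top_in[OF that]])
  then show ?thesis unfolding W_def tword_def by auto
qed

definition crossing_number :: "obj \<Rightarrow> obj \<Rightarrow> (endpoint \<Rightarrow> int) \<Rightarrow> (endpoint \<Rightarrow> endpoint) \<Rightarrow> nat" where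
  "crossing_number X Y e m = inversions N (bword X Y e m {}) (tword X Y e m {})"

text \<open>Tokens enter the words through \<open>bar\<close> only, and \<open>icnt\<close> sees
  only colours.\<close>

lemma inversions_tokens:
  "inversions N (bword X Y e m T) (tword X Y e m T) = crossing_number X Y e m"
proof -
  have "map col (bword X Y e m T) = map col (bword X Y e m {})" "map col (tword X Y e m T) = map col (tword X Y e m {})"
    by (simp_all add: bword_def tword_def idx_def)
  then have "icnt (bword X Y e m T) a b = icnt (bword X Y e m {}) a b"
    "icnt (tword X Y e m T) a b = icnt (tword X Y e m {}) a b" for a b
    using cnt_icnt_cong by blast+
  then show ?thesis by (simp add: crossing_number_def inversions_def)
qed

lemma path_end:
  assumes "diagram X Y D" "p 0 = bword X Y e m T" "p (length D) = tword X Y e m T" "s \<in> origins X Y \<union> termini X Y"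
  shows "p (fst (endpoint_pos D s)) ! snd (endpoint_pos D s) = idx X Y e m T s"
  using assms(4) by (rule endpoint_cases) (simp_all add: assms(2,3) bword_nth tword_nth)

lemma lift_good_atoms: "positive_reduced_lift X Y m D \<Longrightarrow> \<forall>(l, a, r) \<in> set D. good_atom a"
  unfolding positive_reduced_lift_def good_atom_def
proof (elim conjE, intro ballI)
  fix L assume tok: "\<forall>(l, a, r) \<in> set D. a \<notin> {TokUp, TokDown}"
    and pos: "\<forall>(l, a, r) \<in> set D. is_crossing a \<longrightarrow> a \<in> positive_crossings" and L: "L \<in> set D"
  obtain l a r where La: "L = (l, a, r)" by (cases L)
  from bspec[OF tok L] bspec[OF pos L]
  show "case L of (l, a, r) \<Rightarrow> a \<in> positive_crossings \<union> {ACapL, ACapR, ACupL, ACupR}"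
    by (cases a) (simp_all add: La is_crossing_def)
qed

text \<open>The labelling by strings satisfies the assumptions of
  \<open>crossings_eq_inversions\<close>, so all lifts of a matching have the number of crossings
  that the end words dictate.\<close>

lemma crossing_number_eq:
  assumes "matching X Y m" "positive_reduced_lift X Y m D" "inj_on e (origins X Y)" "e ` origins X Y \<subseteq> {0..<N}"
  shows "card (crossing_layers D) = crossing_number X Y e m"
proof -
  obtain p where p': "thru_path D p" "\<forall>h \<le> length D. length (p h) = length (level X D h)"
    "\<forall>h \<le> length D. set (p h) \<subseteq> {-N..<N}"
    "p 0 = bword X Y e m {}" "p (length D) = tword X Y e m {}"
    "\<forall>a b h h'. h \<in> nthru D p a b \<longrightarrow> h' \<in> nthru D p a b \<longrightarrow> h = h'"
    using reduced_lift_path[OF assms] by (elim exE conjE) (rule that)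
  note p = p'[rule_format]
  show ?thesis
    using crossings_eq_inversions[OF p(1,3,6)] by (simp add: p(4,5) crossing_number_def)
qed

text \<open>A nonzero entry yields a labelling of the lift of \<open>m'\<close> with the end words
  of \<open>m\<close>, so \<open>m\<close> has at most as many crossings as \<open>m'\<close>. In
  case of equality this labelling is through, hence constant along the strings of \<open>m'\<close>,
  and comparing the two ends of each string identifies the matchings and excludes tokens.\<close>

lemma lift_entry_nonzero:
  assumes J: "ideal J" and m: "matching X Y m" and m': "matching X Y m'" and D: "positive_reduced_lift X Y m' D"
    and e: "inj_on e (origins X Y)" "e ` origins X Y \<subseteq> {0..<N}"
    and T: "T \<subseteq> termini X Y"
    and nz: "\<not> J (F (diagram_mor z X D) (delta (tword X Y e m T)) (bword X Y e m T))"
  shows "crossing_number X Y e m < crossing_number X Y e m' \<or> (T = {} \<and> (\<forall>s \<in> origins X Y. m s = m' s))"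
proof (rule ccontr)
  assume contr: "\<not> ?thesis"
  have dia: "diagram X Y D" using D by (simp add: positive_reduced_lift_def)
  have bW: "bword X Y e m T \<in> W X" by (rule bword_W[OF m e(2)])
  obtain p where p: "p 0 = bword X Y e m T" "valid_path D p" "p (length D) = tword X Y e m T"
  proof (rule ccontr)
    assume a: "\<not> thesis"
    have "J (F (diagram_mor z X D) (delta (tword X Y e m T)) (bword X Y e m T))"
    proof (rule diagram_support[OF J dia lift_good_atoms[OF D] bW])
      fix p assume "p 0 = bword X Y e m T" "valid_path D p"
      then have "p (length D) \<noteq> tword X Y e m T" using that a by blast
      then show "J (delta (tword X Y e m T) (p (length D)))" using ideal_simps(1)[OF J] by simp
    qed
    then show False using nz by blast
  qed
  have "crossing_number X Y e m \<le> card (crossing_layers D)"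
    using inversions_le_crossings(1)[OF p(2), of N] by (simp add: p(1,3) inversions_tokens)
  then have "crossing_number X Y e m = card (crossing_layers D)"
    using contr crossing_number_eq[OF m' D e] by simp
  then have tp: "thru_path D p"
    using inversions_le_crossings(2)[OF p(2), of N] by (simp add: p(1,3) inversions_tokens)
  have key: "m' s \<notin> T \<and> m s = m' s" if s: "s \<in> origins X Y" for s
  proof -
    have t: "m' s \<in> termini X Y" using m' s by (auto simp: matching_def bij_betw_def)
    have "same_string D (endpoint_pos D s) (endpoint_pos D (m' s))"
      using D s t unfolding positive_reduced_lift_def by blast
    from thru_path_same_string[OF tp this]
    have eq: "idx X Y e m T s = idx X Y e m T (m' s)"
      using path_end[OF dia p(1,3)] s t by (metis UnI1 UnI2)
    have nt: "m' s \<notin> origins X Y" using t origins_termini_disjoint by blast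
    have o: "inv_into (origins X Y) m (m' s) \<in> origins X Y" "m (inv_into (origins X Y) m (m' s)) = m' s"
      using m t unfolding matching_def by (metis bij_betw_imp_surj_on inv_into_into, metis bij_betw_inv_into_right)
    \<comment> \<open>A token would make the label at the terminus negative, while the label at the
      origin is a value of \<open>e\<close>.\<close>
    have "e s \<ge> 0" "e (inv_into (origins X Y) m (m' s)) \<ge> 0"
      using e(2) s o(1) by (meson atLeastLessThan_iff image_subset_iff)+
    then have "m' s \<notin> T" "e s = e (inv_into (origins X Y) m (m' s))"
      using eq s nt by (auto simp: idx_def bar_def split: if_splits)
    then show ?thesis using e(1) s o by (metis inj_onD)
  qed
  have "T = {}"
  proof (rule ccontr)
    assume "T \<noteq> {}"
    then obtain t where t: "t \<in> T" by blast
    then have "t \<in> m' ` origins X Y" using T m' by (auto simp: matching_def bij_betw_def)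
    then show False using key t by blast
  qed
  then show False using contr key by blast
qed

text \<open>The labelling by strings is the only one between its end words: a second one attains the
  bound of \<open>inversions_le_crossings\<close> too, is therefore through, and is determined by
  its ends because every point lies on a string with an endpoint.\<close>

lemma lift_entry_unit:
  assumes J: "ideal J" and m: "matching X Y m" and D: "positive_reduced_lift X Y m D"
    and e: "inj_on e (origins X Y)" "e ` origins X Y \<subseteq> {0..<N}"
  shows "\<exists>u. invertible_elt u \<and> J (F (diagram_mor z X D) (delta (tword X Y e m {})) (bword X Y e m {}) - u)"
proof -
  have dia: "diagram X Y D" using D by (simp add: positive_reduced_lift_def)
  obtain p where p': "thru_path D p" "\<forall>h \<le> length D. length (p h) = length (level X D h)"
    "\<forall>h \<le> length D. set (p h) \<subseteq> {-N..<N}"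
    "p 0 = bword X Y e m {}" "p (length D) = tword X Y e m {}"
    "\<forall>a b h h'. h \<in> nthru D p a b \<longrightarrow> h' \<in> nthru D p a b \<longrightarrow> h = h'"
    using reduced_lift_path[OF m D e] by (elim exE conjE) (rule that)
  note p = p'[rule_format]
  have pin: "path_in X D p" using p(2,3) by (simp add: path_in_def W_def)
  have p0: "p 0 \<in> W X" unfolding p(4) by (rule bword_W[OF m e(2)])
  have "\<exists>u. invertible_elt u \<and> J (F (diagram_mor z X D) (delta (p (length D))) (p 0) - u)"
  proof (rule diagram_unit[OF J dia lift_good_atoms[OF D] p0 p(1) pin])
    fix p' h assume p': "p' 0 = p 0" "valid_path D p'" "path_in X D p'" "p' (length D) = p (length D)" and h: "h \<le> length D"
    have "crossing_number X Y e m = card (crossing_layers D)"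
      using crossing_number_eq[OF m D e] by simp
    then have tp: "thru_path D p'"
      using inversions_le_crossings(2)[OF p'(2), of N] by (simp add: p' p(4,5) crossing_number_def)
    show "p' h = p h"
    proof (rule nth_equalityI)
      show len: "length (p' h) = length (p h)"
        using p'(3) h p(2)[OF h] by (simp add: path_in_def W_def)
      fix i assume "i < length (p' h)"
      then have "(h, i) \<in> points X D" using h p(2)[OF h] len by (simp add: points_def)
      then obtain s where s: "s \<in> origins X Y \<union> termini X Y" "same_string D (h, i) (endpoint_pos D s)"
        using D unfolding positive_reduced_lift_def by blast
      show "p' h ! i = p h ! i"
        using thru_path_same_string[OF tp s(2)] thru_path_same_string[OF p(1) s(2)]
          path_end[OF dia p(4,5) s(1)] path_end[OF dia _ _ s(1), of p' e m "{}"] p'(1,4) p(4,5)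
        by simp
    qed
  qed
  then show ?thesis by (simp add: p(4,5))
qed

section \<open>Tokens as flips of labels\<close>

definition flip :: "nat set \<Rightarrow> int list \<Rightarrow> int list" where
  "flip A w = map (\<lambda>i. if i \<in> A then bar (w ! i) else w ! i) [0..<length w]"

lemma flip_flip [simp]: "flip A (flip A w) = w"
  by (rule nth_equalityI) (auto simp: flip_def)

lemma flip_W [simp]: "flip A w \<in> W X \<longleftrightarrow> w \<in> W X"
proof -
  have *: "flip A w \<in> W X" if w: "w \<in> W X" for w
  proof -
    have nth: "(if i \<in> A then bar (w ! i) else w ! i) \<in> {-N..<N}" if i: "i < length w" for i
    proof -
      have "set w \<subseteq> {-N..<N}" using w by (simp add: W_def)
      from subsetD[OF this nth_mem[OF i]] show ?thesis using W_bar by simp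
    qed
    have "set (flip A w) \<subseteq> {-N..<N}"
    proof
      fix x assume "x \<in> set (flip A w)"
      then obtain i where "i < length (flip A w)" "flip A w ! i = x" by (auto simp: in_set_conv_nth)
      then show "x \<in> {-N..<N}" using nth[of i] by (simp add: flip_def split: if_splits)
    qed
    then show ?thesis using w unfolding W_def by (simp add: flip_def)
  qed
  show ?thesis using *[of w] *[of "flip A w"] flip_flip[of A w] by auto
qed

fun row :: "(orientation \<times> bool) list \<Rightarrow> 'k mor" where
  "row [] = Ident []"
| "row ((c, b) # bs) = (if b then token c else Ident [c]) \<parallel> row bs"

lemma token_row_eq: "token_row X A = row (map (\<lambda>i. (X ! i, i \<in> A)) [0..<length X])"
proof -
  have "foldr (\<parallel>) (map (\<lambda>(c, b). if b then token c else Ident [c]) bs) (Ident []) = row bs" for bs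
    by (induction bs) auto
  from this[of "map (\<lambda>i. (X ! i, i \<in> A)) [0..<length X]"] show ?thesis
    by (simp add: token_row_def comp_def)
qed

lemma F_single:
  assumes "x \<in> {-N..<N}"
  shows "\<exists>u. u * u = 1 \<and> (\<forall>v. F (if b then token c else Ident [c]) v [x] = u * v [if b then bar x else x])"
proof (cases b)
  case True
  show ?thesis
  proof (cases c)
    case Up
    then show ?thesis using True by (intro exI[of _ "sgn_if (odd x)"]) simp
  next
    case Down
    show ?thesis using True Down F_clif_down[OF assms]
      by (intro exI[of _ "sgn_if (odd x) * sgn_if (odd (bar x))"]) (simp add: mult_ac)
  qed
next
  case False
  then show ?thesis by (intro exI[of _ 1]) simp
qed

text \<open>A row of tokens acts as a signed permutation of words. Of the sign only
  \<open>u * u = 1\<close> is recorded, which is enough for invertibility.\<close>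

lemma F_row:
  assumes "length w = length bs" "set w \<subseteq> {-N..<N}"
  shows "\<exists>u. u * u = 1 \<and> (\<forall>v. F (row bs) v w = u * v (map2 (\<lambda>(c, b) x. if b then bar x else x) bs w))"
  using assms
proof (induction bs arbitrary: w)
  case Nil
  then show ?case by (intro exI[of _ 1]) simp
next
  case (Cons cb bs)
  obtain c b where cb: "cb = (c, b)" by (cases cb)
  obtain x w' where w: "w = x # w'" using Cons.prems by (cases w) auto
  let ?f = "if b then token c else Ident [c]"
  have x: "x \<in> {-N..<N}" and w': "length w' = length bs" "set w' \<subseteq> {-N..<N}" using Cons.prems w by auto
  obtain u where u: "u * u = 1" "\<And>v. F (row bs) v w' = u * v (map2 (\<lambda>(c, b) x. if b then bar x else x) bs w')"
    using Cons.IH[OF w'] by blast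
  obtain u0 where u0: "u0 * u0 = 1" "\<And>v. F ?f v [x] = u0 * v [if b then bar x else x]"
    using F_single[OF x] by blast
  have src: "src ?f = 1"
    using src_arrow[of _ "[\<down>]", OF arrow_clif_down] by (cases c) auto
  let ?w = "map2 (\<lambda>(c, b) x. if b then bar x else x) bs w'"
  have "F (row (cb # bs)) v w = (u0 * (u * (sgm [x] w' * sgm [x] ?w))) * v ((if b then bar x else x) # ?w)" for v
  proof -
    have "F (row (cb # bs)) v w = F ?f (\<lambda>y. sgm [x] w' * F (row bs) (\<lambda>y'. sgm [x] y' * v (y @ y')) w') [x]"
      unfolding cb w row.simps F.simps(4) src by simp
    also have "\<dots> = (u0 * (u * (sgm [x] w' * sgm [x] ?w))) * v ((if b then bar x else x) # ?w)"
      unfolding u u0 by (simp add: mult_ac)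
    finally show ?thesis .
  qed
  moreover have "(u0 * (u * (sgm [x] w' * sgm [x] ?w))) * (u0 * (u * (sgm [x] w' * sgm [x] ?w))) = 1"
  proof -
    have "(u0 * (u * (sgm [x] w' * sgm [x] ?w))) * (u0 * (u * (sgm [x] w' * sgm [x] ?w))) =
      (u0 * u0) * ((u * u) * ((sgm [x] w' * sgm [x] w') * (sgm [x] ?w * sgm [x] ?w)))" by (simp only: mult_ac)
    then show ?thesis by (simp only: u0(1) u(1) sgn_if_sq mult_1)
  qed
  ultimately show ?case using cb w by (intro exI conjI) auto
qed

lemma F_token_row:
  assumes "w \<in> W X"
  shows "\<exists>u. u * u = 1 \<and> (\<forall>v. F (token_row X A) v w = u * v (flip A w))"
proof -
  have "map2 (\<lambda>(c, b) x. if b then bar x else x) (map (\<lambda>i. (X ! i, i \<in> A)) [0..<length X]) w = flip A w"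
    using assms by (intro nth_equalityI) (auto simp: W_def flip_def)
  then show ?thesis
    using F_row[of w "map (\<lambda>i. (X ! i, i \<in> A)) [0..<length X]"] assms
    by (simp add: token_row_eq W_def)
qed

lemma F_bullet:
  assumes dia: "diagram X Y D" and w: "w \<in> W X" and y: "y \<in> W Y"
  shows "\<exists>u. u * u = 1 \<and> F (bullet_expr z X Y D T) (delta y) w =
    u * F (diagram_mor z X D) (delta (flip {j. Top j \<in> T} y)) (flip {i. Bot i \<in> T} w)"
proof -
  let ?A = "{j. Top j \<in> T}" and ?B = "{i. Bot i \<in> T}"
  let ?k = "\<lparr>carrier = UNIV, mult = undefined, one = undefined, zero = undefined, add = undefined\<rparr> :: 'k ring"
  have arr: "arrow ?k X Y (diagram_mor z X D)" by (rule arrow_diagram[OF _ dia]) simp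
  obtain u where u: "u * u = 1" "\<And>v. F (token_row X ?B) v w = u * v (flip ?B w)"
    using F_token_row[OF w] by blast
  have fy: "flip ?A y \<in> W Y" using y by simp
  obtain u' where u': "u' * u' = 1" "\<And>v. F (token_row Y ?A) v (flip ?A y) = u' * v (flip ?A (flip ?A y))"
    using F_token_row[OF fy] by blast
  \<comment> \<open>A signed permutation takes the indicator of \<open>y\<close> to a multiple of
    the indicator of \<open>flip ?A y\<close>. The factor is the one found at
    \<open>flip ?A y\<close>; all other values are zero.\<close>
  have "F (token_row Y ?A) (delta y) y' = u' * delta (flip ?A y) y'" if y': "y' \<in> W Y" for y'
  proof (cases "y' = flip ?A y")
    case True
    then show ?thesis using u'(2)[of "delta y"] by simp
  next
    case False
    obtain u'' where "\<And>v. F (token_row Y ?A) v y' = u'' * v (flip ?A y')"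
      using F_token_row[OF y'] by blast
    moreover have "flip ?A y' \<noteq> y" using False flip_flip by metis
    ultimately show ?thesis using False by simp
  qed
  then have "F (diagram_mor z X D) (F (token_row Y ?A) (delta y)) (flip ?B w) =
      F (diagram_mor z X D) (\<lambda>y'. u' * delta (flip ?A y) y') (flip ?B w)"
    by (intro F_cong[OF arr]) (use w in simp_all)
  also have "\<dots> = u' * F (diagram_mor z X D) (delta (flip ?A y)) (flip ?B w)"
    by (rule F_mult)
  finally have "F (bullet_expr z X Y D T) (delta y) w = (u * u') * F (diagram_mor z X D) (delta (flip ?A y)) (flip ?B w)"
    by (simp add: bullet_expr_def u(2) mult.assoc)
  moreover have "(u * u') * (u * u') = 1"
  proof -
    have "(u * u') * (u * u') = (u * u) * (u' * u')" by (simp only: mult_ac)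
    then show ?thesis by (simp add: u(1) u'(1))
  qed
  ultimately show ?thesis by blast
qed

text \<open>Tokens of the diagram and tokens recorded in the end words cancel in pairs. An entry of
  a decorated lift thus becomes an entry of the bare lift at the symmetric difference of the two
  token sets, which is empty exactly if the sets agree.\<close>

lemma flip_words:
  assumes "T' \<subseteq> termini X Y"
  shows "flip {i. Bot i \<in> T'} (bword X Y e m T) = bword X Y e m (T - T' \<union> (T' - T))"
    "flip {j. Top j \<in> T'} (tword X Y e m T) = tword X Y e m (T - T' \<union> (T' - T))"
proof -
  have *: "(if s \<in> T' then bar (idx X Y e m T s) else idx X Y e m T s) = idx X Y e m (T - T' \<union> (T' - T)) s" for s
    using assms origins_termini_disjoint[of X Y] by (auto simp: idx_def)
  show "flip {i. Bot i \<in> T'} (bword X Y e m T) = bword X Y e m (T - T' \<union> (T' - T))"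
    "flip {j. Top j \<in> T'} (tword X Y e m T) = tword X Y e m (T - T' \<union> (T' - T))"
    by (rule nth_equalityI; simp add: flip_def bword_def tword_def flip: *)+
qed

lemma bullet_entry_nonzero:
  assumes J: "ideal J" and m: "matching X Y m" and m': "matching X Y m'" and D: "positive_reduced_lift X Y m' D"
    and e: "inj_on e (origins X Y)" "e ` origins X Y \<subseteq> {0..<N}"
    and T: "T \<subseteq> termini X Y" "T' \<subseteq> termini X Y"
    and nz: "\<not> J (F (bullet_expr z X Y D T') (delta (tword X Y e m T)) (bword X Y e m T))"
  shows "crossing_number X Y e m < crossing_number X Y e m' \<or> (T = T' \<and> (\<forall>s \<in> origins X Y. m s = m' s))"
proof -
  have dia: "diagram X Y D" using D by (simp add: positive_reduced_lift_def)
  obtain u where u: "F (bullet_expr z X Y D T') (delta (tword X Y e m T)) (bword X Y e m T) =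
      u * F (diagram_mor z X D) (delta (tword X Y e m (T - T' \<union> (T' - T)))) (bword X Y e m (T - T' \<union> (T' - T)))"
    using F_bullet[OF dia bword_W[OF m e(2)] tword_W[OF m e(2)], of z T' T T] unfolding flip_words[OF T(2)] by blast
  have "\<not> J (F (diagram_mor z X D) (delta (tword X Y e m (T - T' \<union> (T' - T)))) (bword X Y e m (T - T' \<union> (T' - T))))"
    using nz ideal_simps(3)[OF J] unfolding u by blast
  from lift_entry_nonzero[OF J m m' D e _ this] T show ?thesis by blast
qed

lemma bullet_entry_unit:
  assumes J: "ideal J" and m: "matching X Y m" and D: "positive_reduced_lift X Y m D"
    and e: "inj_on e (origins X Y)" "e ` origins X Y \<subseteq> {0..<N}" and T: "T \<subseteq> termini X Y"
  shows "\<exists>u. invertible_elt u \<and> J (F (bullet_expr z X Y D T) (delta (tword X Y e m T)) (bword X Y e m T) - u)"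
proof -
  have dia: "diagram X Y D" using D by (simp add: positive_reduced_lift_def)
  obtain u where u: "u * u = 1" "F (bullet_expr z X Y D T) (delta (tword X Y e m T)) (bword X Y e m T) =
      u * F (diagram_mor z X D) (delta (tword X Y e m {})) (bword X Y e m {})"
    using F_bullet[OF dia bword_W[OF m e(2)] tword_W[OF m e(2)], of z T T T] unfolding flip_words[OF T] by auto
  obtain u' where u': "invertible_elt u'" "J (F (diagram_mor z X D) (delta (tword X Y e m {})) (bword X Y e m {}) - u')"
    using lift_entry_unit[OF J m D e] by blast
  have "invertible_elt u" using u(1) unfolding invertible_elt_def by blast
  then have "invertible_elt (u * u')" using u'(1) by (rule invertible_elt_mult)
  moreover have "J (F (bullet_expr z X Y D T) (delta (tword X Y e m T)) (bword X Y e m T) - u * u')"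
    using ideal_simps(3)[OF J u'(2), of u] unfolding u(2) by (simp add: right_diff_distrib)
  ultimately show ?thesis by blast
qed

end

section \<open>Words in the generators\<close>

text \<open>Only generators occur as letters. Derived crossings, caps and cups are words themselves,
  so that stability of a family of words has to be checked for six letters.\<close>

type_synonym gword = "(obj \<times> gen \<times> obj) list"

fun gdiag :: "obj \<Rightarrow> obj \<Rightarrow> gword \<Rightarrow> bool" where
  "gdiag X Y [] \<longleftrightarrow> X = Y"
| "gdiag X Y ((l, g, r) # ws) \<longleftrightarrow> X = l @ gdom g @ r \<and> gdiag (l @ gcod g @ r) Y ws"

fun gmor :: "obj \<Rightarrow> gword \<Rightarrow> 'k mor" where
  "gmor X [] = Ident X"
| "gmor X ((l, g, r) # ws) = gmor (l @ gcod g @ r) ws \<cdot> (Ident l \<parallel> (Gen g \<parallel> Ident r))"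

text \<open>Whiskering: the strands \<open>a\<close> are added on the left and \<open>b\<close> on
  the right.\<close>

definition sh :: "obj \<Rightarrow> obj \<Rightarrow> gword \<Rightarrow> gword" where
  "sh a b = map (\<lambda>(l, g, r). (a @ l, g, r @ b))"

lemma sh_simps [simp]:
  "sh a b [] = []" "sh a b ((l, g, r) # ws) = (a @ l, g, r @ b) # sh a b ws" "sh a b (ws @ vs) = sh a b ws @ sh a b vs"
  "sh [] [] ws = ws" "sh a b (sh c d ws) = sh (a @ c) (d @ b) ws"
  by (auto simp: sh_def)

lemma gdiag_append: "gdiag X Z (ws @ vs) \<longleftrightarrow> (\<exists>Y. gdiag X Y ws \<and> gdiag Y Z vs)"
  by (induction X Z ws rule: gdiag.induct) auto

lemma gdiag_appendI: "gdiag X Y ws \<Longrightarrow> gdiag Y Z vs \<Longrightarrow> gdiag X Z (ws @ vs)"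
  by (auto simp: gdiag_append)

lemma gdiag_sh: "gdiag X Y ws \<Longrightarrow> gdiag (a @ X @ b) (a @ Y @ b) (sh a b ws)"
  by (induction X Y ws rule: gdiag.induct) auto

lemma gdiag_sh': "gdiag X Y ws \<Longrightarrow> X' = a @ X @ b \<Longrightarrow> Y' = a @ Y @ b \<Longrightarrow> gdiag X' Y' (sh a b ws)"
  using gdiag_sh by simp

section \<open>Whiskering, and words up to sign\<close>

context cring_param
begin

abbreviation E :: "obj \<Rightarrow> obj \<Rightarrow> 'k mor \<Rightarrow> 'k mor \<Rightarrow> bool" where "E \<equiv> eqv k z"

lemma E_arrow: "E X Y f g \<Longrightarrow> arrow k X Y f" "E X Y f g \<Longrightarrow> arrow k X Y g"
  using eqv_arrow by blast+

lemmas E_sym = eqv.sym and E_trans [trans] = eqv.trans and E_refl = eqv.refl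

abbreviation wh :: "obj \<Rightarrow> 'k mor \<Rightarrow> obj \<Rightarrow> 'k mor" where "wh l f r \<equiv> Ident l \<parallel> (f \<parallel> Ident r)"

lemma arrow_wh: "arrow k X Y f \<Longrightarrow> arrow k (l @ X @ r) (l @ Y @ r) (wh l f r)"
  by (intro arrow.Tens arrow.Ident)

lemma wh_cong: "E X Y f g \<Longrightarrow> E (l @ X @ r) (l @ Y @ r) (wh l f r) (wh l g r)"
  by (intro eqv.tens_cong E_refl arrow.Ident)

lemma wh_wh:
  assumes "arrow k X Y f"
  shows "E (l @ a @ X @ b @ r) (l @ a @ Y @ b @ r) (wh l (wh a f b) r) (wh (l @ a) f (b @ r))"
proof -
  have fb: "arrow k (X @ b) (Y @ b) (f \<parallel> Ident b)" by (intro arrow.Tens assms arrow.Ident)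
  have "E ((a @ X @ b) @ r) ((a @ Y @ b) @ r) (wh a f b \<parallel> Ident r) (Ident a \<parallel> ((f \<parallel> Ident b) \<parallel> Ident r))"
    using eqv.tens_assoc[OF arrow.Ident fb arrow.Ident, of z a r] by simp
  also have "E ((a @ X @ b) @ r) ((a @ Y @ b) @ r) (Ident a \<parallel> ((f \<parallel> Ident b) \<parallel> Ident r)) (Ident a \<parallel> (f \<parallel> (Ident b \<parallel> Ident r)))"
    using eqv.tens_cong[OF E_refl[OF arrow.Ident] eqv.tens_assoc[OF assms arrow.Ident arrow.Ident], of z a b r] by simp
  also have "E ((a @ X @ b) @ r) ((a @ Y @ b) @ r) (Ident a \<parallel> (f \<parallel> (Ident b \<parallel> Ident r))) (Ident a \<parallel> (f \<parallel> Ident (b @ r)))"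
    using eqv.tens_cong[OF E_refl[OF arrow.Ident] eqv.tens_cong[OF E_refl[OF assms] eqv.tens_ident], of z a b r] by simp
  finally have 1: "E ((a @ X @ b) @ r) ((a @ Y @ b) @ r) (wh a f b \<parallel> Ident r) (Ident a \<parallel> (f \<parallel> Ident (b @ r)))" .
  have fbr: "arrow k (X @ b @ r) (Y @ b @ r) (f \<parallel> Ident (b @ r))" by (intro arrow.Tens assms arrow.Ident)
  have "E (l @ (a @ X @ b) @ r) (l @ (a @ Y @ b) @ r) (wh l (wh a f b) r) (Ident l \<parallel> (Ident a \<parallel> (f \<parallel> Ident (b @ r))))"
    by (rule eqv.tens_cong[OF E_refl[OF arrow.Ident] 1])
  also have "E (l @ (a @ X @ b) @ r) (l @ (a @ Y @ b) @ r) (Ident l \<parallel> (Ident a \<parallel> (f \<parallel> Ident (b @ r)))) ((Ident l \<parallel> Ident a) \<parallel> (f \<parallel> Ident (b @ r)))"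
    using E_sym[OF eqv.tens_assoc[OF arrow.Ident arrow.Ident fbr]] by simp
  also have "E (l @ (a @ X @ b) @ r) (l @ (a @ Y @ b) @ r) ((Ident l \<parallel> Ident a) \<parallel> (f \<parallel> Ident (b @ r))) (wh (l @ a) f (b @ r))"
    using eqv.tens_cong[OF eqv.tens_ident E_refl[OF fbr], of z l a] by simp
  finally show ?thesis by simp
qed

text \<open>No sign arises, since one of the two morphisms that pass each other is an identity. The
  parities \<open>p\<close> and \<open>p'\<close> are what the interchange axiom asks for.\<close>

lemma wh_comp:
  assumes "arrow k Y Z f" "arrow k X Y g" "homogeneous p f" "homogeneous p' g"
  shows "E (l @ X @ r) (l @ Z @ r) (wh l f r \<cdot> wh l g r) (wh l (f \<cdot> g) r)"
proof -
  have 1: "E (X @ r) (Z @ r) ((f \<parallel> Ident r) \<cdot> (g \<parallel> Ident r)) ((f \<cdot> g) \<parallel> Ident r)"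
  proof -
    have "E (X @ r) (Z @ r) ((f \<parallel> Ident r) \<cdot> (g \<parallel> Ident r)) (Scale \<one> ((f \<cdot> g) \<parallel> (Ident r \<cdot> Ident r)))"
      using eqv.interchange[OF assms(4) homogeneous.Ident assms(2,1) arrow.Ident arrow.Ident, of z r] by simp
    also have "E (X @ r) (Z @ r) (Scale \<one> ((f \<cdot> g) \<parallel> (Ident r \<cdot> Ident r))) ((f \<cdot> g) \<parallel> (Ident r \<cdot> Ident r))"
      by (rule eqv.scale_one[OF arrow.Tens[OF arrow.Comp[OF assms(1,2)] arrow.Comp[OF arrow.Ident arrow.Ident]]])
    also have "E (X @ r) (Z @ r) ((f \<cdot> g) \<parallel> (Ident r \<cdot> Ident r)) ((f \<cdot> g) \<parallel> Ident r)"
      by (intro eqv.tens_cong eqv.comp_ident_left E_refl arrow.Comp[OF assms(1,2)] arrow.Ident)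
    finally show ?thesis .
  qed
  have h: "homogeneous (p \<noteq> False) (f \<parallel> Ident r)" by (intro homogeneous.Tens assms homogeneous.Ident)
  have ar: "arrow k (Y @ r) (Z @ r) (f \<parallel> Ident r)" "arrow k (X @ r) (Y @ r) (g \<parallel> Ident r)"
    by (intro arrow.Tens assms arrow.Ident)+
  have "E (l @ X @ r) (l @ Z @ r) (wh l f r \<cdot> wh l g r) (Scale \<one> ((Ident l \<cdot> Ident l) \<parallel> ((f \<parallel> Ident r) \<cdot> (g \<parallel> Ident r))))"
    using eqv.interchange[OF homogeneous.Ident h arrow.Ident arrow.Ident ar(2,1), of z l] by simp
  also have "E (l @ X @ r) (l @ Z @ r) (Scale \<one> ((Ident l \<cdot> Ident l) \<parallel> ((f \<parallel> Ident r) \<cdot> (g \<parallel> Ident r))))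
      ((Ident l \<cdot> Ident l) \<parallel> ((f \<parallel> Ident r) \<cdot> (g \<parallel> Ident r)))"
    by (intro eqv.scale_one arrow.Tens arrow.Comp[OF ar] arrow.Comp[OF arrow.Ident arrow.Ident])
  also have "E (l @ X @ r) (l @ Z @ r) ((Ident l \<cdot> Ident l) \<parallel> ((f \<parallel> Ident r) \<cdot> (g \<parallel> Ident r))) (wh l (f \<cdot> g) r)"
    by (intro eqv.tens_cong eqv.comp_ident_left 1 arrow.Ident)
  finally show ?thesis .
qed

lemma arrow_gmor: "gdiag X Y ws \<Longrightarrow> arrow k X Y (gmor X ws)"
proof (induction X Y ws rule: gdiag.induct)
  case (2 X Y l g r ws)
  then show ?case using arrow_wh[OF arrow.Gen[of k g], of l r] by (auto intro: arrow.Comp)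
qed (auto intro: arrow.Ident)

lemma homogeneous_gmor: "\<exists>p. homogeneous p (gmor X ws :: 'k mor)"
proof (induction ws arbitrary: X)
  case (Cons w ws)
  obtain l g r where w: "w = (l, g, r)" by (cases w)
  obtain p where "homogeneous p (gmor (l @ gcod g @ r) ws :: 'k mor)" using Cons by blast
  from homogeneous.Comp[OF this homogeneous.Tens[OF homogeneous.Ident homogeneous.Tens[OF homogeneous.Gen homogeneous.Ident]]]
  show ?case unfolding w gmor.simps by blast
qed (auto intro: homogeneous.Ident)

lemma gmor_append:
  assumes "gdiag X Y ws" "gdiag Y Z vs"
  shows "E X Z (gmor X (ws @ vs)) (gmor Y vs \<cdot> gmor X ws)"
  using assms
proof (induction X Y ws rule: gdiag.induct)
  case (1 X Y)
  then show ?case using E_sym[OF eqv.comp_ident_right[OF arrow_gmor]] by simp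
next
  case (2 X Y l g r ws)
  let ?w = "wh l (Gen g) r" and ?X = "l @ gcod g @ r"
  have ar: "arrow k X ?X ?w" using 2 arrow_wh[OF arrow.Gen[of k g], of l r] by simp
  have ws: "gdiag ?X Y ws" using 2 by simp
  have "E X Z (gmor ?X (ws @ vs) \<cdot> ?w) ((gmor Y vs \<cdot> gmor ?X ws) \<cdot> ?w)"
    using 2 by (intro eqv.comp_cong[OF _ E_refl[OF ar]]) simp
  also have "E X Z ((gmor Y vs \<cdot> gmor ?X ws) \<cdot> ?w) (gmor Y vs \<cdot> (gmor ?X ws \<cdot> ?w))"
    by (rule eqv.comp_assoc[OF arrow_gmor[OF 2(3)] arrow_gmor[OF ws] ar])
  finally show ?case by simp
qed

lemma gmor_sh:
  assumes "gdiag X Y ws"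
  shows "E (a @ X @ b) (a @ Y @ b) (gmor (a @ X @ b) (sh a b ws)) (wh a (gmor X ws) b)"
  using assms
proof (induction X Y ws rule: gdiag.induct)
  case (1 X Y)
  have "E (a @ X @ b) (a @ X @ b) (wh a (Ident X) b) (Ident (a @ X @ b))"
    by (rule E_trans[OF eqv.tens_cong[OF E_refl[OF arrow.Ident] eqv.tens_ident] eqv.tens_ident])
  from E_sym[OF this] show ?case using 1 by simp
next
  case (2 X Y l g r ws)
  let ?X = "l @ gcod g @ r"
  have X: "X = l @ gdom g @ r" and ws: "gdiag ?X Y ws" using 2 by auto
  have ar: "arrow k X ?X (wh l (Gen g) r)" using X arrow_wh[OF arrow.Gen[of k g], of l r] by simp
  obtain p where p: "homogeneous p (gmor ?X ws :: 'k mor)" using homogeneous_gmor by blast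
  have hg: "homogeneous (False \<noteq> (gpar g \<noteq> False)) (wh l (Gen g) r :: 'k mor)"
    by (intro homogeneous.Tens homogeneous.Ident homogeneous.Gen)
  have "E (a @ X @ b) (a @ Y @ b) (gmor (a @ ?X @ b) (sh a b ws) \<cdot> wh (a @ l) (Gen g) (r @ b)) (wh a (gmor ?X ws) b \<cdot> wh a (wh l (Gen g) r) b)"
    using 2(1)[OF ws] E_sym[OF wh_wh[OF arrow.Gen[of k g], of a l r b]] unfolding X
    by (intro eqv.comp_cong) simp_all
  also have "E (a @ X @ b) (a @ Y @ b) (wh a (gmor ?X ws) b \<cdot> wh a (wh l (Gen g) r) b) (wh a (gmor ?X ws \<cdot> wh l (Gen g) r) b)"
    by (rule wh_comp[OF arrow_gmor[OF ws] ar p hg])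
  finally show ?case using X by simp
qed

definition signs :: "'k set" where "signs = {\<one>, \<ominus> \<one>}"

lemma signs_closed [simp, intro]: "s \<in> signs \<Longrightarrow> s \<in> carrier k"
  by (auto simp: signs_def)

lemma signs_mult: "s \<in> signs \<Longrightarrow> t \<in> signs \<Longrightarrow> s \<otimes> t \<in> signs"
  by (auto simp: signs_def l_minus r_minus)

lemma signs_sq: "s \<in> signs \<Longrightarrow> s \<otimes> s = \<one>"
  by (auto simp: signs_def l_minus r_minus)

text \<open>
  Up to sign the super interchange law is a plain commutation of layers, so words can be rewritten
  without keeping track of parities.
\<close>

definition weq :: "obj \<Rightarrow> obj \<Rightarrow> gword \<Rightarrow> gword \<Rightarrow> bool" where
  "weq X Y ws vs \<longleftrightarrow> gdiag X Y ws \<and> gdiag X Y vs \<and> (\<exists>s\<in>signs. E X Y (gmor X ws) (Scale s (gmor X vs)))"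

lemma weq_gdiag: "weq X Y ws vs \<Longrightarrow> gdiag X Y ws" "weq X Y ws vs \<Longrightarrow> gdiag X Y vs"
  by (auto simp: weq_def)

lemma weqI: "gdiag X Y ws \<Longrightarrow> gdiag X Y vs \<Longrightarrow> E X Y (gmor X ws) (gmor X vs) \<Longrightarrow> weq X Y ws vs"
  unfolding weq_def signs_def using E_trans[OF _ E_sym[OF eqv.scale_one[OF arrow_gmor]]] by blast

lemma weq_refl: "gdiag X Y ws \<Longrightarrow> weq X Y ws ws"
  by (intro weqI E_refl arrow_gmor)

lemma scale_signs:
  assumes "s \<in> signs" "arrow k X Y f" "E X Y g (Scale s f)"
  shows "E X Y f (Scale s g)"
proof -
  have "E X Y (Scale s g) (Scale s (Scale s f))" using assms by (intro eqv.scale_cong) auto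
  also have "E X Y (Scale s (Scale s f)) (Scale (s \<otimes> s) f)" using assms by (intro E_sym[OF eqv.scale_mult]) auto
  also have "E X Y (Scale (s \<otimes> s) f) f" using assms by (simp add: signs_sq eqv.scale_one)
  finally show ?thesis by (rule E_sym)
qed

lemma weq_sym: "weq X Y ws vs \<Longrightarrow> weq X Y vs ws"
  unfolding weq_def using scale_signs[OF _ arrow_gmor] by blast

lemma weq_trans [trans]: "weq X Y ws vs \<Longrightarrow> weq X Y vs us \<Longrightarrow> weq X Y ws us"
proof -
  assume "weq X Y ws vs" "weq X Y vs us"
  then obtain s t where st: "s \<in> signs" "t \<in> signs" "gdiag X Y ws" "gdiag X Y us"
    "E X Y (gmor X ws) (Scale s (gmor X vs))" "E X Y (gmor X vs) (Scale t (gmor X us))"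
    unfolding weq_def by blast
  have "E X Y (gmor X ws) (Scale s (Scale t (gmor X us)))"
    using st by (intro E_trans[OF st(5)] eqv.scale_cong) auto
  also have "E X Y (Scale s (Scale t (gmor X us))) (Scale (s \<otimes> t) (gmor X us))"
    using st by (intro E_sym[OF eqv.scale_mult] arrow_gmor) auto
  finally show ?thesis unfolding weq_def using st signs_mult by blast
qed

lemma weq_app:
  assumes "weq X Y ws vs" "gdiag Y Z us"
  shows "weq X Z (ws @ us) (vs @ us)"
proof -
  obtain s where s: "s \<in> signs" "gdiag X Y ws" "gdiag X Y vs" "E X Y (gmor X ws) (Scale s (gmor X vs))"
    using assms(1) unfolding weq_def by blast
  have "E X Z (gmor X (ws @ us)) (gmor Y us \<cdot> gmor X ws)" by (rule gmor_append[OF s(2) assms(2)])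
  also have "E X Z (gmor Y us \<cdot> gmor X ws) (gmor Y us \<cdot> Scale s (gmor X vs))"
    by (rule eqv.comp_cong[OF E_refl[OF arrow_gmor[OF assms(2)]] s(4)])
  also have "E X Z (gmor Y us \<cdot> Scale s (gmor X vs)) (Scale s (gmor Y us \<cdot> gmor X vs))"
    by (rule eqv.comp_scale_right[OF signs_closed[OF s(1)] arrow_gmor[OF assms(2)] arrow_gmor[OF s(3)]])
  also have "E X Z (Scale s (gmor Y us \<cdot> gmor X vs)) (Scale s (gmor X (vs @ us)))"
    by (intro eqv.scale_cong signs_closed s(1) E_sym[OF gmor_append[OF s(3) assms(2)]])
  finally show ?thesis unfolding weq_def using s assms(2) gdiag_appendI by blast
qed

lemma weq_pre:
  assumes "weq Y Z ws vs" "gdiag X Y us"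
  shows "weq X Z (us @ ws) (us @ vs)"
proof -
  obtain s where s: "s \<in> signs" "gdiag Y Z ws" "gdiag Y Z vs" "E Y Z (gmor Y ws) (Scale s (gmor Y vs))"
    using assms(1) unfolding weq_def by blast
  have "E X Z (gmor X (us @ ws)) (gmor Y ws \<cdot> gmor X us)" by (rule gmor_append[OF assms(2) s(2)])
  also have "E X Z (gmor Y ws \<cdot> gmor X us) (Scale s (gmor Y vs) \<cdot> gmor X us)"
    by (rule eqv.comp_cong[OF s(4) E_refl[OF arrow_gmor[OF assms(2)]]])
  also have "E X Z (Scale s (gmor Y vs) \<cdot> gmor X us) (Scale s (gmor Y vs \<cdot> gmor X us))"
    by (rule eqv.comp_scale_left[OF signs_closed[OF s(1)] arrow_gmor[OF s(3)] arrow_gmor[OF assms(2)]])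
  also have "E X Z (Scale s (gmor Y vs \<cdot> gmor X us)) (Scale s (gmor X (us @ vs)))"
    by (intro eqv.scale_cong signs_closed s(1) E_sym[OF gmor_append[OF assms(2) s(3)]])
  finally show ?thesis unfolding weq_def using s assms(2) gdiag_appendI by blast
qed

lemma wh_scale:
  assumes "s \<in> carrier k" "arrow k X Y f"
  shows "E (a @ X @ b) (a @ Y @ b) (wh a (Scale s f) b) (Scale s (wh a f b))"
proof -
  have "E (a @ X @ b) (a @ Y @ b) (wh a (Scale s f) b) (Ident a \<parallel> Scale s (f \<parallel> Ident b))"
    by (intro eqv.tens_cong E_refl arrow.Ident eqv.tens_scale_left assms)
  also have "E (a @ X @ b) (a @ Y @ b) (Ident a \<parallel> Scale s (f \<parallel> Ident b)) (Scale s (wh a f b))"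
    by (intro eqv.tens_scale_right assms arrow.Ident arrow.Tens)
  finally show ?thesis .
qed

lemma weq_sh: "weq X Y ws vs \<Longrightarrow> weq (a @ X @ b) (a @ Y @ b) (sh a b ws) (sh a b vs)"
proof -
  assume "weq X Y ws vs"
  then obtain s where s: "s \<in> signs" "gdiag X Y ws" "gdiag X Y vs" "E X Y (gmor X ws) (Scale s (gmor X vs))"
    unfolding weq_def by blast
  let ?X = "a @ X @ b" and ?Y = "a @ Y @ b"
  have "E ?X ?Y (gmor ?X (sh a b ws)) (wh a (gmor X ws) b)" by (rule gmor_sh[OF s(2)])
  also have "E ?X ?Y (wh a (gmor X ws) b) (wh a (Scale s (gmor X vs)) b)" by (rule wh_cong[OF s(4)])
  also have "E ?X ?Y (wh a (Scale s (gmor X vs)) b) (Scale s (wh a (gmor X vs) b))"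
    by (rule wh_scale[OF signs_closed[OF s(1)] arrow_gmor[OF s(3)]])
  also have "E ?X ?Y (Scale s (wh a (gmor X vs) b)) (Scale s (gmor ?X (sh a b vs)))"
    by (intro eqv.scale_cong signs_closed s(1) E_sym[OF gmor_sh[OF s(3)]])
  finally show ?thesis unfolding weq_def using s gdiag_sh by blast
qed

lemma weq_ctx:
  assumes "weq X' Y' ws vs" "gdiag X (l @ X' @ r) as" "gdiag (l @ Y' @ r) Y bs"
  shows "weq X Y (as @ sh l r ws @ bs) (as @ sh l r vs @ bs)"
  by (intro weq_pre[OF _ assms(2)] weq_app[OF _ assms(3)] weq_sh assms(1))

text \<open>The strands \<open>m\<close> between the two letters are attached to \<open>g\<close>.
  Then both orders equal the tensor product of the two letters, and the sign of the interchange law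
  arises in only one of them.\<close>

lemma weq_comm1:
  "weq (l @ gdom g @ m @ gdom h @ r) (l @ gcod g @ m @ gcod h @ r)
     [(l, g, m @ gdom h @ r), (l @ gcod g @ m, h, r)] [(l @ gdom g @ m, h, r), (l, g, m @ gcod h @ r)]"
proof -
  let ?gm = "Gen g \<parallel> Ident m :: 'k mor"
  let ?X = "l @ gdom g @ m @ gdom h @ r" and ?Y = "l @ gcod g @ m @ gcod h @ r"
  let ?X' = "(gdom g @ m) @ gdom h" and ?Y' = "(gcod g @ m) @ gcod h"
  have gm: "arrow k (gdom g @ m) (gcod g @ m) ?gm" by (intro arrow.intros)
  have hgm: "homogeneous (gpar g) ?gm" using homogeneous.Tens[OF homogeneous.Gen homogeneous.Ident] by simp
  have ws: "E (l @ gdom g @ m @ gdom h' @ r) (l @ gcod g @ m @ gdom h' @ r) (wh l (Gen g) (m @ gdom h' @ r)) (wh l (?gm \<parallel> Ident (gdom h')) r)"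
    and ws': "E (l @ gdom g @ m @ gcod h' @ r) (l @ gcod g @ m @ gcod h' @ r) (wh l (Gen g) (m @ gcod h' @ r)) (wh l (?gm \<parallel> Ident (gcod h')) r)" for h'
  proof -
    have *: "E (l @ gdom g @ m @ n @ r) (l @ gcod g @ m @ n @ r) (wh l (Gen g) (m @ n @ r)) (wh l (?gm \<parallel> Ident n) r)" for n
    proof -
      have "E (gdom g @ m @ n) (gcod g @ m @ n) (?gm \<parallel> Ident n) (Gen g \<parallel> (Ident m \<parallel> Ident n))"
        using eqv.tens_assoc[OF arrow.Gen[of k g] arrow.Ident[of k m] arrow.Ident[of k n]] .
      also have "E (gdom g @ m @ n) (gcod g @ m @ n) (Gen g \<parallel> (Ident m \<parallel> Ident n)) (Gen g \<parallel> Ident (m @ n))"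
        by (intro eqv.tens_cong eqv.tens_ident E_refl arrow.Gen)
      also have "E (gdom g @ m @ n) (gcod g @ m @ n) (Gen g \<parallel> Ident (m @ n)) (wh [] (Gen g) (m @ n))"
        using E_sym[OF eqv.tens_unit_left[OF arrow.Tens[OF arrow.Gen[of k g] arrow.Ident[of k "m @ n"]]]] by simp
      finally have "E (l @ (gdom g @ m @ n) @ r) (l @ (gcod g @ m @ n) @ r) (wh l (?gm \<parallel> Ident n) r) (wh l (wh [] (Gen g) (m @ n)) r)"
        by (rule wh_cong)
      also have "E (l @ (gdom g @ m @ n) @ r) (l @ (gcod g @ m @ n) @ r) (wh l (wh [] (Gen g) (m @ n)) r) (wh l (Gen g) (m @ n @ r))"
        using wh_wh[OF arrow.Gen[of k g], of l "[]" "m @ n" r] by simp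
      finally show ?thesis using E_sym by simp
    qed
    show "E (l @ gdom g @ m @ gdom h' @ r) (l @ gcod g @ m @ gdom h' @ r) (wh l (Gen g) (m @ gdom h' @ r)) (wh l (?gm \<parallel> Ident (gdom h')) r)"
      "E (l @ gdom g @ m @ gcod h' @ r) (l @ gcod g @ m @ gcod h' @ r) (wh l (Gen g) (m @ gcod h' @ r)) (wh l (?gm \<parallel> Ident (gcod h')) r)"
      by (rule *)+
  qed
  have hs: "E (l @ n @ m @ gdom h @ r) (l @ n @ m @ gcod h @ r) (wh (l @ n @ m) (Gen h) r) (wh l (Ident (n @ m) \<parallel> Gen h) r)" for n
  proof -
    have "E ((n @ m) @ gdom h) ((n @ m) @ gcod h) (Ident (n @ m) \<parallel> Gen h) (wh (n @ m) (Gen h) [])"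
      using eqv.tens_cong[OF E_refl[OF arrow.Ident] E_sym[OF eqv.tens_unit_right[OF arrow.Gen[of k h]]], of z "n @ m"] by simp
    then have "E (l @ ((n @ m) @ gdom h) @ r) (l @ ((n @ m) @ gcod h) @ r) (wh l (Ident (n @ m) \<parallel> Gen h) r) (wh l (wh (n @ m) (Gen h) []) r)"
      by (rule wh_cong)
    also have "E (l @ ((n @ m) @ gdom h) @ r) (l @ ((n @ m) @ gcod h) @ r) (wh l (wh (n @ m) (Gen h) []) r) (wh (l @ n @ m) (Gen h) r)"
      using wh_wh[OF arrow.Gen[of k h], of l "n @ m" "[]" r] by simp
    finally show ?thesis using E_sym by simp
  qed
  let ?s = "if gpar g \<and> gpar h then \<ominus> \<one> else \<one>"
  have s: "?s \<in> signs" by (simp add: signs_def)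
  have hI: "homogeneous (False \<noteq> gpar h) (Ident n \<parallel> Gen h)" for n by (intro homogeneous.intros)
  have hI': "homogeneous (gpar g \<noteq> False) (?gm \<parallel> Ident n)" for n by (intro homogeneous.Tens[OF hgm] homogeneous.Ident)
  have arI: "arrow k (n @ gdom h) (n @ gcod h) (Ident n \<parallel> Gen h)" for n by (intro arrow.intros)
  have arg: "arrow k ((gdom g @ m) @ n) ((gcod g @ m) @ n) (?gm \<parallel> Ident n)" for n by (intro arrow.Tens gm arrow.Ident)
  have core1: "E ?X' ?Y' ((Ident (gcod g @ m) \<parallel> Gen h) \<cdot> (?gm \<parallel> Ident (gdom h))) (Scale ?s (?gm \<parallel> Gen h))"
  proof -
    have "E ?X' ?Y' ((Ident (gcod g @ m) \<parallel> Gen h) \<cdot> (?gm \<parallel> Ident (gdom h)))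
        (Scale ?s ((Ident (gcod g @ m) \<cdot> ?gm) \<parallel> (Gen h \<cdot> Ident (gdom h))))"
      by (rule eqv.interchange[OF hgm homogeneous.Gen gm arrow.Ident arrow.Ident arrow.Gen])
    also have "E ?X' ?Y' (Scale ?s ((Ident (gcod g @ m) \<cdot> ?gm) \<parallel> (Gen h \<cdot> Ident (gdom h)))) (Scale ?s (?gm \<parallel> Gen h))"
      by (intro eqv.scale_cong signs_closed[OF s] eqv.tens_cong eqv.comp_ident_left eqv.comp_ident_right gm arrow.Gen)
    finally show ?thesis .
  qed
  have core2: "E ?X' ?Y' ((?gm \<parallel> Ident (gcod h)) \<cdot> (Ident (gdom g @ m) \<parallel> Gen h)) (?gm \<parallel> Gen h)"
  proof -
    have "E ?X' ?Y' ((?gm \<parallel> Ident (gcod h)) \<cdot> (Ident (gdom g @ m) \<parallel> Gen h))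
        (Scale \<one> ((?gm \<cdot> Ident (gdom g @ m)) \<parallel> (Ident (gcod h) \<cdot> Gen h)))"
      using eqv.interchange[OF homogeneous.Ident homogeneous.Ident arrow.Ident gm arrow.Gen arrow.Ident, of z h] by simp
    also have "E ?X' ?Y' (Scale \<one> ((?gm \<cdot> Ident (gdom g @ m)) \<parallel> (Ident (gcod h) \<cdot> Gen h))) (Scale \<one> (?gm \<parallel> Gen h))"
      by (intro eqv.scale_cong one_closed eqv.tens_cong eqv.comp_ident_left eqv.comp_ident_right gm arrow.Gen)
    also have "E ?X' ?Y' (Scale \<one> (?gm \<parallel> Gen h)) (?gm \<parallel> Gen h)"
      by (intro eqv.scale_one arrow.Tens gm arrow.Gen)
    finally show ?thesis .
  qed
  have P: "arrow k ?X' ?Y' (?gm \<parallel> Gen h)" by (intro arrow.Tens gm arrow.Gen)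
  have c1: "E ?X ?Y (wh (l @ gcod g @ m) (Gen h) r \<cdot> wh l (Gen g) (m @ gdom h @ r)) (Scale ?s (wh l (?gm \<parallel> Gen h) r))"
  proof -
    have "E ?X ?Y (wh (l @ gcod g @ m) (Gen h) r \<cdot> wh l (Gen g) (m @ gdom h @ r))
        (wh l (Ident (gcod g @ m) \<parallel> Gen h) r \<cdot> wh l (?gm \<parallel> Ident (gdom h)) r)"
      by (rule eqv.comp_cong[OF hs ws])
    also have "E ?X ?Y (wh l (Ident (gcod g @ m) \<parallel> Gen h) r \<cdot> wh l (?gm \<parallel> Ident (gdom h)) r)
        (wh l ((Ident (gcod g @ m) \<parallel> Gen h) \<cdot> (?gm \<parallel> Ident (gdom h))) r)"
      using wh_comp[OF arI arg hI hI', of l r] by simp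
    also have "E ?X ?Y (wh l ((Ident (gcod g @ m) \<parallel> Gen h) \<cdot> (?gm \<parallel> Ident (gdom h))) r) (wh l (Scale ?s (?gm \<parallel> Gen h)) r)"
      using wh_cong[OF core1, of l r] by simp
    also have "E ?X ?Y (wh l (Scale ?s (?gm \<parallel> Gen h)) r) (Scale ?s (wh l (?gm \<parallel> Gen h) r))"
      using wh_scale[OF signs_closed[OF s] P, of l r] by simp
    finally show ?thesis .
  qed
  have c2: "E ?X ?Y (wh l (Gen g) (m @ gcod h @ r) \<cdot> wh (l @ gdom g @ m) (Gen h) r) (wh l (?gm \<parallel> Gen h) r)"
  proof -
    have "E ?X ?Y (wh l (Gen g) (m @ gcod h @ r) \<cdot> wh (l @ gdom g @ m) (Gen h) r)
        (wh l (?gm \<parallel> Ident (gcod h)) r \<cdot> wh l (Ident (gdom g @ m) \<parallel> Gen h) r)"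
      by (rule eqv.comp_cong[OF ws' hs])
    also have "E ?X ?Y (wh l (?gm \<parallel> Ident (gcod h)) r \<cdot> wh l (Ident (gdom g @ m) \<parallel> Gen h) r)
        (wh l ((?gm \<parallel> Ident (gcod h)) \<cdot> (Ident (gdom g @ m) \<parallel> Gen h)) r)"
      using wh_comp[OF arg arI hI' hI, of l r] by simp
    also have "E ?X ?Y (wh l ((?gm \<parallel> Ident (gcod h)) \<cdot> (Ident (gdom g @ m) \<parallel> Gen h)) r) (wh l (?gm \<parallel> Gen h) r)"
      using wh_cong[OF core2, of l r] by simp
    finally show ?thesis .
  qed
  have g2: "E X' Z' (gmor X' [(a, g1, b), (c, g2, d)]) (wh c (Gen g2) d \<cdot> wh a (Gen g1) b)"
    if "X' = a @ gdom g1 @ b" "a @ gcod g1 @ b = c @ gdom g2 @ d" "Z' = c @ gcod g2 @ d" for X' Z' a g1 b c g2 d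
  proof -
    have "arrow k X' (c @ gdom g2 @ d) (wh a (Gen g1) b)" "arrow k (c @ gdom g2 @ d) Z' (wh c (Gen g2) d)"
      using arrow_wh[OF arrow.Gen[of k g1], of a b] arrow_wh[OF arrow.Gen[of k g2], of c d] that by auto
    then show ?thesis using that(3) by (simp, intro eqv.comp_cong eqv.comp_ident_left E_refl)
  qed
  have "E ?X ?Y (gmor ?X [(l, g, m @ gdom h @ r), (l @ gcod g @ m, h, r)]) (Scale ?s (wh l (?gm \<parallel> Gen h) r))"
    by (rule E_trans[OF g2 c1]) simp_all
  also have "E ?X ?Y (Scale ?s (wh l (?gm \<parallel> Gen h) r)) (Scale ?s (gmor ?X [(l @ gdom g @ m, h, r), (l, g, m @ gcod h @ r)]))"
    by (intro eqv.scale_cong signs_closed[OF s] E_sym[OF E_trans[OF g2 c2]]) simp_all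
  finally show ?thesis unfolding weq_def using s by auto
qed

text \<open>Transports the defining relations, which are stated for expressions, to words.\<close>

definition rep :: "obj \<Rightarrow> obj \<Rightarrow> 'k mor \<Rightarrow> gword \<Rightarrow> bool" where
  "rep X Y f ws \<longleftrightarrow> gdiag X Y ws \<and> E X Y f (gmor X ws)"

lemma tens_decomp:
  assumes "arrow k X Y f" "arrow k X' Y' g"
  shows "E (X @ X') (Y @ Y') (f \<parallel> g) ((f \<parallel> Ident Y') \<cdot> (Ident X \<parallel> g))"
proof -
  have "E (X @ X') (Y @ Y') ((f \<parallel> Ident Y') \<cdot> (Ident X \<parallel> g)) (Scale \<one> ((f \<cdot> Ident X) \<parallel> (Ident Y' \<cdot> g)))"
    using eqv.interchange[OF homogeneous.Ident homogeneous.Ident arrow.Ident assms arrow.Ident, of z] by simp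
  also have "E (X @ X') (Y @ Y') (Scale \<one> ((f \<cdot> Ident X) \<parallel> (Ident Y' \<cdot> g))) ((f \<cdot> Ident X) \<parallel> (Ident Y' \<cdot> g))"
    by (rule eqv.scale_one[OF arrow.Tens[OF arrow.Comp[OF assms(1) arrow.Ident] arrow.Comp[OF arrow.Ident assms(2)]]])
  also have "E (X @ X') (Y @ Y') ((f \<cdot> Ident X) \<parallel> (Ident Y' \<cdot> g)) (f \<parallel> g)"
    by (rule eqv.tens_cong[OF eqv.comp_ident_right[OF assms(1)] eqv.comp_ident_left[OF assms(2)]])
  finally show ?thesis by (rule E_sym)
qed

lemma left_wh: "arrow k X Y f \<Longrightarrow> E (X @ r) (Y @ r) (f \<parallel> Ident r) (wh [] f r)"
  by (rule E_sym, rule eqv.tens_unit_left, rule arrow.Tens[OF _ arrow.Ident])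

lemma right_wh: "arrow k X Y f \<Longrightarrow> E (l @ X) (l @ Y) (Ident l \<parallel> f) (wh l f [])"
  by (rule eqv.tens_cong[OF E_refl[OF arrow.Ident] E_sym]) (use eqv.tens_unit_right in fastforce)

lemma rep_word: "gdiag X Y ws \<Longrightarrow> rep X Y (gmor X ws) ws"
  unfolding rep_def by (simp add: E_refl[OF arrow_gmor])

lemma rep_Ident: "rep X X (Ident X) []"
  using rep_word[of X X "[]"] by simp

lemma rep_Gen: "rep (gdom g) (gcod g) (Gen g) [([], g, [])]"
proof -
  have "E (gdom g) (gcod g) (Gen g) (wh [] (Gen g) [])"
    using E_trans[OF E_sym[OF eqv.tens_unit_right[OF arrow.Gen]] _] left_wh[OF arrow.Gen, of g "[]"]
    by (metis append_Nil2)
  then have "E (gdom g) (gcod g) (Gen g) (Ident (gcod g) \<cdot> wh [] (Gen g) [])"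
    using E_sym[OF eqv.comp_ident_left] E_arrow(2) E_trans by meson
  then show ?thesis unfolding rep_def by simp
qed

lemma rep_Comp: "rep Y Z f ws \<Longrightarrow> rep X Y g vs \<Longrightarrow> rep X Z (f \<cdot> g) (vs @ ws)"
  unfolding rep_def using gdiag_appendI[of X Y vs Z ws] E_trans[OF eqv.comp_cong E_sym[OF gmor_append]] by blast

lemma rep_Tens:
  assumes "rep X Y f ws" "rep X' Y' g vs"
  shows "rep (X @ X') (Y @ Y') (f \<parallel> g) (sh X [] vs @ sh [] Y' ws)"
proof -
  have a: "gdiag X Y ws" "gdiag X' Y' vs" "E X Y f (gmor X ws)" "E X' Y' g (gmor X' vs)"
    using assms by (auto simp: rep_def)
  have ar: "arrow k X Y f" "arrow k X' Y' g" using a E_arrow by auto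
  have w: "gdiag (X @ Y') (Y @ Y') (sh [] Y' ws)" "gdiag (X @ X') (X @ Y') (sh X [] vs)"
    using gdiag_sh[OF a(1), of "[]" Y'] gdiag_sh[OF a(2), of X "[]"] by simp_all
  have 1: "E (X @ Y') (Y @ Y') (f \<parallel> Ident Y') (gmor (X @ Y') (sh [] Y' ws))"
    using E_trans[OF E_trans[OF left_wh[OF ar(1), of Y'] wh_cong[OF a(3), of "[]" Y', simplified append_Nil]]
        E_sym[OF gmor_sh[OF a(1), of "[]" Y', simplified append_Nil]]] .
  have 2: "E (X @ X') (X @ Y') (Ident X \<parallel> g) (gmor (X @ X') (sh X [] vs))"
    using E_trans[OF E_trans[OF right_wh[OF ar(2), of X] wh_cong[OF a(4), of X "[]", simplified append_Nil2]]
        E_sym[OF gmor_sh[OF a(2), of X "[]", simplified append_Nil2]]] .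
  show ?thesis unfolding rep_def
    using gdiag_appendI[OF w(2,1)] E_trans[OF tens_decomp[OF ar] E_trans[OF eqv.comp_cong[OF 1 2] E_sym[OF gmor_append[OF w(2,1)]]]]
    by blast
qed

lemma rep_Tens_left: "rep X Y f ws \<Longrightarrow> rep (X @ r) (Y @ r) (f \<parallel> Ident r) (sh [] r ws)"
  using rep_Tens[OF _ rep_Ident, of X Y f ws r] by simp

lemma rep_Tens_right: "rep X Y f ws \<Longrightarrow> rep (l @ X) (l @ Y) (Ident l \<parallel> f) (sh l [] ws)"
  using rep_Tens[OF rep_Ident, of X Y f ws l] by simp

lemma rep_weq:
  assumes "E X Y f g" "rep X Y f ws" "rep X Y g vs"
  shows "weq X Y ws vs"
  using assms unfolding rep_def by (blast intro: weqI E_trans E_sym)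

lemma rep_weq_neg:
  assumes "E X Y f (Scale (\<ominus> \<one>) g)" "rep X Y f ws" "rep X Y g vs"
  shows "weq X Y ws vs"
proof -
  have "E X Y (gmor X ws) (Scale (\<ominus> \<one>) (gmor X vs))"
    using assms unfolding rep_def by (blast intro: E_trans[OF E_sym E_trans[OF _ eqv.scale_cong]])
  then show ?thesis using assms(2,3) unfolding weq_def rep_def signs_def by blast
qed

lemma zigzag_up_word: "weq [\<up>] [\<up>] [([], CupL, [\<up>]), ([\<up>], CapL, [])] []"
  using rep_weq[OF eqv.rel[OF relation.zigzag_up] rep_Comp[OF rep_Tens_right[OF rep_Gen[of CapL], of "[\<up>]", simplified]
    rep_Tens_left[OF rep_Gen[of CupL], of "[\<up>]", simplified]] rep_Ident] by simp

lemma zigzag_down_word: "weq [\<down>] [\<down>] [([\<down>], CupL, []), ([], CapL, [\<down>])] []"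
  using rep_weq[OF eqv.rel[OF relation.zigzag_down] rep_Comp[OF rep_Tens_left[OF rep_Gen[of CapL], of "[\<down>]", simplified]
    rep_Tens_right[OF rep_Gen[of CupL], of "[\<down>]", simplified]] rep_Ident] by simp

lemma weq_comm_layer:
  assumes "gdiag X' Y' vs"
  shows "weq (l @ gdom g @ r @ X') (l @ gcod g @ r @ Y')
    ((l, g, r @ X') # sh (l @ gcod g @ r) [] vs) (sh (l @ gdom g @ r) [] vs @ [(l, g, r @ Y')])"
  using assms
proof (induction X' Y' vs rule: gdiag.induct)
  case (1 X Y)
  then show ?case by (auto intro!: weq_refl)
next
  case (2 X Y a h b vs)
  let ?X = "a @ gcod h @ b"
  have X: "X = a @ gdom h @ b" and vs: "gdiag ?X Y vs" using 2 by auto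
  let ?h = "(l @ gdom g @ r @ a, h, b)" and ?h' = "(l @ gcod g @ r @ a, h, b)"
  have "weq (l @ gdom g @ r @ X) (l @ gcod g @ r @ Y)
      ((l, g, r @ X) # ?h' # sh (l @ gcod g @ r) [] vs) (?h # (l, g, r @ ?X) # sh (l @ gcod g @ r) [] vs)"
    using weq_app[OF weq_comm1[of l g "r @ a" h b], of "l @ gcod g @ r @ Y" "sh (l @ gcod g @ r) [] vs"]
      gdiag_sh[OF vs, of "l @ gcod g @ r" "[]"] X by simp
  also have "weq (l @ gdom g @ r @ X) (l @ gcod g @ r @ Y)
      (?h # (l, g, r @ ?X) # sh (l @ gcod g @ r) [] vs) (?h # sh (l @ gdom g @ r) [] vs @ [(l, g, r @ Y)])"
    using weq_pre[OF 2(1)[OF vs], of "l @ gdom g @ r @ X" "[?h]"] X by simp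
  finally show ?case by simp
qed

lemma weq_comm:
  assumes "gdiag X Y ws" "gdiag X' Y' vs"
  shows "weq (X @ X') (Y @ Y') (sh [] X' ws @ sh Y [] vs) (sh X [] vs @ sh [] Y' ws)"
  using assms
proof (induction X Y ws rule: gdiag.induct)
  case (1 X Y)
  then show ?case using gdiag_sh[of X' Y' vs X "[]"] by (auto intro!: weq_refl)
next
  case (2 X Y l g r ws)
  let ?X = "l @ gcod g @ r"
  have X: "X = l @ gdom g @ r" and ws: "gdiag ?X Y ws" using 2 by auto
  have "weq (X @ X') (Y @ Y') ((l, g, r @ X') # sh [] X' ws @ sh Y [] vs)
      ((l, g, r @ X') # sh ?X [] vs @ sh [] Y' ws)"
    using weq_pre[OF 2(1)[OF ws 2(3)], of "X @ X'" "[(l, g, r @ X')]"] X by simp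
  also have "weq (X @ X') (Y @ Y') ((l, g, r @ X') # sh ?X [] vs @ sh [] Y' ws)
      (sh X [] vs @ (l, g, r @ Y') # sh [] Y' ws)"
    using weq_app[OF weq_comm_layer[OF 2(3), of l g r], of "Y @ Y'" "sh [] Y' ws"] gdiag_sh[OF ws, of "[]" Y'] X by simp
  finally show ?case by simp
qed

lemma weq_comm':
  assumes "gdiag X Y ws" "gdiag X' Y' vs"
  shows "weq (X @ X') (Y @ Y') (sh X [] vs @ sh [] Y' ws) (sh [] X' ws @ sh Y [] vs)"
  by (rule weq_sym[OF weq_comm[OF assms]])

section \<open>Rotation of crossings\<close>

definition PhiW :: "obj \<Rightarrow> obj \<Rightarrow> gword \<Rightarrow> gword" where
  "PhiW A B ws = (\<down> # A, CupL, []) # sh [\<down>] [\<down>] ws @ [([], CapL, B @ [\<down>])]"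

lemma gdiag_PhiW: "gdiag (A @ [\<up>]) (\<up> # B) ws \<Longrightarrow> gdiag (\<down> # A) (B @ [\<down>]) (PhiW A B ws)"
  unfolding PhiW_def using gdiag_sh[of "A @ [\<up>]" "\<up> # B" ws "[\<down>]" "[\<down>]"] by (auto intro!: gdiag_appendI)

lemma PhiW_cong:
  assumes "weq (A @ [\<up>]) (\<up> # B) ws vs"
  shows "weq (\<down> # A) (B @ [\<down>]) (PhiW A B ws) (PhiW A B vs)"
  using weq_ctx[OF assms, of "\<down> # A" "[\<down>]" "[\<down>]" "[(\<down> # A, CupL, [])]" "B @ [\<down>]" "[([], CapL, B @ [\<down>])]"]
  unfolding PhiW_def by simp

text \<open>The new cup cancels against the cap inside \<open>PhiW\<close> by a zigzag, after the
  other layers have been moved out of the way.\<close>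

lemma PhiW_after_cup:
  assumes "gdiag (A @ [\<up>]) (\<up> # B) ws"
  shows "weq A (\<up> # B @ [\<down>]) (([], CupL, A) # sh [\<up>] [] (PhiW A B ws)) ((A, CupL, []) # sh [] [\<down>] ws)"
proof -
  let ?t = "sh [\<up>, \<down>] [\<down>] ws @ [([\<up>], CapL, B @ [\<down>])]"
  have ws: "gdiag (\<up> # \<down> # A @ [\<up>, \<down>]) (\<up> # \<down> # \<up> # B @ [\<down>]) (sh [\<up>, \<down>] [\<down>] ws)"
    using gdiag_sh[OF assms, of "[\<up>, \<down>]" "[\<down>]"] by simp
  have ws': "gdiag (A @ [\<up>, \<down>]) (\<up> # B @ [\<down>]) (sh [] [\<down>] ws)"
    using gdiag_sh[OF assms, of "[]" "[\<down>]"] by simp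
  have "weq A (\<up> # B @ [\<down>]) (([], CupL, A) # (\<up> # \<down> # A, CupL, []) # ?t) ((A, CupL, []) # ([], CupL, A @ [\<up>, \<down>]) # ?t)"
    using weq_app[OF weq_comm1[of "[]" CupL A CupL "[]"], of "\<up> # B @ [\<down>]" ?t] ws by (simp add: gdiag_append)
  also have "weq A (\<up> # B @ [\<down>]) ((A, CupL, []) # ([], CupL, A @ [\<up>, \<down>]) # ?t)
      ((A, CupL, []) # sh [] [\<down>] ws @ [([], CupL, \<up> # B @ [\<down>]), ([\<up>], CapL, B @ [\<down>])])"
    using weq_pre[OF weq_app[OF weq_comm_layer[OF ws', of "[]" CupL "[]"], of "\<up> # B @ [\<down>]" "[([\<up>], CapL, B @ [\<down>])]"], of A "[(A, CupL, [])]"]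
    by simp
  also have "weq A (\<up> # B @ [\<down>]) ((A, CupL, []) # sh [] [\<down>] ws @ [([], CupL, \<up> # B @ [\<down>]), ([\<up>], CapL, B @ [\<down>])])
      ((A, CupL, []) # sh [] [\<down>] ws)"
    using weq_pre[OF weq_sh[OF zigzag_up_word, of "[]" "B @ [\<down>]"], of A "(A, CupL, []) # sh [] [\<down>] ws"] ws' by simp
  finally show ?thesis unfolding PhiW_def by simp
qed

text \<open>The counterpart of \<open>PhiW_after_cup\<close>: here the cup inside
  \<open>PhiW\<close> cancels against the new cap.\<close>

lemma PhiW_before_cap:
  assumes "gdiag (A @ [\<up>]) (\<up> # B) ws"
  shows "weq (\<down> # A @ [\<up>]) B (sh [] [\<up>] (PhiW A B ws) @ [(B, CapL, [])]) (sh [\<down>] [] ws @ [([], CapL, B)])"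
proof -
  let ?h = "(\<down> # A, CupL, [\<up>]) # sh [\<down>] [\<down>, \<up>] ws"
  have ws: "gdiag (\<down> # A @ [\<up>, \<down>, \<up>]) (\<down> # \<up> # B @ [\<down>, \<up>]) (sh [\<down>] [\<down>, \<up>] ws)"
    using gdiag_sh[OF assms, of "[\<down>]" "[\<down>, \<up>]"] by simp
  have ws': "gdiag (\<down> # A @ [\<up>]) (\<down> # \<up> # B) (sh [\<down>] [] ws)"
    using gdiag_sh[OF assms, of "[\<down>]" "[]"] by simp
  have "weq (\<down> # A @ [\<up>]) B (?h @ [([], CapL, B @ [\<down>, \<up>]), (B, CapL, [])]) (?h @ [(\<down> # \<up> # B, CapL, []), ([], CapL, B)])"
    using weq_pre[OF weq_comm1[of "[]" CapL B CapL "[]"], of "\<down> # A @ [\<up>]" ?h] ws by simp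
  also have "weq (\<down> # A @ [\<up>]) B (?h @ [(\<down> # \<up> # B, CapL, []), ([], CapL, B)])
      ((\<down> # A, CupL, [\<up>]) # (\<down> # A @ [\<up>], CapL, []) # sh [\<down>] [] ws @ [([], CapL, B)])"
    using weq_pre[OF weq_app[OF weq_comm[OF ws', of "[\<down>, \<up>]" "[]" "[([], CapL, [])]"], of B "[([], CapL, B)]"],
        of "\<down> # A @ [\<up>]" "[(\<down> # A, CupL, [\<up>])]"] by simp
  also have "weq (\<down> # A @ [\<up>]) B ((\<down> # A, CupL, [\<up>]) # (\<down> # A @ [\<up>], CapL, []) # sh [\<down>] [] ws @ [([], CapL, B)])
      (sh [\<down>] [] ws @ [([], CapL, B)])"
    using weq_app[OF weq_sh[OF zigzag_up_word, of "\<down> # A" "[]"], of B "sh [\<down>] [] ws @ [([], CapL, B)]"] ws'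
    by (simp add: gdiag_append)
  finally show ?thesis unfolding PhiW_def by simp
qed

text \<open>A downward strand that passes \<open>A\<close> and then \<open>A'\<close> is the
  rotation of an upward strand that passes them in the opposite order. The cup of the first factor
  cancels against the cap of the second.\<close>

lemma PhiW_PhiW:
  assumes "gdiag (A @ [\<up>]) (\<up> # B) ws" "gdiag (A' @ [\<up>]) (\<up> # B') ws'"
  shows "weq (\<down> # A @ A') (B @ B' @ [\<down>]) (sh [] A' (PhiW A B ws) @ sh B [] (PhiW A' B' ws'))
    (PhiW (A @ A') (B @ B') (sh A [] ws' @ sh [] B' ws))"
proof -
  let ?P = "PhiW A' B' ws'" and ?X = "\<down> # A @ A'" and ?Y = "B @ B' @ [\<down>]"
  have P: "gdiag (\<down> # A') (B' @ [\<down>]) ?P" by (rule gdiag_PhiW[OF assms(2)])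
  have ws: "gdiag (\<down> # A @ [\<up>]) (\<down> # \<up> # B) (sh [\<down>] [] ws)"
    using gdiag_sh[OF assms(1), of "[\<down>]" "[]"] by simp
  let ?h = "(\<down> # A, CupL, A') # sh [\<down>] (\<down> # A') ws"
  have h: "gdiag ?X (\<down> # \<up> # B @ \<down> # A') ?h"
    using gdiag_sh[OF assms(1), of "[\<down>]" "\<down> # A'"] by simp
  have "weq ?X ?Y (?h @ ([], CapL, B @ \<down> # A') # sh B [] ?P) (?h @ sh (\<down> # \<up> # B) [] ?P @ [([], CapL, B @ B' @ [\<down>])])"
    using weq_pre[OF weq_comm_layer[OF P, of "[]" CapL B], of ?X ?h] h by simp
  also have "weq ?X ?Y (?h @ sh (\<down> # \<up> # B) [] ?P @ [([], CapL, B @ B' @ [\<down>])])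
      ((\<down> # A, CupL, A') # sh (\<down> # A @ [\<up>]) [] ?P @ sh [\<down>] (B' @ [\<down>]) ws @ [([], CapL, B @ B' @ [\<down>])])"
    using weq_pre[OF weq_app[OF weq_comm[OF ws P], of ?Y "[([], CapL, B @ B' @ [\<down>])]"], of ?X "[(\<down> # A, CupL, A')]"] by simp
  also have "weq ?X ?Y ((\<down> # A, CupL, A') # sh (\<down> # A @ [\<up>]) [] ?P @ sh [\<down>] (B' @ [\<down>]) ws @ [([], CapL, B @ B' @ [\<down>])])
      ((\<down> # A @ A', CupL, []) # sh (\<down> # A) [\<down>] ws' @ sh [\<down>] (B' @ [\<down>]) ws @ [([], CapL, B @ B' @ [\<down>])])"
    using weq_app[OF weq_sh[OF PhiW_after_cup[OF assms(2)], of "\<down> # A" "[]"], of ?Y "sh [\<down>] (B' @ [\<down>]) ws @ [([], CapL, B @ B' @ [\<down>])]"]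
      gdiag_sh[OF ws, of "[]" "B' @ [\<down>]"] by (simp add: gdiag_append)
  finally show ?thesis unfolding PhiW_def by simp
qed

lemma PhiW_pre:
  assumes "gdiag (A @ [\<up>]) (\<up> # B) ws" "gdiag A' A vs"
  shows "weq (\<down> # A') (B @ [\<down>]) (sh [\<down>] [] vs @ PhiW A B ws) (PhiW A' B (sh [] [\<up>] vs @ ws))"
proof -
  have vs: "gdiag (\<down> # A') (\<down> # A) (sh [\<down>] [] vs)" using gdiag_sh[OF assms(2), of "[\<down>]" "[]"] by simp
  show ?thesis
    using weq_app[OF weq_comm[OF vs, of "[]" "[\<up>, \<down>]" "[([], CupL, [])]"], of "B @ [\<down>]" "sh [\<down>] [\<down>] ws @ [([], CapL, B @ [\<down>])]"]
      gdiag_sh[OF assms(1), of "[\<down>]" "[\<down>]"] unfolding PhiW_def by (simp add: gdiag_append)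
qed

lemma PhiW_post:
  assumes "gdiag (A @ [\<up>]) (\<up> # B) ws" "gdiag B B' vs"
  shows "weq (\<down> # A) (B' @ [\<down>]) (PhiW A B ws @ sh [] [\<down>] vs) (PhiW A B' (ws @ sh [\<up>] [] vs))"
proof -
  have vs: "gdiag (B @ [\<down>]) (B' @ [\<down>]) (sh [] [\<down>] vs)" using gdiag_sh[OF assms(2), of "[]" "[\<down>]"] by simp
  show ?thesis
    using weq_pre[OF weq_comm_layer[OF vs, of "[]" CapL "[]"], of "\<down> # A" "(\<down> # A, CupL, []) # sh [\<down>] [\<down>] ws"]
      gdiag_sh[OF assms(1), of "[\<down>]" "[\<down>]"] unfolding PhiW_def by simp
qed

lemma rep_Phi:
  assumes "rep (A @ [\<up>]) (\<up> # B) f ws"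
  shows "rep (\<down> # A) (B @ [\<down>]) (Phi A B f) (PhiW A B ws)"
proof -
  have 1: "rep (\<down> # A @ [\<up>, \<down>]) (\<down> # \<up> # B @ [\<down>]) (Ident [\<down>] \<parallel> f \<parallel> Ident [\<down>]) (sh [\<down>] [\<down>] ws)"
    using rep_Tens_right[OF rep_Tens_left[OF assms, of "[\<down>]"], of "[\<down>]"] by simp
  have 2: "rep (\<down> # A) (\<down> # A @ [\<up>, \<down>]) (Ident (\<down> # A) \<parallel> Gen CupL) [(\<down> # A, CupL, [])]"
    using rep_Tens_right[OF rep_Gen[of CupL], of "\<down> # A"] by simp
  have 3: "rep (\<down> # \<up> # B @ [\<down>]) (B @ [\<down>]) (Gen CapL \<parallel> Ident (B @ [\<down>])) [([], CapL, B @ [\<down>])]"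
    using rep_Tens_left[OF rep_Gen[of CapL], of "B @ [\<down>]"] by simp
  show ?thesis unfolding Phi_def PhiW_def using rep_Comp[OF 3 rep_Comp[OF 1 2]] by simp
qed

definition lw :: gword where "lw = PhiW [\<up>] [\<up>] [([], UPos, [])]"

definition dw :: gword where "dw = PhiW [\<down>] [\<down>] lw"

lemma rep_lw: "rep [\<down>, \<up>] [\<up>, \<down>] l_pos lw"
  unfolding l_pos_def lw_def using rep_Phi[of "[\<up>]" "[\<up>]" "Gen UPos"] rep_Gen[of UPos] by simp

lemma gdiag_lw [simp]: "gdiag [\<down>, \<up>] [\<up>, \<down>] lw"
  using rep_lw by (simp add: rep_def)

lemma gdiag_dw [simp]: "gdiag [\<down>, \<down>] [\<down>, \<down>] dw"
  unfolding dw_def using gdiag_PhiW[of "[\<down>]" "[\<down>]" lw] by simp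

lemma u_inv_word: "weq [\<up>, \<up>] [\<up>, \<up>] [([], UPos, []), ([], UNeg, [])] []"
  using rep_weq[OF eqv.rel[OF relation.u_inv] rep_Comp[OF rep_Gen[of UNeg, simplified] rep_Gen[of UPos, simplified]] rep_Ident] by simp

lemma u_inv'_word: "weq [\<up>, \<up>] [\<up>, \<up>] [([], UNeg, []), ([], UPos, [])] []"
  using rep_weq[OF eqv.rel[OF relation.u_inv'] rep_Comp[OF rep_Gen[of UPos, simplified] rep_Gen[of UNeg, simplified]] rep_Ident] by simp

lemma lr_inv_word: "weq [\<up>, \<down>] [\<up>, \<down>] (([], RNeg, []) # lw) []"
  using rep_weq[OF eqv.rel[OF relation.lr_inv] rep_Comp[OF rep_lw rep_Gen[of RNeg, simplified]] rep_Ident] by simp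

lemma rl_inv_word: "weq [\<down>, \<up>] [\<down>, \<up>] (lw @ [([], RNeg, [])]) []"
  using rep_weq[OF eqv.rel[OF relation.rl_inv] rep_Comp[OF rep_Gen[of RNeg, simplified] rep_lw] rep_Ident] by simp

lemma clif_sq_word: "weq [\<up>] [\<up>] [([], Clif, []), ([], Clif, [])] []"
  using rep_weq_neg[OF eqv.rel[OF relation.clif_sq] rep_Comp[OF rep_Gen[of Clif, simplified] rep_Gen[of Clif, simplified]] rep_Ident] by simp

lemma clif_slide_word: "weq [\<up>, \<up>] [\<up>, \<up>] [([], Clif, [\<up>]), ([], UPos, [])] [([], UPos, []), ([\<up>], Clif, [])]"
  using rep_weq[OF eqv.rel[OF relation.clif_slide]
      rep_Comp[OF rep_Gen[of UPos, simplified] rep_Tens_left[OF rep_Gen[of Clif], of "[\<up>]", simplified]]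
      rep_Comp[OF rep_Tens_right[OF rep_Gen[of Clif], of "[\<up>]", simplified] rep_Gen[of UPos, simplified]]] by simp

lemma braid_word: "weq [\<up>, \<up>, \<up>] [\<up>, \<up>, \<up>] [([], UPos, [\<up>]), ([\<up>], UPos, []), ([], UPos, [\<up>])]
    [([\<up>], UPos, []), ([], UPos, [\<up>]), ([\<up>], UPos, [])]"
proof -
  have a: "rep [\<up>, \<up>, \<up>] [\<up>, \<up>, \<up>] (Gen UPos \<parallel> Ident [\<up>]) [([], UPos, [\<up>])]"
    "rep [\<up>, \<up>, \<up>] [\<up>, \<up>, \<up>] (Ident [\<up>] \<parallel> Gen UPos) [([\<up>], UPos, [])]"
    using rep_Tens_left[OF rep_Gen[of UPos], of "[\<up>]"] rep_Tens_right[OF rep_Gen[of UPos], of "[\<up>]"] by simp_all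
  show ?thesis
    using rep_weq[OF eqv.rel[OF relation.braid] rep_Comp[OF a(1) rep_Comp[OF a(2,1)]] rep_Comp[OF a(2) rep_Comp[OF a(1,2)]]] by simp
qed

lemma weq_ctx':
  assumes "weq X' Y' ws vs" "gdiag X (l @ X' @ r) as" "gdiag (l @ Y' @ r) Y bs"
    and "us = as @ sh l r ws @ bs" "us' = as @ sh l r vs @ bs"
  shows "weq X Y us us'"
  using weq_ctx[OF assms(1-3)] assms(4,5) by simp

text \<open>A rotated braid relation: by \<open>PhiW_PhiW\<close> the two mixed crossings are one
  rotation of two crossings, \<open>PhiW_pre\<close> and \<open>PhiW_post\<close> carry the third
  crossing inside, and there the braid relation applies.\<close>

lemma slide_lw_ups: "weq [\<down>, \<up>, \<up>] [\<up>, \<up>, \<down>]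
    (([\<down>], UPos, []) # sh [] [\<up>] lw @ sh [\<up>] [] lw) (sh [] [\<up>] lw @ sh [\<up>] [] lw @ [([], UPos, [\<down>])])"
proof -
  let ?X = "[\<down>, \<up>, \<up>]" and ?Y = "[\<up>, \<up>, \<down>]" and ?U = "[([], UPos, [])] :: gword"
  let ?w = "sh [\<up>] [] ?U @ sh [] [\<up>] ?U"
  have LL: "weq ?X ?Y (sh [] [\<up>] lw @ sh [\<up>] [] lw) (PhiW [\<up>, \<up>] [\<up>, \<up>] ?w)"
    unfolding lw_def using PhiW_PhiW[of "[\<up>]" "[\<up>]" ?U "[\<up>]" "[\<up>]" ?U] by simp
  have "weq ?X ?Y (([\<down>], UPos, []) # sh [] [\<up>] lw @ sh [\<up>] [] lw) (([\<down>], UPos, []) # PhiW [\<up>, \<up>] [\<up>, \<up>] ?w)"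
    using weq_pre[OF LL, of ?X "[([\<down>], UPos, [])]"] by simp
  also have "weq ?X ?Y (([\<down>], UPos, []) # PhiW [\<up>, \<up>] [\<up>, \<up>] ?w) (PhiW [\<up>, \<up>] [\<up>, \<up>] (([], UPos, [\<up>]) # ?w))"
    using PhiW_pre[of "[\<up>, \<up>]" "[\<up>, \<up>]" ?w "[\<up>, \<up>]" ?U] by simp
  also have "weq ?X ?Y (PhiW [\<up>, \<up>] [\<up>, \<up>] (([], UPos, [\<up>]) # ?w)) (PhiW [\<up>, \<up>] [\<up>, \<up>] (?w @ [([\<up>], UPos, [])]))"
    using PhiW_cong[of "[\<up>, \<up>]" "[\<up>, \<up>]"] braid_word by simp
  also have "weq ?X ?Y (PhiW [\<up>, \<up>] [\<up>, \<up>] (?w @ [([\<up>], UPos, [])])) (PhiW [\<up>, \<up>] [\<up>, \<up>] ?w @ [([], UPos, [\<down>])])"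
    using weq_sym[OF PhiW_post[of "[\<up>, \<up>]" "[\<up>, \<up>]" ?w "[\<up>, \<up>]" ?U]] by simp
  also have "weq ?X ?Y (PhiW [\<up>, \<up>] [\<up>, \<up>] ?w @ [([], UPos, [\<down>])]) (sh [] [\<up>] lw @ sh [\<up>] [] lw @ [([], UPos, [\<down>])])"
    using weq_app[OF weq_sym[OF LL], of ?Y "[([], UPos, [\<down>])]"] by simp
  finally show ?thesis .
qed

text \<open>The rotation of \<open>slide_lw_ups\<close>, by the same argument one step
  further.\<close>

lemma slide_lw_dw: "weq [\<down>, \<down>, \<up>] [\<up>, \<down>, \<down>]
    (sh [] [\<up>] dw @ sh [\<down>] [] lw @ sh [] [\<down>] lw) (sh [\<down>] [] lw @ sh [] [\<down>] lw @ sh [\<up>] [] dw)"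
proof -
  let ?X = "[\<down>, \<down>, \<up>]" and ?Y = "[\<up>, \<down>, \<down>]" and ?U = "[([], UPos, [])] :: gword"
  have lw2: "gdiag [\<up>, \<down>, \<up>] [\<up>, \<up>, \<down>] (sh [\<up>] [] lw)" "gdiag [\<down>, \<up>, \<up>] [\<up>, \<down>, \<up>] (sh [] [\<up>] lw)"
    "gdiag [\<down>, \<up>, \<down>] [\<up>, \<down>, \<down>] (sh [] [\<down>] lw)" "gdiag [\<down>, \<down>, \<up>] [\<down>, \<up>, \<down>] (sh [\<down>] [] lw)"
    by (auto intro: gdiag_sh'[OF gdiag_lw])
  let ?a = "([\<down>], UPos, []) # sh [] [\<up>] lw" and ?b = "sh [\<up>] [] lw @ [([], UPos, [\<down>])]"
  have a: "gdiag [\<down>, \<up>, \<up>] [\<up>, \<down>, \<up>] ?a" and b: "gdiag [\<up>, \<down>, \<up>] [\<up>, \<up>, \<down>] ?b"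
    using lw2 by (simp_all add: gdiag_append)
  have "weq ?X [\<down>, \<up>, \<down>] (sh [] [\<up>] dw @ sh [\<down>] [] lw) (PhiW [\<down>, \<up>] [\<down>, \<up>] ?a)"
    using PhiW_PhiW[of "[\<down>]" "[\<down>]" lw "[\<up>]" "[\<up>]" ?U] unfolding dw_def[symmetric] lw_def[symmetric] by simp
  from weq_app[OF this lw2(3)]
  have "weq ?X ?Y (sh [] [\<up>] dw @ sh [\<down>] [] lw @ sh [] [\<down>] lw) (PhiW [\<down>, \<up>] [\<down>, \<up>] ?a @ sh [] [\<down>] lw)" by simp
  also have "weq ?X ?Y (PhiW [\<down>, \<up>] [\<down>, \<up>] ?a @ sh [] [\<down>] lw) (PhiW [\<down>, \<up>] [\<up>, \<down>] (?a @ sh [\<up>] [] lw))"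
    using PhiW_post[of "[\<down>, \<up>]" "[\<down>, \<up>]" ?a "[\<up>, \<down>]" lw] a by simp
  also have "weq ?X ?Y (PhiW [\<down>, \<up>] [\<up>, \<down>] (?a @ sh [\<up>] [] lw)) (PhiW [\<down>, \<up>] [\<up>, \<down>] (sh [] [\<up>] lw @ ?b))"
    using PhiW_cong[of "[\<down>, \<up>]" "[\<up>, \<down>]"] slide_lw_ups by simp
  also have "weq ?X ?Y (PhiW [\<down>, \<up>] [\<up>, \<down>] (sh [] [\<up>] lw @ ?b)) (sh [\<down>] [] lw @ PhiW [\<up>, \<down>] [\<up>, \<down>] ?b)"
    using weq_sym[OF PhiW_pre[of "[\<up>, \<down>]" "[\<up>, \<down>]" ?b "[\<down>, \<up>]" lw]] b by simp
  also have "weq ?X ?Y (sh [\<down>] [] lw @ PhiW [\<up>, \<down>] [\<up>, \<down>] ?b) (sh [\<down>] [] lw @ sh [] [\<down>] lw @ sh [\<up>] [] dw)"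
    using weq_pre[OF weq_sym[OF PhiW_PhiW[of "[\<up>]" "[\<up>]" ?U "[\<down>]" "[\<down>]" lw]], of ?X "sh [\<down>] [] lw"] lw2
    unfolding dw_def[symmetric] lw_def[symmetric] by simp
  finally show ?thesis .
qed

text \<open>A slide along \<open>q\<close> becomes a slide along its inverse \<open>p\<close>. In
  this way relations of \<open>l_pos\<close>, which is defined by rotation, reach the generator
  \<open>RNeg\<close>.\<close>

lemma slide_conjugate:
  assumes "weq Y Y (p @ q) []" "weq X X (q @ p) []"
    and "gdiag Y X p" "gdiag X Y q" "gdiag X X u" "gdiag Y Y v" "weq X Y (u @ q) (q @ v)"
  shows "weq Y X (p @ u) (v @ p)"
proof -
  have "weq Y X (p @ u) (p @ u @ q @ p)"
    using weq_pre[OF weq_sym[OF assms(2)] gdiag_appendI[OF assms(3,5)]] by simp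
  also have "weq Y X (p @ u @ q @ p) (p @ q @ v @ p)"
    using weq_pre[OF weq_app[OF assms(7,3)] assms(3)] by simp
  also have "weq Y X (p @ q @ v @ p) (v @ p)"
    using weq_app[OF assms(1) gdiag_appendI[OF assms(6,3)]] by simp
  finally show ?thesis .
qed

lemma gdiag_unique: "gdiag X Y ws \<Longrightarrow> gdiag X Y' ws \<Longrightarrow> Y = Y'"
  by (induction X Y ws rule: gdiag.induct) auto

lemma gdiag_lw_sh [simp]: "X = a @ \<down> # \<up> # b \<Longrightarrow> gdiag X Y (sh a b lw) \<longleftrightarrow> Y = a @ \<up> # \<down> # b"
  using gdiag_sh[OF gdiag_lw, of a b] gdiag_unique by force

lemma gdiag_dw_sh [simp]: "X = a @ \<down> # \<down> # b \<Longrightarrow> gdiag X Y (sh a b dw) \<longleftrightarrow> Y = X"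
  using gdiag_sh[OF gdiag_dw, of a b] gdiag_unique by force

lemma gdiag_lw_iff [simp]: "X = \<down> # \<up> # [] \<Longrightarrow> gdiag X Y lw \<longleftrightarrow> Y = [\<up>, \<down>]"
  using gdiag_lw gdiag_unique by force

lemma slide_ups: "weq [\<up>, \<up>, \<down>] [\<down>, \<up>, \<up>]
    [([\<up>], RNeg, []), ([], RNeg, [\<up>]), ([\<down>], UPos, [])] [([], UPos, [\<down>]), ([\<up>], RNeg, []), ([], RNeg, [\<up>])]"
proof -
  have 1: "weq [\<up>, \<up>, \<down>] [\<up>, \<up>, \<down>] ([([\<up>], RNeg, []), ([], RNeg, [\<up>])] @ sh [] [\<up>] lw @ sh [\<up>] [] lw) []"
    by (rule weq_trans[OF weq_ctx'[OF lr_inv_word, of _ "[]" "[\<up>]" "[([\<up>], RNeg, [])]" _ "sh [\<up>] [] lw"]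
          weq_ctx'[OF lr_inv_word, of _ "[\<up>]" "[]" "[]" _ "[]"]]) simp_all
  have 2: "weq [\<down>, \<up>, \<up>] [\<down>, \<up>, \<up>] ((sh [] [\<up>] lw @ sh [\<up>] [] lw) @ [([\<up>], RNeg, []), ([], RNeg, [\<up>])]) []"
    by (rule weq_trans[OF weq_ctx'[OF rl_inv_word, of _ "[\<up>]" "[]" "sh [] [\<up>] lw" _ "[([], RNeg, [\<up>])]"]
          weq_ctx'[OF rl_inv_word, of _ "[]" "[\<up>]" "[]" _ "[]"]]) simp_all
  show ?thesis
    using slide_conjugate[OF 1 2, of "[([\<down>], UPos, [])]" "[([], UPos, [\<down>])]"] slide_lw_ups by (simp add: gdiag_append)
qed

lemma slide_ups_neg: "weq [\<up>, \<up>, \<down>] [\<down>, \<up>, \<up>]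
    [([\<up>], RNeg, []), ([], RNeg, [\<up>]), ([\<down>], UNeg, [])] [([], UNeg, [\<down>]), ([\<up>], RNeg, []), ([], RNeg, [\<up>])]"
proof -
  let ?P = "[([\<up>], RNeg, []), ([], RNeg, [\<up>])]" and ?X = "[\<up>, \<up>, \<down>]" and ?Y = "[\<down>, \<up>, \<up>]"
  have "weq ?X ?Y (?P @ [([\<down>], UNeg, [])]) (([], UNeg, [\<down>]) # ([], UPos, [\<down>]) # ?P @ [([\<down>], UNeg, [])])"
    by (rule weq_sym[OF weq_ctx'[OF u_inv'_word, of _ "[]" "[\<down>]" "[]" _ "?P @ [([\<down>], UNeg, [])]"]]) simp_all
  also have "weq ?X ?Y (([], UNeg, [\<down>]) # ([], UPos, [\<down>]) # ?P @ [([\<down>], UNeg, [])])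
      (([], UNeg, [\<down>]) # ?P @ [([\<down>], UPos, []), ([\<down>], UNeg, [])])"
    by (rule weq_ctx'[OF weq_sym[OF slide_ups], of _ "[]" "[]" "[([], UNeg, [\<down>])]" _ "[([\<down>], UNeg, [])]"]) simp_all
  also have "weq ?X ?Y (([], UNeg, [\<down>]) # ?P @ [([\<down>], UPos, []), ([\<down>], UNeg, [])]) (([], UNeg, [\<down>]) # ?P)"
    by (rule weq_ctx'[OF u_inv_word, of _ "[\<down>]" "[]" "([], UNeg, [\<down>]) # ?P" _ "[]"]) simp_all
  finally show ?thesis by simp
qed

lemma slide_dw: "weq [\<up>, \<down>, \<down>] [\<down>, \<down>, \<up>]
    ([([], RNeg, [\<down>]), ([\<down>], RNeg, [])] @ sh [] [\<up>] dw) (sh [\<up>] [] dw @ [([], RNeg, [\<down>]), ([\<down>], RNeg, [])])"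
proof -
  have 1: "weq [\<up>, \<down>, \<down>] [\<up>, \<down>, \<down>] ([([], RNeg, [\<down>]), ([\<down>], RNeg, [])] @ sh [\<down>] [] lw @ sh [] [\<down>] lw) []"
    by (rule weq_trans[OF weq_ctx'[OF lr_inv_word, of _ "[\<down>]" "[]" "[([], RNeg, [\<down>])]" _ "sh [] [\<down>] lw"]
          weq_ctx'[OF lr_inv_word, of _ "[]" "[\<down>]" "[]" _ "[]"]]) simp_all
  have 2: "weq [\<down>, \<down>, \<up>] [\<down>, \<down>, \<up>] ((sh [\<down>] [] lw @ sh [] [\<down>] lw) @ [([], RNeg, [\<down>]), ([\<down>], RNeg, [])]) []"
    by (rule weq_trans[OF weq_ctx'[OF rl_inv_word, of _ "[]" "[\<down>]" "sh [\<down>] [] lw" _ "[([\<down>], RNeg, [])]"]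
          weq_ctx'[OF rl_inv_word, of _ "[\<down>]" "[]" "[]" _ "[]"]]) simp_all
  show ?thesis
    using slide_conjugate[OF 1 2, of "sh [] [\<up>] dw" "sh [\<up>] [] dw"] slide_lw_dw by (simp add: gdiag_append)
qed

text \<open>Rotation turns \<open>clif_slide\<close> into a relation for \<open>l_pos\<close>, and
  conjugation turns that into one for \<open>RNeg\<close>.\<close>

lemma slide_clif: "weq [\<up>, \<down>] [\<down>, \<up>] [([], RNeg, []), ([\<down>], Clif, [])] [([], Clif, [\<down>]), ([], RNeg, [])]"
proof -
  let ?U = "[([], UPos, [])] :: gword" and ?C = "[([], Clif, [])] :: gword"
  have "weq [\<down>, \<up>] [\<up>, \<down>] (([\<down>], Clif, []) # lw) (PhiW [\<up>] [\<up>] (([], Clif, [\<up>]) # ?U))"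
    unfolding lw_def using PhiW_pre[of "[\<up>]" "[\<up>]" ?U "[\<up>]" ?C] by simp
  also have "weq [\<down>, \<up>] [\<up>, \<down>] (PhiW [\<up>] [\<up>] (([], Clif, [\<up>]) # ?U)) (PhiW [\<up>] [\<up>] (?U @ [([\<up>], Clif, [])]))"
    using PhiW_cong[of "[\<up>]" "[\<up>]"] clif_slide_word by simp
  also have "weq [\<down>, \<up>] [\<up>, \<down>] (PhiW [\<up>] [\<up>] (?U @ [([\<up>], Clif, [])])) (lw @ [([], Clif, [\<down>])])"
    unfolding lw_def using weq_sym[OF PhiW_post[of "[\<up>]" "[\<up>]" ?U "[\<up>]" ?C]] by simp
  finally show ?thesis
    using slide_conjugate[of "[\<up>, \<down>]" "[([], RNeg, [])]" lw "[\<down>, \<up>]" "[([\<down>], Clif, [])]" "[([], Clif, [\<down>])]"]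
      lr_inv_word rl_inv_word by simp
qed

text \<open>\<open>UNeg\<close> and \<open>UPos\<close> are inserted just below the cap.
  \<open>UNeg\<close> slides down through the mixed crossings; \<open>UPos\<close> below the cap is
  the same as \<open>l_pos\<close> with a cap on the other side of the strand, and this
  \<open>l_pos\<close> cancels a mixed crossing.\<close>

lemma cap_R_crossing: "weq [\<up>, \<up>, \<down>] [\<up>]
    [([\<up>], RNeg, []), ([], RNeg, [\<up>]), ([], CapL, [\<up>])] [([], UNeg, [\<down>]), ([\<up>], RNeg, []), ([\<up>], CapL, [])]"
proof -
  let ?P = "[([\<up>], RNeg, []), ([], RNeg, [\<up>])]" and ?X = "[\<up>, \<up>, \<down>]" and ?Y = "[\<up>]"
  have "weq ?X ?Y (?P @ [([], CapL, [\<up>])]) (?P @ [([\<down>], UNeg, []), ([\<down>], UPos, []), ([], CapL, [\<up>])])"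
    by (rule weq_sym[OF weq_ctx'[OF u_inv'_word, of _ "[\<down>]" "[]" ?P _ "[([], CapL, [\<up>])]"]]) simp_all
  also have "weq ?X ?Y (?P @ [([\<down>], UNeg, []), ([\<down>], UPos, []), ([], CapL, [\<up>])])
      (([], UNeg, [\<down>]) # ?P @ [([\<down>], UPos, []), ([], CapL, [\<up>])])"
    by (rule weq_ctx'[OF slide_ups_neg, of _ "[]" "[]" "[]" _ "[([\<down>], UPos, []), ([], CapL, [\<up>])]"]) simp_all
  also have "weq ?X ?Y (([], UNeg, [\<down>]) # ?P @ [([\<down>], UPos, []), ([], CapL, [\<up>])])
      (([], UNeg, [\<down>]) # ?P @ sh [] [\<up>] lw @ [([\<up>], CapL, [])])"
    by (rule weq_ctx'[OF weq_sym[OF PhiW_before_cap[of "[\<up>]" "[\<up>]" "[([], UPos, [])]", folded lw_def]], of _ "[]" "[]" "([], UNeg, [\<down>]) # ?P" _ "[]"])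
      simp_all
  also have "weq ?X ?Y (([], UNeg, [\<down>]) # ?P @ sh [] [\<up>] lw @ [([\<up>], CapL, [])]) [([], UNeg, [\<down>]), ([\<up>], RNeg, []), ([\<up>], CapL, [])]"
    by (rule weq_ctx'[OF lr_inv_word, of _ "[]" "[\<up>]" "[([], UNeg, [\<down>]), ([\<up>], RNeg, [])]" _ "[([\<up>], CapL, [])]"]) simp_all
  finally show ?thesis by simp
qed

text \<open>\<open>d_pos\<close> slides up through the mixed crossings. Below the cap it turns into
  \<open>l_pos\<close>, with the cap on the other side of the remaining strand, and cancels one of
  them.\<close>

lemma cap_R_dw: "weq [\<up>, \<down>, \<down>] [\<down>]
    (sh [\<up>] [] dw @ [([], RNeg, [\<down>]), ([\<down>], RNeg, []), ([\<down>], CapL, [])]) [([], RNeg, [\<down>]), ([], CapL, [\<down>])]"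
proof -
  let ?P = "[([], RNeg, [\<down>]), ([\<down>], RNeg, [])]" and ?X = "[\<up>, \<down>, \<down>]" and ?Y = "[\<down>]"
  have "weq ?X ?Y (sh [\<up>] [] dw @ ?P @ [([\<down>], CapL, [])]) (?P @ sh [] [\<up>] dw @ [([\<down>], CapL, [])])"
    by (rule weq_ctx'[OF weq_sym[OF slide_dw], of _ "[]" "[]" "[]" _ "[([\<down>], CapL, [])]"]) simp_all
  also have "weq ?X ?Y (?P @ sh [] [\<up>] dw @ [([\<down>], CapL, [])]) (?P @ sh [\<down>] [] lw @ [([], CapL, [\<down>])])"
    by (rule weq_ctx'[OF PhiW_before_cap[of "[\<down>]" "[\<down>]" lw, folded dw_def], of _ "[]" "[]" ?P _ "[]"]) simp_all
  also have "weq ?X ?Y (?P @ sh [\<down>] [] lw @ [([], CapL, [\<down>])]) [([], RNeg, [\<down>]), ([], CapL, [\<down>])]"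
    by (rule weq_ctx'[OF lr_inv_word, of _ "[\<down>]" "[]" "[([], RNeg, [\<down>])]" _ "[([], CapL, [\<down>])]"]) simp_all
  finally show ?thesis by simp
qed

text \<open>By \<open>PhiW_after_cup\<close> the cup can be drawn on the other side of the strand
  with \<open>l_pos\<close> in place of \<open>UPos\<close>, and \<open>l_pos\<close> cancels
  against \<open>RNeg\<close>.\<close>

lemma cup_past_up: "weq [\<up>] [\<up>, \<down>, \<up>]
    [([\<up>], CupL, []), ([], UPos, [\<down>]), ([\<up>], RNeg, [])] [([], CupL, [\<up>])]"
proof -
  have "weq [\<up>] [\<up>, \<down>, \<up>] [([\<up>], CupL, []), ([], UPos, [\<down>]), ([\<up>], RNeg, [])] (([], CupL, [\<up>]) # sh [\<up>] [] lw @ [([\<up>], RNeg, [])])"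
    by (rule weq_ctx'[OF weq_sym[OF PhiW_after_cup[of "[\<up>]" "[\<up>]" "[([], UPos, [])]", folded lw_def]], of _ "[]" "[]" "[]" _ "[([\<up>], RNeg, [])]"])
      simp_all
  also have "weq [\<up>] [\<up>, \<down>, \<up>] (([], CupL, [\<up>]) # sh [\<up>] [] lw @ [([\<up>], RNeg, [])]) [([], CupL, [\<up>])]"
    by (rule weq_ctx'[OF rl_inv_word, of _ "[\<up>]" "[]" "[([], CupL, [\<up>])]" _ "[]"]) simp_all
  finally show ?thesis .
qed

lemma cup_past_down: "weq [\<down>] [\<down>, \<up>, \<down>]
    (([], CupL, [\<down>]) # sh [\<up>] [] dw @ [([], RNeg, [\<down>])]) [([\<down>], CupL, [])]"
proof -
  have "weq [\<down>] [\<down>, \<up>, \<down>] (([], CupL, [\<down>]) # sh [\<up>] [] dw @ [([], RNeg, [\<down>])]) (([\<down>], CupL, []) # sh [] [\<down>] (lw @ [([], RNeg, [])]))"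
    by (rule weq_ctx'[OF PhiW_after_cup[of "[\<down>]" "[\<down>]" lw, folded dw_def], of _ "[]" "[]" "[]" _ "[([], RNeg, [\<down>])]"])
      simp_all
  also have "weq [\<down>] [\<down>, \<up>, \<down>] (([\<down>], CupL, []) # sh [] [\<down>] (lw @ [([], RNeg, [])])) [([\<down>], CupL, [])]"
    by (rule weq_ctx'[OF rl_inv_word, of _ "[]" "[\<down>]" "[([\<down>], CupL, [])]" _ "[]"]) simp_all
  finally show ?thesis .
qed

text \<open>The crossing \<open>d_pos\<close> is a twofold rotation. Each of the two nested cups
  undoes one rotation, which carries the crossing from the downward legs to the upward ones.\<close>

lemma nested_cups_dw: "weq [] [\<up>, \<up>, \<down>, \<down>]
    ([([], CupL, []), ([\<up>], CupL, [\<down>])] @ sh [\<up>, \<up>] [] dw) [([], CupL, []), ([\<up>], CupL, [\<down>]), ([], UPos, [\<down>, \<down>])]"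
proof -
  let ?Y = "[\<up>, \<up>, \<down>, \<down>]"
  have "weq [] ?Y ([([], CupL, []), ([\<up>], CupL, [\<down>])] @ sh [\<up>, \<up>] [] dw)
      (([], CupL, []) # ([\<up>, \<down>], CupL, []) # sh [\<up>] [\<down>] lw)"
    by (rule weq_ctx'[OF PhiW_after_cup[of "[\<down>]" "[\<down>]" lw, folded dw_def], of _ "[\<up>]" "[]" "[([], CupL, [])]" _ "[]"]) simp_all
  also have "weq [] ?Y (([], CupL, []) # ([\<up>, \<down>], CupL, []) # sh [\<up>] [\<down>] lw)
      (([], CupL, []) # ([], CupL, [\<up>, \<down>]) # sh [\<up>] [\<down>] lw)"
    using weq_app[OF weq_comm1[of "[]" CupL "[]" CupL "[]"], of ?Y "sh [\<up>] [\<down>] lw"] by simp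
  also have "weq [] ?Y (([], CupL, []) # ([], CupL, [\<up>, \<down>]) # sh [\<up>] [\<down>] lw)
      [([], CupL, []), ([\<up>], CupL, [\<down>]), ([], UPos, [\<down>, \<down>])]"
    by (rule weq_ctx'[OF PhiW_after_cup[of "[\<up>]" "[\<up>]" "[([], UPos, [])]", folded lw_def], of _ "[]" "[\<down>]" "[([], CupL, [])]" _ "[]"]) simp_all
  finally show ?thesis .
qed

end

section \<open>Linear combinations of words\<close>

context cring_param
begin

text \<open>A span of expressions that is saturated under the congruence, so that classes need not
  be formed before the end.\<close>

inductive_set spn :: "obj \<Rightarrow> obj \<Rightarrow> 'k mor set \<Rightarrow> 'k mor set" for X Y :: obj and A :: "'k mor set" where
  base: "f \<in> A \<Longrightarrow> arrow k X Y f \<Longrightarrow> f \<in> spn X Y A"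
| zero: "Zero X Y \<in> spn X Y A"
| add: "f \<in> spn X Y A \<Longrightarrow> g \<in> spn X Y A \<Longrightarrow> Add f g \<in> spn X Y A"
| scale: "a \<in> carrier k \<Longrightarrow> f \<in> spn X Y A \<Longrightarrow> Scale a f \<in> spn X Y A"
| eqv: "f \<in> spn X Y A \<Longrightarrow> E X Y f g \<Longrightarrow> g \<in> spn X Y A"

lemma spn_arrow: "f \<in> spn X Y A \<Longrightarrow> arrow k X Y f"
  by (induction rule: spn.induct) (auto intro: arrow.intros dest: E_arrow)

lemma spn_trans: "f \<in> spn X Y A \<Longrightarrow> (\<And>g. g \<in> A \<Longrightarrow> arrow k X Y g \<Longrightarrow> g \<in> spn X Y B) \<Longrightarrow> f \<in> spn X Y B"
  by (induction rule: spn.induct) (auto intro: spn.intros)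

lemma spn_mono: "f \<in> spn X Y A \<Longrightarrow> A \<subseteq> B \<Longrightarrow> f \<in> spn X Y B"
  by (erule spn_trans) (auto intro: spn.base)

text \<open>Covers composition on either side and whiskering at once: \<open>h\<close> acts on
  expressions and is linear only up to the congruence.\<close>

lemma spn_linear:
  assumes "f \<in> spn X Y A"
    and "\<And>f g. E X Y f g \<Longrightarrow> E X' Y' (h f) (h g)"
    and "E X' Y' (h (Zero X Y)) (Zero X' Y')"
    and "\<And>f g. arrow k X Y f \<Longrightarrow> arrow k X Y g \<Longrightarrow> E X' Y' (h (Add f g)) (Add (h f) (h g))"
    and "\<And>a f. a \<in> carrier k \<Longrightarrow> arrow k X Y f \<Longrightarrow> E X' Y' (h (Scale a f)) (Scale a (h f))"
  shows "h f \<in> spn X' Y' (h ` (A \<inter> {f. arrow k X Y f}))"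
  using assms(1)
proof (induction rule: spn.induct)
  case (base f)
  then show ?case using E_arrow[OF assms(2)[OF E_refl[OF base(2)]]] by (auto intro: spn.base)
next
  case zero
  show ?case by (rule spn.eqv[OF spn.zero E_sym[OF assms(3)]])
next
  case (add f g)
  show ?case by (rule spn.eqv[OF spn.add[OF add.IH] E_sym[OF assms(4)[OF add.hyps[THEN spn_arrow]]]])
next
  case (scale a f)
  show ?case
    by (rule spn.eqv[OF spn.scale[OF scale.hyps(1) scale.IH] E_sym[OF assms(5)[OF scale.hyps(1) spn_arrow[OF scale.hyps(2)]]]])
next
  case (eqv f g)
  show ?case by (rule spn.eqv[OF eqv.IH assms(2)[OF eqv.hyps(2)]])
qed

lemma scale_zero_E:
  assumes "arrow k X Y f"
  shows "E X Y (Scale \<zero> f) (Zero X Y)"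
proof -
  have m: "arrow k X Y (Scale (\<ominus> \<one>) f)" by (intro arrow.Scale assms a_inv_closed one_closed)
  have "E X Y (Scale \<zero> f) (Scale ((\<ominus> \<one>) \<oplus> \<one>) f)" using E_refl[OF arrow.Scale[OF zero_closed assms]] by (simp add: l_neg)
  also have "E X Y (Scale ((\<ominus> \<one>) \<oplus> \<one>) f) (Add (Scale (\<ominus> \<one>) f) (Scale \<one> f))"
    by (rule eqv.scale_add_left[OF a_inv_closed[OF one_closed] one_closed assms])
  also have "E X Y (Add (Scale (\<ominus> \<one>) f) (Scale \<one> f)) (Add (Scale (\<ominus> \<one>) f) f)"
    by (rule eqv.add_cong[OF E_refl[OF m] eqv.scale_one[OF assms]])
  also have "E X Y (Add (Scale (\<ominus> \<one>) f) f) (Zero X Y)" by (rule eqv.add_neg[OF assms])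
  finally show ?thesis .
qed

text \<open>Zero is its own multiple by the scalar zero, so compatibility with scalars is
  enough.\<close>

lemma scale_linear_zero:
  assumes "\<And>f g. E X Y f g \<Longrightarrow> E X' Y' (h f) (h g)"
    and "\<And>a f. a \<in> carrier k \<Longrightarrow> arrow k X Y f \<Longrightarrow> E X' Y' (h (Scale a f)) (Scale a (h f))"
  shows "E X' Y' (h (Zero X Y)) (Zero X' Y')"
proof -
  have Z: "arrow k X Y (Zero X Y)" by (rule arrow.Zero)
  have "E X' Y' (h (Zero X Y)) (h (Scale \<zero> (Zero X Y)))" by (rule assms(1)[OF E_sym[OF scale_zero_E[OF Z]]])
  also have "E X' Y' (h (Scale \<zero> (Zero X Y))) (Scale \<zero> (h (Zero X Y)))" by (rule assms(2)[OF zero_closed Z])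
  also have "E X' Y' (Scale \<zero> (h (Zero X Y))) (Zero X' Y')"
    by (rule scale_zero_E[OF E_arrow(1)[OF assms(1)[OF E_refl[OF Z]]]])
  finally show ?thesis .
qed

lemma spn_post:
  assumes "f \<in> spn X Y A" "arrow k Y Z g"
  shows "g \<cdot> f \<in> spn X Z ((\<lambda>f. g \<cdot> f) ` (A \<inter> {f. arrow k X Y f}))"
proof (rule spn_linear[OF assms(1)])
  show c: "E X Z (g \<cdot> f) (g \<cdot> f')" if "E X Y f f'" for f f' by (rule eqv.comp_cong[OF E_refl[OF assms(2)] that])
  show s: "E X Z (g \<cdot> Scale a f) (Scale a (g \<cdot> f))" if "a \<in> carrier k" "arrow k X Y f" for a f
    by (rule eqv.comp_scale_right[OF that(1) assms(2) that(2)])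
  show "E X Z (g \<cdot> Zero X Y) (Zero X Z)" by (rule scale_linear_zero[of X Y X Z "\<lambda>f. g \<cdot> f", OF c s])
  show "E X Z (g \<cdot> Add f f') (Add (g \<cdot> f) (g \<cdot> f'))" if "arrow k X Y f" "arrow k X Y f'" for f f'
    by (rule eqv.comp_add_right[OF assms(2) that])
qed

lemma spn_pre:
  assumes "f \<in> spn X Y A" "arrow k W X g"
  shows "f \<cdot> g \<in> spn W Y ((\<lambda>f. f \<cdot> g) ` (A \<inter> {f. arrow k X Y f}))"
proof (rule spn_linear[OF assms(1)])
  show c: "E W Y (f \<cdot> g) (f' \<cdot> g)" if "E X Y f f'" for f f' by (rule eqv.comp_cong[OF that E_refl[OF assms(2)]])
  show s: "E W Y (Scale a f \<cdot> g) (Scale a (f \<cdot> g))" if "a \<in> carrier k" "arrow k X Y f" for a f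
    by (rule eqv.comp_scale_left[OF that(1,2) assms(2)])
  show "E W Y (Zero X Y \<cdot> g) (Zero W Y)" by (rule scale_linear_zero[of X Y W Y "\<lambda>f. f \<cdot> g", OF c s])
  show "E W Y (Add f f' \<cdot> g) (Add (f \<cdot> g) (f' \<cdot> g))" if "arrow k X Y f" "arrow k X Y f'" for f f'
    by (rule eqv.comp_add_left[OF that assms(2)])
qed

lemma wh_add:
  assumes "arrow k X Y f" "arrow k X Y g"
  shows "E (l @ X @ r) (l @ Y @ r) (wh l (Add f g) r) (Add (wh l f r) (wh l g r))"
proof -
  have t: "arrow k (X @ r) (Y @ r) (f \<parallel> Ident r)" "arrow k (X @ r) (Y @ r) (g \<parallel> Ident r)"
    by (rule arrow.Tens[OF assms(1) arrow.Ident], rule arrow.Tens[OF assms(2) arrow.Ident])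
  show ?thesis
    by (rule E_trans[OF eqv.tens_cong[OF E_refl[OF arrow.Ident] eqv.tens_add_left[OF assms arrow.Ident]]
        eqv.tens_add_right[OF arrow.Ident t]])
qed

lemma spn_wh:
  assumes "f \<in> spn X Y A"
  shows "wh l f r \<in> spn (l @ X @ r) (l @ Y @ r) ((\<lambda>f. wh l f r) ` (A \<inter> {f. arrow k X Y f}))"
proof (rule spn_linear[OF assms])
  show c: "E (l @ X @ r) (l @ Y @ r) (wh l f r) (wh l f' r)" if "E X Y f f'" for f f' by (rule wh_cong[OF that])
  show s: "E (l @ X @ r) (l @ Y @ r) (wh l (Scale a f) r) (Scale a (wh l f r))" if "a \<in> carrier k" "arrow k X Y f" for a f
    by (rule wh_scale[OF that])
  show "E (l @ X @ r) (l @ Y @ r) (wh l (Zero X Y) r) (Zero (l @ X @ r) (l @ Y @ r))"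
    by (rule scale_linear_zero[of X Y _ _ "\<lambda>f. wh l f r", OF c s])
  show "E (l @ X @ r) (l @ Y @ r) (wh l (Add f f') r) (Add (wh l f r) (wh l f' r))" if "arrow k X Y f" "arrow k X Y f'" for f f'
    by (rule wh_add[OF that])
qed

text \<open>Members of \<open>S\<close> that are not words from \<open>X\<close> to \<open>Y\<close>
  are disregarded, so that \<open>S\<close> can be an image of another set or list without a side
  condition on types.\<close>

definition wmors :: "obj \<Rightarrow> obj \<Rightarrow> gword set \<Rightarrow> 'k mor set" where
  "wmors X Y S = {gmor X s |s. s \<in> S \<and> gdiag X Y s}"

definition wspan :: "obj \<Rightarrow> obj \<Rightarrow> gword set \<Rightarrow> gword \<Rightarrow> bool" where
  "wspan X Y S w \<longleftrightarrow> gdiag X Y w \<and> gmor X w \<in> spn X Y (wmors X Y S)"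

lemma wspan_base: "s \<in> S \<Longrightarrow> gdiag X Y s \<Longrightarrow> wspan X Y S s"
  unfolding wspan_def wmors_def by (auto intro!: spn.base arrow_gmor)

lemma spn_wmors_trans:
  assumes "f \<in> spn X Y (wmors X Y S)" "\<And>s. s \<in> S \<Longrightarrow> gdiag X Y s \<Longrightarrow> wspan X Y S' s"
  shows "f \<in> spn X Y (wmors X Y S')"
  using assms(1) by (rule spn_trans) (use assms(2) in \<open>auto simp: wmors_def wspan_def\<close>)

lemma wspan_trans: "wspan X Y S w \<Longrightarrow> (\<And>s. s \<in> S \<Longrightarrow> gdiag X Y s \<Longrightarrow> wspan X Y S' s) \<Longrightarrow> wspan X Y S' w"
  using spn_wmors_trans[of "gmor X w" X Y S S'] unfolding wspan_def by blast

lemma wspan_weq: "wspan X Y S v \<Longrightarrow> weq X Y w v \<Longrightarrow> wspan X Y S w"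
  unfolding wspan_def weq_def using spn.eqv[OF spn.scale[OF signs_closed] E_sym] by blast

lemma gmor_sandwich:
  assumes "gdiag X0 (l @ X @ r) as" "gdiag X Y w" "gdiag (l @ Y @ r) Y0 bs"
  shows "E X0 Y0 (gmor X0 (as @ sh l r w @ bs)) (gmor (l @ Y @ r) bs \<cdot> (wh l (gmor X w) r \<cdot> gmor X0 as))"
proof -
  have g: "gdiag (l @ X @ r) (l @ Y @ r) (sh l r w)" by (rule gdiag_sh[OF assms(2)])
  have "E X0 Y0 (gmor X0 ((as @ sh l r w) @ bs)) (gmor (l @ Y @ r) bs \<cdot> gmor X0 (as @ sh l r w))"
    by (rule gmor_append[OF gdiag_appendI[OF assms(1) g] assms(3)])
  also have "E X0 Y0 (gmor (l @ Y @ r) bs \<cdot> gmor X0 (as @ sh l r w))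
      (gmor (l @ Y @ r) bs \<cdot> (gmor (l @ X @ r) (sh l r w) \<cdot> gmor X0 as))"
    by (rule eqv.comp_cong[OF E_refl[OF arrow_gmor[OF assms(3)]] gmor_append[OF assms(1) g]])
  also have "E X0 Y0 (gmor (l @ Y @ r) bs \<cdot> (gmor (l @ X @ r) (sh l r w) \<cdot> gmor X0 as))
      (gmor (l @ Y @ r) bs \<cdot> (wh l (gmor X w) r \<cdot> gmor X0 as))"
    by (rule eqv.comp_cong[OF E_refl[OF arrow_gmor[OF assms(3)]] eqv.comp_cong[OF gmor_sh[OF assms(2)] E_refl[OF arrow_gmor[OF assms(1)]]]])
  finally show ?thesis by simp
qed

lemma wspan_ctx:
  assumes "wspan X Y S w" "gdiag X0 (l @ X @ r) as" "gdiag (l @ Y @ r) Y0 bs"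
  shows "wspan X0 Y0 ((\<lambda>s. as @ sh l r s @ bs) ` S) (as @ sh l r w @ bs)"
proof -
  have w: "gdiag X Y w" "gmor X w \<in> spn X Y (wmors X Y S)" using assms(1) by (auto simp: wspan_def)
  let ?h = "\<lambda>f. gmor (l @ Y @ r) bs \<cdot> (wh l f r \<cdot> gmor X0 as)"
  have 1: "?h (gmor X w) \<in> spn X0 Y0 ((\<lambda>f. gmor (l @ Y @ r) bs \<cdot> f) ` ((\<lambda>f. f \<cdot> gmor X0 as) ` ((\<lambda>f. wh l f r) `
      (wmors X Y S \<inter> {f. arrow k X Y f}) \<inter> {f. arrow k (l @ X @ r) (l @ Y @ r) f}) \<inter> {f. arrow k X0 (l @ Y @ r) f}))"
    by (rule spn_post[OF spn_pre[OF spn_wh[OF w(2)] arrow_gmor[OF assms(2)]] arrow_gmor[OF assms(3)]])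
  have 2: "?h (gmor X w) \<in> spn X0 Y0 (wmors X0 Y0 ((\<lambda>s. as @ sh l r s @ bs) ` S))"
  proof (rule spn_trans[OF 1])
    fix g assume "g \<in> (\<lambda>f. gmor (l @ Y @ r) bs \<cdot> f) ` ((\<lambda>f. f \<cdot> gmor X0 as) ` ((\<lambda>f. wh l f r) `
      (wmors X Y S \<inter> {f. arrow k X Y f}) \<inter> {f. arrow k (l @ X @ r) (l @ Y @ r) f}) \<inter> {f. arrow k X0 (l @ Y @ r) f})"
    then obtain s where s: "s \<in> S" "gdiag X Y s" "g = ?h (gmor X s)" by (auto simp: wmors_def)
    have "gdiag X0 Y0 (as @ sh l r s @ bs)"
      by (intro gdiag_appendI[OF assms(2)] gdiag_appendI[OF gdiag_sh[OF s(2)] assms(3)])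
    then have "gmor X0 (as @ sh l r s @ bs) \<in> spn X0 Y0 (wmors X0 Y0 ((\<lambda>s. as @ sh l r s @ bs) ` S))"
      using s(1) by (intro spn.base arrow_gmor) (auto simp: wmors_def)
    then show "g \<in> spn X0 Y0 (wmors X0 Y0 ((\<lambda>s. as @ sh l r s @ bs) ` S))"
      unfolding s(3) by (rule spn.eqv[OF _ gmor_sandwich[OF assms(2) s(2) assms(3)]])
  qed
  show ?thesis unfolding wspan_def
    using spn.eqv[OF 2 E_sym[OF gmor_sandwich[OF assms(2) w(1) assms(3)]]]
      gdiag_appendI[OF assms(2) gdiag_appendI[OF gdiag_sh[OF w(1)] assms(3)]] by blast
qed

text \<open>Rewriting inside a context: a subword is replaced by a linear combination, and each
  resulting word is treated further.\<close>

lemma wspan_ctx':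
  assumes "wspan X Y S w" "gdiag X0 (l @ X @ r) as" "gdiag (l @ Y @ r) Y0 bs" "us = as @ sh l r w @ bs"
    and "\<And>s. s \<in> S \<Longrightarrow> gdiag X Y s \<Longrightarrow> wspan X0 Y0 S' (as @ sh l r s @ bs)"
  shows "wspan X0 Y0 S' us"
proof -
  have "wspan X Y (S \<inter> {s. gdiag X Y s}) w"
    using assms(1) by (rule wspan_trans) (auto intro: wspan_base)
  from wspan_ctx[OF this assms(2,3)] have "wspan X0 Y0 ((\<lambda>s. as @ sh l r s @ bs) ` (S \<inter> {s. gdiag X Y s})) us"
    unfolding assms(4) .
  then show ?thesis by (rule wspan_trans) (auto intro: assms(5))
qed

lemma spn_diff:
  assumes "E X Y (Add f g) h" "h \<in> spn X Y A" "f \<in> spn X Y A"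
  shows "g \<in> spn X Y A"
proof -
  have ar: "arrow k X Y f" "arrow k X Y (Add f g)" "arrow k X Y h"
    using assms spn_arrow E_arrow by blast+
  have g: "arrow k X Y g" using ar(2) by (cases rule: arrow.cases) auto
  have m: "arrow k X Y (Scale (\<ominus> \<one>) f)" by (intro arrow.Scale ar a_inv_closed one_closed)
  have "E X Y (Add (Scale (\<ominus> \<one>) f) h) (Add (Scale (\<ominus> \<one>) f) (Add f g))"
    by (rule eqv.add_cong[OF E_refl[OF m] E_sym[OF assms(1)]])
  also have "E X Y (Add (Scale (\<ominus> \<one>) f) (Add f g)) (Add (Add (Scale (\<ominus> \<one>) f) f) g)"
    by (rule E_sym[OF eqv.add_assoc[OF m ar(1) g]])
  also have "E X Y (Add (Add (Scale (\<ominus> \<one>) f) f) g) (Add (Zero X Y) g)"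
    by (rule eqv.add_cong[OF eqv.add_neg[OF ar(1)] E_refl[OF g]])
  also have "E X Y (Add (Zero X Y) g) g" by (rule eqv.add_zero[OF g])
  finally show ?thesis by (rule spn.eqv[OF spn.add[OF spn.scale[OF a_inv_closed[OF one_closed] assms(3)] assms(2)]])
qed

lemma spn_neg: "Scale (\<ominus> \<one>) f \<in> spn X Y A \<Longrightarrow> arrow k X Y f \<Longrightarrow> f \<in> spn X Y A"
  using spn.eqv[OF spn.scale[OF a_inv_closed[OF one_closed]] E_sym[OF scale_signs[of "\<ominus> \<one>", OF _ _ E_refl]]]
  by (simp add: signs_def arrow.Scale)

lemma spn_rep: "rep X Y f s \<Longrightarrow> s \<in> S \<Longrightarrow> f \<in> spn X Y (wmors X Y S)"
  unfolding rep_def by (rule spn.eqv[OF spn.base E_sym]) (auto simp: wmors_def intro: arrow_gmor)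

lemma rep_wspan: "rep X Y f w \<Longrightarrow> f \<in> spn X Y (wmors X Y S) \<Longrightarrow> wspan X Y S w"
  unfolding rep_def wspan_def using spn.eqv by blast

lemma skein_neg: "wspan [\<up>, \<up>] [\<up>, \<up>] {[([], UPos, [])], []} [([], UNeg, [])]"
  using rep_wspan[OF rep_Gen[of UNeg, simplified] spn_neg[OF spn_diff[OF eqv.rel[OF relation.skein]]]]
    spn_rep[OF rep_Gen[of UPos], of "{[([], UPos, [])], []}"] spn_rep[OF rep_Ident, of "{[([], UPos, [])], []}"]
    arrow.Gen[of k UNeg] z_closed by (simp add: spn.scale)

lemma skein_pos: "wspan [\<up>, \<up>] [\<up>, \<up>] {[([], UNeg, [])], []} [([], UPos, [])]"
proof -
  let ?A = "wmors [\<up>, \<up>] [\<up>, \<up>] {[([], UNeg, [])], []}"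
  have U: "arrow k [\<up>, \<up>] [\<up>, \<up>] (Gen UPos)" "arrow k [\<up>, \<up>] [\<up>, \<up>] (Scale (\<ominus> \<one>) (Gen UNeg))"
    using arrow.Gen[of k UPos] arrow.Scale[OF _ arrow.Gen[of k UNeg], of "\<ominus> \<one>"] by simp_all
  have "Scale (\<ominus> \<one>) (Gen UNeg) \<in> spn [\<up>, \<up>] [\<up>, \<up>] ?A"
    using spn_rep[OF rep_Gen[of UNeg], of "{[([], UNeg, [])], []}"] by (simp add: spn.scale)
  moreover have "Scale z (Ident [\<up>, \<up>]) \<in> spn [\<up>, \<up>] [\<up>, \<up>] ?A"
    using spn_rep[OF rep_Ident, of "{[([], UNeg, [])], []}"] z_closed by (simp add: spn.scale)
  ultimately have "Gen UPos \<in> spn [\<up>, \<up>] [\<up>, \<up>] ?A"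
    using spn_diff[OF E_trans[OF eqv.add_commute[OF U(2,1)] eqv.rel[OF relation.skein]]] by blast
  then show ?thesis using rep_wspan[OF rep_Gen[of UPos]] by simp
qed

lemma wspan_zero:
  assumes "E X Y f (Zero X Y)" "rep X Y f ws"
  shows "wspan X Y S ws"
  using assms unfolding wspan_def rep_def
  by (auto intro!: spn.eqv[OF spn.zero E_trans[OF E_sym]])

lemma bubble_word: "wspan [] [] S [([], CupL, []), ([], RNeg, []), ([], CapL, [])]"
proof -
  have "rep [\<up>, \<down>] [] cap_R [([], RNeg, []), ([], CapL, [])]"
    unfolding cap_R_def using rep_Comp[OF rep_Gen[of CapL, simplified] rep_Gen[of RNeg, simplified]] by simp
  from wspan_zero[OF eqv.rel[OF relation.bubble] rep_Comp[OF this rep_Gen[of CupL, simplified]]] show ?thesis by simp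
qed

lemma clif_bubble_word: "wspan [] [] S [([], CupL, []), ([], Clif, [\<down>]), ([], RNeg, []), ([], CapL, [])]"
proof -
  have 1: "rep [\<up>, \<down>] [] cap_R [([], RNeg, []), ([], CapL, [])]"
    unfolding cap_R_def using rep_Comp[OF rep_Gen[of CapL, simplified] rep_Gen[of RNeg, simplified]] by simp
  have 2: "rep [\<up>, \<down>] [\<up>, \<down>] (Gen Clif \<parallel> Ident [\<down>]) [([], Clif, [\<down>])]"
    using rep_Tens_left[OF rep_Gen[of Clif], of "[\<down>]"] by simp
  from wspan_zero[OF eqv.rel[OF relation.clif_bubble] rep_Comp[OF 1 rep_Comp[OF 2 rep_Gen[of CupL, simplified]]]]
  show ?thesis by simp
qed

lemma spn_words_wh:
  assumes "f \<in> spn X Y (wmors X Y UNIV)"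
  shows "wh l f r \<in> spn (l @ X @ r) (l @ Y @ r) (wmors (l @ X @ r) (l @ Y @ r) UNIV)"
  by (rule spn_trans[OF spn_wh[OF assms]])
    (auto simp: wmors_def intro!: spn.eqv[OF spn.base gmor_sh] arrow_gmor gdiag_sh)

lemma spn_words_comp:
  assumes "f \<in> spn Y Z (wmors Y Z UNIV)" "g \<in> spn X Y (wmors X Y UNIV)"
  shows "f \<cdot> g \<in> spn X Z (wmors X Z UNIV)"
proof (rule spn_trans[OF spn_post[OF assms(2) spn_arrow[OF assms(1)]]])
  fix h assume "h \<in> (\<lambda>g. f \<cdot> g) ` (wmors X Y UNIV \<inter> {g. arrow k X Y g})"
  then obtain w where w: "gdiag X Y w" "h = f \<cdot> gmor X w" by (auto simp: wmors_def)
  show "h \<in> spn X Z (wmors X Z UNIV)" unfolding w(2)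
  proof (rule spn_trans[OF spn_pre[OF assms(1) arrow_gmor[OF w(1)]]])
    fix h' assume "h' \<in> (\<lambda>f. f \<cdot> gmor X w) ` (wmors Y Z UNIV \<inter> {f. arrow k Y Z f})"
    then obtain v where v: "gdiag Y Z v" "h' = gmor Y v \<cdot> gmor X w" by (auto simp: wmors_def)
    show "h' \<in> spn X Z (wmors X Z UNIV)" unfolding v(2)
      by (rule spn.eqv[OF spn.base gmor_append[OF w(1) v(1)]])
        (use gdiag_appendI[OF w(1) v(1)] in \<open>auto simp: wmors_def intro: arrow_gmor\<close>)
  qed
qed

lemma arrow_wspan: "arrow k X Y f \<Longrightarrow> f \<in> spn X Y (wmors X Y UNIV)"
proof (induction rule: arrow.induct)
  case (Ident X)
  show ?case by (rule spn_rep[OF rep_Ident UNIV_I])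
next
  case (Gen g)
  show ?case by (rule spn_rep[OF rep_Gen UNIV_I])
next
  case (Comp Y Z f X g)
  then show ?case using spn_words_comp by blast
next
  case (Tens X Y f X' Y' g)
  have 1: "f \<parallel> Ident Y' \<in> spn (X @ Y') (Y @ Y') (wmors (X @ Y') (Y @ Y') UNIV)"
    by (rule spn.eqv[OF spn_words_wh[OF Tens.IH(1), of "[]" Y', simplified append_Nil] E_sym[OF left_wh[OF Tens.hyps(1)]]])
  have 2: "Ident X \<parallel> g \<in> spn (X @ X') (X @ Y') (wmors (X @ X') (X @ Y') UNIV)"
    by (rule spn.eqv[OF spn_words_wh[OF Tens.IH(2), of X "[]", simplified append_Nil2] E_sym[OF right_wh[OF Tens.hyps(2)]]])
  show ?case by (rule spn.eqv[OF spn_words_comp[OF 1 2] E_sym[OF tens_decomp[OF Tens.hyps]]])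
qed (auto intro: spn.intros)

end

section \<open>Morphisms out of the unit object\<close>

abbreviation "ups n \<equiv> replicate n \<up>"
abbreviation "dns n \<equiv> replicate n \<down>"

fun nest :: "nat \<Rightarrow> gword" where
  "nest 0 = []"
| "nest (Suc a) = nest a @ [(ups a, CupL, dns a)]"

lemma gdiag_nest: "gdiag [] (ups a @ dns a) (nest a)"
  by (induction a) (auto simp: gdiag_append replicate_app_Cons_same)

definition upword :: "nat \<Rightarrow> gword \<Rightarrow> bool" where
  "upword a x \<longleftrightarrow> gdiag (ups a) (ups a) x \<and> (\<forall>(l, g, r) \<in> set x. g \<in> {UPos, UNeg, Clif})"

lemma upword_append: "upword a x \<Longrightarrow> upword a y \<Longrightarrow> upword a (x @ y)"
  by (auto simp: upword_def intro: gdiag_appendI)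

lemma upword_gdiag: "upword a x \<Longrightarrow> gdiag (ups a) (ups a) x"
  by (simp add: upword_def)

lemma upword_Nil: "upword a []"
  by (simp add: upword_def)

lemma upword_sh: "upword a x \<Longrightarrow> upword (Suc a) (sh [] [\<up>] x)"
  using gdiag_sh[of "ups a" "ups a" x "[]" "[\<up>]"] by (auto simp: upword_def sh_def replicate_append_same)

text \<open>Two occurrences of the pattern cannot overlap in one letter, since its two letters
  differ.\<close>

lemma append_eq_descent:
  assumes "A' @ \<down> # \<up> # C' = A @ \<down> # \<up> # C"
  obtains "A' = A" "C' = C" | M where "A' = A @ \<down> # \<up> # M" "C = M @ \<down> # \<up> # C'"
    | M where "A = A' @ \<down> # \<up> # M" "C' = M @ \<down> # \<up> # C"
proof -
  from assms consider M where "A' = A @ M" "M @ \<down> # \<up> # C' = \<down> # \<up> # C" | M where "A' @ M = A" "\<down> # \<up> # C' = M @ \<down> # \<up> # C"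
    unfolding append_eq_append_conv2 by blast
  then show thesis
  proof cases
    case 1
    show thesis
    proof (cases M)
      case Nil
      then show ?thesis using 1 that(1) by simp
    next
      case (Cons m M')
      then show ?thesis using 1 that(2) by (cases M') auto
    qed
  next
    case 2
    show thesis
    proof (cases M)
      case Nil
      then show ?thesis using 2 that(1) by simp
    next
      case (Cons m M')
      then show ?thesis using 2 that(3) by (cases M') auto
    qed
  qed
qed

text \<open>Counts all pairs of a \<open>\<down>\<close> somewhere to the left of an
  \<open>\<up>\<close>, adjacent or not. Undoing one mixed crossing lowers the number by one, which
  makes it the measure of the inductions on objects.\<close>

fun descents :: "obj \<Rightarrow> nat" where
  "descents [] = 0"
| "descents (\<up> # Y) = descents Y"
| "descents (\<down> # Y) = count_list Y \<up> + descents Y"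

lemma descents_swap: "descents (A @ \<down> # \<up> # C) = Suc (descents (A @ \<up> # \<down> # C))"
proof (induction A)
  case (Cons a A)
  then show ?case by (cases a) auto
qed auto

lemma descent_or_sorted: "(\<exists>A C. Y = A @ \<down> # \<up> # C) \<or> (\<exists>a b. Y = ups a @ dns b)"
proof (induction Y)
  case (Cons y Y)
  then consider A C where "Y = A @ \<down> # \<up> # C" | a b where "Y = ups a @ dns b" by blast
  then show ?case
  proof cases
    case 1
    then have "y # Y = (y # A) @ \<down> # \<up> # C" by simp
    then show ?thesis by blast
  next
    case 2
    show ?thesis
    proof (cases y)
      case Up
      then have "y # Y = ups (Suc a) @ dns b" using 2 by simp
      then show ?thesis by blast
    next
      case Down
      show ?thesis
      proof (cases a)
        case 0
        then have "y # Y = ups 0 @ dns (Suc b)" using 2 Down by simp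
        then show ?thesis by blast
      next
        case (Suc a')
        then have "y # Y = [] @ \<down> # \<up> # (ups a' @ dns b)" using 2 Down by simp
        then show ?thesis by blast
      qed
    qed
  qed
qed (metis append.right_neutral replicate_0)

lemma sorted_split_up: "A @ \<up> # C = ups a @ dns b \<Longrightarrow> \<exists>i j. A = ups i \<and> C = ups j @ dns b \<and> a = Suc (i + j)"
proof (induction A arbitrary: a)
  case Nil
  then obtain a' where "a = Suc a'" by (cases a; cases b) auto
  then show ?case using Nil by (auto intro!: exI[of _ 0])
next
  case (Cons x A)
  then obtain a' where a: "a = Suc a'" by (cases a; cases b) (auto simp: Cons_eq_append_conv, metis in_set_conv_decomp in_set_replicate orientation.distinct(1))
  then obtain i j where "A = ups i" "C = ups j @ dns b" "a' = Suc (i + j)" using Cons by auto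
  then show ?case using a Cons.prems by (intro exI[of _ "Suc i"] exI[of _ j]) auto
qed

lemma sorted_split_down: "A @ \<down> # C = ups a @ dns b \<Longrightarrow> \<exists>i j. A = ups a @ dns i \<and> C = dns j \<and> b = Suc (i + j)"
proof (induction A arbitrary: a b)
  case Nil
  then have a: "a = 0" by (cases a) auto
  then obtain b' where "b = Suc b'" using Nil by (cases b) auto
  then show ?case using Nil a by (auto intro!: exI[of _ 0])
next
  case (Cons x A)
  show ?case
  proof (cases a)
    case (Suc a')
    then show ?thesis using Cons.IH[of a' b] Cons.prems by auto
  next
    case 0
    then obtain b' where b: "b = Suc b'" using Cons.prems by (cases b) auto
    then obtain i j where "A = ups 0 @ dns i" "C = dns j" "b' = Suc (i + j)" using Cons.IH[of 0 b'] Cons.prems 0 by auto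
    then show ?thesis using 0 b Cons.prems by (intro exI[of _ "Suc i"] exI[of _ j]) auto
  qed
qed

lemma sorted_no_descent: "A @ \<down> # \<up> # C \<noteq> ups a @ dns b"
  using sorted_split_down[of A "\<up> # C" a b] by (auto simp: Cons_replicate_eq)

section \<open>A family of words out of the unit object\<close>

context cring_param
begin

text \<open>
  Nested cups, then crossings and tokens of upward strands, then mixed crossings that bring the
  endpoints into the order prescribed by the object.
\<close>

inductive fam :: "obj \<Rightarrow> gword \<Rightarrow> bool" where
  base: "upword a x \<Longrightarrow> fam (ups a @ dns a) (nest a @ sh [] (dns a) x)"
| rneg: "fam (A @ \<up> # \<down> # C) ws \<Longrightarrow> fam (A @ \<down> # \<up> # C) (ws @ [(A, RNeg, C)])"
| weq: "fam Y ws \<Longrightarrow> weq [] Y vs ws \<Longrightarrow> fam Y vs"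

lemma fam_gdiag: "fam Y ws \<Longrightarrow> gdiag [] Y ws"
proof (induction rule: fam.induct)
  case (base a x)
  then show ?case using gdiag_sh[OF upword_gdiag[OF base], of "[]" "dns a"] by (auto intro: gdiag_appendI[OF gdiag_nest])
qed (auto simp: gdiag_append dest: weq_gdiag)

text \<open>The rule for mixed crossings ends in an object with a descent, so only the other two
  rules lead to a sorted one.\<close>

lemma fam_sorted:
  assumes "fam Y ws" "Y = ups a @ dns b"
  shows "a = b \<and> (\<exists>x. upword a x \<and> weq [] Y ws (nest a @ sh [] (dns a) x))"
  using assms
proof (induction rule: fam.induct)
  case (base a' x)
  have "a' = a \<and> a' = b"
    using arg_cong[OF base.prems, of "\<lambda>Y. length (filter ((=) \<up>) Y)"] arg_cong[OF base.prems, of "\<lambda>Y. length (filter ((=) \<down>) Y)"]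
    by simp
  then show ?case using base fam_gdiag[OF fam.base[OF base.hyps]] weq_refl by auto
next
  case (rneg A C ws)
  then show ?case using sorted_no_descent by metis
next
  case (weq Y ws vs)
  then show ?case using weq_trans by blast
qed

lemma RNeg_comm:
  "gdiag X (A @ \<up> # \<down> # M @ \<up> # \<down> # C) ws \<Longrightarrow> weq X (A @ \<down> # \<up> # M @ \<down> # \<up> # C)
    (ws @ [(A, RNeg, M @ \<up> # \<down> # C), (A @ \<down> # \<up> # M, RNeg, C)]) (ws @ [(A @ \<up> # \<down> # M, RNeg, C), (A, RNeg, M @ \<down> # \<up> # C)])"
  using weq_pre[OF weq_comm1[of A RNeg M RNeg C], of X ws] by simp

text \<open>Different descents are disjoint, so the mixed crossings at them commute and any descent
  can be chosen as the place of the last crossing.\<close>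

lemma fam_inv:
  assumes "fam Y ws" "Y = A @ \<down> # \<up> # C"
  shows "\<exists>ws'. fam (A @ \<up> # \<down> # C) ws' \<and> weq [] Y ws (ws' @ [(A, RNeg, C)])"
  using assms
proof (induction arbitrary: A C rule: fam.induct)
  case (base a x)
  then show ?case using sorted_no_descent by metis
next
  case (rneg A' C' ws)
  have g: "gdiag [] (A' @ \<up> # \<down> # C') ws" by (rule fam_gdiag[OF rneg.hyps])
  from rneg.prems show ?case
  proof (cases rule: append_eq_descent)
    case 1
    then show ?thesis using rneg.hyps g by (auto intro!: exI[of _ ws] weq_refl simp: gdiag_append)
  next
    case (2 M)
    then obtain ws' where w: "fam (A @ \<up> # \<down> # M @ \<up> # \<down> # C') ws'"
        "weq [] (A' @ \<up> # \<down> # C') ws (ws' @ [(A, RNeg, M @ \<up> # \<down> # C')])"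
      using rneg.IH[of A "M @ \<up> # \<down> # C'"] by auto
    have "weq [] (A' @ \<down> # \<up> # C') (ws @ [(A', RNeg, C')]) (ws' @ [(A, RNeg, M @ \<up> # \<down> # C'), (A', RNeg, C')])"
      using weq_app[OF w(2), of _ "[(A', RNeg, C')]"] by simp
    also have "weq [] (A' @ \<down> # \<up> # C') (ws' @ [(A, RNeg, M @ \<up> # \<down> # C'), (A', RNeg, C')])
        ((ws' @ [(A @ \<up> # \<down> # M, RNeg, C')]) @ [(A, RNeg, C)])"
      using RNeg_comm[OF fam_gdiag[OF w(1)]] 2 by simp
    finally show ?thesis using fam.rneg[of "A @ \<up> # \<down> # M" C' ws'] w(1) 2 by auto
  next
    case (3 M)
    then obtain ws' where w: "fam ((A' @ \<up> # \<down> # M) @ \<up> # \<down> # C) ws'"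
        "weq [] (A' @ \<up> # \<down> # C') ws (ws' @ [(A' @ \<up> # \<down> # M, RNeg, C)])"
      using rneg.IH[of "A' @ \<up> # \<down> # M" C] by auto
    have "weq [] (A' @ \<down> # \<up> # C') (ws @ [(A', RNeg, C')]) (ws' @ [(A' @ \<up> # \<down> # M, RNeg, C), (A', RNeg, C')])"
      using weq_app[OF w(2), of _ "[(A', RNeg, C')]"] by simp
    also have "weq [] (A' @ \<down> # \<up> # C') (ws' @ [(A' @ \<up> # \<down> # M, RNeg, C), (A', RNeg, C')])
        ((ws' @ [(A', RNeg, M @ \<up> # \<down> # C)]) @ [(A, RNeg, C)])"
      using weq_sym[OF RNeg_comm[of "[]" A' M C ws']] fam_gdiag[OF w(1)] 3 by simp
    finally show ?thesis using fam.rneg[of A' "M @ \<up> # \<down> # C" ws'] w(1) 3 by auto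
  qed
next
  case (weq Y ws vs)
  then show ?case using weq_trans by blast
qed

text \<open>
  The descents (adjacent factors \<open>\<down> \<up>\<close>) of an object are pairwise disjoint, and a mixed crossing at a
  descent disjoint from the factor \<open>D\<close> commutes with everything done at \<open>D\<close>. So only descents that
  overlap \<open>D\<close> require a relation.
\<close>

lemma fam_induct:
  assumes "fam (A @ D @ C) ws"
    and D: "\<And>M N. D \<noteq> M @ \<down> # \<up> # N"
    and weq: "\<And>A C ws vs. weq [] (A @ D @ C) ws vs \<Longrightarrow> S A C vs \<Longrightarrow> S A C ws"
    and left: "\<And>A M C ws. fam (A @ \<up> # \<down> # M @ D @ C) ws \<Longrightarrow> S (A @ \<up> # \<down> # M) C ws \<Longrightarrow>
      S (A @ \<down> # \<up> # M) C (ws @ [(A, RNeg, M @ D @ C)])"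
    and right: "\<And>A M C ws. fam (A @ D @ M @ \<up> # \<down> # C) ws \<Longrightarrow> S A (M @ \<up> # \<down> # C) ws \<Longrightarrow>
      S A (M @ \<down> # \<up> # C) (ws @ [(A @ D @ M, RNeg, C)])"
    and sorted: "\<And>A C a x. A @ D @ C = ups a @ dns a \<Longrightarrow> upword a x \<Longrightarrow> S A C (nest a @ sh [] (dns a) x)"
    and overlap_left: "\<And>A C E ws. D @ C = \<up> # E \<Longrightarrow> fam (A @ \<down> # D @ C) ws \<Longrightarrow>
      (\<And>A' C' w. descents (A' @ D @ C') < descents (A @ \<down> # D @ C) \<Longrightarrow> fam (A' @ D @ C') w \<Longrightarrow> S A' C' w) \<Longrightarrow>
      S (A @ [\<down>]) C ws"
    and overlap_right: "\<And>A C E ws. D = E @ [\<down>] \<Longrightarrow> fam (A @ D @ \<up> # C) ws \<Longrightarrow>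
      (\<And>A' C' w. descents (A' @ D @ C') < descents (A @ D @ \<up> # C) \<Longrightarrow> fam (A' @ D @ C') w \<Longrightarrow> S A' C' w) \<Longrightarrow>
      S A (\<up> # C) ws"
  shows "S A C ws"
  using assms(1)
proof (induction "descents (A @ D @ C)" arbitrary: A C ws rule: less_induct)
  case less
  show ?case
  proof (cases "\<exists>a b. A @ D @ C = ups a @ dns b")
    case True
    then obtain a b where ab: "A @ D @ C = ups a @ dns b" by blast
    then obtain x where "upword a x" "weq [] (A @ D @ C) ws (nest a @ sh [] (dns a) x)" "a = b"
      using fam_sorted[OF less.prems ab] by blast
    then show ?thesis using weq sorted ab by blast
  next
    case False
    then obtain A1 C1 where Y: "A @ D @ C = A1 @ \<down> # \<up> # C1" using descent_or_sorted by blast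
    obtain ws' where ws': "fam (A1 @ \<up> # \<down> # C1) ws'" "weq [] (A1 @ \<down> # \<up> # C1) ws (ws' @ [(A1, RNeg, C1)])"
      using fam_inv[OF less.prems Y] unfolding Y by blast
    have d: "descents (A1 @ \<up> # \<down> # C1) < descents (A @ D @ C)" unfolding Y descents_swap by simp
    \<comment> \<open>The descent lies to the left of \<open>D\<close>, overlaps its left end, or
      does not begin before \<open>D\<close>.\<close>
    consider (l) M where "A = A1 @ \<down> # \<up> # M" "C1 = M @ D @ C" | (o) "A = A1 @ [\<down>]" "D @ C = \<up> # C1"
      | (m) M where "A1 = A @ M" "D @ C = M @ \<down> # \<up> # C1"
    proof -
      from Y consider M where "A = A1 @ M" "M @ D @ C = \<down> # \<up> # C1" | M where "A @ M = A1" "D @ C = M @ \<down> # \<up> # C1"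
        unfolding append_eq_append_conv2 by blast
      then show thesis
      proof cases
        case 1
        show thesis
        proof (cases M)
          case Nil
          then show ?thesis using 1 m[of "[]"] by simp
        next
          case (Cons x M')
          then show ?thesis using 1 l o by (cases M') auto
        qed
      next
        case 2
        then show thesis using m by blast
      qed
    qed
    then show ?thesis
    proof cases
      case l
      have f: "fam (A1 @ \<up> # \<down> # M @ D @ C) ws'" using ws'(1) l(2) by simp
      have "S (A1 @ \<up> # \<down> # M) C ws'" using less.hyps[of "A1 @ \<up> # \<down> # M" C ws'] d f l(2) by simp
      then have "S A C (ws' @ [(A1, RNeg, C1)])" using left[OF f] l by simp
      then show ?thesis using weq[of A C ws] ws'(2) Y by simp
    next
      case o
      then show ?thesis using overlap_left[of C C1 A1 ws] less by auto
    next
      case m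
      from m(2) consider (r) N where "M = D @ N" "C = N @ \<down> # \<up> # C1" | (o) "D = M @ [\<down>]" "C = \<up> # C1"
        | (i) N where "D = M @ \<down> # \<up> # N"
      proof -
        from m(2) consider N where "D = M @ N" "N @ C = \<down> # \<up> # C1" | N where "D @ N = M" "C = N @ \<down> # \<up> # C1"
          unfolding append_eq_append_conv2 by blast
        then show thesis
        proof cases
          case 1
          show thesis
          proof (cases N)
            case Nil
            then show ?thesis using 1 r[of "[]"] by simp
          next
            case (Cons x N')
            then show ?thesis using 1 o i by (cases N') auto
          qed
        next
          case 2
          then show thesis using r by blast
        qed
      qed
      then show ?thesis
      proof cases
        case r
        have f: "fam (A @ D @ N @ \<up> # \<down> # C1) ws'" using ws'(1) r m by simp
        have "S A (N @ \<up> # \<down> # C1) ws'" using less.hyps[of A "N @ \<up> # \<down> # C1" ws'] d f r m by simp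
        then have "S A C (ws' @ [(A1, RNeg, C1)])" using right[OF f] r m by simp
        then show ?thesis using weq[of A C ws] ws'(2) Y by simp
      next
        case o
        then show ?thesis using overlap_right[OF o(1), of A C1 ws] less by auto
      next
        case i
        then show ?thesis using D by blast
      qed
    qed
  qed
qed

text \<open>The conclusion is a predicate \<open>Q\<close> instead of \<open>fam\<close> because a
  cap leads only to a linear combination of members of the family. \<open>Q\<close> has to be stable
  under equality up to sign and under mixed crossings.\<close>

lemma fam_closure:
  assumes "fam (A @ D @ C) ws"
    and v: "gdiag D D' v"
    and D: "\<And>M N. D \<noteq> M @ \<down> # \<up> # N"
    and Q_weq: "\<And>Y ws vs. weq [] Y ws vs \<Longrightarrow> Q Y vs \<Longrightarrow> Q Y ws"
    and Q_rneg: "\<And>A C ws. Q (A @ \<up> # \<down> # C) ws \<Longrightarrow> Q (A @ \<down> # \<up> # C) (ws @ [(A, RNeg, C)])"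
    and sorted: "\<And>A C a x. A @ D @ C = ups a @ dns a \<Longrightarrow> upword a x \<Longrightarrow> Q (A @ D' @ C) (nest a @ sh [] (dns a) x @ sh A C v)"
    and overlap_left: "\<And>A C E ws. D @ C = \<up> # E \<Longrightarrow> fam (A @ \<down> # D @ C) ws \<Longrightarrow>
      (\<And>A' C' w. descents (A' @ D @ C') < descents (A @ \<down> # D @ C) \<Longrightarrow> fam (A' @ D @ C') w \<Longrightarrow> Q (A' @ D' @ C') (w @ sh A' C' v)) \<Longrightarrow>
      Q (A @ \<down> # D' @ C) (ws @ sh (A @ [\<down>]) C v)"
    and overlap_right: "\<And>A C E ws. D = E @ [\<down>] \<Longrightarrow> fam (A @ D @ \<up> # C) ws \<Longrightarrow>
      (\<And>A' C' w. descents (A' @ D @ C') < descents (A @ D @ \<up> # C) \<Longrightarrow> fam (A' @ D @ C') w \<Longrightarrow> Q (A' @ D' @ C') (w @ sh A' C' v)) \<Longrightarrow>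
      Q (A @ D' @ \<up> # C) (ws @ sh A (\<up> # C) v)"
  shows "Q (A @ D' @ C) (ws @ sh A C v)"
  using assms(1) D
proof (rule fam_induct[where S = "\<lambda>A C ws. Q (A @ D' @ C) (ws @ sh A C v)"], goal_cases)
  case (1 A C ws vs)
  show ?case by (rule Q_weq[OF weq_app[OF 1(1) gdiag_sh[OF v]] 1(2)])
next
  case (2 A M C ws)
  have vC: "gdiag (D @ C) (D' @ C) (sh [] C v)" using gdiag_sh[OF v, of "[]" C] by simp
  have "weq (A @ \<up> # \<down> # M @ D @ C) (A @ \<down> # \<up> # M @ D' @ C)
      ((A, RNeg, M @ D @ C) # sh (A @ \<down> # \<up> # M) C v) (sh (A @ \<up> # \<down> # M) C v @ [(A, RNeg, M @ D' @ C)])"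
    using weq_comm_layer[OF vC, of A RNeg M] by simp
  then have "weq [] (A @ \<down> # \<up> # M @ D' @ C) (ws @ (A, RNeg, M @ D @ C) # sh (A @ \<down> # \<up> # M) C v)
      ((ws @ sh (A @ \<up> # \<down> # M) C v) @ [(A, RNeg, M @ D' @ C)])"
    using weq_pre[OF _ fam_gdiag[OF 2(1)]] by simp
  from Q_weq[OF this Q_rneg[of A "M @ D' @ C"]] 2(2) show ?case by simp
next
  case (3 A M C ws)
  have Av: "gdiag (A @ D) (A @ D') (sh A [] v)" using gdiag_sh[OF v, of A "[]"] by simp
  have "weq (A @ D @ M @ \<up> # \<down> # C) (A @ D' @ M @ \<down> # \<up> # C)
      ((A @ D @ M, RNeg, C) # sh A (M @ \<down> # \<up> # C) v) (sh A (M @ \<up> # \<down> # C) v @ [(A @ D' @ M, RNeg, C)])"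
    using weq_comm'[OF Av, of "M @ \<up> # \<down> # C" "M @ \<down> # \<up> # C" "[(M, RNeg, C)]"] by simp
  then have "weq [] (A @ D' @ M @ \<down> # \<up> # C) (ws @ (A @ D @ M, RNeg, C) # sh A (M @ \<down> # \<up> # C) v)
      ((ws @ sh A (M @ \<up> # \<down> # C) v) @ [(A @ D' @ M, RNeg, C)])"
    using weq_pre[OF _ fam_gdiag[OF 3(1)]] by simp
  from Q_weq[OF this Q_rneg[of "A @ D' @ M" C, simplified]] 3(2) show ?case by simp
next
  case (4 A C a x)
  then show ?case using sorted by simp
next
  case (5 A C E ws)
  then show ?case using overlap_left[of C E A ws] by simp
next
  case (6 A C E ws)
  then show ?case using overlap_right[of E A C ws] by simp
qed

lemma fam_base_append:
  "upword a x \<Longrightarrow> upword a y \<Longrightarrow> fam (ups a @ dns a) (nest a @ sh [] (dns a) x @ sh [] (dns a) y)"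
  using fam.base[OF upword_append, of a x y] by simp

text \<open>On a sorted object the token joins the layers of upward strands. The only overlap is
  with a mixed crossing on the strand of the token, and the token slides through it.
  \<open>fam_U\<close> is the same with two mixed crossings.\<close>

lemma fam_Clif:
  assumes "fam (A @ \<up> # C) ws"
  shows "fam (A @ \<up> # C) (ws @ [(A, Clif, C)])"
proof -
  have "fam (A @ [\<up>] @ C) (ws @ sh A C [([], Clif, [])])"
  proof (rule fam_closure[where Q = fam])
    show "fam (A @ [\<up>] @ C) ws" using assms by simp
    show "[\<up>] \<noteq> M @ \<down> # \<up> # N" for M N by (cases M) auto
    show "fam Y ws" if "weq [] Y ws vs" "fam Y vs" for Y ws vs using fam.weq[OF that(2,1)] .
    show "fam (A @ [\<up>] @ C) (nest a @ sh [] (dns a) x @ sh A C [([], Clif, [])])"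
      if A: "A @ [\<up>] @ C = ups a @ dns a" and x: "upword a x" for A C a x
    proof -
      obtain i j where ij: "A = ups i" "C = ups j @ dns a" "a = Suc (i + j)" using sorted_split_up[of A C a a] A by auto
      have y: "upword a [(ups i, Clif, ups j)]"
        unfolding upword_def ij(3) by (simp add: replicate_add replicate_app_Cons_same)
      show ?thesis using fam_base_append[OF x y] unfolding A unfolding ij(1,2) by simp
    qed
    show "fam (A @ \<down> # [\<up>] @ C) (ws @ sh (A @ [\<down>]) C [([], Clif, [])])"
      if f: "fam (A @ \<down> # [\<up>] @ C) ws"
        and IH: "\<And>A' C' w. descents (A' @ [\<up>] @ C') < descents (A @ \<down> # [\<up>] @ C) \<Longrightarrow> fam (A' @ [\<up>] @ C') w \<Longrightarrow>
          fam (A' @ [\<up>] @ C') (w @ sh A' C' [([], Clif, [])])" for A C ws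
    proof -
      obtain v where v: "fam (A @ \<up> # \<down> # C) v" "weq [] (A @ \<down> # \<up> # C) ws (v @ [(A, RNeg, C)])"
        using fam_inv[OF f] by auto
      have "fam (A @ \<up> # \<down> # C) (v @ [(A, Clif, \<down> # C)])"
        using IH[of A "\<down> # C" v] v(1) descents_swap[of A C] by simp
      from fam.rneg[OF this] have *: "fam (A @ \<down> # \<up> # C) (v @ [(A, Clif, \<down> # C), (A, RNeg, C)])" by simp
      have "weq [] (A @ \<down> # \<up> # C) (ws @ [(A @ [\<down>], Clif, C)]) (v @ [(A, RNeg, C), (A @ [\<down>], Clif, C)])"
        using weq_app[OF v(2), of _ "[(A @ [\<down>], Clif, C)]"] by simp
      also have "weq [] (A @ \<down> # \<up> # C) (v @ [(A, RNeg, C), (A @ [\<down>], Clif, C)]) (v @ [(A, Clif, \<down> # C), (A, RNeg, C)])"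
        by (rule weq_ctx'[OF slide_clif, of _ A C v _ "[]"]) (simp_all add: fam_gdiag[OF v(1)])
      finally show ?thesis using fam.weq[OF *] by simp
    qed
  qed (auto intro: fam.rneg)
  then show ?thesis by simp
qed

lemma slide_ups': "g \<in> {UPos, UNeg} \<Longrightarrow> weq [\<up>, \<up>, \<down>] [\<down>, \<up>, \<up>]
    [([\<up>], RNeg, []), ([], RNeg, [\<up>]), ([\<down>], g, [])] [([], g, [\<down>]), ([\<up>], RNeg, []), ([], RNeg, [\<up>])]"
  using slide_ups slide_ups_neg by auto

lemma fam_U:
  assumes "fam (A @ \<up> # \<up> # C) ws" and g: "g \<in> {UPos, UNeg}"
  shows "fam (A @ \<up> # \<up> # C) (ws @ [(A, g, C)])"
proof -
  have g': "gdom g = [\<up>, \<up>]" "gcod g = [\<up>, \<up>]" using g by auto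
  have "fam (A @ [\<up>, \<up>] @ C) (ws @ sh A C [([], g, [])])"
  proof (rule fam_closure[where Q = fam])
    show "fam (A @ [\<up>, \<up>] @ C) ws" using assms by simp
    show "gdiag [\<up>, \<up>] [\<up>, \<up>] [([], g, [])]" using g' by simp
    show "[\<up>, \<up>] \<noteq> M @ \<down> # \<up> # N" for M N by (cases M) (auto simp: Cons_eq_append_conv)
    show "fam Y ws" if "weq [] Y ws vs" "fam Y vs" for Y ws vs using fam.weq[OF that(2,1)] .
    show "fam (A @ [\<up>, \<up>] @ C) (nest a @ sh [] (dns a) x @ sh A C [([], g, [])])"
      if A: "A @ [\<up>, \<up>] @ C = ups a @ dns a" and x: "upword a x" for A C a x
    proof -
      obtain i j where ij: "A = ups i" "\<up> # C = ups j @ dns a" "a = Suc (i + j)" using sorted_split_up[of A "\<up> # C" a a] A by auto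
      then obtain l where l: "j = Suc l" "C = ups l @ dns a" by (cases j; cases a) auto
      have y: "upword a [(ups i, g, ups l)]"
        unfolding upword_def ij(3) l using g g' by (auto simp: replicate_add replicate_app_Cons_same)
      show ?thesis using fam_base_append[OF x y] unfolding A unfolding ij(1) l(2) by simp
    qed
    show "fam (A @ \<down> # [\<up>, \<up>] @ C) (ws @ sh (A @ [\<down>]) C [([], g, [])])"
      if f: "fam (A @ \<down> # [\<up>, \<up>] @ C) ws"
        and IH: "\<And>A' C' w. descents (A' @ [\<up>, \<up>] @ C') < descents (A @ \<down> # [\<up>, \<up>] @ C) \<Longrightarrow> fam (A' @ [\<up>, \<up>] @ C') w \<Longrightarrow>
          fam (A' @ [\<up>, \<up>] @ C') (w @ sh A' C' [([], g, [])])" for A C ws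
    proof -
      obtain v where v: "fam (A @ \<up> # \<down> # \<up> # C) v" "weq [] (A @ \<down> # \<up> # \<up> # C) ws (v @ [(A, RNeg, \<up> # C)])"
        using fam_inv[OF f, of A "\<up> # C"] by auto
      obtain u where u: "fam (A @ \<up> # \<up> # \<down> # C) u" "weq [] (A @ \<up> # \<down> # \<up> # C) v (u @ [(A @ [\<up>], RNeg, C)])"
        using fam_inv[OF v(1), of "A @ [\<up>]" C] by auto
      have "fam (A @ \<up> # \<up> # \<down> # C) (u @ [(A, g, \<down> # C)])"
        using IH[of A "\<down> # C" u] u(1) descents_swap[of "A @ [\<up>]" C] descents_swap[of A "\<up> # C"] by simp
      then have "fam (A @ \<up> # \<down> # \<up> # C) (u @ [(A, g, \<down> # C), (A @ [\<up>], RNeg, C)])"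
        using fam.rneg[of "A @ [\<up>]" C "u @ [(A, g, \<down> # C)]"] by simp
      from fam.rneg[OF this] have *: "fam (A @ \<down> # \<up> # \<up> # C) (u @ [(A, g, \<down> # C), (A @ [\<up>], RNeg, C), (A, RNeg, \<up> # C)])" by simp
      have "weq [] (A @ \<down> # \<up> # \<up> # C) (ws @ [(A @ [\<down>], g, C)]) (v @ [(A, RNeg, \<up> # C), (A @ [\<down>], g, C)])"
        using weq_app[OF v(2), of _ "[(A @ [\<down>], g, C)]"] g' by simp
      also have "weq [] (A @ \<down> # \<up> # \<up> # C) (v @ [(A, RNeg, \<up> # C), (A @ [\<down>], g, C)])
          (u @ [(A @ [\<up>], RNeg, C), (A, RNeg, \<up> # C), (A @ [\<down>], g, C)])"
        using weq_app[OF u(2), of _ "[(A, RNeg, \<up> # C), (A @ [\<down>], g, C)]"] g' by simp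
      also have "weq [] (A @ \<down> # \<up> # \<up> # C) (u @ [(A @ [\<up>], RNeg, C), (A, RNeg, \<up> # C), (A @ [\<down>], g, C)])
          (u @ [(A, g, \<down> # C), (A @ [\<up>], RNeg, C), (A, RNeg, \<up> # C)])"
        by (rule weq_ctx'[OF slide_ups'[OF g], of _ A C u _ "[]"]) (simp_all add: fam_gdiag[OF u(1)])
      finally show ?thesis using fam.weq[OF *] by simp
    qed
  qed (auto intro: fam.rneg)
  then show ?thesis by simp
qed

text \<open>The parameter \<open>i\<close> is the number of cups inside the two whose legs cross.
  For \<open>i = 0\<close> the claim is \<open>nested_cups_dw\<close>, and a further inner cup
  commutes with both crossings.\<close>

lemma nest_dw: "weq [] (ups (2 + i + j) @ dns (2 + i + j)) (nest (2 + i + j) @ sh (ups (2 + i + j) @ dns i) (dns j) dw)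
    (nest (2 + i + j) @ [(ups j, UPos, ups i @ dns (2 + i + j))])"
proof (induction i)
  case 0
  show ?case
    using weq_ctx'[OF nested_cups_dw, of "[]" "ups j" "dns j" "nest j" _ "[]"] gdiag_nest[of j]
    by (simp add: replicate_app_Cons_same)
next
  case (Suc i)
  define a where "a = 2 + i + j"
  have IH: "weq [] (ups a @ dns a) (nest a @ sh (ups a @ dns i) (dns j) dw) (nest a @ [(ups j, UPos, ups i @ dns a)])"
    using Suc unfolding a_def .
  let ?Y = "ups (Suc a) @ dns (Suc a)"
  have d: "dns a = dns i @ [\<down>, \<down>] @ dns j" and u: "ups a = ups j @ [\<up>, \<up>] @ ups i"
    unfolding a_def by (simp_all add: replicate_add replicate_app_Cons_same) (simp add: replicate_add[symmetric] add.commute)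
  have v: "gdiag (dns a) (dns a) (sh (dns i) (dns j) dw)"
    by (rule gdiag_sh'[OF gdiag_dw]) (simp_all add: d)
  have "weq (ups a @ dns a) ?Y ((ups a, CupL, dns a) # sh (ups (Suc a) @ dns (Suc i)) (dns j) dw)
      (sh (ups a @ dns i) (dns j) dw @ [(ups a, CupL, dns a)])"
    using weq_comm_layer[OF v, of "ups a" CupL "[]"] by (simp add: replicate_app_Cons_same)
  from weq_pre[OF this gdiag_nest] have "weq [] ?Y (nest (Suc a) @ sh (ups (Suc a) @ dns (Suc i)) (dns j) dw)
      (nest a @ sh (ups a @ dns i) (dns j) dw @ [(ups a, CupL, dns a)])" by simp
  also have "weq [] ?Y (nest a @ sh (ups a @ dns i) (dns j) dw @ [(ups a, CupL, dns a)])
      (nest a @ [(ups j, UPos, ups i @ dns a), (ups a, CupL, dns a)])"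
    using weq_app[OF IH, of ?Y "[(ups a, CupL, dns a)]"] by (simp add: replicate_app_Cons_same)
  also have "weq [] ?Y (nest a @ [(ups j, UPos, ups i @ dns a), (ups a, CupL, dns a)])
      (nest (Suc a) @ [(ups j, UPos, ups (Suc i) @ dns (Suc a))])"
  proof -
    have "weq (ups a @ dns a) ?Y [(ups j, UPos, ups i @ dns a), (ups a, CupL, dns a)]
        [(ups a, CupL, dns a), (ups j, UPos, ups (Suc i) @ dns (Suc a))]"
      using weq_comm1[of "ups j" UPos "ups i" CupL "dns a"] u by (simp add: replicate_app_Cons_same)
    from weq_pre[OF this gdiag_nest] show ?thesis by simp
  qed
  finally show ?case unfolding a_def by simp
qed

lemma nest_dw_comm:
  assumes "upword a y" "a = 2 + i + j"
  shows "weq [] (ups a @ dns a) (nest a @ sh [] (dns a) y @ sh (ups a @ dns i) (dns j) dw)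
    (nest a @ (ups j, UPos, ups i @ dns a) # sh [] (dns a) y)"
proof -
  have d: "dns a = dns i @ [\<down>, \<down>] @ dns j" and u: "ups a = ups j @ [\<up>, \<up>] @ ups i"
    unfolding assms(2) by (simp_all add: replicate_add replicate_app_Cons_same) (simp add: replicate_add[symmetric] add.commute)
  have v: "gdiag (dns a) (dns a) (sh (dns i) (dns j) dw)" by (rule gdiag_sh'[OF gdiag_dw]) (simp_all add: d)
  have y: "gdiag (ups a @ dns a) (ups a @ dns a) (sh [] (dns a) y)" using gdiag_sh[OF upword_gdiag[OF assms(1)], of "[]"] by simp
  have "weq [] (ups a @ dns a) (nest a @ sh [] (dns a) y @ sh (ups a @ dns i) (dns j) dw)
      (nest a @ sh (ups a @ dns i) (dns j) dw @ sh [] (dns a) y)"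
    using weq_pre[OF weq_comm[OF upword_gdiag[OF assms(1)] v] gdiag_nest] by simp
  also have "weq [] (ups a @ dns a) (nest a @ sh (ups a @ dns i) (dns j) dw @ sh [] (dns a) y)
      (nest a @ (ups j, UPos, ups i @ dns a) # sh [] (dns a) y)"
    using weq_app[OF nest_dw[of i j, folded assms(2)] y] by simp
  finally show ?thesis .
qed

lemma sorted_split_downs:
  assumes "A @ [\<down>, \<down>] @ C = ups a @ dns a"
  obtains i j where "A = ups a @ dns i" "C = dns j" "a = 2 + i + j"
proof -
  obtain i j where ij: "A = ups a @ dns i" "\<down> # C = dns j" "a = Suc (i + j)"
    using sorted_split_down[of A "\<down> # C" a a] assms by auto
  then obtain l where "j = Suc l" "C = dns l" by (cases j) auto
  then show thesis using that ij by simp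
qed

lemma upword_single: "g \<in> {UPos, UNeg} \<Longrightarrow> upword (2 + i + j) [(ups j, g, ups i)]"
  by (auto simp: upword_def replicate_add replicate_app_Cons_same)
    (simp_all add: replicate_add[symmetric] add.commute)

lemma fam_RNeg_RNeg:
  assumes "fam (A @ \<down> # \<down> # \<up> # C) ws"
  shows "\<exists>u. fam (A @ \<up> # \<down> # \<down> # C) u \<and> weq [] (A @ \<down> # \<down> # \<up> # C) ws (u @ [(A, RNeg, \<down> # C), (A @ [\<down>], RNeg, C)])"
proof -
  obtain v where v: "fam (A @ \<down> # \<up> # \<down> # C) v" "weq [] (A @ \<down> # \<down> # \<up> # C) ws (v @ [(A @ [\<down>], RNeg, C)])"
    using fam_inv[OF assms, of "A @ [\<down>]" C] by auto
  obtain u where u: "fam (A @ \<up> # \<down> # \<down> # C) u" "weq [] (A @ \<down> # \<up> # \<down> # C) v (u @ [(A, RNeg, \<down> # C)])"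
    using fam_inv[OF v(1), of A "\<down> # C"] by auto
  from weq_app[OF u(2), of "A @ \<down> # \<down> # \<up> # C" "[(A @ [\<down>], RNeg, C)]"]
  show ?thesis using weq_trans[OF v(2)] u(1) by auto
qed

lemma descents_RNeg_RNeg: "descents (A @ \<up> # \<down> # \<down> # C) < descents (A @ \<down> # \<down> # \<up> # C)"
  using descents_swap[of "A @ [\<down>]" C] descents_swap[of A "\<down> # C"] by simp

lemma fam_RNeg_RNegI:
  assumes "fam (A @ \<up> # \<down> # \<down> # C) u"
  shows "fam (A @ \<down> # \<down> # \<up> # C) (u @ [(A, RNeg, \<down> # C), (A @ [\<down>], RNeg, C)])"
  using fam.rneg[of "A @ [\<down>]" C "u @ [(A, RNeg, \<down> # C)]"] fam.rneg[OF assms] by simp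

text \<open>On a sorted object \<open>nest_dw_comm\<close> carries the crossing over to the upward
  strands. The only overlap is with an \<open>\<up>\<close> on the right, whose two mixed crossings
  it passes by \<open>slide_dw\<close>.\<close>

lemma fam_dw:
  assumes "fam (A @ \<down> # \<down> # C) ws"
  shows "fam (A @ \<down> # \<down> # C) (ws @ sh A C dw)"
proof -
  have "fam (A @ [\<down>, \<down>] @ C) (ws @ sh A C dw)"
  proof (rule fam_closure[where Q = fam])
    show "fam (A @ [\<down>, \<down>] @ C) ws" using assms by simp
    show "[\<down>, \<down>] \<noteq> M @ \<down> # \<up> # N" for M N by (cases M) (auto simp: Cons_eq_append_conv)
    show "fam Y ws" if "weq [] Y ws vs" "fam Y vs" for Y ws vs using fam.weq[OF that(2,1)] .
    show "fam (A @ [\<down>, \<down>] @ C) (nest a @ sh [] (dns a) x @ sh A C dw)"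
      if A: "A @ [\<down>, \<down>] @ C = ups a @ dns a" and x: "upword a x" for A C a x
    proof -
      obtain i j where ij: "A = ups a @ dns i" "C = dns j" "a = 2 + i + j" using sorted_split_downs[OF A] .
      have y: "upword a [(ups j, UPos, ups i)]" unfolding ij(3) by (rule upword_single) simp
      have "fam (ups a @ dns a) (nest a @ (ups j, UPos, ups i @ dns a) # sh [] (dns a) x)"
        using fam_base_append[OF y x] by simp
      from fam.weq[OF this nest_dw_comm[OF x ij(3)]] show ?thesis unfolding A unfolding ij(1,2) .
    qed
    show "fam (A @ [\<down>, \<down>] @ \<up> # C) (ws @ sh A (\<up> # C) dw)"
      if f: "fam (A @ [\<down>, \<down>] @ \<up> # C) ws"
        and IH: "\<And>A' C' w. descents (A' @ [\<down>, \<down>] @ C') < descents (A @ [\<down>, \<down>] @ \<up> # C) \<Longrightarrow> fam (A' @ [\<down>, \<down>] @ C') w \<Longrightarrow>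
          fam (A' @ [\<down>, \<down>] @ C') (w @ sh A' C' dw)" for A C ws
    proof -
      let ?Y = "A @ \<down> # \<down> # \<up> # C"
      obtain u where u: "fam (A @ \<up> # \<down> # \<down> # C) u" "weq [] ?Y ws (u @ [(A, RNeg, \<down> # C), (A @ [\<down>], RNeg, C)])"
        using fam_RNeg_RNeg[of A C ws] f by auto
      have "fam (A @ \<up> # \<down> # \<down> # C) (u @ sh (A @ [\<up>]) C dw)"
        using IH[of "A @ [\<up>]" C u] u(1) descents_RNeg_RNeg[of A C] by simp
      from fam_RNeg_RNegI[OF this] have *: "fam ?Y (u @ sh (A @ [\<up>]) C dw @ [(A, RNeg, \<down> # C), (A @ [\<down>], RNeg, C)])" by simp
      have "weq [] ?Y (ws @ sh A (\<up> # C) dw) (u @ [(A, RNeg, \<down> # C), (A @ [\<down>], RNeg, C)] @ sh A (\<up> # C) dw)"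
        using weq_app[OF u(2), of _ "sh A (\<up> # C) dw"] by simp
      also have "weq [] ?Y (u @ [(A, RNeg, \<down> # C), (A @ [\<down>], RNeg, C)] @ sh A (\<up> # C) dw)
          (u @ sh (A @ [\<up>]) C dw @ [(A, RNeg, \<down> # C), (A @ [\<down>], RNeg, C)])"
        by (rule weq_ctx'[OF slide_dw, of _ A C u _ "[]"]) (simp_all add: fam_gdiag[OF u(1)])
      finally show ?thesis using fam.weq[OF *] by simp
    qed
  qed (auto intro: fam.rneg)
  then show ?thesis by simp
qed

text \<open>The induction of \<open>fam_dw\<close> read backwards, with \<open>UNeg\<close> for
  \<open>UPos\<close> on sorted objects. It produces a crossing of downward strands on demand, which
  a right cap can then absorb by \<open>cap_R_dw\<close>.\<close>

lemma fam_dw_inv: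
  assumes "fam (A @ \<down> # \<down> # C) ws"
  shows "\<exists>w. fam (A @ \<down> # \<down> # C) w \<and> weq [] (A @ \<down> # \<down> # C) ws (w @ sh A C dw)"
proof -
  have "\<exists>w. fam (A @ [\<down>, \<down>] @ C) w \<and> weq [] (A @ [\<down>, \<down>] @ C) ws (w @ sh A C dw)"
  proof (rule fam_induct[where D = "[\<down>, \<down>]"
        and S = "\<lambda>A C ws. \<exists>w. fam (A @ [\<down>, \<down>] @ C) w \<and> weq [] (A @ [\<down>, \<down>] @ C) ws (w @ sh A C dw)"])
    show "fam (A @ [\<down>, \<down>] @ C) ws" using assms by simp
    show "[\<down>, \<down>] \<noteq> M @ \<down> # \<up> # N" for M N by (cases M) (auto simp: Cons_eq_append_conv)
    show "\<exists>w. fam (A @ [\<down>, \<down>] @ C) w \<and> weq [] (A @ [\<down>, \<down>] @ C) ws (w @ sh A C dw)"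
      if "weq [] (A @ [\<down>, \<down>] @ C) ws vs" "\<exists>w. fam (A @ [\<down>, \<down>] @ C) w \<and> weq [] (A @ [\<down>, \<down>] @ C) vs (w @ sh A C dw)" for A C ws vs
      using that weq_trans by blast
    show "\<exists>w. fam ((A @ \<down> # \<up> # M) @ [\<down>, \<down>] @ C) w \<and>
        weq [] ((A @ \<down> # \<up> # M) @ [\<down>, \<down>] @ C) (ws @ [(A, RNeg, M @ [\<down>, \<down>] @ C)]) (w @ sh (A @ \<down> # \<up> # M) C dw)"
      if ex: "\<exists>w. fam ((A @ \<up> # \<down> # M) @ [\<down>, \<down>] @ C) w \<and> weq [] ((A @ \<up> # \<down> # M) @ [\<down>, \<down>] @ C) ws (w @ sh (A @ \<up> # \<down> # M) C dw)"
      for A M C ws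
    proof -
      obtain w where w: "fam (A @ \<up> # \<down> # M @ [\<down>, \<down>] @ C) w"
          "weq [] (A @ \<up> # \<down> # M @ [\<down>, \<down>] @ C) ws (w @ sh (A @ \<up> # \<down> # M) C dw)" using ex by auto
      have vC: "gdiag ([\<down>, \<down>] @ C) ([\<down>, \<down>] @ C) (sh [] C dw)" using gdiag_sh[OF gdiag_dw, of "[]" C] by simp
      let ?Y = "A @ \<down> # \<up> # M @ [\<down>, \<down>] @ C"
      have "weq [] ?Y (ws @ [(A, RNeg, M @ [\<down>, \<down>] @ C)]) (w @ sh (A @ \<up> # \<down> # M) C dw @ [(A, RNeg, M @ [\<down>, \<down>] @ C)])"
        using weq_app[OF w(2), of ?Y "[(A, RNeg, M @ [\<down>, \<down>] @ C)]"] by simp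
      also have "weq [] ?Y (w @ sh (A @ \<up> # \<down> # M) C dw @ [(A, RNeg, M @ [\<down>, \<down>] @ C)])
          ((w @ [(A, RNeg, M @ [\<down>, \<down>] @ C)]) @ sh (A @ \<down> # \<up> # M) C dw)"
        using weq_pre[OF weq_sym[OF weq_comm_layer[OF vC, of A RNeg M]], of "[]" w] fam_gdiag[OF w(1)] by simp
      finally show ?thesis using fam.rneg[OF w(1)] by auto
    qed
    show "\<exists>w. fam (A @ [\<down>, \<down>] @ M @ \<down> # \<up> # C) w \<and>
        weq [] (A @ [\<down>, \<down>] @ M @ \<down> # \<up> # C) (ws @ [(A @ [\<down>, \<down>] @ M, RNeg, C)]) (w @ sh A (M @ \<down> # \<up> # C) dw)"
      if ex: "\<exists>w. fam (A @ [\<down>, \<down>] @ M @ \<up> # \<down> # C) w \<and> weq [] (A @ [\<down>, \<down>] @ M @ \<up> # \<down> # C) ws (w @ sh A (M @ \<up> # \<down> # C) dw)"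
      for A M C ws
    proof -
      obtain w where w: "fam ((A @ [\<down>, \<down>] @ M) @ \<up> # \<down> # C) w"
          "weq [] (A @ [\<down>, \<down>] @ M @ \<up> # \<down> # C) ws (w @ sh A (M @ \<up> # \<down> # C) dw)" using ex by auto
      have Av: "gdiag (A @ [\<down>, \<down>]) (A @ [\<down>, \<down>]) (sh A [] dw)" using gdiag_sh[OF gdiag_dw, of A "[]"] by simp
      let ?Y = "A @ [\<down>, \<down>] @ M @ \<down> # \<up> # C"
      have "weq [] ?Y (ws @ [(A @ [\<down>, \<down>] @ M, RNeg, C)]) (w @ sh A (M @ \<up> # \<down> # C) dw @ [(A @ [\<down>, \<down>] @ M, RNeg, C)])"
        using weq_app[OF w(2), of ?Y "[(A @ [\<down>, \<down>] @ M, RNeg, C)]"] by simp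
      also have "weq [] ?Y (w @ sh A (M @ \<up> # \<down> # C) dw @ [(A @ [\<down>, \<down>] @ M, RNeg, C)])
          ((w @ [(A @ [\<down>, \<down>] @ M, RNeg, C)]) @ sh A (M @ \<down> # \<up> # C) dw)"
        using weq_pre[OF weq_comm[OF Av, of "M @ \<up> # \<down> # C" "M @ \<down> # \<up> # C" "[(M, RNeg, C)]"], of "[]" w] fam_gdiag[OF w(1)] by simp
      finally show ?thesis using fam.rneg[OF w(1)] by auto
    qed
    show "\<exists>w. fam (A @ [\<down>, \<down>] @ C) w \<and> weq [] (A @ [\<down>, \<down>] @ C) (nest a @ sh [] (dns a) x) (w @ sh A C dw)"
      if A: "A @ [\<down>, \<down>] @ C = ups a @ dns a" and x: "upword a x" for A C a x
    proof -
      obtain i j where ij: "A = ups a @ dns i" "C = dns j" "a = 2 + i + j" using sorted_split_downs[OF A] .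
      have y: "upword a [(ups j, UNeg, ups i)]" unfolding ij(3) by (rule upword_single) simp
      let ?w = "nest a @ sh [] (dns a) ((ups j, UNeg, ups i) # x)"
      have yx: "upword a ((ups j, UNeg, ups i) # x)" using upword_append[OF y x] by simp
      have u: "ups a = ups j @ [\<up>, \<up>] @ ups i"
        unfolding ij(3) by (simp add: replicate_add replicate_app_Cons_same) (simp add: replicate_add[symmetric] add.commute)
      have "weq [] (ups a @ dns a) (?w @ sh (ups a @ dns i) (dns j) dw)
          (nest a @ (ups j, UPos, ups i @ dns a) # sh [] (dns a) ((ups j, UNeg, ups i) # x))"
        using nest_dw_comm[OF yx ij(3)] by simp
      also have "weq [] (ups a @ dns a) (nest a @ (ups j, UPos, ups i @ dns a) # sh [] (dns a) ((ups j, UNeg, ups i) # x))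
          (nest a @ sh [] (dns a) x)"
      proof (rule weq_ctx'[OF u_inv_word, of _ "ups j" "ups i @ dns a" "nest a" _ "sh [] (dns a) x"])
        show "gdiag [] (ups j @ [\<up>, \<up>] @ ups i @ dns a) (nest a)" using gdiag_nest[of a] by (simp add: u)
        show "gdiag (ups j @ [\<up>, \<up>] @ ups i @ dns a) (ups a @ dns a) (sh [] (dns a) x)"
          using gdiag_sh[OF upword_gdiag[OF x], of "[]" "dns a"] by (simp add: u)
      qed simp_all
      finally have "weq [] (ups a @ dns a) (nest a @ sh [] (dns a) x) (?w @ sh (ups a @ dns i) (dns j) dw)" by (rule weq_sym)
      then show ?thesis unfolding A unfolding ij(1,2) using fam.base[OF yx] by blast
    qed
    show "\<exists>w. fam (A @ [\<down>, \<down>] @ \<up> # C) w \<and> weq [] (A @ [\<down>, \<down>] @ \<up> # C) ws (w @ sh A (\<up> # C) dw)"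
      if f: "fam (A @ [\<down>, \<down>] @ \<up> # C) ws"
        and IH: "\<And>A' C' w. descents (A' @ [\<down>, \<down>] @ C') < descents (A @ [\<down>, \<down>] @ \<up> # C) \<Longrightarrow> fam (A' @ [\<down>, \<down>] @ C') w \<Longrightarrow>
          \<exists>v. fam (A' @ [\<down>, \<down>] @ C') v \<and> weq [] (A' @ [\<down>, \<down>] @ C') w (v @ sh A' C' dw)" for A C ws
    proof -
      let ?Y = "A @ \<down> # \<down> # \<up> # C" and ?R = "[(A, RNeg, \<down> # C), (A @ [\<down>], RNeg, C)]"
      obtain u where u: "fam (A @ \<up> # \<down> # \<down> # C) u" "weq [] ?Y ws (u @ ?R)"
        using fam_RNeg_RNeg[of A C ws] f by auto
      obtain w where w: "fam (A @ \<up> # \<down> # \<down> # C) w" "weq [] (A @ \<up> # \<down> # \<down> # C) u (w @ sh (A @ [\<up>]) C dw)"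
        using IH[of "A @ [\<up>]" C u] u(1) descents_RNeg_RNeg[of A C] by auto
      have "weq [] ?Y ws (u @ ?R)" by (rule u(2))
      also have "weq [] ?Y (u @ ?R) (w @ sh (A @ [\<up>]) C dw @ ?R)"
        using weq_app[OF w(2), of ?Y ?R] by simp
      also have "weq [] ?Y (w @ sh (A @ [\<up>]) C dw @ ?R) ((w @ ?R) @ sh A (\<up> # C) dw)"
        by (rule weq_ctx'[OF weq_sym[OF slide_dw], of _ A C w _ "[]"]) (simp_all add: fam_gdiag[OF w(1)])
      finally show ?thesis using fam_RNeg_RNegI[OF w(1)] by auto
    qed
  qed auto
  then show ?thesis by simp
qed

text \<open>The cup enters a sorted object in the middle, as a further nested cup, and is moved from
  there strand by strand, by \<open>up\<close> to the left and by \<open>down\<close> to the right.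
  A cup to be inserted into a descent is created to the right of the descent and moved by
  \<open>up\<close>.\<close>

lemma fam_cup:
  assumes "fam (A @ C) ws"
  shows "fam (A @ \<up> # \<down> # C) (ws @ [(A, CupL, C)])"
proof -
  have up: "fam (A @ \<up> # \<down> # \<up> # C) (ws @ [(A, CupL, \<up> # C)])"
    if f: "fam (A @ \<up> # C) ws" and IH: "fam (A @ \<up> # \<up> # \<down> # C) (ws @ [(A @ [\<up>], CupL, C)])" for A C ws
  proof -
    have "fam ((A @ [\<up>]) @ \<up> # \<down> # C) (ws @ [(A @ [\<up>], CupL, C), (A, UPos, \<down> # C)])"
      using fam_U[OF IH, of UPos] by simp
    from fam.rneg[OF this] have *: "fam (A @ \<up> # \<down> # \<up> # C) (ws @ [(A @ [\<up>], CupL, C), (A, UPos, \<down> # C), (A @ [\<up>], RNeg, C)])" by simp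
    show ?thesis
      by (rule fam.weq[OF * weq_ctx'[OF weq_sym[OF cup_past_up], of _ A C ws _ "[]"]]) (simp_all add: fam_gdiag[OF f])
  qed
  have down: "fam (A @ \<down> # \<up> # \<down> # C) (ws @ [(A @ [\<down>], CupL, C)])"
    if f: "fam (A @ \<down> # C) ws" and IH: "fam (A @ \<up> # \<down> # \<down> # C) (ws @ [(A, CupL, \<down> # C)])" for A C ws
  proof -
    have "fam (A @ \<up> # \<down> # \<down> # C) (ws @ (A, CupL, \<down> # C) # sh (A @ [\<up>]) C dw)"
      using fam_dw[of "A @ [\<up>]" C "ws @ [(A, CupL, \<down> # C)]"] IH by simp
    from fam.rneg[OF this] have *: "fam (A @ \<down> # \<up> # \<down> # C) (ws @ (A, CupL, \<down> # C) # sh (A @ [\<up>]) C dw @ [(A, RNeg, \<down> # C)])" by simp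
    show ?thesis
      by (rule fam.weq[OF * weq_ctx'[OF weq_sym[OF cup_past_down], of _ A C ws _ "[]"]]) (simp_all add: fam_gdiag[OF f])
  qed
  have "fam (A @ [\<up>, \<down>] @ C) (ws @ sh A C [([], CupL, [])])"
  proof (rule fam_closure[where Q = fam and D = "[]"])
    show "fam (A @ [] @ C) ws" using assms by simp
    show "fam Y ws" if "weq [] Y ws vs" "fam Y vs" for Y ws vs using fam.weq[OF that(2,1)] .
    show "fam (A @ [\<up>, \<down>] @ C) (nest a @ sh [] (dns a) x @ sh A C [([], CupL, [])])"
      if A: "A @ [] @ C = ups a @ dns a" and x: "upword a x" for A C a x
    proof -
      let ?w = "nest a @ sh [] (dns a) x"
      have w: "fam (ups a @ dns a) ?w" by (rule fam.base[OF x])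
      \<comment> \<open>The new cup is the innermost one; only \<open>x\<close> has to be moved
        above it.\<close>
      have mid: "fam (ups a @ \<up> # \<down> # dns a) (?w @ [(ups a, CupL, dns a)])"
      proof -
        have "fam (ups (Suc a) @ dns (Suc a)) (nest (Suc a) @ sh [] (dns (Suc a)) (sh [] [\<up>] x))"
          by (rule fam.base[OF upword_sh[OF x]])
        moreover have "weq [] (ups (Suc a) @ dns (Suc a)) (?w @ [(ups a, CupL, dns a)]) (nest (Suc a) @ sh [] (dns (Suc a)) (sh [] [\<up>] x))"
          using weq_pre[OF weq_comm[OF upword_gdiag[OF x], of "dns a" "\<up> # \<down> # dns a" "[([], CupL, dns a)]"] gdiag_nest[of a]]
          by (simp add: replicate_app_Cons_same)
        ultimately show ?thesis using fam.weq by (simp add: replicate_app_Cons_same)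
      qed
      have ups: "fam (ups i @ \<up> # \<down> # ups j @ dns a) (?w @ [(ups i, CupL, ups j @ dns a)])" if "a = i + j" for i j
        using that
      proof (induction j arbitrary: i)
        case (Suc j)
        have "fam (ups (Suc i) @ \<up> # \<down> # ups j @ dns a) (?w @ [(ups (Suc i), CupL, ups j @ dns a)])"
          using Suc.IH[of "Suc i"] Suc.prems by simp
        then have "fam (ups i @ \<up> # \<up> # \<down> # ups j @ dns a) (?w @ [(ups i @ [\<up>], CupL, ups j @ dns a)])"
          by (simp add: replicate_app_Cons_same)
        moreover have "fam (ups i @ \<up> # ups j @ dns a) ?w"
          using w Suc.prems by (simp add: replicate_add replicate_app_Cons_same)
        ultimately show ?case using up[of "ups i" "ups j @ dns a" ?w] by simp
      qed (use mid in simp)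
      have dns: "fam (ups a @ dns i @ \<up> # \<down> # dns j) (?w @ [(ups a @ dns i, CupL, dns j)])" if "a = i + j" for i j
        using that
      proof (induction i arbitrary: j)
        case (Suc i)
        have "fam (ups a @ dns i @ \<up> # \<down> # dns (Suc j)) (?w @ [(ups a @ dns i, CupL, dns (Suc j))])"
          using Suc.IH[of "Suc j"] Suc.prems by simp
        moreover have "fam (ups a @ dns i @ \<down> # dns j) ?w"
          using w Suc.prems by (simp add: replicate_add replicate_app_Cons_same)
        ultimately show ?case using down[of "ups a @ dns i" "dns j" ?w] by (simp add: replicate_app_Cons_same)
      qed (use mid in simp)
      have "(\<exists>i j. A = ups i \<and> C = ups j @ dns a \<and> a = i + j) \<or> (\<exists>i j. A = ups a @ dns i \<and> C = dns j \<and> a = i + j)"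
      proof (cases C)
        case Nil
        then have "A = ups a @ dns a" using A by simp
        then show ?thesis using Nil by (intro disjI2 exI[of _ a] exI[of _ 0]) simp
      next
        case (Cons c C')
        show ?thesis
        proof (cases c)
          case Up
          then obtain i j where "A = ups i" "C' = ups j @ dns a" "a = Suc (i + j)" using sorted_split_up[of A C' a a] A Cons by auto
          then show ?thesis using Cons Up by (intro disjI1 exI[of _ i] exI[of _ "Suc j"]) simp
        next
          case Down
          then obtain i j where "A = ups a @ dns i" "C' = dns j" "a = Suc (i + j)" using sorted_split_down[of A C' a a] A Cons by auto
          then show ?thesis using Cons Down by (intro disjI2 exI[of _ i] exI[of _ "Suc j"]) simp
        qed
      qed
      then show ?thesis using ups dns by auto
    qed
    show "fam (A @ \<down> # [\<up>, \<down>] @ C) (ws @ sh (A @ [\<down>]) C [([], CupL, [])])"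
      if C: "[] @ C = \<up> # B" and f: "fam (A @ \<down> # [] @ C) ws"
        and IH: "\<And>A' C' w. descents (A' @ [] @ C') < descents (A @ \<down> # [] @ C) \<Longrightarrow> fam (A' @ [] @ C') w \<Longrightarrow>
          fam (A' @ [\<up>, \<down>] @ C') (w @ sh A' C' [([], CupL, [])])" for A C B ws
    proof -
      have C': "C = \<up> # B" using C by simp
      obtain v where v: "fam (A @ \<up> # \<down> # B) v" "weq [] (A @ \<down> # \<up> # B) ws (v @ [(A, RNeg, B)])"
        using fam_inv[of "A @ \<down> # C" ws A B] f C' by auto
      have "fam (A @ \<up> # \<down> # \<up> # \<down> # B) (v @ [(A @ [\<up>, \<down>], CupL, B)])"
        using IH[of "A @ [\<up>, \<down>]" B v] v(1) descents_swap[of A B] C' by simp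
      from fam.rneg[OF this] have "fam (A @ \<down> # \<up> # \<up> # \<down> # B) (v @ [(A @ [\<up>, \<down>], CupL, B), (A, RNeg, \<up> # \<down> # B)])" by simp
      moreover have "weq [] (A @ \<down> # \<up> # \<up> # \<down> # B) (ws @ [(A @ [\<down>, \<up>], CupL, B)]) (v @ [(A @ [\<up>, \<down>], CupL, B), (A, RNeg, \<up> # \<down> # B)])"
        using weq_trans[OF weq_app[OF v(2), of "A @ \<down> # \<up> # \<up> # \<down> # B" "[(A @ [\<down>, \<up>], CupL, B)]"]]
          weq_pre[OF weq_comm1[of A RNeg "[]" CupL B], of "[]" v] fam_gdiag[OF v(1)] by simp
      ultimately have "fam (A @ \<down> # \<up> # \<up> # \<down> # B) (ws @ [(A @ [\<down>, \<up>], CupL, B)])" using fam.weq by blast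
      then show ?thesis using up[of "A @ [\<down>]" B ws] f C' by simp
    qed
  qed (auto intro: fam.rneg)
  then show ?thesis by simp
qed

end

section \<open>Coset decomposition of the Hecke-Clifford algebra\<close>

text \<open>
  \<open>tws b\<close> represents the \<open>2 (b + 1)\<close> cosets of the Hecke-Clifford algebra on the first \<open>b\<close> strands in
  the one on \<open>b + 1\<close> strands: a token at some position, or none, and then the strand at this position
  moves to the right end.
\<close>

fun tws :: "nat \<Rightarrow> gword list" where
  "tws 0 = [[], [([], Clif, [])]]"
| "tws (Suc b) = [] # [(ups (Suc b), Clif, [])] # map (\<lambda>t. sh [] [\<up>] t @ [(ups b, UPos, [])]) (tws b)"

lemma length_tws: "length (tws b) = 2 * Suc b"
  by (induction b) auto

lemma tws_Nil: "[] \<in> set (tws b)"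
  by (cases b) auto

lemma tws_Clif: "[(ups b, Clif, [])] \<in> set (tws b)"
  by (cases b) auto

lemma upword_Clif: "upword (Suc (i + j)) [(ups i, Clif, ups j)]"
  by (auto simp: upword_def replicate_add replicate_app_Cons_same)

lemma upword_UPos: "upword (Suc (Suc b)) [(ups b, UPos, [])]"
  by (auto simp: upword_def replicate_app_Cons_same)

lemma upword_tws: "t \<in> set (tws b) \<Longrightarrow> upword (Suc b) t"
proof (induction b arbitrary: t)
  case 0
  then show ?case by (auto simp: upword_def)
next
  case (Suc b)
  then consider "t = []" | "t = [(ups (Suc b), Clif, [])]" | t' where "t' \<in> set (tws b)" "t = sh [] [\<up>] t' @ [(ups b, UPos, [])]"
    by auto
  then show ?case
  proof cases
    case 1
    then show ?thesis by (simp add: upword_Nil)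
  next
    case 2
    then show ?thesis using upword_Clif[of "Suc b" 0] by simp
  next
    case 3
    show ?thesis unfolding 3(2) by (rule upword_append[OF upword_sh[OF Suc.IH[OF 3(1)]] upword_UPos])
  qed
qed

definition cosets :: "nat \<Rightarrow> gword set" where
  "cosets b = {t @ sh [] [\<up>] g |t g. t \<in> set (tws b) \<and> upword b g}"

lemma cosetsI: "t \<in> set (tws b) \<Longrightarrow> upword b g \<Longrightarrow> t @ sh [] [\<up>] g \<in> cosets b"
  by (auto simp: cosets_def)

lemma cosets_Nil: "upword b g \<Longrightarrow> sh [] [\<up>] g \<in> cosets b"
  using cosetsI[OF tws_Nil, of b g] by simp

lemma tws_cosets: "t \<in> set (tws b) \<Longrightarrow> t \<in> cosets b"
  using cosetsI[OF _ upword_Nil, of t b] by simp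

lemma upword_cosets: "s \<in> cosets b \<Longrightarrow> upword (Suc b) s"
  by (auto simp: cosets_def intro!: upword_append[OF upword_tws upword_sh])

lemma upword_letterE:
  assumes "upword (Suc (Suc b)) [p]"
  obtains p' where "upword (Suc b) [p']" "[p] = sh [] [\<up>] [p']"
    | "p = (ups (Suc b), Clif, [])" | g where "p = (ups b, g, [])" "g \<in> {UPos, UNeg}"
proof -
  obtain l g r where p: "p = (l, g, r)" by (cases p)
  have g: "g \<in> {UPos, UNeg, Clif}" and e: "l @ gdom g @ r = ups (Suc (Suc b))" using assms by (auto simp: upword_def p)
  have c: "gcod g = gdom g" using g by auto
  show thesis
  proof (cases r rule: rev_cases)
    case Nil
    have u: "ups (Suc (Suc b)) = ups b @ [\<up>, \<up>]" "ups (Suc (Suc b)) = ups (Suc b) @ [\<up>]"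
      by (simp_all add: replicate_app_Cons_same)
    show ?thesis
    proof (cases "g = Clif")
      case True
      then show ?thesis using that(2) e p Nil unfolding u(2) by simp
    next
      case False
      then show ?thesis using that(3)[of g] e g p Nil unfolding u(1) by auto
    qed
  next
    case (snoc r' x)
    have "ups (Suc (Suc b)) = ups (Suc b) @ [\<up>]" by (simp add: replicate_app_Cons_same)
    then have "(l @ gdom g @ r') @ [x] = ups (Suc b) @ [\<up>]" using e snoc by simp
    then have "x = \<up>" "l @ gdom g @ r' = ups (Suc b)" unfolding append1_eq_conv by blast+
    then have "upword (Suc b) [(l, g, r')]" "[p] = sh [] [\<up>] [(l, g, r')]"
      using g c by (auto simp: upword_def p snoc)
    then show ?thesis by (rule that(1))
  qed
qed

context cring_param
begin

lemma clif_slide_neg: "weq [\<up>, \<up>] [\<up>, \<up>] [([], UNeg, []), ([], Clif, [\<up>])] [([\<up>], Clif, []), ([], UNeg, [])]"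
  using slide_conjugate[of "[\<up>, \<up>]" "[([], UNeg, [])]" "[([], UPos, [])]" "[\<up>, \<up>]" "[([], Clif, [\<up>])]" "[([\<up>], Clif, [])]"]
    u_inv_word u_inv'_word clif_slide_word by simp

text \<open>The slide of a token from the lower right to the upper left is a relation of
  \<open>UNeg\<close>. So \<open>UPos\<close> is exchanged for \<open>UNeg\<close> and back, and
  each exchange costs a term without crossing.\<close>

lemma clif_right_UPos: "wspan [\<up>, \<up>] [\<up>, \<up>] {[([], UPos, []), ([], Clif, [\<up>])], [([], Clif, [\<up>])], [([\<up>], Clif, [])]}
    [([\<up>], Clif, []), ([], UPos, [])]"
proof (rule wspan_ctx'[OF skein_pos, of _ "[]" "[]" "[([\<up>], Clif, [])]" _ "[]"])
  let ?S = "{[([], UPos, []), ([], Clif, [\<up>])], [([], Clif, [\<up>])], [([\<up>], Clif, [])]} :: gword set"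
  have "wspan [\<up>, \<up>] [\<up>, \<up>] ?S [([], UNeg, []), ([], Clif, [\<up>])]"
    by (rule wspan_ctx'[OF skein_neg, of _ "[]" "[]" "[]" _ "[([], Clif, [\<up>])]"]) (auto intro: wspan_base)
  from wspan_weq[OF this weq_sym[OF clif_slide_neg]]
  show "wspan [\<up>, \<up>] [\<up>, \<up>] ?S ([([\<up>], Clif, [])] @ sh [] [] s @ [])" if "s \<in> {[([], UNeg, [])], []}" for s
    using that by (auto intro: wspan_base)
qed simp_all

lemma cosets_append:
  assumes "wspan (ups (Suc b)) (ups (Suc b)) (cosets b) w" "upword b g"
  shows "wspan (ups (Suc b)) (ups (Suc b)) (cosets b) (w @ sh [] [\<up>] g)"
proof (rule wspan_ctx'[OF assms(1), of _ "[]" "[]" "[]" _ "sh [] [\<up>] g"])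
  show "gdiag ([] @ ups (Suc b) @ []) (ups (Suc b)) (sh [] [\<up>] g)"
    using upword_gdiag[OF upword_sh[OF assms(2)]] by simp
  show "wspan (ups (Suc b)) (ups (Suc b)) (cosets b) ([] @ sh [] [] s @ sh [] [\<up>] g)"
    if "s \<in> cosets b" "gdiag (ups (Suc b)) (ups (Suc b)) s" for s
  proof -
    obtain t h where s: "s = t @ sh [] [\<up>] h" "t \<in> set (tws b)" "upword b h" using \<open>s \<in> cosets b\<close> by (auto simp: cosets_def)
    have "t @ sh [] [\<up>] (h @ g) \<in> cosets b" by (rule cosetsI[OF s(2) upword_append[OF s(3) assms(2)]])
    then show ?thesis using wspan_base[OF _ upword_gdiag[OF upword_cosets]] s(1) by simp
  qed
qed simp_all

lemma upword_comm_last: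
  assumes "upword b x" "gdom g = gcod g"
  shows "weq (ups b @ gdom g) (ups b @ gdom g) (sh [] (gdom g) x @ [(ups b, g, [])]) ((ups b, g, []) # sh [] (gdom g) x)"
  using weq_comm[OF upword_gdiag[OF assms(1)], of "gdom g" "gdom g" "[([], g, [])]"] assms(2) by simp

text \<open>The letter acts on \<open>t'\<close> by the induction hypothesis. What it leaves on the
  first \<open>b\<close> strands commutes with the crossing of the last two strands and joins the
  second factor of the coset.\<close>

lemma coset_letter_inner:
  assumes IH: "\<And>t. t \<in> set (tws b) \<Longrightarrow> wspan (ups (Suc b)) (ups (Suc b)) (cosets b) (p # t)"
    and p: "upword (Suc b) [p]" and t: "t \<in> set (tws (Suc b))"
  shows "wspan (ups (Suc (Suc b))) (ups (Suc (Suc b))) (cosets (Suc b)) (sh [] [\<up>] [p] @ t)"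
proof -
  let ?X = "ups (Suc (Suc b))"
  consider "t = []" | "t = [(ups (Suc b), Clif, [])]" | t' where "t' \<in> set (tws b)" "t = sh [] [\<up>] t' @ [(ups b, UPos, [])]"
    using t by auto
  then show ?thesis
  proof cases
    case 1
    then show ?thesis using wspan_base[OF cosets_Nil[OF p] upword_gdiag[OF upword_sh[OF p]]] by simp
  next
    case 2
    have c: "[(ups (Suc b), Clif, [])] @ sh [] [\<up>] [p] \<in> cosets (Suc b)" by (rule cosetsI[OF tws_Clif p])
    show ?thesis unfolding 2
      by (rule wspan_weq[OF wspan_base[OF c upword_gdiag[OF upword_cosets[OF c]]]])
        (use upword_comm_last[OF p, of Clif] in \<open>simp add: replicate_append_same\<close>)
  next
    case 3
    show ?thesis
    proof (rule wspan_ctx'[OF IH[OF 3(1)], of _ "[]" "[\<up>]" "[]" _ "[(ups b, UPos, [])]"])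
      show "wspan ?X ?X (cosets (Suc b)) ([] @ sh [] [\<up>] s @ [(ups b, UPos, [])])" if sc: "s \<in> cosets b" for s
      proof -
        obtain t h where s: "s = t @ sh [] [\<up>] h" "t \<in> set (tws b)" "upword b h" using sc by (auto simp: cosets_def)
        have T: "sh [] [\<up>] t @ [(ups b, UPos, [])] \<in> set (tws (Suc b))" using s(2) by simp
        have c: "(sh [] [\<up>] t @ [(ups b, UPos, [])]) @ sh [] [\<up>] (sh [] [\<up>] h) \<in> cosets (Suc b)"
          by (rule cosetsI[OF T upword_sh[OF s(3)]])
        have "weq ?X ?X (sh [] [\<up>] t @ (sh [] [\<up>, \<up>] h @ [(ups b, UPos, [])]))
            (sh [] [\<up>] t @ ((ups b, UPos, []) # sh [] [\<up>, \<up>] h))"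
          using weq_pre[OF upword_comm_last[OF s(3), of UPos, simplified] , of ?X "sh [] [\<up>] t"]
            upword_gdiag[OF upword_sh[OF upword_tws[OF s(2)]]] by (simp add: replicate_app_Cons_same)
        from wspan_weq[OF wspan_base[OF c upword_gdiag[OF upword_cosets[OF c]]]] this
        show ?thesis unfolding s(1) by simp
      qed
    next
      show "sh [] [\<up>] [p] @ t = [] @ sh [] [\<up>] (p # t') @ [(ups b, UPos, [])]" unfolding 3(2) by (simp add: sh_def)
    qed (simp_all add: replicate_app_Cons_same)
  qed
qed

text \<open>The token on the last strand commutes with \<open>t'\<close> and meets the final
  crossing from the right. Each of the three words of \<open>clif_right_UPos\<close> completes
  \<open>t'\<close> to a word in a coset.\<close>

lemma coset_letter_Clif:
  assumes t: "t \<in> set (tws (Suc b))"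
  shows "wspan (ups (Suc (Suc b))) (ups (Suc (Suc b))) (cosets (Suc b)) ((ups (Suc b), Clif, []) # t)"
proof -
  let ?X = "ups (Suc (Suc b))" and ?c = "(ups (Suc b), Clif, []) :: obj \<times> gen \<times> obj"
  have X: "?X = ups b @ [\<up>, \<up>]" "?X = ups (Suc b) @ [\<up>]" by (simp_all add: replicate_app_Cons_same replicate_append_same)
  have base: "wspan ?X ?X (cosets (Suc b)) s" if "s \<in> cosets (Suc b)" for s
    by (rule wspan_base[OF that upword_gdiag[OF upword_cosets[OF that]]])
  consider "t = []" | "t = [?c]" | t' where "t' \<in> set (tws b)" "t = sh [] [\<up>] t' @ [(ups b, UPos, [])]"
    using t by auto
  then show ?thesis
  proof cases
    case 1
    then show ?thesis using base[OF tws_cosets[OF tws_Clif]] by simp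
  next
    case 2
    have "weq ?X ?X [?c, ?c] []"
      by (rule weq_ctx'[OF clif_sq_word, of _ "ups (Suc b)" "[]" "[]" _ "[]"]) (simp_all add: replicate_append_same)
    then show ?thesis unfolding 2 by (rule wspan_weq[OF base[OF tws_cosets[OF tws_Nil]]])
  next
    case 3
    have t': "upword (Suc b) t'" by (rule upword_tws[OF 3(1)])
    have g: "gdiag ?X ?X (sh [] [\<up>] t')" by (rule upword_gdiag[OF upword_sh[OF t']])
    have cb: "upword (Suc b) [(ups b, Clif, [])]" using upword_Clif[of b 0] by simp
    have comm: "weq ?X ?X (sh [] [\<up>] t' @ [?c]) (?c # sh [] [\<up>] t')"
      using upword_comm_last[OF t', of Clif] by (simp add: replicate_append_same)
    have "wspan ?X ?X (cosets (Suc b)) (sh [] [\<up>] t' @ [?c, (ups b, UPos, [])])"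
    proof (rule wspan_ctx'[OF clif_right_UPos, of _ "ups b" "[]" "sh [] [\<up>] t'" _ "[]"])
      fix s :: gword
      have "wspan ?X ?X (cosets (Suc b)) (sh [] [\<up>] t' @ [(ups b, UPos, []), (ups b, Clif, [\<up>])])"
        using base[OF cosetsI[OF t cb]] 3(2) by simp
      moreover have "wspan ?X ?X (cosets (Suc b)) (sh [] [\<up>] t' @ [(ups b, Clif, [\<up>])])"
        using base[OF cosets_Nil[OF upword_append[OF t' cb]]] by simp
      moreover have "wspan ?X ?X (cosets (Suc b)) (sh [] [\<up>] t' @ [?c])"
        using wspan_weq[OF base[OF cosetsI[OF tws_Clif t']], of "sh [] [\<up>] t' @ [?c]"] comm by simp
      moreover assume "s \<in> {[([], UPos, []), ([], Clif, [\<up>])], [([], Clif, [\<up>])], [([\<up>], Clif, [])]}"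
      ultimately show "wspan ?X ?X (cosets (Suc b)) (sh [] [\<up>] t' @ sh (ups b) [] s @ [])"
        by (auto simp: replicate_append_same)
    qed (use g X in \<open>auto simp: replicate_append_same\<close>)
    moreover have "weq ?X ?X (?c # t) (sh [] [\<up>] t' @ [?c, (ups b, UPos, [])])"
      using weq_app[OF weq_sym[OF comm], of ?X "[(ups b, UPos, [])]"] unfolding 3(2) X(1) by simp
    ultimately show ?thesis by (rule wspan_weq)
  qed
qed

text \<open>Of the two crossings the one is taken that is absorbed without remainder, by a slide, a
  cancellation or the braid relation; \<open>wspan_skein\<close> supplies the other at the cost of a
  multiple of \<open>t\<close>.\<close>

lemma coset_letter_U:
  assumes t: "t \<in> set (tws (Suc b))"
  shows "\<exists>g \<in> {UPos, UNeg}. wspan (ups (Suc (Suc b))) (ups (Suc (Suc b))) (cosets (Suc b)) ((ups b, g, []) # t)"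
proof -
  let ?X = "ups (Suc (Suc b))" and ?c = "(ups (Suc b), Clif, []) :: obj \<times> gen \<times> obj" and ?u = "(ups b, UPos, []) :: obj \<times> gen \<times> obj"
  have X: "?X = ups b @ [\<up>, \<up>]" by (simp add: replicate_app_Cons_same)
  have base: "wspan ?X ?X (cosets (Suc b)) s" if "s \<in> cosets (Suc b)" for s
    by (rule wspan_base[OF that upword_gdiag[OF upword_cosets[OF that]]])
  consider "t = []" | "t = [?c]" | "t = [?u]" | "t = [(ups b, Clif, [\<up>]), ?u]"
    | b' t' where "b = Suc b'" "t' \<in> set (tws b')" "t = sh [] [\<up>] (sh [] [\<up>] t' @ [(ups b', UPos, [])]) @ [?u]"
    using t by (cases b) auto
  then show ?thesis
  proof cases
    case 1
    have "[?u] \<in> set (tws (Suc b))" using tws_Nil[of b] by (force simp: image_iff)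
    then show ?thesis unfolding 1 using base[OF tws_cosets] by blast
  next
    case 2
    have "[(ups b, Clif, [\<up>]), ?u] \<in> set (tws (Suc b))" using tws_Clif[of b] by (force simp: image_iff)
    moreover have "weq ?X ?X [?u, ?c] [(ups b, Clif, [\<up>]), ?u]"
      by (rule weq_ctx'[OF weq_sym[OF clif_slide_word], of _ "ups b" "[]" "[]" _ "[]"]) (simp_all add: replicate_app_Cons_same)
    ultimately show ?thesis unfolding 2 using wspan_weq[OF base[OF tws_cosets]] by blast
  next
    case 3
    have "weq ?X ?X [(ups b, UNeg, []), ?u] []"
      by (rule weq_ctx'[OF u_inv'_word, of _ "ups b" "[]" "[]" _ "[]"]) (simp_all add: replicate_app_Cons_same)
    then show ?thesis unfolding 3 using wspan_weq[OF base[OF tws_cosets[OF tws_Nil]]] by blast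
  next
    case 4
    have "weq ?X ?X [(ups b, UNeg, []), (ups b, Clif, [\<up>]), ?u] [?c, (ups b, UNeg, []), ?u]"
      by (rule weq_ctx'[OF clif_slide_neg, of _ "ups b" "[]" "[]" _ "[?u]"]) (simp_all add: replicate_app_Cons_same)
    also have "weq ?X ?X [?c, (ups b, UNeg, []), ?u] [?c]"
      by (rule weq_ctx'[OF u_inv'_word, of _ "ups b" "[]" "[?c]" _ "[]"]) (simp_all add: replicate_app_Cons_same)
    finally show ?thesis unfolding 4 using wspan_weq[OF base[OF tws_cosets[OF tws_Clif]]] by blast
  next
    case 5
    let ?v = "(ups b', UPos, [\<up>]) :: obj \<times> gen \<times> obj"
    have t': "upword b t'" unfolding 5(1) by (rule upword_tws[OF 5(2)])
    have g: "gdiag ?X ?X (sh [] [\<up>, \<up>] t')"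
      using upword_gdiag[OF upword_sh[OF upword_sh[OF t']]] by simp
    have X': "?X = ups b' @ [\<up>, \<up>, \<up>]" "ups b = ups b' @ [\<up>]" unfolding 5(1) by (simp_all add: replicate_app_Cons_same replicate_append_same)
    have "weq ?X ?X (?u # t) (sh [] [\<up>, \<up>] t' @ [?u, ?v, ?u])"
      using weq_app[OF weq_sym[OF upword_comm_last[OF t', of UPos]], of ?X "[?v, ?u]"] unfolding 5(3) X
      by (simp add: X')
    also have "weq ?X ?X (sh [] [\<up>, \<up>] t' @ [?u, ?v, ?u]) (sh [] [\<up>, \<up>] t' @ [?v, ?u, ?v])"
      by (rule weq_ctx'[OF weq_sym[OF braid_word], of _ "ups b'" "[]" "sh [] [\<up>, \<up>] t'" _ "[]"]) (use g in \<open>simp_all add: 5(1) replicate_app_Cons_same\<close>)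
    finally have "weq ?X ?X (?u # t) (t @ sh [] [\<up>] [(ups b', UPos, [])])" unfolding 5(3) by simp
    moreover have "t @ sh [] [\<up>] [(ups b', UPos, [])] \<in> cosets (Suc b)"
      by (rule cosetsI[OF t]) (use upword_UPos[of b'] 5(1) in simp)
    ultimately show ?thesis using wspan_weq[OF base] by blast
  qed
qed

lemma wspan_skein:
  assumes "g \<in> {UPos, UNeg}" "h \<in> {UPos, UNeg}" "wspan X X S ((l, g, r) # t)" "wspan X X S t" "X = l @ [\<up>, \<up>] @ r"
  shows "wspan X X S ((l, h, r) # t)"
proof -
  have gh: "wspan [\<up>, \<up>] [\<up>, \<up>] {[([], g, [])], []} [([], h, [])]"
    using assms(1,2) skein_neg skein_pos by (auto intro: wspan_base)
  show ?thesis
  proof (rule wspan_ctx'[OF gh, of _ l r "[]" _ t])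
    show "gdiag (l @ [\<up>, \<up>] @ r) X t" using assms(4,5) by (simp add: wspan_def)
    show "wspan X X S ([] @ sh l r s @ t)" if "s \<in> {[([], g, [])], []}" for s
      using that assms(3,4) by auto
  qed (use assms(5) in simp_all)
qed

text \<open>Together with \<open>cosets_append\<close> this makes the span of the cosets stable
  under composition with letters from below. As it contains the empty word, it then contains all
  words of upward strands.\<close>

lemma coset_letter:
  "t \<in> set (tws b) \<Longrightarrow> upword (Suc b) [p] \<Longrightarrow> wspan (ups (Suc b)) (ups (Suc b)) (cosets b) (p # t)"
proof (induction b arbitrary: t p)
  case 0
  obtain l g r where p: "p = (l, g, r)" by (cases p)
  have p: "p = ([], Clif, [])"
    using 0 by (auto simp: upword_def p Cons_eq_append_conv append_eq_Cons_conv)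
  have base: "wspan [\<up>] [\<up>] (cosets 0) s" if "s \<in> set (tws 0)" for s
    using wspan_base[OF tws_cosets[OF that]] upword_gdiag[OF upword_tws[OF that]] by simp
  show ?case using base[of "[([], Clif, [])]"] wspan_weq[OF base[of "[]"] clif_sq_word] 0(1) unfolding p by auto
next
  case (Suc b)
  have tc: "wspan (ups (Suc (Suc b))) (ups (Suc (Suc b))) (cosets (Suc b)) t"
    using tws_cosets[OF Suc.prems(1)] by (rule wspan_base) (rule upword_gdiag[OF upword_tws[OF Suc.prems(1)]])
  from Suc.prems(2) show ?case
  proof (cases rule: upword_letterE)
    case (1 p')
    show ?thesis using coset_letter_inner[OF Suc.IH[OF _ 1(1)] 1(1) Suc.prems(1)] unfolding 1(2)[symmetric] by simp
  next
    case 2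
    show ?thesis unfolding 2 by (rule coset_letter_Clif[OF Suc.prems(1)])
  next
    case (3 h)
    obtain g where "g \<in> {UPos, UNeg}" "wspan (ups (Suc (Suc b))) (ups (Suc (Suc b))) (cosets (Suc b)) ((ups b, g, []) # t)"
      using coset_letter_U[OF Suc.prems(1)] by blast
    then show ?thesis unfolding 3(1) using wspan_skein[OF _ 3(2) _ tc, of g "ups b" "[]"] by (simp add: replicate_app_Cons_same)
  qed
qed

lemma upword_cosets_span: "upword (Suc b) x \<Longrightarrow> wspan (ups (Suc b)) (ups (Suc b)) (cosets b) x"
proof (induction x)
  case Nil
  show ?case using wspan_base[OF tws_cosets[OF tws_Nil]] by simp
next
  case (Cons p x)
  have px: "upword (Suc b) [p]" "upword (Suc b) x"
    using Cons.prems by (cases p; auto simp: upword_def)+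
  show ?case
  proof (rule wspan_ctx'[OF Cons.IH[OF px(2)], of _ "[]" "[]" "[p]" _ "[]"])
    show "gdiag (ups (Suc b)) ([] @ ups (Suc b) @ []) [p]" using upword_gdiag[OF px(1)] by simp
    show "wspan (ups (Suc b)) (ups (Suc b)) (cosets b) ([p] @ sh [] [] s @ [])" if sc: "s \<in> cosets b" for s
    proof -
      obtain t g where s: "s = t @ sh [] [\<up>] g" "t \<in> set (tws b)" "upword b g" using sc by (auto simp: cosets_def)
      show ?thesis using cosets_append[OF coset_letter[OF s(2) px(1)] s(3)] s(1) by simp
    qed
  qed simp_all
qed

text \<open>Products of coset representatives, one factor for each strand. A list and not a set: its
  length bounds the number of generators without a proof that they are distinct.\<close>

fun upgens :: "nat \<Rightarrow> gword list" where
  "upgens 0 = [[]]"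
| "upgens (Suc b) = [t @ sh [] [\<up>] g. t \<leftarrow> tws b, g \<leftarrow> upgens b]"

lemma length_upgens: "length (upgens b) = 2 ^ b * fact b"
proof (induction b)
  case (Suc b)
  have "length (upgens (Suc b)) = length (tws b) * length (upgens b)"
    by (simp add: length_concat comp_def sum_list_triv)
  then show ?case using Suc by (simp add: length_tws algebra_simps)
qed simp

lemma upgens_span: "upword b x \<Longrightarrow> wspan (ups b) (ups b) (set (upgens b)) x"
proof (induction b arbitrary: x)
  case 0
  have "x = []"
  proof (cases x)
    case (Cons p x')
    then show ?thesis using 0 by (cases p) (auto simp: upword_def)
  qed
  then show ?case by (auto intro: wspan_base)
next
  case (Suc b)
  show ?case
  proof (rule wspan_trans[OF upword_cosets_span[OF Suc.prems]])
    fix s assume "s \<in> cosets b"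
    then obtain t g where s: "s = t @ sh [] [\<up>] g" "t \<in> set (tws b)" "upword b g" by (auto simp: cosets_def)
    show "wspan (ups (Suc b)) (ups (Suc b)) (set (upgens (Suc b))) s"
    proof (rule wspan_ctx'[OF Suc.IH[OF s(3)], of _ "[]" "[\<up>]" t _ "[]"])
      have t: "gdiag (ups (Suc b)) (ups (Suc b)) t" by (rule upword_gdiag[OF upword_tws[OF s(2)]])
      then show "gdiag (ups (Suc b)) ([] @ ups b @ [\<up>]) t" by (simp add: replicate_app_Cons_same)
      fix g' assume g': "g' \<in> set (upgens b)" "gdiag (ups b) (ups b) g'"
      have "gdiag (ups (Suc b)) (ups (Suc b)) (sh [] [\<up>] g')"
        by (rule gdiag_sh'[OF g'(2)]) (simp_all add: replicate_app_Cons_same)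
      moreover have "t @ sh [] [\<up>] g' \<in> set (upgens (Suc b))" using s(2) g'(1) by auto
      ultimately show "wspan (ups (Suc b)) (ups (Suc b)) (set (upgens (Suc b))) (t @ sh [] [\<up>] g' @ [])"
        using gdiag_appendI[OF t] by (simp add: wspan_base)
    qed (use s(1) in \<open>simp_all add: replicate_app_Cons_same\<close>)
  qed
qed

section \<open>Partial traces and caps\<close>

definition kfam :: "obj \<Rightarrow> gword \<Rightarrow> bool" where
  "kfam Y = wspan [] Y {s. fam Y s}"

lemma kfam_fam: "fam Y s \<Longrightarrow> kfam Y s"
  unfolding kfam_def by (intro wspan_base fam_gdiag) auto

lemma kfam_weq: "weq [] Y ws vs \<Longrightarrow> kfam Y vs \<Longrightarrow> kfam Y ws"
  unfolding kfam_def by (rule wspan_weq)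

lemma kfam_app:
  assumes "kfam Y w" "gdiag Y Y' v" "\<And>s. fam Y s \<Longrightarrow> kfam Y' (s @ v)"
  shows "kfam Y' (w @ v)"
  using wspan_ctx'[of "[]" Y "{s. fam Y s}" w "[]" "[]" "[]" "[]" Y' v "w @ v" "{s. fam Y' s}"] assms
  unfolding kfam_def by simp

lemma kfam_rneg: "kfam (A @ \<up> # \<down> # C) ws \<Longrightarrow> kfam (A @ \<down> # \<up> # C) (ws @ [(A, RNeg, C)])"
  by (rule kfam_app) (auto intro: kfam_fam fam.rneg)

text \<open>\<open>cup_past_up\<close> turns the curl into a zigzag.\<close>

lemma cup_curl: "weq [\<up>] [\<up>] [([\<up>], CupL, []), ([], UPos, [\<down>]), ([\<up>], RNeg, []), ([\<up>], CapL, [])] []"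
  by (rule weq_trans[OF weq_ctx'[OF cup_past_up, of _ "[]" "[]" "[]" _ "[([\<up>], CapL, [])]"] zigzag_up_word]) simp_all

text \<open>Closing the last strand of a representative gives a bubble, a bubble with a token, or a
  curl. The bubbles vanish, being in the span of no words at all, and the curl is unwound and leaves
  \<open>t'\<close>.\<close>

lemma trace_tws:
  assumes "t \<in> set (tws b)"
  shows "kfam (ups b @ dns b) (nest (Suc b) @ sh [] (dns (Suc b)) t @ [(ups b, RNeg, dns b), (ups b, CapL, dns b)])"
proof -
  let ?Y = "ups b @ dns b" and ?e = "[(ups b, RNeg, dns b), (ups b, CapL, dns b)]"
  consider "t = []" | "t = [(ups b, Clif, [])]" | b' t' where "b = Suc b'" "t' \<in> set (tws b')" "t = sh [] [\<up>] t' @ [(ups b', UPos, [])]"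
    using assms by (cases b) auto
  then show ?thesis
  proof cases
    case 1
    show ?thesis unfolding kfam_def 1
      by (rule wspan_ctx'[OF bubble_word[of "{}"], of _ "ups b" "dns b" "nest b" _ "[]"]) (simp_all add: gdiag_nest)
  next
    case 2
    show ?thesis unfolding kfam_def 2
      by (rule wspan_ctx'[OF clif_bubble_word[of "{}"], of _ "ups b" "dns b" "nest b" _ "[]"]) (simp_all add: gdiag_nest)
  next
    case 3
    have t': "upword b t'" unfolding 3(1) by (rule upword_tws[OF 3(2)])
    let ?f = "fam ?Y (nest b @ sh [] (dns b) t')"
    have f: ?f by (rule fam.base[OF t'])
    let ?u = "(ups b', UPos, dns (Suc b))"
    have "weq ?Y (ups b @ [\<up>, \<down>] @ dns b) ((ups b, CupL, dns b) # sh [] (\<up> # \<down> # dns b) t') (sh [] (dns b) t' @ [(ups b, CupL, dns b)])"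
      using weq_comm'[OF upword_gdiag[OF t'], of "dns b" "[\<up>, \<down>] @ dns b" "[([], CupL, dns b)]"] by simp
    from weq_app[OF weq_pre[OF this gdiag_nest], of ?Y "?u # ?e"]
    have "weq [] ?Y (nest (Suc b) @ sh [] (dns (Suc b)) t @ ?e) (nest b @ sh [] (dns b) t' @ (ups b, CupL, dns b) # ?u # ?e)"
      unfolding 3(1,3) by (simp add: replicate_app_Cons_same)
    also have "weq [] ?Y (nest b @ sh [] (dns b) t' @ (ups b, CupL, dns b) # ?u # ?e) (nest b @ sh [] (dns b) t')"
      by (rule weq_ctx'[OF cup_curl, of _ "ups b'" "dns b" "nest b @ sh [] (dns b) t'" _ "[]"])
        (use fam_gdiag[OF f] in \<open>simp_all add: 3(1) replicate_app_Cons_same\<close>)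
    finally show ?thesis by (rule kfam_weq[OF _ kfam_fam[OF f]])
  qed
qed

lemma kfam_upword:
  assumes "kfam (ups b @ dns b) w" "upword b g"
  shows "kfam (ups b @ dns b) (w @ sh [] (dns b) g)"
proof (rule kfam_app[OF assms(1)])
  show g: "gdiag (ups b @ dns b) (ups b @ dns b) (sh [] (dns b) g)"
    using gdiag_sh[OF upword_gdiag[OF assms(2)], of "[]" "dns b"] by simp
  fix s assume "fam (ups b @ dns b) s"
  then obtain x where x: "upword b x" "weq [] (ups b @ dns b) s (nest b @ sh [] (dns b) x)" using fam_sorted by blast
  show "kfam (ups b @ dns b) (s @ sh [] (dns b) g)"
    by (rule kfam_weq[OF weq_app[OF x(2) g]]) (use kfam_fam[OF fam_base_append[OF x(1) assms(2)]] in simp)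
qed

text \<open>The factor \<open>g\<close> of a coset avoids the last strand, so it can be moved above
  the trace, and only the representatives have to be closed.\<close>

lemma trace_upword:
  assumes "upword (Suc b) x"
  shows "kfam (ups b @ dns b) (nest (Suc b) @ sh [] (dns (Suc b)) x @ [(ups b, RNeg, dns b), (ups b, CapL, dns b)])"
proof -
  let ?Y = "ups b @ dns b" and ?e = "[(ups b, RNeg, dns b), (ups b, CapL, dns b)]"
  have e: "gdiag (ups (Suc b) @ dns (Suc b)) ?Y ?e" by (simp add: replicate_app_Cons_same)
  show ?thesis unfolding kfam_def
  proof (rule wspan_ctx'[OF upword_cosets_span[OF assms], of _ "[]" "dns (Suc b)" "nest (Suc b)" _ ?e])
    fix s assume "s \<in> cosets b"
    then obtain t g where s: "s = t @ sh [] [\<up>] g" "t \<in> set (tws b)" "upword b g" by (auto simp: cosets_def)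
    have t: "gdiag [] (ups (Suc b) @ dns (Suc b)) (nest (Suc b) @ sh [] (dns (Suc b)) t)"
      by (rule gdiag_appendI[OF gdiag_nest gdiag_sh'[OF upword_gdiag[OF upword_tws[OF s(2)]]]]) simp_all
    have "weq (ups (Suc b) @ dns (Suc b)) ?Y (sh [] (\<up> # dns (Suc b)) g @ ?e) (?e @ sh [] (dns b) g)"
      using weq_comm[OF upword_gdiag[OF s(3)], of "\<up> # \<down> # dns b" "dns b" "[([], RNeg, dns b), ([], CapL, dns b)]"]
      by (simp add: replicate_app_Cons_same)
    from weq_pre[OF this t] have "weq [] ?Y (nest (Suc b) @ sh [] (dns (Suc b)) s @ ?e)
        ((nest (Suc b) @ sh [] (dns (Suc b)) t @ ?e) @ sh [] (dns b) g)" unfolding s(1) by simp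
    from kfam_weq[OF this kfam_upword[OF trace_tws[OF s(2)] s(3)]]
    show "wspan [] ?Y {s. fam ?Y s} (nest (Suc b) @ sh [] (dns (Suc b)) s @ ?e)" unfolding kfam_def .
  qed (use e gdiag_nest[of "Suc b"] in \<open>simp_all del: nest.simps\<close>)
qed

text \<open>A sorted object leads to a partial trace. If a \<open>\<down>\<close> stands just before
  the pair or an \<open>\<up>\<close> just behind it, \<open>cap_R_dw\<close> or
  \<open>cap_R_crossing\<close> moves the cap to the other side of this strand, and
  \<open>descents\<close> decreases.\<close>

lemma kfam_cap_R:
  assumes "fam (A @ \<up> # \<down> # C) ws"
  shows "kfam (A @ C) (ws @ [(A, RNeg, C), (A, CapL, C)])"
proof -
  let ?v = "[([], RNeg, []), ([], CapL, [])]"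
  have "kfam (A @ [] @ C) (ws @ sh A C ?v)"
  proof (rule fam_closure[where Q = kfam and D = "[\<up>, \<down>]"])
    show "fam (A @ [\<up>, \<down>] @ C) ws" using assms by simp
    show "[\<up>, \<down>] \<noteq> M @ \<down> # \<up> # N" for M N by (cases M) (auto simp: Cons_eq_append_conv)
    show "kfam (A @ [] @ C) (nest a @ sh [] (dns a) x @ sh A C ?v)"
      if A: "A @ [\<up>, \<down>] @ C = ups a @ dns a" and x: "upword a x" for A C a x
    proof -
      obtain i j where ij: "A = ups i" "\<down> # C = ups j @ dns a" "a = Suc (i + j)" using sorted_split_up[of A "\<down> # C" a a] A by auto
      then have j: "j = 0" by (cases j) auto
      then have C: "C = dns i" "a = Suc i" using ij by auto
      show ?thesis using trace_upword[of i x] x unfolding ij(1) C by simp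
    qed
    show "kfam (A @ \<down> # [] @ C) (ws @ sh (A @ [\<down>]) C ?v)"
      if f: "fam (A @ \<down> # [\<up>, \<down>] @ C) ws"
        and IH: "\<And>A' C' w. descents (A' @ [\<up>, \<down>] @ C') < descents (A @ \<down> # [\<up>, \<down>] @ C) \<Longrightarrow> fam (A' @ [\<up>, \<down>] @ C') w \<Longrightarrow>
          kfam (A' @ [] @ C') (w @ sh A' C' ?v)" for A C ws
    proof -
      let ?Y = "A @ \<down> # C"
      obtain v where v: "fam (A @ \<up> # \<down> # \<down> # C) v" "weq [] (A @ \<down> # \<up> # \<down> # C) ws (v @ [(A, RNeg, \<down> # C)])"
        using fam_inv[OF f, of A "\<down> # C"] by auto
      obtain w where w: "fam (A @ \<up> # \<down> # \<down> # C) w" "weq [] (A @ \<up> # \<down> # \<down> # C) v (w @ sh (A @ [\<up>]) C dw)"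
        using fam_dw_inv[of "A @ [\<up>]" C v] v(1) by auto
      let ?e = "[(A @ [\<down>], RNeg, C), (A @ [\<down>], CapL, C)]"
      have "weq [] ?Y (ws @ ?e) (v @ (A, RNeg, \<down> # C) # ?e)" using weq_app[OF v(2), of ?Y ?e] by simp
      also have "weq [] ?Y (v @ (A, RNeg, \<down> # C) # ?e) (w @ sh (A @ [\<up>]) C dw @ (A, RNeg, \<down> # C) # ?e)"
        using weq_app[OF w(2), of ?Y "(A, RNeg, \<down> # C) # ?e"] by simp
      also have "weq [] ?Y (w @ sh (A @ [\<up>]) C dw @ (A, RNeg, \<down> # C) # ?e) (w @ [(A, RNeg, \<down> # C), (A, CapL, \<down> # C)])"
        by (rule weq_ctx'[OF cap_R_dw, of _ A C w _ "[]"]) (simp_all add: fam_gdiag[OF w(1)])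
      finally show ?thesis
        using kfam_weq[of ?Y "ws @ ?e"] IH[of A "\<down> # C" w] w(1) descents_swap[of A "\<down> # C"] by simp
    qed
    show "kfam (A @ [] @ \<up> # C) (ws @ sh A (\<up> # C) ?v)"
      if f: "fam (A @ [\<up>, \<down>] @ \<up> # C) ws"
        and IH: "\<And>A' C' w. descents (A' @ [\<up>, \<down>] @ C') < descents (A @ [\<up>, \<down>] @ \<up> # C) \<Longrightarrow> fam (A' @ [\<up>, \<down>] @ C') w \<Longrightarrow>
          kfam (A' @ [] @ C') (w @ sh A' C' ?v)" for A C ws
    proof -
      let ?Y = "A @ \<up> # C"
      obtain v where v: "fam (A @ \<up> # \<up> # \<down> # C) v" "weq [] (A @ \<up> # \<down> # \<up> # C) ws (v @ [(A @ [\<up>], RNeg, C)])"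
        using fam_inv[OF f, of "A @ [\<up>]" C] by auto
      let ?e = "[(A, RNeg, \<up> # C), (A, CapL, \<up> # C)]"
      let ?e' = "[(A @ [\<up>], RNeg, C), (A @ [\<up>], CapL, C)]"
      have w: "fam (A @ \<up> # \<up> # \<down> # C) (v @ [(A, UNeg, \<down> # C)])" using fam_U[OF v(1)] by simp
      have "weq [] ?Y (ws @ ?e) (v @ (A @ [\<up>], RNeg, C) # ?e)" using weq_app[OF v(2), of ?Y ?e] by simp
      also have "weq [] ?Y (v @ (A @ [\<up>], RNeg, C) # ?e) ((v @ [(A, UNeg, \<down> # C)]) @ ?e')"
        by (rule weq_ctx'[OF cap_R_crossing, of _ A C v _ "[]"]) (simp_all add: fam_gdiag[OF v(1)])
      finally show ?thesis
        using kfam_weq[of ?Y "ws @ ?e"] IH[of "A @ [\<up>]" C "v @ [(A, UNeg, \<down> # C)]"] w descents_swap[of "A @ [\<up>]" C] by simp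
    qed
  qed (auto intro: kfam_rneg kfam_weq)
  then show ?thesis by simp
qed

lemma kfam_layer:
  assumes "fam (l @ gdom g @ r) s"
  shows "kfam (l @ gcod g @ r) (s @ [(l, g, r)])"
proof (cases g)
  \<comment> \<open>A left cap closes a descent. The word can be taken to end in a mixed crossing
    there, and with it the cap becomes a right cap.\<close>
  case CapL
  then obtain s' where s': "fam (l @ \<up> # \<down> # r) s'" "weq [] (l @ \<down> # \<up> # r) s (s' @ [(l, RNeg, r)])"
    using fam_inv[OF assms, of l r] by auto
  have "weq [] (l @ r) (s @ [(l, CapL, r)]) (s' @ [(l, RNeg, r), (l, CapL, r)])"
    using weq_app[OF s'(2), of "l @ r" "[(l, CapL, r)]"] by simp
  from kfam_weq[OF this kfam_cap_R[OF s'(1)]] show ?thesis using CapL by simp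
qed (use assms in \<open>auto intro!: kfam_fam fam_U fam_Clif fam_cup fam.rneg\<close>)

lemma gdiag_kfam: "gdiag [] Y ws \<Longrightarrow> kfam Y ws"
proof (induction ws arbitrary: Y rule: rev_induct)
  case Nil
  then show ?case using kfam_fam[OF fam.base[OF upword_Nil[of 0]]] by simp
next
  case (snoc p ws)
  obtain l g r where p: "p = (l, g, r)" by (cases p)
  have ws: "gdiag [] (l @ gdom g @ r) ws" "Y = l @ gcod g @ r" using snoc.prems by (auto simp: p gdiag_append)
  show ?case unfolding p ws(2) by (rule kfam_app[OF snoc.IH[OF ws(1)]]) (auto intro: kfam_layer)
qed

text \<open>For a sorted object these are the generators of the Hecke-Clifford algebra on top of
  nested cups, or none if the arrows are not balanced. Each further descent adds one layer to every
  generator and keeps their number.\<close>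

lemma fam_generators:
  "\<exists>L. (\<forall>w. fam Y w \<longrightarrow> wspan [] Y (set L) w) \<and>
    length L = (if count_list Y \<up> = count_list Y \<down> then 2 ^ count_list Y \<up> * fact (count_list Y \<up>) else 0)"
proof (induction "descents Y" arbitrary: Y rule: less_induct)
  case less
  show ?case
  proof (cases "\<exists>a b. Y = ups a @ dns b")
    case True
    then obtain a b where Y: "Y = ups a @ dns b" by blast
    have c: "count_list Y \<up> = a" "count_list Y \<down> = b" unfolding Y by (simp_all add: count_list_eq_length_filter)
    show ?thesis
    proof (cases "a = b")
      case False
      then have "\<not> fam Y w" for w using fam_sorted[of Y w a b] Y by blast
      then show ?thesis unfolding c using False by (intro exI[of _ "[]"]) simp
    next
      case True
      let ?L = "map (\<lambda>x. nest a @ sh [] (dns a) x) (upgens a)"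
      have "wspan [] Y (set ?L) w" if w: "fam Y w" for w
      proof -
        obtain x where x: "upword a x" "weq [] Y w (nest a @ sh [] (dns a) x)" using fam_sorted[OF w Y] by blast
        have "wspan [] Y (set ?L) (nest a @ sh [] (dns a) x)"
        proof (rule wspan_ctx'[OF upgens_span[OF x(1)], of _ "[]" "dns a" "nest a" _ "[]"])
          fix s assume s: "s \<in> set (upgens a)" "gdiag (ups a) (ups a) s"
          have "gdiag (ups a @ dns a) Y (sh [] (dns a) s)" using gdiag_sh[OF s(2), of "[]" "dns a"] Y True by simp
          from gdiag_appendI[OF gdiag_nest this] s(1) show "wspan [] Y (set ?L) (nest a @ sh [] (dns a) s @ [])"
            by (auto intro: wspan_base)
        qed (use gdiag_nest Y True in auto)
        then show ?thesis by (rule wspan_weq[OF _ x(2)])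
      qed
      then show ?thesis unfolding c using True by (intro exI[of _ ?L]) (simp add: length_upgens)
    qed
  next
    case False
    then obtain A C where Y: "Y = A @ \<down> # \<up> # C" using descent_or_sorted by blast
    let ?Y = "A @ \<up> # \<down> # C"
    obtain L where L: "\<And>w. fam ?Y w \<Longrightarrow> wspan [] ?Y (set L) w"
      "length L = (if count_list ?Y \<up> = count_list ?Y \<down> then 2 ^ count_list ?Y \<up> * fact (count_list ?Y \<up>) else 0)"
      using less[of ?Y] unfolding Y descents_swap by blast
    let ?L = "map (\<lambda>w. w @ [(A, RNeg, C)]) L"
    have "wspan [] Y (set ?L) w" if w: "fam Y w" for w
    proof -
      obtain w' where w': "fam ?Y w'" "weq [] Y w (w' @ [(A, RNeg, C)])" using fam_inv[OF w Y] by blast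
      have "wspan [] Y (set ?L) (w' @ [(A, RNeg, C)])"
      proof (rule wspan_ctx'[OF L(1)[OF w'(1)], of _ "[]" "[]" "[]" _ "[(A, RNeg, C)]"])
        fix s assume "s \<in> set L" "gdiag [] ?Y s"
        then show "wspan [] Y (set ?L) ([] @ sh [] [] s @ [(A, RNeg, C)])"
          by (intro wspan_base) (auto simp: Y gdiag_append)
      qed (auto simp: Y)
      then show ?thesis by (rule wspan_weq[OF _ w'(2)])
    qed
    then show ?thesis using L(2) unfolding Y by (intro exI[of _ ?L]) simp
  qed
qed

end

section \<open>Bending strands\<close>

context cring_param
begin

definition wgen :: "obj \<Rightarrow> obj \<Rightarrow> nat \<Rightarrow> bool" where
  "wgen X Y n \<longleftrightarrow> (\<exists>L. length L = n \<and> (\<forall>w. gdiag X Y w \<longrightarrow> wspan X Y (set L) w))"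

text \<open>Only a number of generators is transferred, so it is enough that each word of the new
  type factors, up to sign, through a word of the old type.\<close>

lemma wgen_transfer:
  assumes "wgen X Y n" "gdiag X' (l @ X @ r) as" "gdiag (l @ Y @ r) Y' bs"
    and h: "\<And>w. gdiag X' Y' w \<Longrightarrow> \<exists>v. gdiag X Y v \<and> weq X' Y' w (as @ sh l r v @ bs)"
  shows "wgen X' Y' n"
proof -
  obtain L where L: "length L = n" "\<And>w. gdiag X Y w \<Longrightarrow> wspan X Y (set L) w"
    using assms(1) unfolding wgen_def by blast
  let ?L = "map (\<lambda>s. as @ sh l r s @ bs) L"
  have "wspan X' Y' (set ?L) w" if w: "gdiag X' Y' w" for w
  proof -
    obtain v where v: "gdiag X Y v" "weq X' Y' w (as @ sh l r v @ bs)" using h[OF w] by blast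
    have "wspan X' Y' (set ?L) (as @ sh l r v @ bs)"
      using wspan_ctx[OF L(2)[OF v(1)] assms(2,3)] by simp
    then show ?thesis by (rule wspan_weq[OF _ v(2)])
  qed
  then show ?thesis unfolding wgen_def using L(1) by (intro exI[of _ ?L]) simp
qed

text \<open>A zigzag is inserted below \<open>w\<close>. Its cup together with \<open>w\<close>
  forms the bent word, and its cap is moved to the top.\<close>

lemma wgen_bend_down:
  assumes "wgen X (\<up> # Y) n"
  shows "wgen (\<down> # X) Y n"
proof (rule wgen_transfer[OF assms, of _ "[\<down>]" "[]" "[]" _ "[([], CapL, Y)]"])
  fix w assume w: "gdiag (\<down> # X) Y w"
  let ?v = "([], CupL, X) # sh [\<up>] [] w"
  have v: "gdiag X (\<up> # Y) ?v" using gdiag_sh[OF w, of "[\<up>]" "[]"] by simp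
  have "weq (\<down> # X) Y w ((([\<down>], CupL, X) # [([], CapL, \<down> # X)]) @ w)"
    by (rule weq_sym, rule weq_ctx'[OF zigzag_down_word, of _ "[]" X "[]" _ w]) (use w in simp_all)
  also have "weq (\<down> # X) Y ((([\<down>], CupL, X) # [([], CapL, \<down> # X)]) @ w) (([\<down>], CupL, X) # sh [\<down>, \<up>] [] w @ [([], CapL, Y)])"
    using weq_pre[OF weq_comm_layer[OF w, of "[]" CapL "[]"], of "\<down> # X" "[([\<down>], CupL, X)]"] by simp
  finally show "\<exists>v. gdiag X (\<up> # Y) v \<and> weq (\<down> # X) Y w ([] @ sh [\<down>] [] v @ [([], CapL, Y)])"
    using v by (intro exI[of _ ?v]) simp
qed simp_all

lemma wgen_bend_up:
  assumes "wgen X (Y @ [\<down>]) n"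
  shows "wgen (X @ [\<up>]) Y n"
proof (rule wgen_transfer[OF assms, of _ "[]" "[\<up>]" "[]" _ "[(Y, CapL, [])]"])
  fix w assume w: "gdiag (X @ [\<up>]) Y w"
  let ?v = "(X, CupL, []) # sh [] [\<down>] w"
  have v: "gdiag X (Y @ [\<down>]) ?v" using gdiag_sh[OF w, of "[]" "[\<down>]"] by simp
  have "weq (X @ [\<up>]) Y w (((X, CupL, [\<up>]) # [(X @ [\<up>], CapL, [])]) @ w)"
    by (rule weq_sym, rule weq_ctx'[OF zigzag_up_word, of _ X "[]" "[]" _ w]) (use w in simp_all)
  also have "weq (X @ [\<up>]) Y (((X, CupL, [\<up>]) # [(X @ [\<up>], CapL, [])]) @ w) ((X, CupL, [\<up>]) # sh [] [\<down>, \<up>] w @ [(Y, CapL, [])])"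
    using weq_pre[OF weq_comm'[OF w, of "[\<down>, \<up>]" "[]" "[([], CapL, [])]"], of "X @ [\<up>]" "[(X, CupL, [\<up>])]"] by simp
  finally show "\<exists>v. gdiag X (Y @ [\<down>]) v \<and> weq (X @ [\<up>]) Y w ([] @ sh [] [\<up>] v @ [(Y, CapL, [])])"
    using v by (intro exI[of _ ?v]) simp
qed simp_all

text \<open>The mixed crossing is invertible, so every word factors through it.\<close>

lemma wgen_swap:
  assumes "wgen (A @ \<down> # \<up> # C) Y n"
  shows "wgen (A @ \<up> # \<down> # C) Y n"
proof (rule wgen_transfer[OF assms, of _ "[]" "[]" "[(A, RNeg, C)]" _ "[]"])
  fix w assume w: "gdiag (A @ \<up> # \<down> # C) Y w"
  have "gdiag (A @ \<down> # \<up> # C) Y (sh A C lw @ w)" using w by (simp add: gdiag_append)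
  moreover have "weq (A @ \<up> # \<down> # C) Y w ((A, RNeg, C) # sh A C lw @ w)"
    by (rule weq_sym, rule weq_ctx'[OF lr_inv_word, of _ A C "[]" _ w]) (use w in simp_all)
  ultimately show "\<exists>v. gdiag (A @ \<down> # \<up> # C) Y v \<and> weq (A @ \<up> # \<down> # C) Y w ([(A, RNeg, C)] @ sh [] [] v @ [])"
    by (intro exI[of _ "sh A C lw @ w"]) simp
qed simp_all

lemma wgen_remove_down: "wgen (ups i @ C) (\<up> # Y) n \<Longrightarrow> wgen (ups i @ \<down> # C) Y n"
proof (induction i arbitrary: C)
  case (Suc i)
  have "wgen (ups i @ \<down> # \<up> # C) Y n" using Suc.IH[of "\<up> # C"] Suc.prems by (simp add: replicate_app_Cons_same)
  from wgen_swap[OF this] show ?case by (simp add: replicate_app_Cons_same)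
qed (simp add: wgen_bend_down)

text \<open>The arguments are the numbers of origins and of termini. If they differ there is no
  matching, and the rank is zero.\<close>

definition rank_formula :: "nat \<Rightarrow> nat \<Rightarrow> nat" where
  "rank_formula a b = (if a = b then 2 ^ a * fact a else 0)"

lemma wgen_unit: "wgen [] Y (rank_formula (count_list Y \<down>) (count_list Y \<up>))"
proof -
  obtain L where L: "\<And>w. fam Y w \<Longrightarrow> wspan [] Y (set L) w"
    "length L = (if count_list Y \<up> = count_list Y \<down> then 2 ^ count_list Y \<up> * fact (count_list Y \<up>) else 0)"
    using fam_generators by blast
  have "wspan [] Y (set L) w" if "gdiag [] Y w" for w
    using gdiag_kfam[OF that] unfolding kfam_def by (rule wspan_trans) (auto intro: L(1))
  then show ?thesis unfolding wgen_def rank_formula_def using L(2) by (intro exI[of _ L]) auto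
qed

lemma wgen_all: "wgen X Y (rank_formula (count_list X \<up> + count_list Y \<down>) (count_list X \<down> + count_list Y \<up>))"
proof (induction "length X" arbitrary: X Y)
  case 0
  then show ?case using wgen_unit[of Y] by simp
next
  case (Suc n)
  show ?case
  proof (cases "\<down> \<in> set X")
    case True
    \<comment> \<open>Only upward strands stand to the left of the first downward one, so it can be
      moved to the left end and bent there.\<close>
    then obtain A C where X: "X = A @ \<down> # C" "\<down> \<notin> set A" using split_list_first by metis
    then have A: "A = ups (length A)" by (metis orientation.exhaust replicate_length_same)
    have "wgen (ups (length A) @ \<down> # C) Y (rank_formula (count_list X \<up> + count_list Y \<down>) (count_list X \<down> + count_list Y \<up>))"
      by (rule wgen_remove_down) (use Suc(1)[of "A @ C" "\<up> # Y"] Suc(2) A X(1) in simp)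
    then show ?thesis using X(1) A by simp
  next
    case False
    then have X: "X = ups (Suc n)" using Suc(2) by (metis orientation.exhaust replicate_length_same)
    then have X': "X = ups n @ [\<up>]" by (simp add: replicate_app_Cons_same)
    show ?thesis unfolding X' by (rule wgen_bend_up) (use Suc(1)[of "ups n" "Y @ [\<down>]"] in \<open>simp add: add.assoc add.commute\<close>)
  qed
qed

theorem generators:
  "\<exists>L :: 'k mor list. length L = rank_formula (count_list X \<up> + count_list Y \<down>) (count_list X \<down> + count_list Y \<up>) \<and>
    (\<forall>f\<in>set L. arrow k X Y f) \<and> (\<forall>f. arrow k X Y f \<longrightarrow> f \<in> spn X Y (set L))"
proof -
  obtain L where L: "\<And>w. gdiag X Y w \<Longrightarrow> wspan X Y (set L) w"
    "length L = rank_formula (count_list X \<up> + count_list Y \<down>) (count_list X \<down> + count_list Y \<up>)"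
    using wgen_all unfolding wgen_def by blast
  \<comment> \<open>Words of the wrong type are replaced by zero, so that the length of the list
    stays the same.\<close>
  let ?g = "\<lambda>s. if gdiag X Y s then gmor X s else Zero X Y"
  have "f \<in> spn X Y (set (map ?g L))" if f: "arrow k X Y f" for f
  proof -
    have "f \<in> spn X Y (wmors X Y (set L))"
      by (rule spn_wmors_trans[OF arrow_wspan[OF f]]) (rule L(1))
    then show ?thesis by (rule spn_mono) (auto simp: wmors_def)
  qed
  moreover have "\<forall>f\<in>set (map ?g L). arrow k X Y f" by (auto intro: arrow_gmor arrow.Zero)
  ultimately show ?thesis using L(2) by (intro exI[of _ "map ?g L"]) simp
qed

end

context cring_param
begin

section \<open>Bases from triangular functionals\<close>

definition linear_functional :: "('k, 'v, 'n) module_scheme \<Rightarrow> ('v \<Rightarrow> 'k) \<Rightarrow> bool" where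
  "linear_functional M \<phi> \<longleftrightarrow> \<phi> \<in> carrier M \<rightarrow> carrier k \<and>
     (\<forall>x \<in> carrier M. \<forall>y \<in> carrier M. \<phi> (x \<oplus>\<^bsub>M\<^esub> y) = \<phi> x \<oplus> \<phi> y) \<and>
     (\<forall>a \<in> carrier k. \<forall>x \<in> carrier M. \<phi> (a \<odot>\<^bsub>M\<^esub> x) = a \<otimes> \<phi> x)"

lemma linear_functionalD:
  assumes "linear_functional M \<phi>"
  shows "x \<in> carrier M \<Longrightarrow> \<phi> x \<in> carrier k"
    "x \<in> carrier M \<Longrightarrow> y \<in> carrier M \<Longrightarrow> \<phi> (x \<oplus>\<^bsub>M\<^esub> y) = \<phi> x \<oplus> \<phi> y"
    "a \<in> carrier k \<Longrightarrow> x \<in> carrier M \<Longrightarrow> \<phi> (a \<odot>\<^bsub>M\<^esub> x) = a \<otimes> \<phi> x"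
  using assms unfolding linear_functional_def by auto

lemma finsum_swap:
  assumes "abelian_group M" "finite A" "finite B" "\<And>i j. i \<in> A \<Longrightarrow> j \<in> B \<Longrightarrow> f i j \<in> carrier M"
  shows "(\<Oplus>\<^bsub>M\<^esub>i\<in>A. \<Oplus>\<^bsub>M\<^esub>j\<in>B. f i j) = (\<Oplus>\<^bsub>M\<^esub>j\<in>B. \<Oplus>\<^bsub>M\<^esub>i\<in>A. f i j)"
proof -
  interpret M: abelian_group M by fact
  show ?thesis using assms(2,4)
  proof (induction A rule: finite_induct)
    case empty
    show ?case by simp
  next
    case (insert a A)
    have c: "(\<lambda>j. f a j) \<in> B \<rightarrow> carrier M" "(\<lambda>j. \<Oplus>\<^bsub>M\<^esub>i\<in>A. f i j) \<in> B \<rightarrow> carrier M"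
      "(\<lambda>i. \<Oplus>\<^bsub>M\<^esub>j\<in>B. f i j) \<in> A \<rightarrow> carrier M" "(\<Oplus>\<^bsub>M\<^esub>j\<in>B. f a j) \<in> carrier M"
      using insert.prems by (auto intro!: M.finsum_closed)
    have "(\<Oplus>\<^bsub>M\<^esub>j\<in>B. \<Oplus>\<^bsub>M\<^esub>i\<in>insert a A. f i j) = (\<Oplus>\<^bsub>M\<^esub>j\<in>B. f a j \<oplus>\<^bsub>M\<^esub> (\<Oplus>\<^bsub>M\<^esub>i\<in>A. f i j))"
      using insert by (intro M.finsum_cong') (auto intro!: M.finsum_closed)
    then show ?case using insert c by (simp add: M.finsum_addf)
  qed
qed

context
  fixes M :: "('k, 'v, 'n) module_scheme"
  assumes M: "module k M"
begin

interpretation M: module k M by (rule M)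

lemma linear_functional_zero: "linear_functional M \<phi> \<Longrightarrow> \<phi> \<zero>\<^bsub>M\<^esub> = \<zero>"
  using linear_functionalD(3)[of M \<phi> \<zero> "\<zero>\<^bsub>M\<^esub>"] linear_functionalD(1)[of M \<phi> "\<zero>\<^bsub>M\<^esub>"] by simp

lemma linear_functional_finsum:
  assumes "linear_functional M \<phi>" "finite A" "\<And>i. i \<in> A \<Longrightarrow> f i \<in> carrier M"
  shows "\<phi> (\<Oplus>\<^bsub>M\<^esub>i\<in>A. f i) = (\<Oplus>i\<in>A. \<phi> (f i))"
  using assms(2,3)
proof (induction A rule: finite_induct)
  case empty
  then show ?case using linear_functional_zero[OF assms(1)] by simp
next
  case (insert a A)
  then have "f \<in> A \<rightarrow> carrier M" "(\<lambda>i. \<phi> (f i)) \<in> A \<rightarrow> carrier k" "f a \<in> carrier M" "\<phi> (f a) \<in> carrier k"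
    using linear_functionalD(1)[OF assms(1)] by auto
  then show ?case using insert by (simp add: linear_functionalD(2)[OF assms(1)])
qed

lemma linear_functional_combination:
  assumes "linear_functional M \<psi>" "finite S" "\<And>j. j \<in> S \<Longrightarrow> a j \<in> carrier k \<and> linear_functional M (\<Phi> j)"
  shows "linear_functional M (\<lambda>x. \<psi> x \<oplus> (\<Oplus>j\<in>S. a j \<otimes> \<Phi> j x))"
  using assms(2,3)
proof (induction S rule: finite_induct)
  case empty
  then show ?case using assms(1) unfolding linear_functional_def by (simp add: Pi_def)
next
  case (insert b S)
  let ?f = "\<lambda>x. \<psi> x \<oplus> (\<Oplus>j\<in>S. a j \<otimes> \<Phi> j x)"
  have f: "linear_functional M ?f" using insert by simp
  have b: "a b \<in> carrier k" "linear_functional M (\<Phi> b)" using insert.prems by auto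
  have fa: "a j \<in> carrier k" "\<Phi> j x \<in> carrier k" if "j \<in> insert b S" "x \<in> carrier M" for j x
    using insert.prems[OF that(1)] linear_functionalD(1)[OF _ that(2)] by blast+
  have cl: "(\<lambda>j. a j \<otimes> \<Phi> j x) \<in> S \<rightarrow> carrier k" "a b \<otimes> \<Phi> b x \<in> carrier k" "\<psi> x \<in> carrier k" if "x \<in> carrier M" for x
    using fa[OF _ that] linear_functionalD(1)[OF assms(1) that] by auto
  have e: "\<psi> x \<oplus> (\<Oplus>j\<in>insert b S. a j \<otimes> \<Phi> j x) = ?f x \<oplus> a b \<otimes> \<Phi> b x" if "x \<in> carrier M" for x
    using cl[OF that] insert.hyps by (simp add: a_ac)
  have g: "linear_functional M (\<lambda>x. ?f x \<oplus> a b \<otimes> \<Phi> b x)"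
    unfolding linear_functional_def
  proof (intro conjI ballI)
    show "(\<lambda>x. ?f x \<oplus> a b \<otimes> \<Phi> b x) \<in> carrier M \<rightarrow> carrier k" using cl by auto
    show "?f (x \<oplus>\<^bsub>M\<^esub> y) \<oplus> a b \<otimes> \<Phi> b (x \<oplus>\<^bsub>M\<^esub> y) = (?f x \<oplus> a b \<otimes> \<Phi> b x) \<oplus> (?f y \<oplus> a b \<otimes> \<Phi> b y)"
      if "x \<in> carrier M" "y \<in> carrier M" for x y
      unfolding linear_functionalD(2)[OF f that] linear_functionalD(2)[OF b(2) that]
      using linear_functionalD(1)[OF f] linear_functionalD(1)[OF b(2)] b(1) that by (simp add: r_distr a_ac)
    show "?f (c \<odot>\<^bsub>M\<^esub> x) \<oplus> a b \<otimes> \<Phi> b (c \<odot>\<^bsub>M\<^esub> x) = c \<otimes> (?f x \<oplus> a b \<otimes> \<Phi> b x)"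
      if "c \<in> carrier k" "x \<in> carrier M" for c x
      unfolding linear_functionalD(3)[OF f that] linear_functionalD(3)[OF b(2) that]
      using linear_functionalD(1)[OF f] linear_functionalD(1)[OF b(2)] b(1) that by (simp add: r_distr m_ac)
  qed
  show ?case using g e unfolding linear_functional_def by (simp add: Pi_iff)
qed

text \<open>Back substitution in a unitriangular system, starting from the largest value of
  \<open>c\<close>. The last clause is what has to be remembered of the fact that the new
  functionals are combinations of the old ones; it serves to separate the parities.\<close>

lemma dual_functionals:
  fixes c :: "'i \<Rightarrow> nat"
  assumes I: "finite I" and v: "\<And>i. i \<in> I \<Longrightarrow> v i \<in> carrier M" and lin: "\<And>i. i \<in> I \<Longrightarrow> linear_functional M (\<psi> i)"
    and diag: "\<And>i. i \<in> I \<Longrightarrow> \<psi> i (v i) = \<one>"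
    and tri: "\<And>i j. i \<in> I \<Longrightarrow> j \<in> I \<Longrightarrow> \<psi> i (v j) \<noteq> \<zero> \<Longrightarrow> i = j \<or> c i < c j"
    and i: "i \<in> I"
  shows "\<exists>\<phi>. linear_functional M \<phi> \<and> (\<forall>j\<in>I. \<phi> (v j) = (if j = i then \<one> else \<zero>)) \<and>
    (\<forall>x\<in>carrier M. (\<forall>j\<in>I. \<psi> j x = \<zero>) \<longrightarrow> \<phi> x = \<zero>)"
proof -
  obtain C where C: "\<And>j. j \<in> I \<Longrightarrow> c j \<le> C" using I by (meson Max_ge finite_imageI imageI)
  show ?thesis using i
  proof (induction "C - c i" arbitrary: i rule: less_induct)
    case less
    let ?P = "\<lambda>i \<phi>. linear_functional M \<phi> \<and> (\<forall>j\<in>I. \<phi> (v j) = (if j = i then \<one> else \<zero>)) \<and>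
      (\<forall>x\<in>carrier M. (\<forall>j\<in>I. \<psi> j x = \<zero>) \<longrightarrow> \<phi> x = \<zero>)"
    define S where "S = {j \<in> I. c i < c j}"
    have "\<forall>j\<in>S. \<exists>\<phi>. ?P j \<phi>"
    proof
      fix j assume j: "j \<in> S"
      then have "C - c j < C - c i" using C[of j] by (auto simp: S_def)
      then show "\<exists>\<phi>. ?P j \<phi>" using less.hyps[of j] j by (auto simp: S_def)
    qed
    then obtain \<Phi> where \<Phi>: "\<And>j. j \<in> S \<Longrightarrow> ?P j (\<Phi> j)" by metis
    define a where "a j = \<ominus> \<psi> i (v j)" for j
    have cl: "\<psi> i (v j) \<in> carrier k" if "j \<in> I" for j using linear_functionalD(1)[OF lin[OF less.prems] v[OF that]] .
    have fS: "finite S" "S \<subseteq> I" using I by (auto simp: S_def)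
    define \<phi> where "\<phi> x = \<psi> i x \<oplus> (\<Oplus>j\<in>S. a j \<otimes> \<Phi> j x)" for x
    have a: "a j \<in> carrier k" if "j \<in> I" for j using cl[OF that] by (simp add: a_def)
    have "linear_functional M \<phi>" unfolding \<phi>_def
      by (rule linear_functional_combination[OF lin[OF less.prems] fS(1)]) (use a fS \<Phi> in auto)
    moreover have "\<phi> (v t) = (if t = i then \<one> else \<zero>)" if t: "t \<in> I" for t
    proof -
      have "(\<Oplus>j\<in>S. a j \<otimes> \<Phi> j (v t)) = (\<Oplus>j\<in>S. if t = j then a j else \<zero>)"
        by (rule finsum_cong') (use a fS \<Phi> t in auto)
      also have "\<dots> = (if t \<in> S then a t else \<zero>)"
      proof (cases "t \<in> S")
        case True
        then show ?thesis using add.finprod_singleton[OF True fS(1), of a] a fS by (auto simp: Pi_def)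
      next
        case False
        have "(\<Oplus>j\<in>S. if t = j then a j else \<zero>) = (\<Oplus>j\<in>S. \<zero>)"
          by (rule finsum_cong') (use False in auto)
        then show ?thesis using False by simp
      qed
      finally have e: "\<phi> (v t) = \<psi> i (v t) \<oplus> (if t \<in> S then a t else \<zero>)" by (simp add: \<phi>_def)
      show ?thesis
      proof (cases "t \<in> S")
        case True
        then have "t \<noteq> i" by (auto simp: S_def)
        then show ?thesis using e True cl[OF t] by (simp add: a_def r_neg)
      next
        case False
        then have "t \<noteq> i \<Longrightarrow> \<psi> i (v t) = \<zero>" using tri[OF less.prems t] t by (auto simp: S_def)
        then show ?thesis using e False diag[OF t] cl[OF t] by auto
      qed
    qed
    moreover have "\<phi> x = \<zero>" if x: "x \<in> carrier M" "\<forall>j\<in>I. \<psi> j x = \<zero>" for x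
    proof -
      have "(\<Oplus>j\<in>S. a j \<otimes> \<Phi> j x) = (\<Oplus>j\<in>S. \<zero>)"
        by (rule finsum_cong') (use a fS \<Phi> x in auto)
      then show ?thesis using x less.prems by (simp add: \<phi>_def)
    qed
    ultimately show ?case by blast
  qed
qed

text \<open>
  As many generators as there are dual functionals: the matrices expressing the two families through
  each other are one-sided inverses of each other, hence two-sided over a commutative ring.
\<close>

lemma basis_of_dual_functionals:
  assumes I: "finite I" and v: "\<And>i. i \<in> I \<Longrightarrow> v i \<in> carrier M" and lin: "\<And>i. i \<in> I \<Longrightarrow> linear_functional M (\<phi> i)"
    and dual: "\<And>i j. i \<in> I \<Longrightarrow> j \<in> I \<Longrightarrow> \<phi> i (v j) = (if j = i then \<one> else \<zero>)"
    and w: "\<And>l. l < card I \<Longrightarrow> w l \<in> carrier M"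
    and gen: "\<And>x. x \<in> carrier M \<Longrightarrow> \<exists>a\<in>{..<card I} \<rightarrow> carrier k. x = (\<Oplus>\<^bsub>M\<^esub>l\<in>{..<card I}. a l \<odot>\<^bsub>M\<^esub> w l)"
    and x: "x \<in> carrier M"
  shows "x = (\<Oplus>\<^bsub>M\<^esub>i\<in>I. \<phi> i x \<odot>\<^bsub>M\<^esub> v i)"
proof -
  let ?n = "card I"
  obtain h where h: "bij_betw h {..<?n} I" using I by (metis ex_bij_betw_nat_finite lessThan_atLeast0)
  have hI: "h i \<in> I" if "i < ?n" for i using h that by (auto simp: bij_betw_def)
  obtain P where P: "\<And>j. j \<in> I \<Longrightarrow> P j \<in> {..<?n} \<rightarrow> carrier k \<and> v j = (\<Oplus>\<^bsub>M\<^esub>l\<in>{..<?n}. P j l \<odot>\<^bsub>M\<^esub> w l)"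
    using gen[OF v] by metis
  have Pc: "P j l \<in> carrier k" if "j \<in> I" "l < ?n" for j l using P[OF that(1)] that(2) by auto
  have Qc: "\<phi> j (w l) \<in> carrier k" if "j \<in> I" "l < ?n" for j l using linear_functionalD(1)[OF lin[OF that(1)] w[OF that(2)]] .
  have "(\<Oplus>l\<in>{..<?n}. P (h i) l \<otimes> \<phi> (h j) (w l)) = (if i = j then \<one> else \<zero>)" if "i < ?n" "j < ?n" for i j
  proof -
    have "\<phi> (h j) (v (h i)) = (\<Oplus>l\<in>{..<?n}. \<phi> (h j) (P (h i) l \<odot>\<^bsub>M\<^esub> w l))"
      using P[OF hI[OF that(1)]] linear_functional_finsum[OF lin[OF hI[OF that(2)]], of "{..<?n}" "\<lambda>l. P (h i) l \<odot>\<^bsub>M\<^esub> w l"]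
        Pc[OF hI[OF that(1)]] w by auto
    also have "\<dots> = (\<Oplus>l\<in>{..<?n}. P (h i) l \<otimes> \<phi> (h j) (w l))"
      by (rule finsum_cong') (use Pc hI that w Qc linear_functionalD(3)[OF lin[OF hI[OF that(2)]]] in auto)
    finally have "(\<Oplus>l\<in>{..<?n}. P (h i) l \<otimes> \<phi> (h j) (w l)) = \<phi> (h j) (v (h i))" ..
    moreover have "h i = h j \<longleftrightarrow> i = j" using h that by (auto simp: bij_betw_def inj_on_def)
    ultimately show ?thesis using dual[OF hI[OF that(2)] hI[OF that(1)]] by simp
  qed
  \<comment> \<open>Over a commutative ring a right inverse of a square matrix is a left inverse, so
    the \<open>v j\<close> express the generators in turn.\<close>
  then have QP: "(\<Oplus>j\<in>{..<?n}. \<phi> (h j) (w l) \<otimes> P (h j) l') = (if l = l' then \<one> else \<zero>)" if "l < ?n" "l' < ?n" for l l'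
    by (intro left_inverse_of_right_inverse[of ?n "\<lambda>i l. P (h i) l" "\<lambda>l j. \<phi> (h j) (w l)"]) (use that Pc Qc hI in auto)
  have QP': "(\<Oplus>j\<in>I. \<phi> j (w l) \<otimes> P j l') = (if l = l' then \<one> else \<zero>)" if "l < ?n" "l' < ?n" for l l'
  proof -
    have hb: "I = h ` {..<?n}" "inj_on h {..<?n}" using h by (auto simp: bij_betw_def)
    have "(\<Oplus>j\<in>h ` {..<?n}. \<phi> j (w l) \<otimes> P j l') = (\<Oplus>j\<in>{..<?n}. \<phi> (h j) (w l) \<otimes> P (h j) l')"
      by (rule add.finprod_reindex[OF _ hb(2)]) (use Pc Qc that hb(1) in auto)
    then show ?thesis using QP[OF that] hb(1) by simp
  qed
  have gen_w: "(\<Oplus>\<^bsub>M\<^esub>j\<in>I. \<phi> j (w l) \<odot>\<^bsub>M\<^esub> v j) = w l" if l: "l < ?n" for l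
  proof -
    have "(\<Oplus>\<^bsub>M\<^esub>j\<in>I. \<phi> j (w l) \<odot>\<^bsub>M\<^esub> v j) = (\<Oplus>\<^bsub>M\<^esub>j\<in>I. \<Oplus>\<^bsub>M\<^esub>l'\<in>{..<?n}. (\<phi> j (w l) \<otimes> P j l') \<odot>\<^bsub>M\<^esub> w l')"
    proof (rule M.finsum_cong')
      fix j assume j: "j \<in> I"
      have "\<phi> j (w l) \<odot>\<^bsub>M\<^esub> (\<Oplus>\<^bsub>M\<^esub>l'\<in>{..<?n}. P j l' \<odot>\<^bsub>M\<^esub> w l') = (\<Oplus>\<^bsub>M\<^esub>l'\<in>{..<?n}. \<phi> j (w l) \<odot>\<^bsub>M\<^esub> (P j l' \<odot>\<^bsub>M\<^esub> w l'))"
        by (rule M.finsum_smult_ldistr) (use Qc[OF j l] Pc[OF j] w in auto)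
      also have "\<dots> = (\<Oplus>\<^bsub>M\<^esub>l'\<in>{..<?n}. (\<phi> j (w l) \<otimes> P j l') \<odot>\<^bsub>M\<^esub> w l')"
        by (rule M.finsum_cong') (use Qc[OF j l] Pc[OF j] w in \<open>auto simp: M.smult_assoc1\<close>)
      finally show "\<phi> j (w l) \<odot>\<^bsub>M\<^esub> v j = (\<Oplus>\<^bsub>M\<^esub>l'\<in>{..<?n}. (\<phi> j (w l) \<otimes> P j l') \<odot>\<^bsub>M\<^esub> w l')" using P[OF j] by simp
    qed (use Qc l Pc w in \<open>auto intro!: M.finsum_closed\<close>)
    also have "\<dots> = (\<Oplus>\<^bsub>M\<^esub>l'\<in>{..<?n}. \<Oplus>\<^bsub>M\<^esub>j\<in>I. (\<phi> j (w l) \<otimes> P j l') \<odot>\<^bsub>M\<^esub> w l')"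
      by (rule finsum_swap[OF M.abelian_group_axioms I]) (use Qc l Pc w in auto)
    also have "\<dots> = (\<Oplus>\<^bsub>M\<^esub>l'\<in>{..<?n}. if l = l' then w l' else \<zero>\<^bsub>M\<^esub>)"
    proof (rule M.finsum_cong')
      fix l' assume l': "l' \<in> {..<?n}"
      have "(\<Oplus>\<^bsub>M\<^esub>j\<in>J. (\<phi> j (w l) \<otimes> P j l') \<odot>\<^bsub>M\<^esub> w l') = (\<Oplus>j\<in>J. \<phi> j (w l) \<otimes> P j l') \<odot>\<^bsub>M\<^esub> w l'" if "finite J" "J \<subseteq> I" for J
        using that
      proof (induction J rule: finite_induct)
        case (insert j J)
        have "(\<lambda>j. \<phi> j (w l) \<otimes> P j l') \<in> J \<rightarrow> carrier k" "\<phi> j (w l) \<otimes> P j l' \<in> carrier k"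
          using insert.prems Qc[OF _ l] Pc l' by auto
        then show ?case using insert w l' by (simp add: M.smult_l_distr Pi_def)
      qed (use w l' in simp)
      from this[OF I order_refl] show "(\<Oplus>\<^bsub>M\<^esub>j\<in>I. (\<phi> j (w l) \<otimes> P j l') \<odot>\<^bsub>M\<^esub> w l') = (if l = l' then w l' else \<zero>\<^bsub>M\<^esub>)"
        using QP'[OF l, of l'] l' w by auto
    qed (use w in auto)
    also have "\<dots> = w l" by (rule M.add.finprod_singleton) (use l w in auto)
    finally show ?thesis .
  qed
  obtain a where a: "a \<in> {..<?n} \<rightarrow> carrier k" "x = (\<Oplus>\<^bsub>M\<^esub>l\<in>{..<?n}. a l \<odot>\<^bsub>M\<^esub> w l)" using gen[OF x] by blast
  \<comment> \<open>The candidate for the projection onto the span of the \<open>v i\<close>. It is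
    linear and fixes the generators, hence it is the identity.\<close>
  let ?\<pi> = "\<lambda>x. \<Oplus>\<^bsub>M\<^esub>i\<in>I. \<phi> i x \<odot>\<^bsub>M\<^esub> v i"
  have cl: "(\<lambda>i. \<phi> i x \<odot>\<^bsub>M\<^esub> v i) \<in> I \<rightarrow> carrier M" if "x \<in> carrier M" for x
    using linear_functionalD(1)[OF lin] v that by auto
  have \<pi>_smult: "?\<pi> (b \<odot>\<^bsub>M\<^esub> x) = b \<odot>\<^bsub>M\<^esub> ?\<pi> x" if "b \<in> carrier k" "x \<in> carrier M" for b x
  proof -
    have "?\<pi> (b \<odot>\<^bsub>M\<^esub> x) = (\<Oplus>\<^bsub>M\<^esub>i\<in>I. b \<odot>\<^bsub>M\<^esub> (\<phi> i x \<odot>\<^bsub>M\<^esub> v i))"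
      by (rule M.finsum_cong')
        (use that v linear_functionalD(1)[OF lin] linear_functionalD(3)[OF lin] in \<open>auto simp: M.smult_assoc1\<close>)
    also have "\<dots> = b \<odot>\<^bsub>M\<^esub> ?\<pi> x"
      by (rule M.finsum_smult_ldistr[symmetric]) (use I that cl[OF that(2)] in auto)
    finally show ?thesis .
  qed
  have \<pi>_add: "?\<pi> (x \<oplus>\<^bsub>M\<^esub> y) = ?\<pi> x \<oplus>\<^bsub>M\<^esub> ?\<pi> y" if "x \<in> carrier M" "y \<in> carrier M" for x y
  proof -
    have "?\<pi> (x \<oplus>\<^bsub>M\<^esub> y) = (\<Oplus>\<^bsub>M\<^esub>i\<in>I. (\<phi> i x \<odot>\<^bsub>M\<^esub> v i) \<oplus>\<^bsub>M\<^esub> (\<phi> i y \<odot>\<^bsub>M\<^esub> v i))"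
      by (rule M.finsum_cong')
        (use that v linear_functionalD(1)[OF lin] linear_functionalD(2)[OF lin] in \<open>auto simp: M.smult_l_distr\<close>)
    then show ?thesis using M.finsum_addf[OF cl[OF that(1)] cl[OF that(2)]] by simp
  qed
  have "?\<pi> (\<Oplus>\<^bsub>M\<^esub>l\<in>L. a l \<odot>\<^bsub>M\<^esub> w l) = (\<Oplus>\<^bsub>M\<^esub>l\<in>L. a l \<odot>\<^bsub>M\<^esub> w l)" if "finite L" "L \<subseteq> {..<?n}" for L
    using that
  proof (induction L rule: finite_induct)
    case empty
    have "?\<pi> \<zero>\<^bsub>M\<^esub> = (\<Oplus>\<^bsub>M\<^esub>i\<in>I. \<zero>\<^bsub>M\<^esub>)"
      by (rule M.finsum_cong') (use linear_functional_zero[OF lin] v in auto)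
    then show ?case by simp
  next
    case (insert l L)
    have c: "(\<lambda>l. a l \<odot>\<^bsub>M\<^esub> w l) \<in> L \<rightarrow> carrier M" "a l \<odot>\<^bsub>M\<^esub> w l \<in> carrier M" "a l \<in> carrier k" "w l \<in> carrier M" "l < ?n"
      using insert.prems a(1) w by (auto simp: Pi_def subset_eq)
    show ?case
      using insert c \<pi>_add[OF c(2) M.finsum_closed[OF c(1)]] \<pi>_smult[OF c(3,4)] gen_w[OF c(5)] by simp
  qed
  from this[of "{..<?n}"] show ?thesis unfolding a(2)[symmetric] by simp
qed

text \<open>\<open>\<phi> i\<close> reads off the coefficient of \<open>v i\<close> in any
  expansion.\<close>

lemma unique_coefficients:
  assumes I: "finite I" and v: "\<And>i. i \<in> I \<Longrightarrow> v i \<in> carrier M" and lin: "\<And>i. i \<in> I \<Longrightarrow> linear_functional M (\<phi> i)"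
    and dual: "\<And>i j. i \<in> I \<Longrightarrow> j \<in> I \<Longrightarrow> \<phi> i (v j) = (if j = i then \<one> else \<zero>)"
    and x: "x \<in> carrier M" "x = (\<Oplus>\<^bsub>M\<^esub>i\<in>I. \<phi> i x \<odot>\<^bsub>M\<^esub> v i)"
  shows "\<exists>!a. a \<in> I \<rightarrow>\<^sub>E carrier k \<and> finite {i \<in> I. a i \<noteq> \<zero>} \<and> x = (\<Oplus>\<^bsub>M\<^esub>i \<in> {i \<in> I. a i \<noteq> \<zero>}. a i \<odot>\<^bsub>M\<^esub> v i)"
proof (rule ex1I)
  have supp: "(\<Oplus>\<^bsub>M\<^esub>i \<in> {i \<in> I. a i \<noteq> \<zero>}. a i \<odot>\<^bsub>M\<^esub> v i) = (\<Oplus>\<^bsub>M\<^esub>i\<in>I. a i \<odot>\<^bsub>M\<^esub> v i)" if "a \<in> I \<rightarrow> carrier k" for a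
    by (rule M.add.finprod_mono_neutral_cong_left) (use I v that in \<open>auto simp: Pi_def\<close>)
  let ?a = "\<lambda>i\<in>I. \<phi> i x"
  have a: "?a \<in> I \<rightarrow>\<^sub>E carrier k" using linear_functionalD(1)[OF lin x(1)] by auto
  have "(\<Oplus>\<^bsub>M\<^esub>i\<in>I. ?a i \<odot>\<^bsub>M\<^esub> v i) = (\<Oplus>\<^bsub>M\<^esub>i\<in>I. \<phi> i x \<odot>\<^bsub>M\<^esub> v i)"
    by (rule M.finsum_cong') (use v linear_functionalD(1)[OF lin x(1)] in auto)
  then have "x = (\<Oplus>\<^bsub>M\<^esub>i \<in> {i \<in> I. ?a i \<noteq> \<zero>}. ?a i \<odot>\<^bsub>M\<^esub> v i)" using x(2) supp[of ?a] a by (auto simp: PiE_def)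
  then show "?a \<in> I \<rightarrow>\<^sub>E carrier k \<and> finite {i \<in> I. ?a i \<noteq> \<zero>} \<and> x = (\<Oplus>\<^bsub>M\<^esub>i \<in> {i \<in> I. ?a i \<noteq> \<zero>}. ?a i \<odot>\<^bsub>M\<^esub> v i)"
    using a I by auto
  fix a assume a: "a \<in> I \<rightarrow>\<^sub>E carrier k \<and> finite {i \<in> I. a i \<noteq> \<zero>} \<and> x = (\<Oplus>\<^bsub>M\<^esub>i \<in> {i \<in> I. a i \<noteq> \<zero>}. a i \<odot>\<^bsub>M\<^esub> v i)"
  then have ac: "a \<in> I \<rightarrow> carrier k" by (auto simp: PiE_def)
  have xa: "x = (\<Oplus>\<^bsub>M\<^esub>i\<in>I. a i \<odot>\<^bsub>M\<^esub> v i)" using a supp[OF ac] by simp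
  have "\<phi> i x = a i" if i: "i \<in> I" for i
  proof -
    have "\<phi> i x = (\<Oplus>j\<in>I. \<phi> i (a j \<odot>\<^bsub>M\<^esub> v j))"
      unfolding xa by (rule linear_functional_finsum[OF lin[OF i] I]) (use ac v in auto)
    also have "\<dots> = (\<Oplus>j\<in>I. if i = j then a j else \<zero>)"
    proof (rule finsum_cong')
      fix j assume j: "j \<in> I"
      have "a j \<in> carrier k" using ac j by auto
      then show "\<phi> i (a j \<odot>\<^bsub>M\<^esub> v j) = (if i = j then a j else \<zero>)"
        using linear_functionalD(3)[OF lin[OF i] _ v[OF j]] dual[OF i j] by auto
    qed (use ac in auto)
    also have "\<dots> = a i" by (rule add.finprod_singleton) (use i I ac in auto)
    finally show ?thesis .
  qed
  then show "a = ?a" using a by (auto simp: PiE_def extensional_def)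
qed

end

end

section \<open>The morphism spaces\<close>

text \<open>Composition with one fixed bijection identifies the permutations of \<open>A\<close>
  with the bijections to \<open>B\<close>, taken as extensional functions.\<close>

lemma card_bijections:
  assumes "finite A" "finite B" "card A = card B"
  shows "card {m \<in> A \<rightarrow>\<^sub>E B. bij_betw m A B} = fact (card A)"
proof -
  obtain m0 where m0: "bij_betw m0 A B" using assms finite_same_card_bij by blast
  have "bij_betw (\<lambda>p. restrict (m0 \<circ> p) A) {p. p permutes A} {m \<in> A \<rightarrow>\<^sub>E B. bij_betw m A B}"
  proof (rule bij_betwI')
    fix p p' assume p: "p \<in> {p. p permutes A}" "p' \<in> {p. p permutes A}"
    show "restrict (m0 \<circ> p) A = restrict (m0 \<circ> p') A \<longleftrightarrow> p = p'"
    proof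
      assume e: "restrict (m0 \<circ> p) A = restrict (m0 \<circ> p') A"
      show "p = p'"
      proof
        fix x
        show "p x = p' x"
        proof (cases "x \<in> A")
          case True
          then have "m0 (p x) = m0 (p' x)" "p x \<in> A" "p' x \<in> A"
            using fun_cong[OF e, of x] p by (auto simp: permutes_in_image)
          then show ?thesis using m0 by (auto simp: bij_betw_def inj_on_def)
        next
          case False
          then show ?thesis using p by (auto simp: permutes_def)
        qed
      qed
    qed simp
  next
    fix p assume "p \<in> {p. p permutes A}"
    then have "bij_betw (m0 \<circ> p) A B" using bij_betw_trans[OF permutes_imp_bij m0] by simp
    then have b: "bij_betw (restrict (m0 \<circ> p) A) A B" by (subst bij_betw_cong[of _ _ "m0 \<circ> p"]) auto
    then have "restrict (m0 \<circ> p) A \<in> A \<rightarrow>\<^sub>E B" by (auto simp: bij_betw_def)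
    then show "restrict (m0 \<circ> p) A \<in> {m \<in> A \<rightarrow>\<^sub>E B. bij_betw m A B}" using b by simp
  next
    fix m assume m: "m \<in> {m \<in> A \<rightarrow>\<^sub>E B. bij_betw m A B}"
    define p where "p x = (if x \<in> A then inv_into A m0 (m x) else x)" for x
    have "bij_betw (inv_into A m0 \<circ> m) A A" using m by (intro bij_betw_trans[OF _ bij_betw_inv_into[OF m0]]) simp
    then have "bij_betw p A A" by (subst bij_betw_cong[of _ _ "inv_into A m0 \<circ> m"]) (auto simp: p_def)
    then have "p permutes A" by (rule bij_imp_permutes) (simp add: p_def)
    moreover have "m = restrict (m0 \<circ> p) A"
    proof
      fix x
      have "x \<in> A \<Longrightarrow> m x \<in> m0 ` A" using m m0 by (auto simp: bij_betw_def)
      then show "m x = restrict (m0 \<circ> p) A x"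
        using m by (auto simp: p_def f_inv_into_f PiE_def extensional_def)
    qed
    ultimately show "\<exists>p\<in>{p. p permutes A}. m = restrict (m0 \<circ> p) A" by blast
  qed
  then have "card {p. p permutes A} = card {m \<in> A \<rightarrow>\<^sub>E B. bij_betw m A B}" by (rule bij_betw_same_card)
  then show ?thesis using card_permutations[OF HOL.refl assms(1)] by simp
qed

lemma finite_endpoints [simp]: "finite (origins X Y)" "finite (termini X Y)"
  by (auto simp: origins_def termini_def)

lemma card_positions: "card {i. i < length X \<and> X ! i = x} = count_list X x"
  by (simp add: count_list_eq_length_filter length_filter_conv_card eq_commute)

lemma card_endpoints:
  "card (origins X Y) = count_list X \<up> + count_list Y \<down>" "card (termini X Y) = count_list X \<down> + count_list Y \<up>"
  unfolding origins_def termini_def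
  by (subst card_Un_disjoint; auto simp: card_image inj_on_def card_positions)+

lemma matching_unique:
  assumes "matching X Y m" "positive_reduced_lift X Y m D" "positive_reduced_lift X Y m' D" "s \<in> origins X Y"
  shows "m' s = m s"
proof -
  have "m s \<in> termini X Y" using assms(1,4) by (auto simp: matching_def bij_betw_def)
  then show ?thesis
    using assms(2)[unfolded positive_reduced_lift_def, THEN conjunct2, THEN conjunct1, rule_format, OF assms(4), of "m s"]
      assms(3)[unfolded positive_reduced_lift_def, THEN conjunct2, THEN conjunct1, rule_format, OF assms(4), of "m s"] by simp
qed

lemma lift_cong: "(\<And>s. s \<in> origins X Y \<Longrightarrow> m s = m' s) \<Longrightarrow> positive_reduced_lift X Y m D \<longleftrightarrow> positive_reduced_lift X Y m' D"
  unfolding positive_reduced_lift_def by simp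

text \<open>A matching is arbitrary outside the origins, so matchings are counted by their
  restrictions. A lift determines its matching there, and \<open>B\<close> contains one lift of
  each.\<close>

lemma lift_choice_card:
  assumes "lift_choice X Y B"
  shows "finite B \<and> card B = (if card (origins X Y) = card (termini X Y) then fact (card (origins X Y)) else 0)"
proof -
  let ?O = "origins X Y" and ?T = "termini X Y"
  define mt where "mt D = (SOME m. matching X Y m \<and> positive_reduced_lift X Y m D)" for D
  have mt: "matching X Y (mt D) \<and> positive_reduced_lift X Y (mt D) D" if "D \<in> B" for D
    unfolding mt_def by (rule someI_ex[OF assms[unfolded lift_choice_def, THEN conjunct1, rule_format, OF that]])
  have u: "D = D'" if "D \<in> B" "D' \<in> B" "matching X Y m" "positive_reduced_lift X Y m D" "positive_reduced_lift X Y m D'" for D D' m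
    using assms[unfolded lift_choice_def, THEN conjunct2, rule_format, OF that(3)] that by blast
  have "bij_betw (\<lambda>D. restrict (mt D) ?O) B {m \<in> ?O \<rightarrow>\<^sub>E ?T. bij_betw m ?O ?T}"
  proof (rule bij_betwI')
    fix D D' assume D: "D \<in> B" "D' \<in> B"
    show "restrict (mt D) ?O = restrict (mt D') ?O \<longleftrightarrow> D = D'"
    proof
      assume e: "restrict (mt D) ?O = restrict (mt D') ?O"
      have "mt D s = mt D' s" if "s \<in> ?O" for s using fun_cong[OF e, of s] that by simp
      then have "positive_reduced_lift X Y (mt D) D'" using lift_cong[of X Y "mt D" "mt D'" D'] mt[OF D(2)] by blast
      then show "D = D'" using u[OF D] mt[OF D(1)] by blast
    qed simp
  next
    fix D assume "D \<in> B"
    then have "bij_betw (mt D) ?O ?T" using mt by (simp add: matching_def)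
    then have b: "bij_betw (restrict (mt D) ?O) ?O ?T" by (subst bij_betw_cong[of _ _ "mt D"]) auto
    then have "restrict (mt D) ?O \<in> ?O \<rightarrow>\<^sub>E ?T" by (auto simp: bij_betw_def)
    then show "restrict (mt D) ?O \<in> {m \<in> ?O \<rightarrow>\<^sub>E ?T. bij_betw m ?O ?T}" using b by simp
  next
    fix m assume m: "m \<in> {m \<in> ?O \<rightarrow>\<^sub>E ?T. bij_betw m ?O ?T}"
    then have mm: "matching X Y m" by (simp add: matching_def)
    then obtain D where D: "D \<in> B" "positive_reduced_lift X Y m D"
      using assms[unfolded lift_choice_def, THEN conjunct2, rule_format, OF mm] by blast
    have "m = restrict (mt D) ?O"
    proof
      fix s
      show "m s = restrict (mt D) ?O s"
        using matching_unique[OF mm D(2), of "mt D" s] mt[OF D(1)] m by (auto simp: PiE_def extensional_def)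
    qed
    then show "\<exists>D\<in>B. m = restrict (mt D) ?O" using D(1) by blast
  qed
  then have bb: "finite B \<longleftrightarrow> finite {m \<in> ?O \<rightarrow>\<^sub>E ?T. bij_betw m ?O ?T}" "card B = card {m \<in> ?O \<rightarrow>\<^sub>E ?T. bij_betw m ?O ?T}"
    using bij_betw_finite bij_betw_same_card by blast+
  have "finite (?O \<rightarrow>\<^sub>E ?T)" by (intro finite_PiE) auto
  then have "finite B" using bb(1) by simp
  moreover have "card B = fact (card ?O)" if "card ?O = card ?T"
    using bb(2) card_bijections[of ?O ?T] that by simp
  moreover have "card B = 0" if "card ?O \<noteq> card ?T"
  proof -
    have "{m \<in> ?O \<rightarrow>\<^sub>E ?T. bij_betw m ?O ?T} = {}" using that bij_betw_same_card by blast
    then show ?thesis using bb(2) by (simp only: card.empty)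
  qed
  ultimately show ?thesis by simp
qed

section \<open>Homogeneity and typing of decorated diagrams\<close>

lemma homogeneous_Phi:
  assumes "homogeneous p f"
  shows "homogeneous p (Phi A B f)"
proof -
  have g: "homogeneous False (Gen CapL)" "homogeneous False (Gen CupL)"
    using homogeneous.Gen[of CapL] homogeneous.Gen[of CupL] by (simp_all add: gpar_def)
  show ?thesis
    unfolding Phi_def
    using homogeneous.Comp[OF homogeneous.Tens[OF g(1) homogeneous.Ident[of "B @ [\<down>]"]]
        homogeneous.Comp[OF homogeneous.Tens[OF homogeneous.Ident[of "[\<down>]"] homogeneous.Tens[OF assms homogeneous.Ident[of "[\<down>]"]]]
          homogeneous.Tens[OF homogeneous.Ident[of "\<down> # A"] g(2)]]] by simp
qed

lemma homogeneous_atom: "\<exists>p. homogeneous p (atom_mor z a)"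
proof -
  have g: "homogeneous False (Gen g)" if "g \<noteq> Clif" for g using homogeneous.Gen[of g] that by (simp add: gpar_def)
  have l: "homogeneous False l_pos" "homogeneous False l_neg"
    unfolding l_pos_def l_neg_def by (auto intro!: homogeneous_Phi g)
  have d: "homogeneous False d_pos" "homogeneous False d_neg"
    unfolding d_pos_def d_neg_def using l by (auto intro!: homogeneous_Phi)
  have c: "homogeneous False cap_R" "homogeneous False cup_R"
    unfolding cap_R_def cup_R_def using homogeneous.Comp[OF g g] by auto
  have "homogeneous False (cup_R \<cdot> cap_R)" using homogeneous.Comp[OF c(2,1)] by simp
  then have r: "homogeneous False (r_pos z)"
    unfolding r_pos_def using homogeneous.Add[OF g[of RNeg] homogeneous.Scale] by simp
  have t: "homogeneous True (Gen Clif)" using homogeneous.Gen[of Clif] by (simp add: gpar_def)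
  then have "homogeneous True clif_down" unfolding clif_down_def by (rule homogeneous_Phi)
  then show ?thesis using g l d c r t by (cases a) (auto split: if_splits)
qed

lemma homogeneous_diagram: "\<exists>p. homogeneous p (diagram_mor z X D)"
proof (induction D arbitrary: X)
  case (Cons L D)
  obtain l a r where L: "L = (l, a, r)" by (cases L)
  obtain p q where "homogeneous p (diagram_mor z (l @ acod a @ r) D)" "homogeneous q (atom_mor z a)"
    using Cons[of "l @ acod a @ r"] homogeneous_atom[of z a] by blast
  from homogeneous.Comp[OF this(1) homogeneous.Tens[OF homogeneous.Ident homogeneous.Tens[OF this(2) homogeneous.Ident]]]
  show ?case unfolding L by auto
qed (auto intro: homogeneous.Ident)

lemma homogeneous_token: "\<exists>p. homogeneous p (token x)"
  using homogeneous.Gen[of Clif] homogeneous_Phi[OF homogeneous.Gen[of Clif], of "[]" "[]"] by (cases x) (auto simp: clif_down_def)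

lemma homogeneous_token_row: "\<exists>p. homogeneous p (token_row X S :: 'k mor)"
proof -
  have "\<exists>p. homogeneous p (foldr (\<parallel>) (map (\<lambda>i. if i \<in> S then token (X ! i) else Ident [X ! i]) is) (Ident []) :: 'k mor)" for "is"
  proof (induction "is")
    case (Cons i "is")
    have "\<exists>p. homogeneous p (if i \<in> S then token (X ! i) else Ident [X ! i] :: 'k mor)"
      using homogeneous_token homogeneous.Ident by (cases "i \<in> S") auto
    then obtain p q where "homogeneous p (if i \<in> S then token (X ! i) else Ident [X ! i] :: 'k mor)"
      "homogeneous q (foldr (\<parallel>) (map (\<lambda>i. if i \<in> S then token (X ! i) else Ident [X ! i]) is) (Ident []) :: 'k mor)"
      using Cons by blast
    from homogeneous.Tens[OF this] show ?case by auto
  qed (auto intro: homogeneous.Ident)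
  then show ?thesis unfolding token_row_def .
qed

lemma homogeneous_bullet: "\<exists>p. homogeneous p (bullet_expr (z :: 'k) X Y D T)"
proof -
  obtain p q r where "homogeneous p (token_row Y {j. Top j \<in> T} :: 'k mor)" "homogeneous q (diagram_mor z X D)"
    "homogeneous r (token_row X {i. Bot i \<in> T} :: 'k mor)"
    using homogeneous_token_row[of Y "{j. Top j \<in> T}"] homogeneous_diagram[of z X D] homogeneous_token_row[of X "{i. Bot i \<in> T}"]
    by blast
  from homogeneous.Comp[OF this(1) homogeneous.Comp[OF this(2,3)]] show ?thesis unfolding bullet_expr_def by blast
qed

lemma arrow_token: "arrow k [x] [x] (token x)"
  using arrow.Gen[of k Clif] arrow_clif_down by (cases x) auto

lemma arrow_token_row: "arrow k X X (token_row X S)"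
proof -
  have "arrow k (map (\<lambda>i. X ! i) is) (map (\<lambda>i. X ! i) is)
      (foldr (\<parallel>) (map (\<lambda>i. if i \<in> S then token (X ! i) else Ident [X ! i]) is) (Ident []))" for "is"
  proof (induction "is")
    case (Cons i "is")
    have "arrow k [X ! i] [X ! i] (if i \<in> S then token (X ! i) else Ident [X ! i])"
      using arrow_token arrow.Ident by auto
    from arrow.Tens[OF this Cons] show ?case by simp
  qed (auto intro: arrow.Ident)
  from this[of "[0..<length X]"] show ?thesis unfolding token_row_def by (simp add: map_nth)
qed

lemma arrow_bullet: "z \<in> carrier k \<Longrightarrow> diagram X Y D \<Longrightarrow> arrow k X Y (bullet_expr z X Y D T)"
  unfolding bullet_expr_def by (rule arrow.Comp[OF arrow_token_row arrow.Comp[OF arrow_diagram arrow_token_row]])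

section \<open>The supermodule of morphisms\<close>

context cring_param
begin

abbreviation cl :: "obj \<Rightarrow> obj \<Rightarrow> 'k mor \<Rightarrow> 'k mor set" where "cl \<equiv> mclass k z"
abbreviation HomM :: "obj \<Rightarrow> obj \<Rightarrow> ('k, 'k mor set) module" where "HomM \<equiv> Hom k z"

lemma cl_eqI:
  assumes "E X Y f g"
  shows "cl X Y f = cl X Y g"
  using E_trans[OF assms] E_trans[OF E_sym[OF assms]] unfolding mclass_def by auto

lemma cl_self: "arrow k X Y f \<Longrightarrow> f \<in> cl X Y f"
  using E_refl by (simp add: mclass_def)

lemma Hom_carrier: "carrier (HomM X Y) = cl X Y ` {f. arrow k X Y f}"
  by (simp add: Hom_def)

lemma Hom_zero: "\<zero>\<^bsub>HomM X Y\<^esub> = cl X Y (Zero X Y)"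
  by (simp add: Hom_def)

lemma Hom_add:
  assumes "arrow k X Y f" "arrow k X Y g"
  shows "cl X Y f \<oplus>\<^bsub>HomM X Y\<^esub> cl X Y g = cl X Y (Add f g)"
proof -
  have "(\<Union>f' \<in> cl X Y f. \<Union>g' \<in> cl X Y g. cl X Y (Add f' g')) = cl X Y (Add f g)"
  proof (intro SUP_eq_const)
    fix f' g' assume "f' \<in> cl X Y f" "g' \<in> cl X Y g"
    then have "E X Y f f'" "E X Y g g'" by (simp_all add: mclass_def)
    from cl_eqI[OF eqv.add_cong[OF this]] show "cl X Y (Add f' g') = cl X Y (Add f g)" ..
  qed (use cl_self[OF assms(1)] cl_self[OF assms(2)] in blast)+
  then show ?thesis unfolding Hom_def by simp
qed

lemma Hom_smult:
  assumes "a \<in> carrier k" "arrow k X Y f"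
  shows "a \<odot>\<^bsub>HomM X Y\<^esub> cl X Y f = cl X Y (Scale a f)"
proof -
  have "(\<Union>f' \<in> cl X Y f. cl X Y (Scale a f')) = cl X Y (Scale a f)"
  proof (rule SUP_eq_const)
    fix f' assume "f' \<in> cl X Y f"
    then have "E X Y f f'" by (simp add: mclass_def)
    from cl_eqI[OF eqv.scale_cong[OF assms(1) this]] show "cl X Y (Scale a f') = cl X Y (Scale a f)" ..
  qed (use cl_self[OF assms(2)] in blast)
  then show ?thesis unfolding Hom_def by simp
qed

lemma Hom_abelian_group: "abelian_group (HomM X Y)"
proof (rule abelian_groupI)
  fix x assume "x \<in> carrier (HomM X Y)"
  then obtain f where f: "arrow k X Y f" "x = cl X Y f" by (auto simp: Hom_carrier)
  have m: "arrow k X Y (Scale (\<ominus> \<one>) f)" by (intro arrow.Scale f a_inv_closed one_closed)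
  show "\<zero>\<^bsub>HomM X Y\<^esub> \<oplus>\<^bsub>HomM X Y\<^esub> x = x"
    unfolding Hom_zero f(2) Hom_add[OF arrow.Zero f(1)] by (rule cl_eqI[OF eqv.add_zero[OF f(1)]])
  show "\<exists>y\<in>carrier (HomM X Y). y \<oplus>\<^bsub>HomM X Y\<^esub> x = \<zero>\<^bsub>HomM X Y\<^esub>"
    unfolding f(2) using Hom_add[OF m f(1)] cl_eqI[OF eqv.add_neg[OF f(1)]] m by (auto simp: Hom_carrier Hom_zero)
  fix y assume "y \<in> carrier (HomM X Y)"
  then obtain g where g: "arrow k X Y g" "y = cl X Y g" by (auto simp: Hom_carrier)
  show "x \<oplus>\<^bsub>HomM X Y\<^esub> y \<in> carrier (HomM X Y)"
    unfolding f(2) g(2) Hom_add[OF f(1) g(1)] using arrow.Add[OF f(1) g(1)] by (auto simp: Hom_carrier)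
  show "x \<oplus>\<^bsub>HomM X Y\<^esub> y = y \<oplus>\<^bsub>HomM X Y\<^esub> x"
    unfolding f(2) g(2) Hom_add[OF f(1) g(1)] Hom_add[OF g(1) f(1)] by (rule cl_eqI[OF eqv.add_commute[OF f(1) g(1)]])
  fix w assume "w \<in> carrier (HomM X Y)"
  then obtain h where h: "arrow k X Y h" "w = cl X Y h" by (auto simp: Hom_carrier)
  show "x \<oplus>\<^bsub>HomM X Y\<^esub> y \<oplus>\<^bsub>HomM X Y\<^esub> w = x \<oplus>\<^bsub>HomM X Y\<^esub> (y \<oplus>\<^bsub>HomM X Y\<^esub> w)"
    unfolding f(2) g(2) h(2) Hom_add[OF f(1) g(1)] Hom_add[OF g(1) h(1)]
      Hom_add[OF arrow.Add[OF f(1) g(1)] h(1)] Hom_add[OF f(1) arrow.Add[OF g(1) h(1)]]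
    by (rule cl_eqI[OF eqv.add_assoc[OF f(1) g(1) h(1)]])
qed (auto simp: Hom_carrier Hom_zero intro: arrow.Zero)

lemma Hom_module: "module k (HomM X Y)"
proof (rule moduleI[OF is_cring Hom_abelian_group])
  fix a x assume a: "a \<in> carrier k" and "x \<in> carrier (HomM X Y)"
  then obtain f where f: "arrow k X Y f" "x = cl X Y f" by (auto simp: Hom_carrier)
  have af: "arrow k X Y (Scale a f)" by (rule arrow.Scale[OF a f(1)])
  show "a \<odot>\<^bsub>HomM X Y\<^esub> x \<in> carrier (HomM X Y)"
    unfolding f(2) Hom_smult[OF a f(1)] using af by (auto simp: Hom_carrier)
  {
    fix b assume b: "b \<in> carrier k"
    have bf: "arrow k X Y (Scale b f)" by (rule arrow.Scale[OF b f(1)])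
    show "(a \<oplus> b) \<odot>\<^bsub>HomM X Y\<^esub> x = (a \<odot>\<^bsub>HomM X Y\<^esub> x) \<oplus>\<^bsub>HomM X Y\<^esub> (b \<odot>\<^bsub>HomM X Y\<^esub> x)"
      unfolding f(2) Hom_smult[OF a f(1)] Hom_smult[OF b f(1)] Hom_smult[OF a_closed[OF a b] f(1)] Hom_add[OF af bf]
      by (rule cl_eqI[OF eqv.scale_add_left[OF a b f(1)]])
    show "(a \<otimes> b) \<odot>\<^bsub>HomM X Y\<^esub> x = a \<odot>\<^bsub>HomM X Y\<^esub> (b \<odot>\<^bsub>HomM X Y\<^esub> x)"
      unfolding f(2) Hom_smult[OF b f(1)] Hom_smult[OF m_closed[OF a b] f(1)] Hom_smult[OF a bf]
      by (rule cl_eqI[OF eqv.scale_mult[OF a b f(1)]])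
  }
  fix y assume "y \<in> carrier (HomM X Y)"
  then obtain g where g: "arrow k X Y g" "y = cl X Y g" by (auto simp: Hom_carrier)
  show "a \<odot>\<^bsub>HomM X Y\<^esub> (x \<oplus>\<^bsub>HomM X Y\<^esub> y) = (a \<odot>\<^bsub>HomM X Y\<^esub> x) \<oplus>\<^bsub>HomM X Y\<^esub> (a \<odot>\<^bsub>HomM X Y\<^esub> y)"
    unfolding f(2) g(2) Hom_add[OF f(1) g(1)] Hom_smult[OF a f(1)] Hom_smult[OF a g(1)]
      Hom_smult[OF a arrow.Add[OF f(1) g(1)]] Hom_add[OF af arrow.Scale[OF a g(1)]]
    by (rule cl_eqI[OF eqv.scale_add_right[OF a f(1) g(1)]])
next
  fix x assume "x \<in> carrier (HomM X Y)"
  then obtain f where f: "arrow k X Y f" "x = cl X Y f" by (auto simp: Hom_carrier)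
  show "\<one> \<odot>\<^bsub>HomM X Y\<^esub> x = x"
    unfolding f(2) Hom_smult[OF one_closed f(1)] by (rule cl_eqI[OF eqv.scale_one[OF f(1)]])
qed

lemma Hom_part_submodule: "submodule (Hom_part k z X Y p) k (HomM X Y)"
proof -
  interpret M: module k "HomM X Y" by (rule Hom_module)
  have sm: "a \<odot>\<^bsub>HomM X Y\<^esub> x \<in> Hom_part k z X Y p" if a: "a \<in> carrier k" and x: "x \<in> Hom_part k z X Y p" for a x
  proof -
    obtain f where f: "arrow k X Y f" "homogeneous p f" "x = cl X Y f" using x by (auto simp: Hom_part_def)
    show ?thesis unfolding f(3) Hom_smult[OF a f(1)] Hom_part_def
      using arrow.Scale[OF a f(1)] homogeneous.Scale[OF f(2)] by blast
  qed
  show ?thesis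
  proof (rule M.submoduleI)
    show sub: "Hom_part k z X Y p \<subseteq> carrier (HomM X Y)" by (auto simp: Hom_part_def Hom_carrier)
    show "\<zero>\<^bsub>HomM X Y\<^esub> \<in> Hom_part k z X Y p"
      unfolding Hom_zero Hom_part_def using arrow.Zero homogeneous.Zero by blast
    show "\<ominus>\<^bsub>HomM X Y\<^esub> x \<in> Hom_part k z X Y p" if x: "x \<in> Hom_part k z X Y p" for x
    proof -
      have "(\<ominus> \<one>) \<odot>\<^bsub>HomM X Y\<^esub> x = \<ominus>\<^bsub>HomM X Y\<^esub> x" using x sub by (subst M.smult_l_minus) auto
      then show ?thesis using sm[OF a_inv_closed[OF one_closed] x] by simp
    qed
    show "x \<oplus>\<^bsub>HomM X Y\<^esub> y \<in> Hom_part k z X Y p" if xy: "x \<in> Hom_part k z X Y p" "y \<in> Hom_part k z X Y p" for x y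
    proof -
      obtain f where f: "arrow k X Y f" "homogeneous p f" "x = cl X Y f" using xy by (auto simp: Hom_part_def)
      obtain g where g: "arrow k X Y g" "homogeneous p g" "y = cl X Y g" using xy by (auto simp: Hom_part_def)
      show ?thesis unfolding f(3) g(3) Hom_add[OF f(1) g(1)] Hom_part_def
        using arrow.Add[OF f(1) g(1)] homogeneous.Add[OF f(2) g(2)] by blast
    qed
  qed (rule sm)
qed

text \<open>Words are homogeneous and span, so each class splits. That the splitting is unique has
  to wait for the functionals.\<close>

lemma Hom_part_decomposition:
  assumes "x \<in> carrier (HomM X Y)"
  shows "\<exists>y0\<in>Hom_part k z X Y False. \<exists>y1\<in>Hom_part k z X Y True. x = y0 \<oplus>\<^bsub>HomM X Y\<^esub> y1"
proof -
  interpret M: module k "HomM X Y" by (rule Hom_module)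
  let ?P = "Hom_part k z X Y"
  have P: "submodule (?P p) k (HomM X Y)" for p by (rule Hom_part_submodule)
  note PE = M.submoduleE[OF P]
  have Pc: "y \<in> ?P p \<Longrightarrow> y \<in> carrier (HomM X Y)" for y p using PE(1) by blast
  have zero: "\<zero>\<^bsub>HomM X Y\<^esub> \<in> ?P p" for p
    unfolding Hom_zero Hom_part_def using arrow.Zero homogeneous.Zero by blast
  obtain f where f: "arrow k X Y f" "x = cl X Y f" using assms by (auto simp: Hom_carrier)
  have "\<exists>y0\<in>?P False. \<exists>y1\<in>?P True. cl X Y f = y0 \<oplus>\<^bsub>HomM X Y\<^esub> y1" if "f \<in> spn X Y (wmors X Y UNIV)" for f
    using that
  proof (induction rule: spn.induct)
    case (base f)
    then obtain w where w: "gdiag X Y w" "f = gmor X w" by (auto simp: wmors_def)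
    obtain p where "homogeneous p (gmor X w :: 'k mor)" using homogeneous_gmor by blast
    then have c: "cl X Y f \<in> ?P p" unfolding w(2) Hom_part_def using arrow_gmor[OF w(1)] by blast
    show ?case
    proof (cases p)
      case True
      then show ?thesis using c zero[of False] Pc[OF c] by (intro bexI[of _ "\<zero>\<^bsub>HomM X Y\<^esub>"] bexI[of _ "cl X Y f"]) auto
    next
      case False
      then show ?thesis using c zero[of True] Pc[OF c] by (intro bexI[of _ "cl X Y f"] bexI[of _ "\<zero>\<^bsub>HomM X Y\<^esub>"]) auto
    qed
  next
    case zero
    show ?case using \<open>\<And>p. \<zero>\<^bsub>HomM X Y\<^esub> \<in> ?P p\<close>
      by (intro bexI[of _ "\<zero>\<^bsub>HomM X Y\<^esub>"]) (auto simp: Hom_zero[symmetric])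
  next
    case (add f g)
    then obtain y0 y1 w0 w1 where y: "y0 \<in> ?P False" "y1 \<in> ?P True" "cl X Y f = y0 \<oplus>\<^bsub>HomM X Y\<^esub> y1"
      "w0 \<in> ?P False" "w1 \<in> ?P True" "cl X Y g = w0 \<oplus>\<^bsub>HomM X Y\<^esub> w1" by blast
    have "cl X Y (Add f g) = (y0 \<oplus>\<^bsub>HomM X Y\<^esub> w0) \<oplus>\<^bsub>HomM X Y\<^esub> (y1 \<oplus>\<^bsub>HomM X Y\<^esub> w1)"
      unfolding Hom_add[OF spn_arrow[OF add.hyps(1)] spn_arrow[OF add.hyps(2)], symmetric] y(3,6)
      using y Pc by (simp add: M.a_ac)
    then show ?case using PE(5)[OF y(1,4)] PE(5)[OF y(2,5)] by blast
  next
    case (scale a f)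
    then obtain y0 y1 where y: "y0 \<in> ?P False" "y1 \<in> ?P True" "cl X Y f = y0 \<oplus>\<^bsub>HomM X Y\<^esub> y1" by blast
    have "cl X Y (Scale a f) = (a \<odot>\<^bsub>HomM X Y\<^esub> y0) \<oplus>\<^bsub>HomM X Y\<^esub> (a \<odot>\<^bsub>HomM X Y\<^esub> y1)"
      unfolding Hom_smult[OF scale.hyps(1) spn_arrow[OF scale.hyps(2)], symmetric] y(3)
      using y Pc scale.hyps(1) by (simp add: M.smult_r_distr)
    then show ?case using PE(4)[OF scale.hyps(1) y(1)] PE(4)[OF scale.hyps(1) y(2)] by blast
  next
    case (eqv f g)
    then show ?case using cl_eqI[OF eqv.hyps(2)] by simp
  qed
  from this[OF arrow_wspan[OF f(1)]] show ?thesis unfolding f(2) .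
qed

lemma Hom_generators:
  assumes n: "n = rank_formula (count_list X \<up> + count_list Y \<down>) (count_list X \<down> + count_list Y \<up>)"
  shows "\<exists>w. (\<forall>l < n. w l \<in> carrier (HomM X Y)) \<and>
    (\<forall>x \<in> carrier (HomM X Y). \<exists>a\<in>{..<n} \<rightarrow> carrier k. x = (\<Oplus>\<^bsub>HomM X Y\<^esub>l\<in>{..<n}. a l \<odot>\<^bsub>HomM X Y\<^esub> w l))"
proof -
  interpret M: module k "HomM X Y" by (rule Hom_module)
  obtain L :: "'k mor list" where L: "length L = n"
    "\<And>f. f \<in> set L \<Longrightarrow> arrow k X Y f" "\<And>f. arrow k X Y f \<Longrightarrow> f \<in> spn X Y (set L)"
    using generators[of X Y] unfolding n by blast
  define w where "w l = cl X Y (L ! l)" for l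
  have w: "w l \<in> carrier (HomM X Y)" if "l < n" for l
    using L(2)[of "L ! l"] that by (auto simp: w_def L(1) Hom_carrier)
  let ?c = "\<lambda>a. \<Oplus>\<^bsub>HomM X Y\<^esub>l\<in>{..<n}. a l \<odot>\<^bsub>HomM X Y\<^esub> w l"
  have cc: "(\<lambda>l. a l \<odot>\<^bsub>HomM X Y\<^esub> w l) \<in> {..<n} \<rightarrow> carrier (HomM X Y)" if "a \<in> {..<n} \<rightarrow> carrier k" for a
    using that w by auto
  have "\<exists>a\<in>{..<n} \<rightarrow> carrier k. cl X Y f = ?c a" if "f \<in> spn X Y (set L)" for f
    using that
  proof (induction rule: spn.induct)
    case (base f)
    then obtain l where l: "l < n" "f = L ! l" by (auto simp: in_set_conv_nth L(1))
    let ?a = "\<lambda>l'. if l = l' then \<one> else \<zero>"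
    have "?c ?a = (\<Oplus>\<^bsub>HomM X Y\<^esub>l'\<in>{..<n}. if l = l' then w l' else \<zero>\<^bsub>HomM X Y\<^esub>)"
      by (rule M.finsum_cong') (use w in auto)
    also have "\<dots> = w l" by (rule M.add.finprod_singleton) (use l w in auto)
    finally have "cl X Y f = ?c ?a" by (simp add: l(2) w_def)
    then show ?case by (intro bexI[of _ ?a]) auto
  next
    case zero
    have "?c (\<lambda>l. \<zero>) = (\<Oplus>\<^bsub>HomM X Y\<^esub>l\<in>{..<n}. \<zero>\<^bsub>HomM X Y\<^esub>)" by (rule M.finsum_cong') (use w in auto)
    then have "cl X Y (Zero X Y) = ?c (\<lambda>l. \<zero>)" unfolding Hom_zero[symmetric] by simp
    then show ?case by (intro bexI[of _ "\<lambda>l. \<zero>"]) auto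
  next
    case (add f g)
    then obtain a b where ab: "a \<in> {..<n} \<rightarrow> carrier k" "cl X Y f = ?c a" "b \<in> {..<n} \<rightarrow> carrier k" "cl X Y g = ?c b" by blast
    have "?c (\<lambda>l. a l \<oplus> b l) = (\<Oplus>\<^bsub>HomM X Y\<^esub>l\<in>{..<n}. (a l \<odot>\<^bsub>HomM X Y\<^esub> w l) \<oplus>\<^bsub>HomM X Y\<^esub> (b l \<odot>\<^bsub>HomM X Y\<^esub> w l))"
      by (rule M.finsum_cong') (use ab w in \<open>auto simp: M.smult_l_distr Pi_iff\<close>)
    also have "\<dots> = cl X Y (Add f g)"
      unfolding Hom_add[OF spn_arrow[OF add.hyps(1)] spn_arrow[OF add.hyps(2)], symmetric] ab(2,4)
      by (rule M.finsum_addf[OF cc[OF ab(1)] cc[OF ab(3)]])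
    finally have "cl X Y (Add f g) = ?c (\<lambda>l. a l \<oplus> b l)" ..
    moreover have "(\<lambda>l. a l \<oplus> b l) \<in> {..<n} \<rightarrow> carrier k" using ab by auto
    ultimately show ?case by (intro bexI[of _ "\<lambda>l. a l \<oplus> b l"])
  next
    case (scale b f)
    then obtain a where a: "a \<in> {..<n} \<rightarrow> carrier k" "cl X Y f = ?c a" by blast
    have "?c (\<lambda>l. b \<otimes> a l) = (\<Oplus>\<^bsub>HomM X Y\<^esub>l\<in>{..<n}. b \<odot>\<^bsub>HomM X Y\<^esub> (a l \<odot>\<^bsub>HomM X Y\<^esub> w l))"
      by (rule M.finsum_cong') (use a w scale.hyps(1) in \<open>auto simp: M.smult_assoc1 Pi_iff\<close>)
    also have "\<dots> = cl X Y (Scale b f)"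
      unfolding Hom_smult[OF scale.hyps(1) spn_arrow[OF scale.hyps(2)], symmetric] a(2)
      by (rule M.finsum_smult_ldistr[symmetric]) (use scale.hyps(1) cc[OF a(1)] in auto)
    finally have "cl X Y (Scale b f) = ?c (\<lambda>l. b \<otimes> a l)" ..
    moreover have "(\<lambda>l. b \<otimes> a l) \<in> {..<n} \<rightarrow> carrier k" using a scale.hyps(1) by auto
    ultimately show ?case by (intro bexI[of _ "\<lambda>l. b \<otimes> a l"])
  next
    case (eqv f g)
    then show ?case using cl_eqI[OF eqv.hyps(2)] by simp
  qed
  then have "\<exists>a\<in>{..<n} \<rightarrow> carrier k. x = ?c a" if "x \<in> carrier (HomM X Y)" for x
    using L(3) that by (auto simp: Hom_carrier)
  then show ?thesis using w by (intro exI[of _ w]) simp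
qed

section \<open>Functionals from matrix entries\<close>

lemma ev_diff_zero: "ev (a - b) = \<zero>\<^bsub>K\<^esub> \<longleftrightarrow> ev a = ev b"
proof -
  have "ev a = ev (a - b) \<oplus>\<^bsub>K\<^esub> ev b" using ev_add[of "a - b" b] by simp
  then show ?thesis using K.add.r_cancel_one by (auto simp: K.add.r_cancel_one')
qed

lemma fst_K:
  "x \<in> carrier K \<Longrightarrow> y \<in> carrier K \<Longrightarrow> fst (x \<oplus>\<^bsub>K\<^esub> y) = fst x \<oplus> fst y"
  "a \<in> carrier k \<Longrightarrow> x \<in> carrier K \<Longrightarrow> fst ((a, \<zero>) \<otimes>\<^bsub>K\<^esub> x) = a \<otimes> fst x"
  "x \<in> carrier K \<Longrightarrow> fst x \<in> carrier k" "fst \<one>\<^bsub>K\<^esub> = \<one>" "fst \<zero>\<^bsub>K\<^esub> = \<zero>"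
  by (auto simp: K_simps)

text \<open>On the carrier of \<open>k\<close>, \<open>xscal\<close> is a homomorphism up to the
  kernel of \<open>ev\<close>, and \<open>ev_qq_qi\<close> matches \<open>z\<close> with
  \<open>q\<close> minus its inverse.\<close>

lemma rmat_sound_ev: "rmat_sound qq qi xscal k z (\<lambda>r. ev r = \<zero>\<^bsub>K\<^esub>)"
proof -
  interpret rmat qq qi xscal by unfold_locales (rule qq_qi)
  show ?thesis
  proof (unfold_locales)
    show "ideal (\<lambda>r. ev r = \<zero>\<^bsub>K\<^esub>)" unfolding ideal_def by (auto simp: ev_add ev_mult)
    show "ev (xscal (\<ominus> \<one>) + 1) = \<zero>\<^bsub>K\<^esub>" by (simp add: ev_add ev_xscal K_simps l_neg)
  qed (simp_all only: ev_diff_zero, simp_all add: ev_add ev_mult ev_xscal K_simps ev_qq_qi)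
qed

text \<open>The functional that belongs to a lift with tokens is the matrix entry at the words of
  its matching and its tokens, divided by the unit found there on the diagonal and projected from
  \<open>K\<close> to its summand \<open>k\<close>. The level \<open>c\<close> is the crossing
  number.\<close>

lemma bullet_functionals:
  assumes lift: "lift_choice X Y B"
  obtains \<psi> and c :: "layer list \<times> endpoint set \<Rightarrow> nat"
  where "\<And>i. i \<in> B_bullet X Y B \<Longrightarrow> linear_functional (HomM X Y) (\<psi> i)"
    "\<And>i. i \<in> B_bullet X Y B \<Longrightarrow> \<psi> i (bullet_mor k z X Y i) = \<one>"
    "\<And>i j. i \<in> B_bullet X Y B \<Longrightarrow> j \<in> B_bullet X Y B \<Longrightarrow> \<psi> i (bullet_mor k z X Y j) \<noteq> \<zero> \<Longrightarrow> i = j \<or> c i < c j"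
    "\<And>i x. i \<in> B_bullet X Y B \<Longrightarrow> x \<in> Hom_part k z X Y False \<Longrightarrow> x \<in> Hom_part k z X Y True \<Longrightarrow> \<psi> i x = \<zero>"
proof -
  \<comment> \<open>One colour for each string. A colour has two labels, hence the range from
    \<open>-N\<close> to \<open>N - 1\<close>.\<close>
  define N where "N = int (card (origins X Y))"
  let ?J = "\<lambda>r. ev r = \<zero>\<^bsub>K\<^esub>"
  interpret R: rmat_sound qq qi xscal N k z ?J by (rule rmat_sound_ev)
  obtain e :: "endpoint \<Rightarrow> int" where e: "inj_on e (origins X Y)" "e ` origins X Y \<subseteq> {0..<N}"
  proof -
    obtain h where h: "bij_betw h (origins X Y) {0..<card (origins X Y)}" using ex_bij_betw_finite_nat[of "origins X Y"] by auto
    have "inj_on (int \<circ> h) (origins X Y)" using h by (auto simp: bij_betw_def inj_on_def)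
    moreover have "(int \<circ> h) ` origins X Y \<subseteq> {0..<N}" using h by (auto simp: bij_betw_def N_def)
    ultimately show thesis by (rule that)
  qed
  define mt where "mt D = (SOME m. matching X Y m \<and> positive_reduced_lift X Y m D)" for D
  have mt: "matching X Y (mt D)" "positive_reduced_lift X Y (mt D) D" if "D \<in> B" for D
    using someI_ex[OF lift[unfolded lift_choice_def, THEN conjunct1, rule_format, OF that]] unfolding mt_def by simp_all
  let ?I = "B_bullet X Y B"
  define v where "v i = bullet_expr z X Y (fst i) (snd i)" for i
  have v: "bullet_mor k z X Y i = cl X Y (v i)" for i
    unfolding bullet_mor_def v_def bullet_expr_def by (simp add: case_prod_beta)
  have I: "fst i \<in> B" "snd i \<subseteq> termini X Y" if "i \<in> ?I" for i using that by (auto simp: B_bullet_def)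
  have arr_v: "arrow k X Y (v i)" if "i \<in> ?I" for i
    unfolding v_def using mt(2)[OF I(1)[OF that]] by (intro arrow_bullet z_closed) (simp add: positive_reduced_lift_def)
  define row where "row i = bword X Y e (mt (fst i)) (snd i)" for i
  define col where "col i = tword X Y e (mt (fst i)) (snd i)" for i
  have row: "row i \<in> R.W X" if "i \<in> ?I" for i unfolding row_def by (rule R.bword_W[OF mt(1)[OF I(1)[OF that]] e(2)])
  define raw where "raw i f = R.F f (R.delta (col i)) (row i)" for i f
  have "\<exists>u'. ev (u' * raw i (v i)) = \<one>\<^bsub>K\<^esub>" if i: "i \<in> ?I" for i
  proof -
    obtain u where u: "R.invertible_elt u" "ev (raw i (v i) - u) = \<zero>\<^bsub>K\<^esub>"
      using R.bullet_entry_unit[OF R.J mt(1,2)[OF I(1)[OF i]] e I(2)[OF i], of z] unfolding raw_def row_def col_def v_def by blast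
    obtain u' where "u * u' = 1" using u(1) unfolding R.invertible_elt_def by blast
    then have "ev (u' * raw i (v i)) = \<one>\<^bsub>K\<^esub>"
      using u(2) ev_mult[of u u'] unfolding ev_diff_zero by (simp add: ev_mult K.m_comm)
    then show ?thesis by blast
  qed
  then obtain u' where u': "\<And>i. i \<in> ?I \<Longrightarrow> ev (u' i * raw i (v i)) = \<one>\<^bsub>K\<^esub>" by metis
  \<comment> \<open>The first component is linear over \<open>k\<close> and takes one to
    one.\<close>
  define \<Phi> where "\<Phi> i f = fst (ev (u' i * raw i f))" for i f
  have \<Phi>_E: "\<Phi> i f = \<Phi> i g" if "E X Y f g" "i \<in> ?I" for i f g
  proof -
    have "ev (raw i f) = ev (raw i g)"
      using R.F_sound[OF that(1) row[OF that(2)]] unfolding raw_def R.sim_def ev_diff_zero .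
    then show ?thesis unfolding \<Phi>_def by (simp add: ev_mult)
  qed
  \<comment> \<open>A representative of the class is chosen; by \<open>\<Phi>_E\<close> the value
    does not depend on it.\<close>
  define \<psi> where "\<psi> i C = \<Phi> i (SOME f. f \<in> C)" for i and C :: "'k mor set"
  have \<psi>_cl: "\<psi> i (cl X Y f) = \<Phi> i f" if "arrow k X Y f" "i \<in> ?I" for i f
  proof -
    have "(SOME g. g \<in> cl X Y f) \<in> cl X Y f" by (rule someI[of "\<lambda>g. g \<in> cl X Y f", OF cl_self[OF that(1)]])
    then have "E X Y f (SOME g. g \<in> cl X Y f)" by (simp add: mclass_def)
    from \<Phi>_E[OF this that(2)] show ?thesis unfolding \<psi>_def by simp
  qed
  have \<Phi>_zero: "\<Phi> i f = \<zero>" if "ev (raw i f) = \<zero>\<^bsub>K\<^esub>" for i f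
    unfolding \<Phi>_def ev_mult that by (simp add: fst_K)
  define c where "c i = R.crossing_number X Y e (mt (fst i))" for i :: "layer list \<times> endpoint set"
  show thesis
  proof (rule that[of \<psi> c])
    fix i assume i: "i \<in> ?I"
    show "linear_functional (HomM X Y) (\<psi> i)"
      unfolding linear_functional_def
    proof (intro conjI ballI)
      show "\<psi> i \<in> carrier (HomM X Y) \<rightarrow> carrier k" unfolding \<psi>_def \<Phi>_def using fst_K(3)[OF ev_closed] by auto
      fix x assume "x \<in> carrier (HomM X Y)"
      then obtain f where f: "arrow k X Y f" "x = cl X Y f" by (auto simp: Hom_carrier)
      {
        fix y assume "y \<in> carrier (HomM X Y)"
        then obtain g where g: "arrow k X Y g" "y = cl X Y g" by (auto simp: Hom_carrier)
        show "\<psi> i (x \<oplus>\<^bsub>HomM X Y\<^esub> y) = \<psi> i x \<oplus> \<psi> i y"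
          unfolding f(2) g(2) Hom_add[OF f(1) g(1)] \<psi>_cl[OF f(1) i] \<psi>_cl[OF g(1) i] \<psi>_cl[OF arrow.Add[OF f(1) g(1)] i]
          by (simp add: \<Phi>_def raw_def distrib_left ev_add fst_K)
      }
      show "\<psi> i (a \<odot>\<^bsub>HomM X Y\<^esub> x) = a \<otimes> \<psi> i x" if a: "a \<in> carrier k" for a
        unfolding f(2) Hom_smult[OF a f(1)] \<psi>_cl[OF f(1) i] \<psi>_cl[OF arrow.Scale[OF a f(1)] i]
        using a by (simp add: \<Phi>_def raw_def mult.left_commute[of _ "xscal a"] ev_mult[of "xscal a"] ev_xscal fst_K)
    qed
    show "\<psi> i (bullet_mor k z X Y i) = \<one>"
      unfolding v \<psi>_cl[OF arr_v[OF i] i] \<Phi>_def u'[OF i] by (rule fst_K)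
    show "i = j \<or> c i < c j" if j: "j \<in> ?I" and nz: "\<psi> i (bullet_mor k z X Y j) \<noteq> \<zero>" for j
    proof -
      have "\<not> ev (raw i (v j)) = \<zero>\<^bsub>K\<^esub>" using nz \<Phi>_zero unfolding v \<psi>_cl[OF arr_v[OF j] i] by blast
      then have "c i < c j \<or> (snd i = snd j \<and> (\<forall>s\<in>origins X Y. mt (fst i) s = mt (fst j) s))"
        using R.bullet_entry_nonzero[OF R.J mt(1)[OF I(1)[OF i]] mt(1,2)[OF I(1)[OF j]] e I(2)[OF i] I(2)[OF j], of z]
        unfolding raw_def row_def col_def v_def c_def by blast
      then show ?thesis
      proof
        assume a: "snd i = snd j \<and> (\<forall>s\<in>origins X Y. mt (fst i) s = mt (fst j) s)"
        then have "positive_reduced_lift X Y (mt (fst i)) (fst j)"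
          using lift_cong[of X Y "mt (fst i)" "mt (fst j)" "fst j"] mt(2)[OF I(1)[OF j]] by simp
        then have "fst i = fst j"
          using lift[unfolded lift_choice_def, THEN conjunct2, rule_format, OF mt(1)[OF I(1)[OF i]]]
            mt(2)[OF I(1)[OF i]] I(1)[OF i] I(1)[OF j] by blast
        then show ?thesis using a by (simp add: prod_eq_iff)
      qed simp
    qed
    show "\<psi> i x = \<zero>" if "x \<in> Hom_part k z X Y False" "x \<in> Hom_part k z X Y True" for x
    proof -
      \<comment> \<open>Morphisms of parity \<open>p\<close> have a zero entry at these two words,
        because the parities of the words differ in the other way.\<close>
      define p where "p = (par (col i) = par (row i))"
      have "x \<in> Hom_part k z X Y p" using that by (cases p) auto
      then obtain f where f: "arrow k X Y f" "homogeneous p f" "x = cl X Y f" by (auto simp: Hom_part_def)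
      have "ev (raw i f) = \<zero>\<^bsub>K\<^esub>"
        unfolding raw_def by (rule R.F_ideal_par[OF R.J f(2,1) row[OF i]]) (auto simp: p_def)
      from \<Phi>_zero[OF this] show ?thesis unfolding f(3) \<psi>_cl[OF f(1) i] .
    qed
  qed
qed

lemma Hom_free:
  assumes lift: "lift_choice X Y B"
  shows "free_supermodule_with_basis k (HomM X Y) (Hom_part k z X Y) (B_bullet X Y B) (bullet_mor k z X Y)"
proof -
  let ?M = "HomM X Y" and ?I = "B_bullet X Y B" and ?v = "bullet_mor k z X Y"
  interpret M: module k ?M by (rule Hom_module)
  obtain \<psi> and c :: "layer list \<times> endpoint set \<Rightarrow> nat" where
    lin: "\<And>i. i \<in> ?I \<Longrightarrow> linear_functional ?M (\<psi> i)"
    and diag: "\<And>i. i \<in> ?I \<Longrightarrow> \<psi> i (?v i) = \<one>"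
    and tri: "\<And>i j. i \<in> ?I \<Longrightarrow> j \<in> ?I \<Longrightarrow> \<psi> i (?v j) \<noteq> \<zero> \<Longrightarrow> i = j \<or> c i < c j"
    and par: "\<And>i x. i \<in> ?I \<Longrightarrow> x \<in> Hom_part k z X Y False \<Longrightarrow> x \<in> Hom_part k z X Y True \<Longrightarrow> \<psi> i x = \<zero>"
    using bullet_functionals[OF lift] by blast
  have vp: "\<exists>p. ?v i \<in> Hom_part k z X Y p" if i: "i \<in> ?I" for i
  proof -
    obtain D T where DT: "i = (D, T)" "D \<in> B" using i by (auto simp: B_bullet_def)
    obtain m where "positive_reduced_lift X Y m D"
      using lift[unfolded lift_choice_def, THEN conjunct1, rule_format, OF DT(2)] by blast
    then have "arrow k X Y (bullet_expr z X Y D T)" by (intro arrow_bullet z_closed) (simp add: positive_reduced_lift_def)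
    moreover obtain p where "homogeneous p (bullet_expr z X Y D T)" using homogeneous_bullet[of z X Y D T] by (elim exE)
    ultimately show ?thesis unfolding DT(1) bullet_mor_def Hom_part_def bullet_expr_def by auto
  qed
  have part: "Hom_part k z X Y p \<subseteq> carrier ?M" for p by (auto simp: Hom_part_def Hom_carrier)
  have vc: "?v i \<in> carrier ?M" if "i \<in> ?I" for i using vp[OF that] part by blast
  have finI: "finite ?I" using lift_choice_card[OF lift] by (simp add: B_bullet_def)
  \<comment> \<open>For \<open>n\<close> strings there are \<open>n!\<close> lifts and
    \<open>2^n\<close> sets of tokens, in agreement with the number of generators.\<close>
  have cardI: "card ?I = rank_formula (count_list X \<up> + count_list Y \<down>) (count_list X \<down> + count_list Y \<up>)"
    using lift_choice_card[OF lift]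
    by (simp add: B_bullet_def card_cartesian_product card_Pow rank_formula_def flip: card_endpoints)
  have "\<forall>i\<in>?I. \<exists>\<phi>. linear_functional ?M \<phi> \<and> (\<forall>j\<in>?I. \<phi> (?v j) = (if j = i then \<one> else \<zero>)) \<and>
      (\<forall>x\<in>carrier ?M. (\<forall>j\<in>?I. \<psi> j x = \<zero>) \<longrightarrow> \<phi> x = \<zero>)"
    by (intro ballI dual_functionals[OF Hom_module finI vc lin diag tri])
  from bchoice[OF this] obtain \<phi> where \<phi>': "\<forall>i\<in>?I. linear_functional ?M (\<phi> i) \<and>
      (\<forall>j\<in>?I. \<phi> i (?v j) = (if j = i then \<one> else \<zero>)) \<and>
      (\<forall>x\<in>carrier ?M. (\<forall>j\<in>?I. \<psi> j x = \<zero>) \<longrightarrow> \<phi> i x = \<zero>)" by (elim exE)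
  have \<phi>: "\<And>i. i \<in> ?I \<Longrightarrow> linear_functional ?M (\<phi> i)"
    "\<And>i j. i \<in> ?I \<Longrightarrow> j \<in> ?I \<Longrightarrow> \<phi> i (?v j) = (if j = i then \<one> else \<zero>)"
    "\<And>i x. i \<in> ?I \<Longrightarrow> x \<in> carrier ?M \<Longrightarrow> (\<forall>j\<in>?I. \<psi> j x = \<zero>) \<Longrightarrow> \<phi> i x = \<zero>"
    using bspec[OF \<phi>'] by simp_all
  obtain w where "(\<forall>l < card ?I. w l \<in> carrier ?M) \<and>
      (\<forall>x \<in> carrier ?M. \<exists>a\<in>{..<card ?I} \<rightarrow> carrier k. x = (\<Oplus>\<^bsub>?M\<^esub>l\<in>{..<card ?I}. a l \<odot>\<^bsub>?M\<^esub> w l))"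
    using Hom_generators[OF cardI] by (elim exE)
  then have w: "\<And>l. l < card ?I \<Longrightarrow> w l \<in> carrier ?M"
    "\<And>x. x \<in> carrier ?M \<Longrightarrow> \<exists>a\<in>{..<card ?I} \<rightarrow> carrier k. x = (\<Oplus>\<^bsub>?M\<^esub>l\<in>{..<card ?I}. a l \<odot>\<^bsub>?M\<^esub> w l)"
    by simp_all
  have expand: "x = (\<Oplus>\<^bsub>?M\<^esub>i\<in>?I. \<phi> i x \<odot>\<^bsub>?M\<^esub> ?v i)" if "x \<in> carrier ?M" for x
    by (rule basis_of_dual_functionals[OF Hom_module finI vc \<phi>(1,2) w that])
  \<comment> \<open>All the triangular functionals vanish on \<open>x\<close>, hence so do the dual
    ones, which are the coefficients of \<open>x\<close>.\<close>
  have inter: "x = \<zero>\<^bsub>?M\<^esub>" if x: "x \<in> Hom_part k z X Y False" "x \<in> Hom_part k z X Y True" for x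
  proof -
    have xc: "x \<in> carrier ?M" using x part by blast
    have "(\<Oplus>\<^bsub>?M\<^esub>i\<in>?I. \<phi> i x \<odot>\<^bsub>?M\<^esub> ?v i) = (\<Oplus>\<^bsub>?M\<^esub>i\<in>?I. \<zero>\<^bsub>?M\<^esub>)"
      by (rule M.finsum_cong') (use \<phi>(3)[OF _ xc] par[OF _ x] vc in auto)
    then show ?thesis using expand[OF xc] by simp
  qed
  have "\<exists>!y. y \<in> Hom_part k z X Y False \<times> Hom_part k z X Y True \<and> x = fst y \<oplus>\<^bsub>?M\<^esub> snd y" if x: "x \<in> carrier ?M" for x
  proof -
    obtain y0 y1 where y: "y0 \<in> Hom_part k z X Y False" "y1 \<in> Hom_part k z X Y True" "x = y0 \<oplus>\<^bsub>?M\<^esub> y1"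
      using Hom_part_decomposition[OF x] by blast
    show ?thesis
    proof (rule ex1I[of _ "(y0, y1)"])
      fix t assume t: "t \<in> Hom_part k z X Y False \<times> Hom_part k z X Y True \<and> x = fst t \<oplus>\<^bsub>?M\<^esub> snd t"
      obtain t0 t1 where t01: "t = (t0, t1)" by (cases t)
      have t': "t0 \<in> Hom_part k z X Y False" "t1 \<in> Hom_part k z X Y True" "y0 \<oplus>\<^bsub>?M\<^esub> y1 = t0 \<oplus>\<^bsub>?M\<^esub> t1"
        using t y(3) unfolding t01 by auto
      note c = subsetD[OF part y(1)] subsetD[OF part y(2)] subsetD[OF part t'(1)] subsetD[OF part t'(2)]
      \<comment> \<open>The difference \<open>y0 - t0 = t1 - y1\<close> is both even and
        odd.\<close>
      let ?d = "y0 \<oplus>\<^bsub>?M\<^esub> (\<ominus>\<^bsub>?M\<^esub> t0)"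
      have "t0 \<oplus>\<^bsub>?M\<^esub> (?d \<oplus>\<^bsub>?M\<^esub> y1) = (t0 \<oplus>\<^bsub>?M\<^esub> (\<ominus>\<^bsub>?M\<^esub> t0)) \<oplus>\<^bsub>?M\<^esub> (y0 \<oplus>\<^bsub>?M\<^esub> y1)"
        using c by (simp only: M.a_ac M.a_closed M.a_inv_closed)
      also have "\<dots> = t0 \<oplus>\<^bsub>?M\<^esub> t1" using c t'(3) by (simp add: M.r_neg)
      finally have t1: "t1 = ?d \<oplus>\<^bsub>?M\<^esub> y1" using c by simp
      have d: "?d = t1 \<oplus>\<^bsub>?M\<^esub> (\<ominus>\<^bsub>?M\<^esub> y1)" unfolding t1 using c by (simp add: M.a_assoc M.r_neg)
      have "?d \<in> Hom_part k z X Y False"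
        by (rule M.submoduleE(5)[OF Hom_part_submodule y(1) M.submoduleE(3)[OF Hom_part_submodule t'(1)]])
      moreover have "?d \<in> Hom_part k z X Y True"
        unfolding d by (rule M.submoduleE(5)[OF Hom_part_submodule t'(2) M.submoduleE(3)[OF Hom_part_submodule y(2)]])
      ultimately have d0: "?d = \<zero>\<^bsub>?M\<^esub>" by (rule inter)
      have "\<ominus>\<^bsub>?M\<^esub> (\<ominus>\<^bsub>?M\<^esub> t0) = y0" by (rule M.minus_equality) (use d0 c in simp_all)
      then have "y0 = t0" using c by simp
      moreover have "t1 = y1" using t1 c unfolding d0 by simp
      ultimately have "y0 = t0" "t1 = y1" by simp_all
      then show "t = (y0, y1)" unfolding t01 by simp
    qed (use y in simp)
  qed
  then have "supermodule k ?M (Hom_part k z X Y)"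
    unfolding supermodule_def by (intro conjI allI ballI Hom_module Hom_part_submodule)
  moreover have "\<exists>!a. a \<in> ?I \<rightarrow>\<^sub>E carrier k \<and> finite {i \<in> ?I. a i \<noteq> \<zero>} \<and>
      x = (\<Oplus>\<^bsub>?M\<^esub>i \<in> {i \<in> ?I. a i \<noteq> \<zero>}. a i \<odot>\<^bsub>?M\<^esub> ?v i)" if "x \<in> carrier ?M" for x
    by (rule unique_coefficients[OF Hom_module finI vc \<phi>(1,2) that expand[OF that]])
  ultimately show ?thesis unfolding free_supermodule_with_basis_def by (intro conjI ballI vp)
qed

end

theorem theorem4p5:
  fixes k :: "('k, 'm) ring_scheme" and z :: 'k
    and X Y :: "orientation list" and B :: "layer list set"
  assumes "cring k" and "characteristic k \<noteq> 2" and "z \<in> carrier k"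
    and "lift_choice X Y B"
  shows "free_supermodule_with_basis k (Hom k z X Y) (Hom_part k z X Y)
           (B_bullet X Y B) (bullet_mor k z X Y)"
proof -
  interpret cring_param k z by (intro cring_param.intro cring_param_axioms.intro assms)
  show ?thesis by (rule Hom_free[OF assms(4)])
qed

end
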